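(* Let $\mathcal{O}_S$ be a Dedekind domain of arithmetic type belonging to one of the following families: (1) $K=\mathbb{Q}(\sqrt d)$ and $\mathcal{O}_S=\mathcal{O}_K$ (the ring of integers), where $d<0$ is squarefree and $d\notin\{-1,-2,-3,-7,-11\}$; (2) $K$ is a finite extension of $\mathbb{F}_q(T)$ with $q$ odd, $S=\{f\}$ consists of a single place $f$ of $K$, and either $|\mathrm{Cl}(\mathcal{O}_S)|\ne 1$ or $\deg f\ge 2$. Then the $(n-1)$-dimensional complex of partial bases $\mathcal{B}_n(\mathcal{O}_S)$ is not Cohen--Macaulay for any $n\ge 2$.
   Context: A Dedekind domain of arithmetic type: $K$ a global field, $S$ a finite nonempty set of places of $K$ (containing the infinite places if $K$ is a number field), $\mathcal{O}_S=\{x\in K:\mathrm{ord}_{\mathfrak p}(x)\ge0\text{ for all }\mathfrak p\notin S\}$. $\mathcal{B}_n(R)$ is the simplicial complex whose $(k-1)$-simplices are partial bases of $R^n$ of size $k$, i.e. sets $\{v_1,\dots,v_k\}$ extendable to a basis of $R^n$. A $d$-dimensional complex $X$ is Cohen--Macaulay of dimension $d$ if it is $(d-1)$-connected and for every $k$-simplex $\sigma$ the link $\mathrm{Link}_X(\sigma)$ is $(d-k-1)$-dimensional and $(d-k-2)$-connected ($(-1)$-connected meaning nonempty). *)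

theory Defs
  imports
    "HOL-Analysis.Analysis"
    "HOL-Computational_Algebra.Squarefree"
    "HOL-Algebra.Finite_Extensions"
    "HOL-Algebra.Generated_Fields"
    "HOL-Algebra.Ideal_Product"
    "HOL-Algebra.QuotRing"
    "HOL-Algebra.Elementary_Groups"
    "HOL-Algebra.Module"
begin

section \<open>Global fields and their places\<close>

definition char_zero :: "('a, 'b) ring_scheme \<Rightarrow> bool" where
  "char_zero K \<longleftrightarrow> (\<forall>m::nat. m > 0 \<longrightarrow> [m] \<cdot>\<^bsub>K\<^esub> \<one>\<^bsub>K\<^esub> \<noteq> \<zero>\<^bsub>K\<^esub>)"

text \<open>The prime field of \<open>K\<close> is \<open>generate_field K {}\<close>.\<close>

definition number_field :: "('a, 'b) ring_scheme \<Rightarrow> bool" where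
  "number_field K \<longleftrightarrow> field K \<and> char_zero K \<and>
     ring.finite_dimension K (generate_field K {}) (carrier K)"

text \<open>\<open>K\<close> is a finite extension of the rational function field \<open>k(t)\<close> over the finite field \<open>k\<close>;
  \<open>k\<close> need not be algebraically closed in \<open>K\<close>.\<close>

definition function_field_over :: "('a, 'b) ring_scheme \<Rightarrow> 'a set \<Rightarrow> bool" where
  "function_field_over K k \<longleftrightarrow> field K \<and> subfield k K \<and> finite k \<and>
     (\<exists>t\<in>carrier K. ring.transcendental K k t \<and>
        ring.finite_dimension K (generate_field K (insert t k)) (carrier K))"

definition global_field :: "('a, 'b) ring_scheme \<Rightarrow> bool" where
  "global_field K \<longleftrightarrow> number_field K \<or> (\<exists>k. function_field_over K k)"

text \<open>A non-archimedean place is represented by its normalised discrete valuation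
  \<open>ord : K\<^sup>* \<rightarrow> \<int>\<close>, an archimedean one by the unique absolute value in its class that extends the
  usual absolute value of the rationals. Extensionality makes these representatives unique.
  The value \<open>ord 0 = \<infinity>\<close> is not represented; zero is treated separately wherever it occurs.\<close>

datatype 'a place = Finite_Place (place_ord: "'a \<Rightarrow> int") | Infinite_Place (place_abs: "'a \<Rightarrow> real")

definition normalized_valuation :: "('a, 'b) ring_scheme \<Rightarrow> ('a \<Rightarrow> int) \<Rightarrow> bool" where
  "normalized_valuation K v \<longleftrightarrow>
     v \<in> extensional (carrier K - {\<zero>\<^bsub>K\<^esub>}) \<and>
     v \<in> epi (Multiplicative_Group.mult_of K) integer_group \<and>
     (\<forall>x\<in>carrier K - {\<zero>\<^bsub>K\<^esub>}. \<forall>y\<in>carrier K - {\<zero>\<^bsub>K\<^esub>}.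
        x \<oplus>\<^bsub>K\<^esub> y \<noteq> \<zero>\<^bsub>K\<^esub> \<longrightarrow> min (v x) (v y) \<le> v (x \<oplus>\<^bsub>K\<^esub> y))"

definition normalized_arch_abs :: "('a, 'b) ring_scheme \<Rightarrow> ('a \<Rightarrow> real) \<Rightarrow> bool" where
  "normalized_arch_abs K a \<longleftrightarrow>
     a \<in> extensional (carrier K) \<and>
     (\<forall>x\<in>carrier K. 0 \<le> a x \<and> (a x = 0 \<longleftrightarrow> x = \<zero>\<^bsub>K\<^esub>)) \<and>
     (\<forall>x\<in>carrier K. \<forall>y\<in>carrier K.
        a (x \<otimes>\<^bsub>K\<^esub> y) = a x * a y \<and> a (x \<oplus>\<^bsub>K\<^esub> y) \<le> a x + a y) \<and>
     (\<forall>m::nat. a ([m] \<cdot>\<^bsub>K\<^esub> \<one>\<^bsub>K\<^esub>) = real m)"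

definition finite_places :: "('a, 'b) ring_scheme \<Rightarrow> 'a place set" where
  "finite_places K = Finite_Place ` {v. normalized_valuation K v}"

definition infinite_places :: "('a, 'b) ring_scheme \<Rightarrow> 'a place set" where
  "infinite_places K = Infinite_Place ` {a. normalized_arch_abs K a}"

definition places :: "('a, 'b) ring_scheme \<Rightarrow> 'a place set" where
  "places K = finite_places K \<union> infinite_places K"

text \<open>\<open>S\<close> is an admissible set of places for a Dedekind domain of arithmetic type in \<open>K\<close>.\<close>

definition arithmetic_type :: "('a, 'b) ring_scheme \<Rightarrow> 'a place set \<Rightarrow> bool" where
  "arithmetic_type K S \<longleftrightarrow> global_field K \<and> S \<subseteq> places K \<and> finite S \<and> S \<noteq> {} \<and>
     (number_field K \<longrightarrow> infinite_places K \<subseteq> S)"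

definition S_integers :: "('a, 'b) ring_scheme \<Rightarrow> 'a place set \<Rightarrow> 'a set" where
  "S_integers K S =
     {x \<in> carrier K. \<forall>v. Finite_Place v \<in> places K - S \<longrightarrow> x = \<zero>\<^bsub>K\<^esub> \<or> 0 \<le> v x}"

text \<open>Elements integral over the image of \<open>\<int>\<close>.\<close>

definition ring_of_integers :: "('a, 'b) ring_scheme \<Rightarrow> 'a set" where
  "ring_of_integers K =
     {x \<in> carrier K. \<exists>p. polynomial\<^bsub>K\<^esub> (range (\<lambda>m::int. [m] \<cdot>\<^bsub>K\<^esub> \<one>\<^bsub>K\<^esub>)) p \<and>
        p \<noteq> [] \<and> lead_coeff p = \<one>\<^bsub>K\<^esub> \<and> ring.eval K p x = \<zero>\<^bsub>K\<^esub>}"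

text \<open>\<open>K\<close> is (a copy of) \<open>\<rat>(\<surd>d)\<close>.\<close>

definition adjoins_sqrt_to_rationals :: "('a, 'b) ring_scheme \<Rightarrow> int \<Rightarrow> bool" where
  "adjoins_sqrt_to_rationals K d \<longleftrightarrow> field K \<and> char_zero K \<and>
     (\<exists>s\<in>carrier K. s \<otimes>\<^bsub>K\<^esub> s = [d] \<cdot>\<^bsub>K\<^esub> \<one>\<^bsub>K\<^esub> \<and> generate_field K {s} = carrier K)"


section \<open>Degree of a place\<close>

definition full_constant_field :: "('a, 'b) ring_scheme \<Rightarrow> 'a set \<Rightarrow> 'a set" where
  "full_constant_field K k = {x \<in> carrier K. \<not> ring.transcendental K k x}"

definition valuation_ring :: "('a, 'b) ring_scheme \<Rightarrow> ('a \<Rightarrow> int) \<Rightarrow> ('a, 'b) ring_scheme" where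
  "valuation_ring K v = K\<lparr>carrier := {x \<in> carrier K. x = \<zero>\<^bsub>K\<^esub> \<or> 0 \<le> v x}\<rparr>"

definition valuation_ideal :: "('a, 'b) ring_scheme \<Rightarrow> ('a \<Rightarrow> int) \<Rightarrow> 'a set" where
  "valuation_ideal K v = {x \<in> carrier K. x = \<zero>\<^bsub>K\<^esub> \<or> 0 < v x}"

definition residue_field :: "('a, 'b) ring_scheme \<Rightarrow> ('a \<Rightarrow> int) \<Rightarrow> 'a set ring" where
  "residue_field K v = valuation_ring K v Quot valuation_ideal K v"

text \<open>The degree is taken over the full field of constants of \<open>K\<close>, not over the field \<open>k\<close> that
  happens to be used to present \<open>K\<close> as a finite extension of \<open>k(t)\<close>.\<close>

definition place_degree :: "('a, 'b) ring_scheme \<Rightarrow> 'a set \<Rightarrow> 'a place \<Rightarrow> nat" where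
  "place_degree K k f =
     (let v = place_ord f; F = residue_field K v in
      ring.dim F ((\<lambda>c. valuation_ideal K v +>\<^bsub>valuation_ring K v\<^esub> c) ` full_constant_field K k)
        (carrier F))"


section \<open>The ideal class group\<close>

text \<open>Here \<open>A\<close> is a subring of the field \<open>K\<close> with fraction field \<open>K\<close>.\<close>

definition fractional_ideal :: "('a, 'b) ring_scheme \<Rightarrow> 'a set \<Rightarrow> 'a set \<Rightarrow> bool" where
  "fractional_ideal K A I \<longleftrightarrow> additive_subgroup I K \<and> I \<noteq> {\<zero>\<^bsub>K\<^esub>} \<and>
     (\<forall>a\<in>A. \<forall>x\<in>I. a \<otimes>\<^bsub>K\<^esub> x \<in> I) \<and>
     (\<exists>a\<in>A. a \<noteq> \<zero>\<^bsub>K\<^esub> \<and> (\<forall>x\<in>I. a \<otimes>\<^bsub>K\<^esub> x \<in> A))"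

definition fractional_ideal_group :: "('a, 'b) ring_scheme \<Rightarrow> 'a set \<Rightarrow> 'a set monoid" where
  "fractional_ideal_group K A =
     \<lparr>carrier = {I. fractional_ideal K A I}, monoid.mult = ideal_prod K, one = A\<rparr>"

definition principal_fractional_ideals :: "('a, 'b) ring_scheme \<Rightarrow> 'a set \<Rightarrow> 'a set set" where
  "principal_fractional_ideals K A = {x <#\<^bsub>K\<^esub> A | x. x \<in> carrier K - {\<zero>\<^bsub>K\<^esub>}}"

definition class_group :: "('a, 'b) ring_scheme \<Rightarrow> 'a set \<Rightarrow> 'a set set monoid" where
  "class_group K A = fractional_ideal_group K A Mod principal_fractional_ideals K A"


section \<open>Simplicial complexes\<close>

text \<open>Complexes are families of nonempty finite sets; the empty complex has dimension \<open>-1\<close>.\<close>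

definition simplicial_complex :: "'v set set \<Rightarrow> bool" where
  "simplicial_complex C \<longleftrightarrow>
     (\<forall>s\<in>C. finite s \<and> s \<noteq> {}) \<and> (\<forall>s\<in>C. \<forall>t. t \<subseteq> s \<and> t \<noteq> {} \<longrightarrow> t \<in> C)"

definition simplex_dim :: "'v set \<Rightarrow> int" where
  "simplex_dim s = int (card s) - 1"

definition has_dimension :: "'v set set \<Rightarrow> int \<Rightarrow> bool" where
  "has_dimension C d \<longleftrightarrow>
     (if C = {} then d = -1 else (\<exists>s\<in>C. simplex_dim s = d) \<and> (\<forall>s\<in>C. simplex_dim s \<le> d))"

definition link :: "'v set set \<Rightarrow> 'v set \<Rightarrow> 'v set set" where
  "link C s = {t \<in> C. t \<inter> s = {} \<and> t \<union> s \<in> C}"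

text \<open>Points of the geometric realization in barycentric coordinates. A set is open iff it meets
  every closed simplex in a relatively open set (weak topology); the product topology on functions
  restricts to the Euclidean topology on each closed simplex.\<close>

definition realization_points :: "'v set set \<Rightarrow> ('v \<Rightarrow> real) set" where
  "realization_points C =
     {x. (\<forall>v. 0 \<le> x v) \<and> {v. x v \<noteq> 0} \<in> C \<and> (\<Sum>v | x v \<noteq> 0. x v) = 1}"

definition closed_simplex :: "'v set set \<Rightarrow> 'v set \<Rightarrow> ('v \<Rightarrow> real) set" where
  "closed_simplex C s = {x \<in> realization_points C. {v. x v \<noteq> 0} \<subseteq> s}"

definition realization :: "'v set set \<Rightarrow> ('v \<Rightarrow> real) topology" where
  "realization C = topology (\<lambda>U. U \<subseteq> realization_points C \<and>
     (\<forall>s\<in>C. openin (top_of_set (closed_simplex C s)) (U \<inter> closed_simplex C s)))"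

lemma openin_realization:
  "openin (realization C) U \<longleftrightarrow> U \<subseteq> realization_points C \<and>
     (\<forall>s\<in>C. openin (top_of_set (closed_simplex C s)) (U \<inter> closed_simplex C s))"
proof -
  have "istopology (\<lambda>U. U \<subseteq> realization_points C \<and>
     (\<forall>s\<in>C. openin (top_of_set (closed_simplex C s)) (U \<inter> closed_simplex C s)))"
    (is "istopology ?P")
    unfolding istopology_def
  proof (intro conjI allI impI ballI)
    fix U V assume U: "?P U" and V: "?P V"
    show "U \<inter> V \<subseteq> realization_points C" using U by blast
    fix s assume s: "s \<in> C"
    have "U \<inter> V \<inter> closed_simplex C s = (U \<inter> closed_simplex C s) \<inter> (V \<inter> closed_simplex C s)"
      by blast
    moreover have "openin (top_of_set (closed_simplex C s))
        ((U \<inter> closed_simplex C s) \<inter> (V \<inter> closed_simplex C s))"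
      by (rule openin_Int) (use U V s in blast)+
    ultimately show "openin (top_of_set (closed_simplex C s)) (U \<inter> V \<inter> closed_simplex C s)"
      by (simp only:)
  next
    fix \<U> assume \<U>: "\<forall>U\<in>\<U>. ?P U"
    show "\<Union>\<U> \<subseteq> realization_points C" using \<U> by blast
    fix s assume s: "s \<in> C"
    have "\<Union>\<U> \<inter> closed_simplex C s = \<Union>((\<lambda>U. U \<inter> closed_simplex C s) ` \<U>)"
      by blast
    moreover have "openin (top_of_set (closed_simplex C s))
        (\<Union>((\<lambda>U. U \<inter> closed_simplex C s) ` \<U>))"
      by (rule openin_Union) (use \<U> s in blast)
    ultimately show "openin (top_of_set (closed_simplex C s)) (\<Union>\<U> \<inter> closed_simplex C s)"
      by (simp only:)
  qed
  then show ?thesis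
    unfolding realization_def by (simp only: topology_inverse')
qed

lemma topspace_realization: "topspace (realization C) = realization_points C"
proof
  show "topspace (realization C) \<subseteq> realization_points C"
    using openin_realization[of C "topspace (realization C)"] openin_topspace by blast
  have "realization_points C \<inter> closed_simplex C s = closed_simplex C s" for s
    by (auto simp: closed_simplex_def)
  then have "openin (realization C) (realization_points C)"
    by (simp add: openin_realization)
  then show "realization_points C \<subseteq> topspace (realization C)"
    by (rule openin_subset)
qed

text \<open>Vanishing of homotopy in degrees \<open>\<le> k\<close>: every map from a sphere of dimension at most \<open>k\<close> is
  null-homotopic. For \<open>k = -1\<close> this says nonempty, for \<open>k \<le> -2\<close> nothing.\<close>

definition k_connected :: "int \<Rightarrow> 'p topology \<Rightarrow> bool" where
  "k_connected k T \<longleftrightarrow> (-1 \<le> k \<longrightarrow> topspace T \<noteq> {}) \<and>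
     (\<forall>i::nat. int i \<le> k \<longrightarrow> (\<forall>f. continuous_map (nsphere i) T f \<longrightarrow>
        (\<exists>c\<in>topspace T. homotopic_with (\<lambda>_. True) (nsphere i) T f (\<lambda>_. c))))"

definition cohen_macaulay :: "'v set set \<Rightarrow> int \<Rightarrow> bool" where
  "cohen_macaulay C d \<longleftrightarrow>
     has_dimension C d \<and> k_connected (d - 1) (realization C) \<and>
     (\<forall>s\<in>C. has_dimension (link C s) (d - simplex_dim s - 1) \<and>
        k_connected (d - simplex_dim s - 2) (realization (link C s)))"


section \<open>The complex of partial bases\<close>

text \<open>The multiplicative components of the module record are meaningless here.\<close>

definition free_module :: "('a, 'b) ring_scheme \<Rightarrow> nat \<Rightarrow> ('a, nat \<Rightarrow> 'a) module" where
  "free_module R n =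
     \<lparr>carrier = {..<n} \<rightarrow>\<^sub>E carrier R, monoid.mult = undefined, one = undefined,
      zero = (\<lambda>i\<in>{..<n}. \<zero>\<^bsub>R\<^esub>), add = (\<lambda>v w. \<lambda>i\<in>{..<n}. v i \<oplus>\<^bsub>R\<^esub> w i),
      smult = (\<lambda>a v. \<lambda>i\<in>{..<n}. a \<otimes>\<^bsub>R\<^esub> v i)\<rparr>"

definition finite_basis :: "('a, 'b) ring_scheme \<Rightarrow> ('a, 'm, 'c) module_scheme \<Rightarrow> 'm set \<Rightarrow> bool" where
  "finite_basis R M B \<longleftrightarrow> finite B \<and> B \<subseteq> carrier M \<and>
     (\<forall>v\<in>carrier M. \<exists>!c. c \<in> B \<rightarrow>\<^sub>E carrier R \<and> v = (\<Oplus>\<^bsub>M\<^esub>b\<in>B. c b \<odot>\<^bsub>M\<^esub> b))"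

definition partial_bases_complex :: "('a, 'b) ring_scheme \<Rightarrow> nat \<Rightarrow> (nat \<Rightarrow> 'a) set set" where
  "partial_bases_complex R n = {s. s \<noteq> {} \<and> (\<exists>B. finite_basis R (free_module R n) B \<and> s \<subseteq> B)}"

lemma simplicial_complex_partial_bases: "simplicial_complex (partial_bases_complex R n)"
  unfolding simplicial_complex_def
proof (intro conjI ballI allI impI)
  fix s assume "s \<in> partial_bases_complex R n"
  then obtain B where B: "finite_basis R (free_module R n) B" "s \<subseteq> B" and "s \<noteq> {}"
    unfolding partial_bases_complex_def by blast
  then show "finite s" "s \<noteq> {}"
    unfolding finite_basis_def by (auto dest: finite_subset)
  fix t assume "t \<subseteq> s \<and> t \<noteq> {}"
  then show "t \<in> partial_bases_complex R n"
    using B unfolding partial_bases_complex_def by blast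
qed

end

theory Submission
  imports Defs
begin

text \<open>
  In both families \<open>\<O>\<^sub>S\<close> carries a multiplicative absolute value that is at least \<open>1\<close> on nonzero elements
  and at least \<open>2\<close> on nonzero nonunits. If the complex of partial bases were Cohen--Macaulay, the
  link of \<open>n - 2\<close> standard basis vectors (or the complex itself, for \<open>n = 2\<close>) would be connected, so
  any two unimodular pairs would be joined by a path of pairs whose consecutive determinants are
  units. Along a shortest path from \<open>(0, 1)\<close> the absolute value of the first coordinate grows by at
  least \<open>1\<close> in every step, since two pairs at distance two have a nonunit determinant; estimating the
  quotients as convergents of a continued fraction shows that the quotient \<open>b / a\<close> of a reachable pair
  lies at distance less than \<open>1\<close> from an integer \<open>c \<in> \<O>\<^sub>S\<close>. On the other hand every point of \<open>K\<close>
  is approximated by quotients of unimodular pairs. So it is enough to find a point of \<open>K\<close> that is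
  stably at distance at least \<open>1\<close> from \<open>\<O>\<^sub>S\<close>.

  For imaginary quadratic fields such a point is written down explicitly. For function fields with
  \<open>S = {f}\<close>, if it did not exist, then \<open>\<O>\<^sub>S\<close> would be Euclidean with respect to the valuation of \<open>f\<close>
  and every residue at \<open>f\<close> would be represented by a constant, so that the class group would be trivial
  and \<open>f\<close> would have degree \<open>1\<close>.
\<close>

section \<open>Simplicial complexes whose realization is connected\<close>

text \<open>The bound \<open>2\<close> for nonunits is where the excluded \<open>d\<close> come
  from: they are the fields with an integer of norm 2 or 3; otherwise a nonunit has norm at least 4.
  For function fields the bound needs that an element of the ring without pole at \<open>f\<close>
  is constant, and approximating a far point by unimodular pairs needs that \<open>K\<close> is the
  field of fractions of the ring. Classically this comes from the product formula and Riemann-Roch.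
  Here it rests on one finiteness statement: sufficiently many elements of \<open>K\<close> satisfy
  a linear relation over \<open>k[y]\<close>, and after division by powers of \<open>y\<close> such
  a relation can be read modulo \<open>y\<close>. A transcendental element gets its pole from a
  maximal subring avoiding it, which this finiteness makes discrete; a nonconstant element with its
  only pole at \<open>f\<close> comes from counting over the finite field \<open>k\<close>. The far
  point must be stable because only points near it are known to be quotients of unimodular pairs.
  Over the complex numbers stability is a strict inequality, for a discrete valuation it is
  automatic.\<close>

lemma simplicial_complex_face:
  "simplicial_complex C \<Longrightarrow> s \<in> C \<Longrightarrow> t \<subseteq> s \<Longrightarrow> t \<noteq> {} \<Longrightarrow> t \<in> C"
  unfolding simplicial_complex_def by blast

lemma simplicial_complex_edge:
  "simplicial_complex C \<Longrightarrow> s \<in> C \<Longrightarrow> v \<in> s \<Longrightarrow> w \<in> s \<Longrightarrow> {v, w} \<in> C"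
  by (rule simplicial_complex_face) auto

text \<open>An edge-closed \<open>V\<close> contains each simplex or misses it, so these points meet
  every closed simplex in all of it or in nothing. Both are relatively open, which is what the weak
  topology asks.\<close>

lemma openin_realization_component:
  assumes C: "simplicial_complex C"
    and V: "\<And>v w. {v, w} \<in> C \<Longrightarrow> v \<in> V \<Longrightarrow> w \<in> V"
  shows "openin (realization C) {x \<in> realization_points C. {v. x v \<noteq> 0} \<subseteq> V}" (is "openin _ ?U")
  unfolding openin_realization
proof (intro conjI ballI)
  fix s assume s: "s \<in> C"
  have edge: "{v, w} \<in> C" if "v \<in> s" "w \<in> s" for v w
    using simplicial_complex_edge[OF C s that] .
  have "?U \<inter> closed_simplex C s = closed_simplex C s \<or> ?U \<inter> closed_simplex C s = {}"
  proof (cases "s \<subseteq> V")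
    case True
    then show ?thesis unfolding closed_simplex_def by auto
  next
    case False
    then have disj: "s \<inter> V = {}" using edge V by blast
    have "{v. x v \<noteq> 0} \<noteq> {}" if "x \<in> realization_points C" for x
      using that C unfolding realization_points_def simplicial_complex_def by blast
    then have "?U \<inter> closed_simplex C s = {}"
      using disj unfolding closed_simplex_def by blast
    then show ?thesis ..
  qed
  then show "openin (top_of_set (closed_simplex C s)) (?U \<inter> closed_simplex C s)"
  proof
    assume eq: "?U \<inter> closed_simplex C s = closed_simplex C s"
    show ?thesis unfolding eq by (rule openin_subtopology_self)
  next
    assume eq: "?U \<inter> closed_simplex C s = {}"
    show ?thesis unfolding eq by (rule openin_empty)
  qed
qed auto

text \<open>Two points are a map from the 0-sphere, and the two tracks of a contracting homotopy end
  in the same point; the union of the tracks is the connected set.\<close>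

lemma k_connected_0_imp_pathwise:
  assumes T: "k_connected 0 T" and pq: "p \<in> topspace T" "q \<in> topspace T"
  obtains S where "connectedin T S" "p \<in> S" "q \<in> S"
proof -
  let ?f = "\<lambda>x::nat \<Rightarrow> real. if x 0 > 0 then p else q"
  have coord: "continuous_map (nsphere 0) euclideanreal (\<lambda>x. x 0)"
    unfolding nsphere_def Euclidean_space_def
    by (intro continuous_map_from_subtopology continuous_map_product_projection) auto
  have pos: "openin (nsphere 0) {x \<in> topspace (nsphere 0). x 0 \<in> {0<..}}"
    by (rule openin_continuous_map_preimage[OF coord]) auto
  have neg: "openin (nsphere 0) {x \<in> topspace (nsphere 0). x 0 \<in> {..<0}}"
    by (rule openin_continuous_map_preimage[OF coord]) auto
  have dich: "x 0 = 1 \<or> x 0 = -1" if "x \<in> topspace (nsphere 0)" for x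
    using that unfolding nsphere_def by (auto simp: power2_eq_1_iff)
  have "continuous_map (nsphere 0) T ?f"
    unfolding continuous_map_def
  proof (intro conjI allI impI)
    show "?f \<in> topspace (nsphere 0) \<rightarrow> topspace T" using pq by auto
    fix U assume "openin T U"
    \<comment> \<open>By \<open>dich\<close> the coordinate is never 0 on the sphere, so every
      preimage is a union of the two open pieces \<open>pos\<close> and \<open>neg\<close>.\<close>
    have "{x \<in> topspace (nsphere 0). ?f x \<in> U} =
      (if p \<in> U then {x \<in> topspace (nsphere 0). x 0 \<in> {0<..}} else {}) \<union>
      (if q \<in> U then {x \<in> topspace (nsphere 0). x 0 \<in> {..<0}} else {})"
      using dich by (auto; force)
    moreover have "openin (nsphere 0) (if p \<in> U then {x \<in> topspace (nsphere 0). x 0 \<in> {0<..}} else {})"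
      using pos by (cases "p \<in> U") (simp_all only: if_True if_False openin_empty)
    moreover have "openin (nsphere 0) (if q \<in> U then {x \<in> topspace (nsphere 0). x 0 \<in> {..<0}} else {})"
      using neg by (cases "q \<in> U") (simp_all only: if_True if_False openin_empty)
    ultimately show "openin (nsphere 0) {x \<in> topspace (nsphere 0). ?f x \<in> U}"
      by (simp only: openin_Un)
  qed
  then obtain c where "homotopic_with (\<lambda>_. True) (nsphere 0) T ?f (\<lambda>_. c)"
    using T unfolding k_connected_def by force
  then obtain h where h: "continuous_map (prod_topology (top_of_set {0..1::real}) (nsphere 0)) T h"
    "\<And>x. h (0, x) = ?f x" "\<And>x. h (1, x) = c"
    unfolding homotopic_with_def by auto
  have path: "connectedin T ((\<lambda>t. h (t, x)) ` {0..1})" if "x \<in> topspace (nsphere 0)" for x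
  proof (rule connectedin_continuous_map_image)
    have "continuous_map (top_of_set {0..1::real}) (prod_topology (top_of_set {0..1::real}) (nsphere 0)) (\<lambda>t. (t, x))"
      using that by (intro continuous_map_pairedI) auto
    from continuous_map_compose[OF this h(1)]
    show "continuous_map (top_of_set {0..1::real}) T (\<lambda>t. h (t, x))" by (simp add: o_def)
    show "connectedin (top_of_set {0..1::real}) {0..1}" by (simp add: connectedin_subtopology)
  qed
  \<comment> \<open>The points of \<open>nsphere 0\<close> are sequences supported in coordinate 0;
    the two of them are \<open>e 1\<close> and \<open>e (-1)\<close>.\<close>
  define e where "e r = (\<lambda>i::nat. if i = 0 then r else (0::real))" for r
  have e: "e 1 \<in> topspace (nsphere 0)" "e (-1) \<in> topspace (nsphere 0)"
    by (auto simp: e_def nsphere_def Euclidean_space_def)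
  let ?P = "(\<lambda>t. h (t, e 1)) ` {0..1}" and ?Q = "(\<lambda>t. h (t, e (-1))) ` {0..1}"
  have "c \<in> ?P" by (rule image_eqI[of _ _ 1]) (simp_all add: h)
  moreover have "c \<in> ?Q" by (rule image_eqI[of _ _ 1]) (simp_all add: h)
  moreover have "p \<in> ?P" by (rule image_eqI[of _ _ 0]) (simp_all add: h e_def)
  moreover have "q \<in> ?Q" by (rule image_eqI[of _ _ 0]) (simp_all add: h e_def)
  ultimately show thesis
    using that[of "?P \<union> ?Q"] connectedin_Un[OF path[OF e(1)] path[OF e(2)]] by blast
qed

text \<open>If \<open>b\<close> were not reachable from \<open>a\<close>, the reachable vertices and
  their complement would split the realization into two open sets, and no connected set could
  contain both vertices.\<close>

lemma k_connected_0_realization_imp_edge_path: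
  assumes C: "simplicial_complex C" and T: "k_connected 0 (realization C)"
    and ab: "{a} \<in> C" "{b} \<in> C"
  shows "(a, b) \<in> {(v, w). {v, w} \<in> C}\<^sup>*"
proof (rule ccontr)
  assume nb: "(a, b) \<notin> {(v, w). {v, w} \<in> C}\<^sup>*"
  define V where "V = {v. (a, v) \<in> {(v, w). {v, w} \<in> C}\<^sup>*}"
  have V: "w \<in> V" if "{v, w} \<in> C" "v \<in> V" for v w
    using that unfolding V_def by (auto intro: rtrancl.rtrancl_into_rtrancl)
  have V': "w \<in> - V" if "{v, w} \<in> C" "v \<in> - V" for v w
    using V[of w v] that by (auto simp: insert_commute)
  define U where "U W = {x \<in> realization_points C. {v. x v \<noteq> 0} \<subseteq> W}" for W
  \<comment> \<open>The vertex \<open>u\<close> in barycentric coordinates.\<close>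
  define d where "d u = (\<lambda>v. if v = u then 1 else (0::real))" for u :: 'a
  have supp: "{v. d u v \<noteq> 0} = {u}" for u by (auto simp: d_def)
  have d: "d u \<in> realization_points C" if "{u} \<in> C" for u
    using that by (simp add: realization_points_def supp) (simp add: d_def)
  obtain S where S: "connectedin (realization C) S" "d a \<in> S" "d b \<in> S"
    by (rule k_connected_0_imp_pathwise[OF T, of "d a" "d b"])
       (use d ab in \<open>auto simp: topspace_realization\<close>)
  have op: "openin (realization C) (U V)" "openin (realization C) (U (-V))"
    unfolding U_def using openin_realization_component[OF C] V V' by blast+
  have sub: "realization_points C \<subseteq> U V \<union> U (-V)"
  proof
    fix x assume x: "x \<in> realization_points C"
    let ?s = "{v. x v \<noteq> 0}"
    have "?s \<in> C" using x by (simp add: realization_points_def)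
    then have "{v, w} \<in> C" if "v \<in> ?s" "w \<in> ?s" for v w
      using simplicial_complex_edge[OF C _ that] by blast
    then have "?s \<subseteq> V \<or> ?s \<subseteq> - V" using V by blast
    then show "x \<in> U V \<union> U (-V)" using x by (auto simp: U_def)
  qed
  have disj: "U V \<inter> U (-V) \<inter> S = {}"
  proof -
    have "{v. x v \<noteq> 0} \<noteq> {}" if "x \<in> realization_points C" for x
      using that C unfolding realization_points_def simplicial_complex_def by blast
    then show ?thesis unfolding U_def by blast
  qed
  have "d a \<in> U V" "d b \<in> U (- V)"
    using d ab nb by (auto simp: U_def supp V_def)
  moreover have "S \<subseteq> U V \<union> U (-V)"
    using sub connectedin_subset_topspace[OF S(1)] by (auto simp: topspace_realization)
  ultimately show False
    using S op disj unfolding connectedin by blast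
qed

section \<open>Bases of free modules\<close>

definition plane_vec :: "('a, 'b) ring_scheme \<Rightarrow> nat \<Rightarrow> 'a \<Rightarrow> 'a \<Rightarrow> nat \<Rightarrow> 'a" where
  "plane_vec R n x y = (\<lambda>i\<in>{..<n}. if i = 0 then x else if i = 1 then y else \<zero>\<^bsub>R\<^esub>)"

definition unit_vec :: "('a, 'b) ring_scheme \<Rightarrow> nat \<Rightarrow> nat \<Rightarrow> nat \<Rightarrow> 'a" where
  "unit_vec R n j = (\<lambda>i\<in>{..<n}. if i = j then \<one>\<^bsub>R\<^esub> else \<zero>\<^bsub>R\<^esub>)"

context cring
begin

lemma free_module_coord: "x \<in> carrier (free_module R n) \<Longrightarrow> i < n \<Longrightarrow> x i \<in> carrier R"
  by (auto simp: free_module_def)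

lemma free_module_eqI:
  assumes "x \<in> carrier (free_module R n)" "y \<in> carrier (free_module R n)"
    and "\<And>i. i < n \<Longrightarrow> x i = y i"
  shows "x = y"
  using assms by (auto simp: free_module_def intro: PiE_ext)

lemma free_module_add:
  "i < n \<Longrightarrow> (x \<oplus>\<^bsub>free_module R n\<^esub> y) i = x i \<oplus> y i"
  by (simp add: free_module_def)

lemma free_module_zero: "i < n \<Longrightarrow> \<zero>\<^bsub>free_module R n\<^esub> i = \<zero>"
  by (simp add: free_module_def)

lemma abelian_group_free_module: "abelian_group (free_module R n)"
proof -
  let ?M = "free_module R n"
  have add: "x \<oplus>\<^bsub>?M\<^esub> y \<in> carrier ?M" if "x \<in> carrier ?M" "y \<in> carrier ?M" for x y
    using free_module_coord[OF that(1)] free_module_coord[OF that(2)] by (simp add: free_module_def)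
  have zero: "\<zero>\<^bsub>?M\<^esub> \<in> carrier ?M" by (simp add: free_module_def)
  note coord = free_module_coord[of _ n] free_module_add free_module_zero
  show ?thesis
  proof (rule abelian_groupI)
    fix x assume x: "x \<in> carrier ?M"
    let ?y = "\<lambda>i\<in>{..<n}. \<ominus> x i"
    have y: "?y \<in> carrier ?M" using free_module_coord[OF x] by (simp add: free_module_def)
    have "?y \<oplus>\<^bsub>?M\<^esub> x = \<zero>\<^bsub>?M\<^esub>"
      by (rule free_module_eqI[OF add[OF y x] zero]) (simp add: coord x l_neg)
    then show "\<exists>y\<in>carrier ?M. y \<oplus>\<^bsub>?M\<^esub> x = \<zero>\<^bsub>?M\<^esub>" using y by blast
    show "\<zero>\<^bsub>?M\<^esub> \<oplus>\<^bsub>?M\<^esub> x = x"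
      by (rule free_module_eqI[OF add[OF zero x] x]) (simp add: coord x)
    fix y assume y: "y \<in> carrier ?M"
    show "x \<oplus>\<^bsub>?M\<^esub> y = y \<oplus>\<^bsub>?M\<^esub> x"
      by (rule free_module_eqI[OF add[OF x y] add[OF y x]]) (simp add: coord x y a_comm)
    fix z assume z: "z \<in> carrier ?M"
    show "x \<oplus>\<^bsub>?M\<^esub> y \<oplus>\<^bsub>?M\<^esub> z = x \<oplus>\<^bsub>?M\<^esub> (y \<oplus>\<^bsub>?M\<^esub> z)"
      by (rule free_module_eqI[OF add[OF add[OF x y] z] add[OF x add[OF y z]]])
         (simp add: coord x y z a_assoc)
  qed (fact add zero)+
qed

lemma finsum_free_module:
  assumes "finite B" "f \<in> B \<rightarrow> carrier (free_module R n)" "i < n"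
  shows "finsum (free_module R n) f B i = (\<Oplus>b\<in>B. f b i)"
  using assms(1,2)
proof (induction B rule: finite_induct)
  interpret M: abelian_group "free_module R n" by (rule abelian_group_free_module)
  case empty
  then show ?case using assms(3) by (simp add: M.finsum_empty) (simp add: free_module_def)
next
  interpret M: abelian_group "free_module R n" by (rule abelian_group_free_module)
  case (insert b B)
  have f: "f e i \<in> carrier R" if "e \<in> insert b B" for e
    using insert.prems that assms(3) by (auto simp: free_module_def PiE_def Pi_def)
  have "finsum (free_module R n) f (insert b B) = f b \<oplus>\<^bsub>free_module R n\<^esub> finsum (free_module R n) f B"
    using insert by (intro M.finsum_insert) auto
  then have "finsum (free_module R n) f (insert b B) i = f b i \<oplus> finsum (free_module R n) f B i"
    using assms(3) by (simp add: free_module_def)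
  also have "\<dots> = f b i \<oplus> (\<Oplus>b\<in>B. f b i)" using insert by auto
  also have "\<dots> = (\<Oplus>b\<in>insert b B. f b i)"
    using insert f by (intro finsum_insert[symmetric]) auto
  finally show ?case .
qed

lemma unit_vec_closed [simp]: "unit_vec R n j \<in> carrier (free_module R n)"
  by (auto simp: unit_vec_def free_module_def)

lemma plane_vec_closed:
  "x \<in> carrier R \<Longrightarrow> y \<in> carrier R \<Longrightarrow> plane_vec R n x y \<in> carrier (free_module R n)"
  by (auto simp: plane_vec_def free_module_def)

lemma inj_unit_vec: "\<one> \<noteq> \<zero> \<Longrightarrow> inj_on (unit_vec R n) {..<n}"
proof (rule inj_onI)
  fix i j assume "\<one> \<noteq> \<zero>" "i \<in> {..<n}" "j \<in> {..<n}" "unit_vec R n i = unit_vec R n j"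
  then have "unit_vec R n i i = unit_vec R n j i" by simp
  then show "i = j" using \<open>\<one> \<noteq> \<zero>\<close> \<open>i \<in> {..<n}\<close> by (simp add: unit_vec_def split: if_splits)
qed

lemma plane_vec_not_unit: "\<one> \<noteq> \<zero> \<Longrightarrow> plane_vec R n x y \<notin> unit_vec R n ` {2..<n}"
proof
  assume "\<one> \<noteq> \<zero>" "plane_vec R n x y \<in> unit_vec R n ` {2..<n}"
  then obtain j where j: "2 \<le> j" "j < n" "plane_vec R n x y = unit_vec R n j" by auto
  then have "plane_vec R n x y j = unit_vec R n j j" by simp
  then show False using j \<open>\<one> \<noteq> \<zero>\<close> by (simp add: plane_vec_def unit_vec_def)
qed

text \<open>In coordinates 0 and 1 the unit vectors contribute nothing, which reduces basis
  questions about \<open>v\<close>, \<open>w\<close> and the unit vectors to two-by-two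
  matrices.\<close>

lemma linear_combination_coordinate:
  assumes one: "\<one> \<noteq> \<zero>"
    and vw: "v \<in> carrier (free_module R n)" "w \<in> carrier (free_module R n)" "v \<noteq> w"
      "v \<notin> unit_vec R n ` {2..<n}" "w \<notin> unit_vec R n ` {2..<n}"
    and c: "c \<in> insert v (insert w (unit_vec R n ` {2..<n})) \<rightarrow> carrier R"
    and i: "i < n"
  shows "(\<Oplus>\<^bsub>free_module R n\<^esub>b\<in>insert v (insert w (unit_vec R n ` {2..<n})). c b \<odot>\<^bsub>free_module R n\<^esub> b) i
    = c v \<otimes> v i \<oplus> (c w \<otimes> w i \<oplus> (if 2 \<le> i then c (unit_vec R n i) else \<zero>))"
proof -
  let ?U = "unit_vec R n ` {2..<n}" and ?B = "insert v (insert w (unit_vec R n ` {2..<n}))"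
  have smult: "(c b \<odot>\<^bsub>free_module R n\<^esub> b) i = c b \<otimes> b i" for b
    using i by (simp add: free_module_def)
  have B: "?B \<subseteq> carrier (free_module R n)" using vw by auto
  have bi: "b i \<in> carrier R" if "b \<in> ?B" for b
    using B that i by (auto simp: free_module_def PiE_def Pi_def)
  have closed: "c b \<odot>\<^bsub>free_module R n\<^esub> b \<in> carrier (free_module R n)" if "b \<in> ?B" for b
  proof -
    have "c b \<in> carrier R" "b \<in> carrier (free_module R n)" using that B c by blast+
    then show ?thesis by (auto simp: free_module_def PiE_def Pi_def)
  qed
  have cb: "c b \<otimes> b i \<in> carrier R" if "b \<in> ?B" for b
    using bi[OF that] c that by auto
  have inj: "inj_on (unit_vec R n) {2..<n}"
    using inj_unit_vec[OF one] by (rule inj_on_subset) auto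
  have "(\<Oplus>b\<in>?U. c b \<otimes> b i) = (\<Oplus>j\<in>{2..<n}. c (unit_vec R n j) \<otimes> unit_vec R n j i)"
    by (rule finsum_reindex[OF _ inj]) (use cb in auto)
  also have "\<dots> = (\<Oplus>j\<in>{2..<n}. if i = j then c (unit_vec R n j) else \<zero>)"
    using c i by (intro finsum_cong') (auto simp: unit_vec_def Pi_def)
  also have "\<dots> = (if 2 \<le> i then c (unit_vec R n i) else \<zero>)"
  proof (cases "2 \<le> i")
    case True
    then show ?thesis using i c
      by (subst add.finprod_singleton[of i "{2..<n}" "\<lambda>j. c (unit_vec R n j)"]) (auto simp: Pi_def)
  next
    case False
    then have "(\<Oplus>j\<in>{2..<n}. if i = j then c (unit_vec R n j) else \<zero>) = (\<Oplus>j\<in>{2..<n}. \<zero>)"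
      by (intro finsum_cong') auto
    then show ?thesis using False by (simp add: add.finprod_one_eqI)
  qed
  finally have U: "(\<Oplus>b\<in>?U. c b \<otimes> b i) = (if 2 \<le> i then c (unit_vec R n i) else \<zero>)" .
  have "(\<Oplus>\<^bsub>free_module R n\<^esub>b\<in>?B. c b \<odot>\<^bsub>free_module R n\<^esub> b) i = (\<Oplus>b\<in>?B. c b \<otimes> b i)"
    by (subst finsum_free_module) (use closed i smult in auto)
  also have "\<dots> = c v \<otimes> v i \<oplus> (\<Oplus>b\<in>insert w ?U. c b \<otimes> b i)"
    by (rule finsum_insert) (use vw cb in auto)
  also have "(\<Oplus>b\<in>insert w ?U. c b \<otimes> b i) = c w \<otimes> w i \<oplus> (\<Oplus>b\<in>?U. c b \<otimes> b i)"
    by (rule finsum_insert) (use vw cb in auto)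
  finally show ?thesis using U by simp
qed

text \<open>The pair \<open>(a, b)\<close> is completed by \<open>(-y, x)\<close>, so that the
  determinant is \<open>a x + b y = 1\<close>. The inverse matrix supplies the coefficients of a
  vector and shows that they are unique.\<close>

lemma finite_basis_plane_vec:
  assumes one: "\<one> \<noteq> \<zero>" and n: "n \<ge> 2"
    and R: "a \<in> carrier R" "b \<in> carrier R" "x \<in> carrier R" "y \<in> carrier R"
    and det: "a \<otimes> x \<oplus> b \<otimes> y = \<one>"
  shows "finite_basis R (free_module R n)
    (insert (plane_vec R n a b) (insert (plane_vec R n (\<ominus> y) x) (unit_vec R n ` {2..<n})))"
    (is "finite_basis R ?M ?B")
    "plane_vec R n a b \<noteq> plane_vec R n (\<ominus> y) x"
proof -
  let ?v = "plane_vec R n a b" and ?w = "plane_vec R n (\<ominus> y) x"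
  have coords: "plane_vec R n s t 0 = s" "plane_vec R n s t (Suc 0) = t"
     "\<And>i. 2 \<le> i \<Longrightarrow> i < n \<Longrightarrow> plane_vec R n s t i = \<zero>" for s t
    using n by (auto simp: plane_vec_def)
  show vw: "?v \<noteq> ?w"
  proof
    assume eq: "?v = ?w"
    have "a = \<ominus> y" "b = x" using coords arg_cong[OF eq, of "\<lambda>f. f 0"] arg_cong[OF eq, of "\<lambda>f. f (Suc 0)"]
      by auto
    then have "a \<otimes> x \<oplus> b \<otimes> y = \<zero>" using R by algebra
    then show False using det one by simp
  qed
  note nu = plane_vec_not_unit[OF one, of n]
  have lin: "(\<Oplus>\<^bsub>?M\<^esub>b\<in>?B. c b \<odot>\<^bsub>?M\<^esub> b) i
    = c ?v \<otimes> ?v i \<oplus> (c ?w \<otimes> ?w i \<oplus> (if 2 \<le> i then c (unit_vec R n i) else \<zero>))"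
    if "c \<in> ?B \<rightarrow> carrier R" "i < n" for c i
    by (rule linear_combination_coordinate[OF one])
       (use that vw nu R in \<open>auto intro: plane_vec_closed\<close>)
  interpret M: abelian_group ?M by (rule abelian_group_free_module)
  have Bsub: "?B \<subseteq> carrier ?M" using R by (auto intro!: plane_vec_closed)
  have inj: "inj_on (unit_vec R n) {2..<n}"
    using inj_unit_vec[OF one] by (rule inj_on_subset) auto
  show "finite_basis R ?M ?B"
    unfolding finite_basis_def
  proof (intro conjI ballI)
    show "finite ?B" by auto
    show "?B \<subseteq> carrier ?M" by (rule Bsub)
    fix u assume u: "u \<in> carrier ?M"
    have ui: "u i \<in> carrier R" if "i < n" for i
      using u that by (auto simp: free_module_def PiE_def Pi_def)
    have u0: "u 0 \<in> carrier R" "u (Suc 0) \<in> carrier R" using ui n by auto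
    \<comment> \<open>Coefficients are indexed by vectors, so the position of a unit vector has to
      be recovered from the vector itself.\<close>
    define idx where "idx e = (THE j. j \<in> {2..<n} \<and> unit_vec R n j = e)" for e
    have idx: "idx (unit_vec R n j) = j" if "2 \<le> j" "j < n" for j
      unfolding idx_def using that inj by (intro the_equality) (auto simp: inj_on_def)
    define c where "c = (\<lambda>e\<in>?B. if e = ?v then x \<otimes> u 0 \<oplus> y \<otimes> u (Suc 0)
       else if e = ?w then \<ominus> b \<otimes> u 0 \<oplus> a \<otimes> u (Suc 0) else u (idx e))"
    have c: "c ?v = x \<otimes> u 0 \<oplus> y \<otimes> u (Suc 0)" "c ?w = \<ominus> b \<otimes> u 0 \<oplus> a \<otimes> u (Suc 0)"
      "\<And>j. 2 \<le> j \<Longrightarrow> j < n \<Longrightarrow> c (unit_vec R n j) = u j"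
      subgoal by (simp add: c_def)
      subgoal using vw by (simp add: c_def)
      subgoal for j
      proof -
        assume j: "2 \<le> j" "j < n"
        then have "unit_vec R n j \<in> unit_vec R n ` {2..<n}" by auto
        then have "unit_vec R n j \<noteq> ?v" "unit_vec R n j \<noteq> ?w" "unit_vec R n j \<in> ?B"
          using nu[of a b] nu[of "\<ominus> y" x] by auto
        then show ?thesis using j idx by (simp add: c_def)
      qed
      done
    have cR: "c \<in> ?B \<rightarrow> carrier R"
    proof
      fix e assume "e \<in> ?B"
      then consider "e = ?v" | "e = ?w" | j where "2 \<le> j" "j < n" "e = unit_vec R n j" by auto
      then show "c e \<in> carrier R" by cases (use R u0 ui c in auto)
    qed
    then have cE: "c \<in> ?B \<rightarrow>\<^sub>E carrier R" by (auto simp: PiE_def c_def)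
    \<comment> \<open>Applying the inverse matrix to the first two coordinates of a combination
      returns its coefficients \<open>p\<close> and \<open>q\<close>; this is the uniqueness
      part.\<close>
    have solve: "p = x \<otimes> (p \<otimes> a \<oplus> q \<otimes> (\<ominus> y)) \<oplus> y \<otimes> (p \<otimes> b \<oplus> q \<otimes> x)"
      "q = \<ominus> b \<otimes> (p \<otimes> a \<oplus> q \<otimes> (\<ominus> y)) \<oplus> a \<otimes> (p \<otimes> b \<oplus> q \<otimes> x)"
      if "p \<in> carrier R" "q \<in> carrier R" for p q
    proof -
      have "x \<otimes> (p \<otimes> a \<oplus> q \<otimes> (\<ominus> y)) \<oplus> y \<otimes> (p \<otimes> b \<oplus> q \<otimes> x) = p \<otimes> (a \<otimes> x \<oplus> b \<otimes> y)"
        using R that by algebra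
      then show "p = x \<otimes> (p \<otimes> a \<oplus> q \<otimes> (\<ominus> y)) \<oplus> y \<otimes> (p \<otimes> b \<oplus> q \<otimes> x)" using det that by simp
      have "\<ominus> b \<otimes> (p \<otimes> a \<oplus> q \<otimes> (\<ominus> y)) \<oplus> a \<otimes> (p \<otimes> b \<oplus> q \<otimes> x) = q \<otimes> (a \<otimes> x \<oplus> b \<otimes> y)"
        using R that by algebra
      then show "q = \<ominus> b \<otimes> (p \<otimes> a \<oplus> q \<otimes> (\<ominus> y)) \<oplus> a \<otimes> (p \<otimes> b \<oplus> q \<otimes> x)" using det that by simp
    qed
    have sum_closed: "(\<Oplus>\<^bsub>?M\<^esub>b\<in>?B. d b \<odot>\<^bsub>?M\<^esub> b) \<in> carrier ?M" if d: "d \<in> ?B \<rightarrow> carrier R" for d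
    proof (rule M.finsum_closed)
      show "(\<lambda>b. d b \<odot>\<^bsub>?M\<^esub> b) \<in> ?B \<rightarrow> carrier ?M"
      proof
        fix e assume "e \<in> ?B"
        then have "d e \<in> carrier R" "e \<in> carrier ?M" using d Bsub by blast+
        then show "d e \<odot>\<^bsub>?M\<^esub> e \<in> carrier ?M" by (auto simp: free_module_def PiE_def Pi_def)
      qed
    qed
    show "\<exists>!c. c \<in> ?B \<rightarrow>\<^sub>E carrier R \<and> u = (\<Oplus>\<^bsub>?M\<^esub>b\<in>?B. c b \<odot>\<^bsub>?M\<^esub> b)"
    proof (rule ex1I[of _ c])
      have "u = (\<Oplus>\<^bsub>?M\<^esub>b\<in>?B. c b \<odot>\<^bsub>?M\<^esub> b)"
      proof (rule PiE_ext)
        show "u \<in> {..<n} \<rightarrow>\<^sub>E carrier R" using u by (simp add: free_module_def)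
        show "(\<Oplus>\<^bsub>?M\<^esub>b\<in>?B. c b \<odot>\<^bsub>?M\<^esub> b) \<in> {..<n} \<rightarrow>\<^sub>E carrier R"
          using sum_closed[OF cR] by (simp add: free_module_def)
        fix i assume "i \<in> {..<n}"
        then have i: "i < n" by simp
        consider "i = 0" | "i = 1" | "2 \<le> i" by linarith
        then show "u i = (\<Oplus>\<^bsub>?M\<^esub>b\<in>?B. c b \<odot>\<^bsub>?M\<^esub> b) i"
        proof cases
          case 1
          have "(x \<otimes> u 0 \<oplus> y \<otimes> u (Suc 0)) \<otimes> a \<oplus> ((\<ominus> b \<otimes> u 0 \<oplus> a \<otimes> u (Suc 0)) \<otimes> (\<ominus> y) \<oplus> \<zero>) = u 0 \<otimes> (a \<otimes> x \<oplus> b \<otimes> y)"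
            using R u0 by algebra
          then show ?thesis using 1 i lin[OF cR i] u0 by (simp add: coords c det)
        next
          case 2
          have "(x \<otimes> u 0 \<oplus> y \<otimes> u (Suc 0)) \<otimes> b \<oplus> ((\<ominus> b \<otimes> u 0 \<oplus> a \<otimes> u (Suc 0)) \<otimes> x \<oplus> \<zero>) = u (Suc 0) \<otimes> (a \<otimes> x \<oplus> b \<otimes> y)"
            using R u0 by algebra
          then show ?thesis using 2 i lin[OF cR i] u0 by (simp add: coords c det)
        next
          case 3
          then show ?thesis using i lin[OF cR i] R u0 ui by (simp add: coords c)
        qed
      qed
      then show "c \<in> ?B \<rightarrow>\<^sub>E carrier R \<and> u = (\<Oplus>\<^bsub>?M\<^esub>b\<in>?B. c b \<odot>\<^bsub>?M\<^esub> b)" using cE by blast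
    next
      fix d assume d: "d \<in> ?B \<rightarrow>\<^sub>E carrier R \<and> u = (\<Oplus>\<^bsub>?M\<^esub>b\<in>?B. d b \<odot>\<^bsub>?M\<^esub> b)"
      then have dR: "d \<in> ?B \<rightarrow> carrier R" by auto
      have dvw: "d ?v \<in> carrier R" "d ?w \<in> carrier R" using dR by auto
      have l: "u i = d ?v \<otimes> ?v i \<oplus> (d ?w \<otimes> ?w i \<oplus> (if 2 \<le> i then d (unit_vec R n i) else \<zero>))" if "i < n" for i
        using lin[OF dR that] d by metis
      have d0: "u 0 = d ?v \<otimes> a \<oplus> d ?w \<otimes> (\<ominus> y)" using l[of 0] n R dvw by (simp add: coords)
      have d1: "u (Suc 0) = d ?v \<otimes> b \<oplus> d ?w \<otimes> x" using l[of "Suc 0"] n R dvw by (simp add: coords)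
      have d2: "u i = d (unit_vec R n i)" if "2 \<le> i" "i < n" for i
      proof -
        have "d (unit_vec R n i) \<in> carrier R" using dR that by auto
        then show ?thesis using l[of i] that R dvw by (simp add: coords)
      qed
      show "d = c"
      proof (rule PiE_ext)
        show "d \<in> ?B \<rightarrow>\<^sub>E carrier R" "c \<in> ?B \<rightarrow>\<^sub>E carrier R" using d cE by auto
        fix e assume "e \<in> ?B"
        then consider "e = ?v" | "e = ?w" | j where "2 \<le> j" "j < n" "e = unit_vec R n j" by auto
        then show "d e = c e"
          by cases (use solve[OF dvw] c d0 d1 d2 in metis)+
      qed
    qed
  qed
qed

text \<open>Expanding the first two unit vectors in the basis gives coefficient rows
  \<open>(p, q)\<close> and \<open>(s, t)\<close> that invert the matrix of \<open>v\<close> and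
  \<open>w\<close> in coordinates 0 and 1, whatever their other coordinates are.\<close>

lemma det_unit_of_finite_basis:
  assumes one: "\<one> \<noteq> \<zero>" and n: "n \<ge> 2"
    and vw: "v \<noteq> w" "v \<notin> unit_vec R n ` {2..<n}" "w \<notin> unit_vec R n ` {2..<n}"
    and B: "finite_basis R (free_module R n) (insert v (insert w (unit_vec R n ` {2..<n})))"
      (is "finite_basis R ?M ?B")
  shows "v 0 \<otimes> w 1 \<ominus> v 1 \<otimes> w 0 \<in> Units R"
proof -
  have sub: "?B \<subseteq> carrier ?M" using B by (simp add: finite_basis_def)
  then have vM: "v \<in> carrier ?M" "w \<in> carrier ?M" by auto
  then have R: "v 0 \<in> carrier R" "v 1 \<in> carrier R" "w 0 \<in> carrier R" "w 1 \<in> carrier R"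
    using n by (auto simp: free_module_def PiE_def Pi_def)
  have ex: "\<exists>p\<in>carrier R. \<exists>q\<in>carrier R. \<forall>i<2. u i = p \<otimes> v i \<oplus> q \<otimes> w i" if u: "u \<in> carrier ?M" for u
  proof -
    obtain c where c: "c \<in> ?B \<rightarrow>\<^sub>E carrier R" "u = (\<Oplus>\<^bsub>?M\<^esub>b\<in>?B. c b \<odot>\<^bsub>?M\<^esub> b)"
      using B u unfolding finite_basis_def by blast
    have cR: "c \<in> ?B \<rightarrow> carrier R" using c by auto
    have "u i = c v \<otimes> v i \<oplus> c w \<otimes> w i" if i: "i < 2" for i
    proof -
      have "v i \<in> carrier R" "w i \<in> carrier R" "c v \<in> carrier R" "c w \<in> carrier R"
        using vM i n cR by (auto simp: free_module_def PiE_def Pi_def)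
      then show ?thesis
        using linear_combination_coordinate[OF one vM vw cR, of i] c(2) i n by simp
    qed
    then show ?thesis using cR by blast
  qed
  obtain p q where pq: "p \<in> carrier R" "q \<in> carrier R" "\<And>i. i < 2 \<Longrightarrow> unit_vec R n 0 i = p \<otimes> v i \<oplus> q \<otimes> w i"
    using ex[OF unit_vec_closed[of n 0]] by blast
  obtain s t where st: "s \<in> carrier R" "t \<in> carrier R" "\<And>i. i < 2 \<Longrightarrow> unit_vec R n 1 i = s \<otimes> v i \<oplus> t \<otimes> w i"
    using ex[OF unit_vec_closed[of n 1]] by blast
  have e: "p \<otimes> v 0 \<oplus> q \<otimes> w 0 = \<one>" "p \<otimes> v 1 \<oplus> q \<otimes> w 1 = \<zero>"
    "s \<otimes> v 0 \<oplus> t \<otimes> w 0 = \<zero>" "s \<otimes> v 1 \<oplus> t \<otimes> w 1 = \<one>"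
    using pq(3)[of 0] pq(3)[of 1] st(3)[of 0] st(3)[of 1] n by (auto simp: unit_vec_def)
  \<comment> \<open>Multiplicativity of the two-by-two determinant.\<close>
  have "(v 0 \<otimes> w 1 \<ominus> v 1 \<otimes> w 0) \<otimes> (p \<otimes> t \<ominus> q \<otimes> s)
    = (p \<otimes> v 0 \<oplus> q \<otimes> w 0) \<otimes> (s \<otimes> v 1 \<oplus> t \<otimes> w 1) \<ominus> (p \<otimes> v 1 \<oplus> q \<otimes> w 1) \<otimes> (s \<otimes> v 0 \<oplus> t \<otimes> w 0)"
    using R pq(1,2) st(1,2) by algebra
  also have "\<dots> = \<one>" unfolding e by (simp add: minus_eq)
  finally have *: "(v 0 \<otimes> w 1 \<ominus> v 1 \<otimes> w 0) \<otimes> (p \<otimes> t \<ominus> q \<otimes> s) = \<one>" .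
  show ?thesis
    by (rule unit_factor[of _ "p \<otimes> t \<ominus> q \<otimes> s"]) (use * R pq(1,2) st(1,2) in simp_all)
qed

end

section \<open>Unimodular pairs over discretely normed rings\<close>

lemma (in field) nonzero_inv:
  assumes "x \<in> carrier R" "x \<noteq> \<zero>"
  shows "inv x \<in> carrier R" "inv x \<noteq> \<zero>" "x \<otimes> inv x = \<one>" "inv x \<otimes> x = \<one>"
proof -
  have "x \<in> Units R" using assms by (simp add: field_Units)
  then show "inv x \<in> carrier R" "x \<otimes> inv x = \<one>" "inv x \<otimes> x = \<one>" by auto
  then show "inv x \<noteq> \<zero>" using assms(1) by force
qed

text \<open>\<open>N\<close> is an absolute value on \<open>K\<close> for which \<open>A\<close> is
  discrete. The gap between \<open>1\<close> and \<open>2\<close> drives the path argument: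
  multiplying by a nonzero nonunit of \<open>A\<close> at least doubles \<open>N\<close>.\<close>

locale discretely_normed_subring = field K for K :: "('a, 'b) ring_scheme" (structure) +
  fixes A :: "'a set" and N :: "'a \<Rightarrow> real"
  assumes subring_A: "subring A K"
    and N_zero: "N \<zero> = 0"
    and N_mult: "x \<in> carrier K \<Longrightarrow> y \<in> carrier K \<Longrightarrow> N (x \<otimes> y) = N x * N y"
    and N_add: "x \<in> carrier K \<Longrightarrow> y \<in> carrier K \<Longrightarrow> N (x \<oplus> y) \<le> N x + N y"
    and N_ge_1: "x \<in> A \<Longrightarrow> x \<noteq> \<zero> \<Longrightarrow> 1 \<le> N x"
    and N_ge_2: "x \<in> A \<Longrightarrow> x \<noteq> \<zero> \<Longrightarrow> inv x \<notin> A \<Longrightarrow> 2 \<le> N x"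
begin

lemma A_sub: "x \<in> A \<Longrightarrow> x \<in> carrier K"
  using subringE(1)[OF subring_A] by blast

lemma A_closed [simp, intro]:
  "\<one> \<in> A" "\<zero> \<in> A" "x \<in> A \<Longrightarrow> y \<in> A \<Longrightarrow> x \<otimes> y \<in> A" "x \<in> A \<Longrightarrow> y \<in> A \<Longrightarrow> x \<oplus> y \<in> A"
  "x \<in> A \<Longrightarrow> \<ominus> x \<in> A" "x \<in> A \<Longrightarrow> y \<in> A \<Longrightarrow> x \<ominus> y \<in> A"
  using subringE[OF subring_A] by (auto simp: minus_eq)

lemma N_one: "N \<one> = 1"
proof -
  have "N \<one> * N \<one> = N \<one>" using N_mult[of \<one> \<one>] by simp
  moreover have "N \<one> \<ge> 1" by (rule N_ge_1) auto
  ultimately show ?thesis by simp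
qed

lemma N_uminus: "x \<in> carrier K \<Longrightarrow> N (\<ominus> x) = N x"
proof -
  assume x: "x \<in> carrier K"
  have "\<ominus> \<one> \<otimes> \<ominus> \<one> = \<one>" by algebra
  then have "N (\<ominus> \<one>) * N (\<ominus> \<one>) = 1" using N_mult[of "\<ominus> \<one>" "\<ominus> \<one>"] N_one by simp
  moreover have "\<ominus> \<one> \<noteq> \<zero>" using add.inv_eq_1_iff by auto
  then have "N (\<ominus> \<one>) \<ge> 1" by (intro N_ge_1) auto
  moreover from this have "N (\<ominus> \<one>) * 1 \<le> N (\<ominus> \<one>) * N (\<ominus> \<one>)"
    by (intro mult_left_mono) auto
  ultimately have "N (\<ominus> \<one>) = 1" by simp
  then show ?thesis using N_mult[of "\<ominus> \<one>" x] x by (simp add: l_minus)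
qed

lemma N_nonneg: "x \<in> carrier K \<Longrightarrow> 0 \<le> N x"
  using N_add[of x "\<ominus> x"] N_uminus[of x] by (simp add: r_neg N_zero)

lemma N_diff: "x \<in> carrier K \<Longrightarrow> y \<in> carrier K \<Longrightarrow> N (x \<ominus> y) \<le> N x + N y"
  using N_add[of x "\<ominus> y"] N_uminus[of y] by (simp add: minus_eq)

lemma N_inv: "x \<in> carrier K \<Longrightarrow> x \<noteq> \<zero> \<Longrightarrow> N x * N (inv x) = 1"
  using N_mult[of x "inv x"] nonzero_inv[of x] N_one by simp

lemma N_pos: "x \<in> carrier K \<Longrightarrow> x \<noteq> \<zero> \<Longrightarrow> 0 < N x"
  using N_inv[of x] N_nonneg[of x] by (cases "N x = 0") auto

definition A_unit :: "'a \<Rightarrow> bool" where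
  "A_unit u \<longleftrightarrow> u \<in> A \<and> u \<noteq> \<zero> \<and> inv u \<in> A"

lemma A_unit_in: "A_unit u \<Longrightarrow> u \<in> A" "A_unit u \<Longrightarrow> u \<in> carrier K" "A_unit u \<Longrightarrow> u \<noteq> \<zero>"
  by (auto simp: A_unit_def A_sub)

lemma N_A_unit: assumes "A_unit u" shows "N u = 1"
proof -
  have u: "u \<in> carrier K" "u \<noteq> \<zero>" using A_unit_in[OF assms] by auto
  have "1 \<le> N u" "1 \<le> N (inv u)"
    using assms nonzero_inv[OF u] by (auto simp: A_unit_def intro: N_ge_1)
  moreover have "N u * N (inv u) = 1" using N_inv u by auto
  ultimately have "N u * 1 \<le> 1" by (metis mult_left_mono order_trans zero_le_one order_refl)
  then show ?thesis using \<open>1 \<le> N u\<close> by simp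
qed

lemma A_unitI:
  assumes "x \<in> A" "y \<in> A" "x \<otimes> y = \<one>"
  shows "A_unit x"
proof -
  have "x \<in> carrier K" "y \<in> carrier K" using assms A_sub by auto
  then have "inv x = y" "x \<noteq> \<zero>" using assms by (auto intro: comm_inv_char)
  then show ?thesis using assms by (simp add: A_unit_def)
qed

lemma A_unitE:
  assumes "A_unit x"
  obtains y where "y \<in> A" "x \<otimes> y = \<one>"
  using assms nonzero_inv(3)[of x] A_sub by (auto simp: A_unit_def)

lemma A_unit_cancel:
  assumes u: "A_unit u" and v: "A_unit v" and x: "x \<in> A" and eq: "u \<otimes> x = v"
  shows "A_unit x"
proof -
  obtain v' where v': "v' \<in> A" "v \<otimes> v' = \<one>" using v A_unitE by blast
  have c: "u \<in> carrier K" "x \<in> carrier K" "v' \<in> carrier K" using u x v' A_unit_in A_sub by auto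
  have "x \<otimes> (u \<otimes> v') = (u \<otimes> x) \<otimes> v'" using c by algebra
  then show ?thesis using x u v' A_unit_in by (intro A_unitI[of x "u \<otimes> v'"]) (auto simp: eq)
qed

lemma A_unit_mult: "A_unit u \<Longrightarrow> A_unit v \<Longrightarrow> A_unit (u \<otimes> v)"
proof -
  assume uv: "A_unit u" "A_unit v"
  obtain u' v' where i: "u' \<in> A" "u \<otimes> u' = \<one>" "v' \<in> A" "v \<otimes> v' = \<one>" using uv A_unitE by metis
  have c: "u \<in> carrier K" "v \<in> carrier K" "u' \<in> carrier K" "v' \<in> carrier K"
    using uv i A_unit_in A_sub by auto
  have "u \<otimes> v \<otimes> (u' \<otimes> v') = (u \<otimes> u') \<otimes> (v \<otimes> v')" using c by algebra
  then show ?thesis using uv i A_unit_in by (intro A_unitI[of "u \<otimes> v" "u' \<otimes> v'"]) auto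
qed

lemma A_unit_uminus: assumes "A_unit u" shows "A_unit (\<ominus> u)"
proof -
  obtain u' where i: "u' \<in> A" "u \<otimes> u' = \<one>" using assms A_unitE by metis
  have c: "u \<in> carrier K" "u' \<in> carrier K" using assms i A_unit_in A_sub by auto
  have "\<ominus> u \<otimes> \<ominus> u' = u \<otimes> u'" using c by algebra
  then show ?thesis using assms i A_unit_in by (intro A_unitI[of "\<ominus> u" "\<ominus> u'"]) auto
qed

fun det2 :: "'a \<times> 'a \<Rightarrow> 'a \<times> 'a \<Rightarrow> 'a" where
  "det2 (a, b) (c, d) = a \<otimes> d \<ominus> b \<otimes> c"

definition unimodular_edges :: "(('a \<times> 'a) \<times> ('a \<times> 'a)) set" where
  "unimodular_edges = {(v, w). v \<in> A \<times> A \<and> w \<in> A \<times> A \<and> A_unit (det2 v w)}"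

text \<open>The quotient of second by first coordinate has distance at least 1 from every element of
  \<open>A\<close>, with the denominator cleared.\<close>

definition far_from_integers :: "'a \<times> 'a \<Rightarrow> bool" where
  "far_from_integers v \<longleftrightarrow> fst v \<noteq> \<zero> \<and> (\<forall>c\<in>A. N (fst v) \<le> N (snd v \<ominus> c \<otimes> fst v))"

lemma det2_in: "v \<in> A \<times> A \<Longrightarrow> w \<in> A \<times> A \<Longrightarrow> det2 v w \<in> A"
  by (cases v; cases w) auto

lemma det2_cramer:
  assumes "v \<in> A \<times> A" "w \<in> A \<times> A" "x \<in> A \<times> A"
  shows "det2 v w \<otimes> fst x = det2 x w \<otimes> fst v \<oplus> det2 v x \<otimes> fst w"
    "det2 v w \<otimes> snd x = det2 x w \<otimes> snd v \<oplus> det2 v x \<otimes> snd w"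
proof -
  have c: "fst v \<in> carrier K" "snd v \<in> carrier K" "fst w \<in> carrier K" "snd w \<in> carrier K"
    "fst x \<in> carrier K" "snd x \<in> carrier K"
    using assms by (simp_all add: mem_Times_iff A_sub)
  have d: "det2 y z = fst y \<otimes> snd z \<ominus> snd y \<otimes> fst z" for y z by (cases y; cases z) auto
  show "det2 v w \<otimes> fst x = det2 x w \<otimes> fst v \<oplus> det2 v x \<otimes> fst w"
    "det2 v w \<otimes> snd x = det2 x w \<otimes> snd v \<oplus> det2 v x \<otimes> snd w"
    unfolding d using c by algebra+
qed

text \<open>Used with \<open>det2 v x = 0\<close>: it then carries the units \<open>det2 v w\<close>
  and \<open>det2 x y\<close> over to \<open>det2 v y\<close>, so the pair following two
  proportional ones is adjacent to the first of them.\<close>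

lemma det2_plucker:
  assumes "v \<in> A \<times> A" "w \<in> A \<times> A" "x \<in> A \<times> A" "y \<in> A \<times> A"
  shows "det2 v w \<otimes> det2 x y = det2 x w \<otimes> det2 v y \<oplus> det2 v x \<otimes> det2 w y"
proof -
  have c: "fst v \<in> carrier K" "snd v \<in> carrier K" "fst w \<in> carrier K" "snd w \<in> carrier K"
    "fst x \<in> carrier K" "snd x \<in> carrier K" "fst y \<in> carrier K" "snd y \<in> carrier K"
    using assms by (simp_all add: mem_Times_iff A_sub)
  have d: "det2 y z = fst y \<otimes> snd z \<ominus> snd y \<otimes> fst z" for y z by (cases y; cases z) auto
  show ?thesis unfolding d using c by algebra
qed

lemma det2_swap: "v \<in> A \<times> A \<Longrightarrow> w \<in> A \<times> A \<Longrightarrow> det2 w v = \<ominus> det2 v w"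
  by (cases v; cases w) (use A_sub in \<open>auto, algebra\<close>)

text \<open>The equations make \<open>x\<close> a unit multiple of \<open>v\<close>. Units have norm
  1, so none of the compared norms changes.\<close>

lemma far_from_integers_unit_multiple:
  assumes v: "v \<in> A \<times> A" and x: "x \<in> A \<times> A" and D: "A_unit D" "A_unit D'"
    and eq: "D \<otimes> fst x = D' \<otimes> fst v" "D \<otimes> snd x = D' \<otimes> snd v"
    and far: "far_from_integers x"
  shows "far_from_integers v"
proof -
  have c: "fst v \<in> carrier K" "snd v \<in> carrier K" "fst x \<in> carrier K" "snd x \<in> carrier K"
    "D \<in> carrier K" "D' \<in> carrier K" using v x D by (simp_all add: mem_Times_iff A_sub A_unit_in)
  have N1: "N (fst x) = N (fst v)"
    using arg_cong[OF eq(1), of N] c D by (simp add: N_mult N_A_unit)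
  have N2: "N (snd x \<ominus> e \<otimes> fst x) = N (snd v \<ominus> e \<otimes> fst v)" if "e \<in> A" for e
  proof -
    have e: "e \<in> carrier K" using that A_sub by auto
    have "D \<otimes> (snd x \<ominus> e \<otimes> fst x) = D \<otimes> snd x \<ominus> e \<otimes> (D \<otimes> fst x)" using c e by algebra
    also have "\<dots> = D' \<otimes> (snd v \<ominus> e \<otimes> fst v)" unfolding eq using c e by algebra
    finally have "N (D \<otimes> (snd x \<ominus> e \<otimes> fst x)) = N (D' \<otimes> (snd v \<ominus> e \<otimes> fst v))" by simp
    then show ?thesis using c e D by (simp add: N_mult N_A_unit)
  qed
  have "fst v \<noteq> \<zero>" using far N_pos[of "fst x"] c N1 N_zero by (auto simp: far_from_integers_def)
  then show ?thesis using far N1 N2 by (simp add: far_from_integers_def)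
qed

theorem not_far_from_integers_if_connected:
  assumes "((\<zero>, \<one>), v) \<in> unimodular_edges\<^sup>*"
  shows "\<not> far_from_integers v"
proof
  let ?E = unimodular_edges
  assume "far_from_integers v"
  then have ex: "\<exists>m. \<exists>v. far_from_integers v \<and> ((\<zero>, \<one>), v) \<in> ?E ^^ m"
    using assms rtrancl_imp_relpow by blast
  \<comment> \<open>The minimum runs over all far pairs, not only over paths to \<open>v\<close>. A
    shortest path to \<open>v\<close> alone might end in a unit multiple of the pair two steps
    before, which gives no shortcut to \<open>v\<close>.\<close>
  define m where "m = (LEAST m. \<exists>v. far_from_integers v \<and> ((\<zero>, \<one>), v) \<in> ?E ^^ m)"
  obtain z where z: "far_from_integers z" "((\<zero>, \<one>), z) \<in> ?E ^^ m"
    using LeastI_ex[OF ex] unfolding m_def by blast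
  have min: "m \<le> l" if "far_from_integers x" "((\<zero>, \<one>), x) \<in> ?E ^^ l" for x l
    unfolding m_def using that by (intro Least_le) blast
  obtain f where f: "f 0 = (\<zero>, \<one>)" "f m = z" "\<And>i. i < m \<Longrightarrow> (f i, f (Suc i)) \<in> ?E"
    using z(2) unfolding relpow_fun_conv by blast
  have start: "(f 0, f i) \<in> ?E ^^ i" if "i \<le> m" for i
    unfolding relpow_fun_conv using f(3) that by (intro exI[of _ f]) auto
  have end': "(f i, f m) \<in> ?E ^^ (m - i)" if "i \<le> m" for i
    unfolding relpow_fun_conv using f(3) that by (intro exI[of _ "\<lambda>k. f (i + k)"]) auto
  \<comment> \<open>A path of minimal length has no chords.\<close>
  have shortcut: False if "i < j" "j \<le> m" "Suc i < j" "(f i, f j) \<in> ?E" for i j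
  proof -
    have "(f 0, f m) \<in> ?E ^^ i O ?E O ?E ^^ (m - j)"
      using start[of i] end'[of j] that by auto
    then have "(f 0, f m) \<in> ?E ^^ (i + (1 + (m - j)))"
      unfolding relpow_add by simp
    then have "m \<le> i + (1 + (m - j))" using min z f by metis
    then show False using that by linarith
  qed
  have m0: "m \<noteq> 0"
  proof
    assume "m = 0"
    then have "z = (\<zero>, \<one>)" using f by simp
    then show False using z(1) by (simp add: far_from_integers_def)
  qed
  have fA: "f i \<in> A \<times> A" if "i \<le> m" for i
    using f(1) f(3)[of "i - 1"] that by (cases i) (auto simp: unimodular_edges_def)
  have D: "A_unit (det2 (f i) (f (Suc i)))" if "i < m" for i
    using f(3)[OF that] by (simp add: unimodular_edges_def)
  define a b where "a i = fst (f i)" and "b i = snd (f i)" for i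
  have ab: "a i \<in> A" "b i \<in> A" if "i \<le> m" for i
    using fA[OF that] by (auto simp: a_def b_def)
  have abK: "a i \<in> carrier K" "b i \<in> carrier K" if "i \<le> m" for i using ab[OF that] A_sub by auto
  \<comment> \<open>For pairs at distance two a unit determinant would be a chord. A zero
    determinant makes them proportional, which is excluded as well, so the determinant is a nonzero
    nonunit.\<close>
  have gap: "2 \<le> N (det2 (f i) (f (Suc (Suc i))))" if i: "Suc (Suc i) \<le> m" for i
  proof -
    let ?v = "f i" and ?w = "f (Suc i)" and ?x = "f (Suc (Suc i))"
    have vwx: "?v \<in> A \<times> A" "?w \<in> A \<times> A" "?x \<in> A \<times> A" using fA i by auto
    have Dvw: "A_unit (det2 ?v ?w)" and Dwx: "A_unit (det2 ?w ?x)" using D i by auto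
    have Dxw: "A_unit (det2 ?x ?w)"
      using A_unit_uminus[OF Dwx] det2_swap[OF vwx(2,3)] by simp
    have in': "det2 ?v ?x \<in> A" "det2 ?x ?w \<in> A" "det2 ?v ?w \<in> A" using det2_in vwx by auto
    have "\<not> A_unit (det2 ?v ?x)"
    proof
      assume "A_unit (det2 ?v ?x)"
      then have "(?v, ?x) \<in> ?E" using vwx by (simp add: unimodular_edges_def)
      then show False using shortcut[of i "Suc (Suc i)"] i by simp
    qed
    moreover have "det2 ?v ?x \<noteq> \<zero>"
    proof
      \<comment> \<open>At the end of the path the earlier of the two proportional pairs would be
        far and nearer to the start; elsewhere it would be adjacent to the pair after them, a
        chord.\<close>
      assume z0: "det2 ?v ?x = \<zero>"
      show False
      proof (cases "Suc (Suc i) = m")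
        case True
        have "far_from_integers ?v"
        proof (rule far_from_integers_unit_multiple[OF vwx(1,3) Dvw Dxw])
          show "det2 ?v ?w \<otimes> fst ?x = det2 ?x ?w \<otimes> fst ?v" "det2 ?v ?w \<otimes> snd ?x = det2 ?x ?w \<otimes> snd ?v"
            using det2_cramer[OF vwx] z0 vwx in' A_sub by (auto simp: mem_Times_iff)
          show "far_from_integers ?x" using z f True by simp
        qed
        then have "m \<le> i" using min start[of i] f(1) i by simp
        then show False using i by simp
      next
        case False
        then have i': "Suc (Suc i) < m" using i by simp
        let ?y = "f (Suc (Suc (Suc i)))"
        have y: "?y \<in> A \<times> A" using fA i' by auto
        have "det2 ?x ?w \<otimes> det2 ?v ?y = det2 ?v ?w \<otimes> det2 ?x ?y"
          using det2_plucker[OF vwx y] z0 det2_in[OF vwx(1) y] det2_in[OF vwx(2) y] in' A_sub by simp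
        then have "A_unit (det2 ?v ?y)"
          using A_unit_cancel[OF Dxw A_unit_mult[OF Dvw D[OF i']] det2_in[OF vwx(1) y]] by simp
        then have "(?v, ?y) \<in> ?E" using vwx y by (simp add: unimodular_edges_def)
        then show False using shortcut[of i "Suc (Suc (Suc i))"] i' by simp
      qed
    qed
    ultimately show ?thesis using in' N_ge_2 by (auto simp: A_unit_def)
  qed
  have a0: "a 0 = \<zero>" "b 0 = \<one>" by (auto simp: a_def b_def f)
  have det: "det2 (f i) (f j) = a i \<otimes> b j \<ominus> b i \<otimes> a j" for i j
    by (cases "f i"; cases "f j") (auto simp: a_def b_def)
  have a1u: "A_unit (a (Suc 0))"
  proof -
    have "det2 (f 0) (f (Suc 0)) = \<ominus> a (Suc 0)"
      unfolding det a0 using abK[of "Suc 0"] m0 by (simp add: minus_eq)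
    then show ?thesis using A_unit_uminus[OF D[of 0]] m0 abK[of "Suc 0"] by simp
  qed
  \<comment> \<open>Cramer's rule with the nonunit \<open>?G\<close> gives
    \<open>N (a (i+2)) >= 2 * N (a (i+1)) - N (a i)\<close>, so the increments never fall below the
    first one, which is 1.\<close>
  have grow: "N (a i) + 1 \<le> N (a (Suc i))" if "i < m" for i
    using that
  proof (induction i)
    case 0
    then show ?case using a1u by (simp add: a0 N_zero N_A_unit)
  next
    case (Suc i)
    have i: "i \<le> m" "Suc i \<le> m" "Suc (Suc i) \<le> m" using Suc.prems by auto
    note vwx = fA[OF i(1)] fA[OF i(2)] fA[OF i(3)]
    let ?P = "det2 (f i) (f (Suc i))" and ?Q = "det2 (f (Suc (Suc i))) (f (Suc i))"
      and ?G = "det2 (f i) (f (Suc (Suc i)))"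
    have P: "A_unit ?P" "?P \<in> carrier K" using D[of i] Suc.prems A_unit_in by auto
    have Q: "A_unit ?Q"
      using A_unit_uminus[OF D[OF Suc.prems]] det2_swap[OF vwx(2,3)] by simp
    have Q': "?Q \<in> carrier K" using Q A_unit_in by auto
    have G: "?G \<in> carrier K" using det2_in vwx A_sub by auto
    have "?P \<otimes> a (Suc (Suc i)) = ?Q \<otimes> a i \<oplus> ?G \<otimes> a (Suc i)"
      using det2_cramer(1)[OF vwx] by (simp add: a_def)
    then have "?G \<otimes> a (Suc i) = ?P \<otimes> a (Suc (Suc i)) \<ominus> ?Q \<otimes> a i"
      using P Q' G abK[OF i(1)] abK[OF i(2)] abK[OF i(3)] by (simp, algebra)
    then have "N (?G \<otimes> a (Suc i)) \<le> N (?P \<otimes> a (Suc (Suc i))) + N (?Q \<otimes> a i)"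
      using N_diff P Q' abK i by simp
    then have "N ?G * N (a (Suc i)) \<le> N (a (Suc (Suc i))) + N (a i)"
      using P Q Q' G abK i by (simp add: N_mult N_A_unit)
    moreover have "2 * N (a (Suc i)) \<le> N ?G * N (a (Suc i))"
      using gap[OF i(3)] N_nonneg abK i by (intro mult_right_mono) auto
    ultimately show ?case using Suc.IH Suc.prems by simp
  qed
  \<comment> \<open>The first quotient is an integer: the determinant of the first edge is
    \<open>- a 1\<close>, so \<open>a 1\<close> is a unit.\<close>
  define c where "c = b (Suc 0) \<otimes> inv (a (Suc 0))"
  have cA: "c \<in> A" using a1u ab[of "Suc 0"] m0 by (auto simp: c_def A_unit_def)
  then have cK: "c \<in> carrier K" by (rule A_sub)
  \<comment> \<open>Equivalently, the quotient \<open>b / a\<close> stays within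
    \<open>1 - 1 / N a\<close> of \<open>c\<close>. Consecutive quotients differ by the reciprocal
    of \<open>N (a i) * N (a (i+1))\<close>, and by \<open>grow\<close> this is at most
    \<open>1 / N (a i) - 1 / N (a (i+1))\<close>, so the errors telescope.\<close>
  have close: "N (b (Suc i) \<ominus> c \<otimes> a (Suc i)) \<le> N (a (Suc i)) - 1" if "i < m" for i
    using that
  proof (induction i)
    case 0
    have K1: "a (Suc 0) \<in> carrier K" "b (Suc 0) \<in> carrier K" "a (Suc 0) \<noteq> \<zero>"
      using abK[of "Suc 0"] 0 A_unit_in[OF a1u] by auto
    have "c \<otimes> a (Suc 0) = b (Suc 0)"
      unfolding c_def using K1 nonzero_inv[OF K1(1,3)] by (simp add: m_assoc)
    then show ?case using N_A_unit[OF a1u] K1 N_zero by (simp add: minus_eq r_neg)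
  next
    case (Suc i)
    let ?j = "Suc i" and ?k = "Suc (Suc i)"
    have j: "?j \<le> m" "?k \<le> m" using Suc.prems by auto
    note K' = abK[OF j(1)] abK[OF j(2)]
    let ?P = "a ?j \<otimes> b ?k \<ominus> b ?j \<otimes> a ?k"
    have P: "A_unit ?P" using D[OF Suc.prems] det by simp
    have "(b ?k \<ominus> c \<otimes> a ?k) \<otimes> a ?j = ?P \<oplus> a ?k \<otimes> (b ?j \<ominus> c \<otimes> a ?j)"
      using K' cK by algebra
    then have "N ((b ?k \<ominus> c \<otimes> a ?k) \<otimes> a ?j) \<le> N ?P + N (a ?k \<otimes> (b ?j \<ominus> c \<otimes> a ?j))"
      using N_add K' cK by simp
    then have "N (b ?k \<ominus> c \<otimes> a ?k) * N (a ?j) \<le> 1 + N (a ?k) * N (b ?j \<ominus> c \<otimes> a ?j)"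
      using K' cK P by (simp add: N_mult N_A_unit)
    also have "\<dots> \<le> 1 + N (a ?k) * (N (a ?j) - 1)"
      using Suc N_nonneg[OF K'(3)] by (intro add_left_mono mult_left_mono) auto
    also have "\<dots> \<le> (N (a ?k) - 1) * N (a ?j)"
      using grow[OF Suc.prems] by (simp add: algebra_simps)
    finally have "N (b ?k \<ominus> c \<otimes> a ?k) * N (a ?j) \<le> (N (a ?k) - 1) * N (a ?j)" .
    moreover have "0 < N (a ?j)" using grow[of i] N_nonneg abK[of i] Suc.prems by force
    ultimately show ?case by simp
  qed
  obtain l where "m = Suc l" using m0 by (cases m) auto
  then have "N (b m \<ominus> c \<otimes> a m) \<le> N (a m) - 1" using close[of l] by simp
  moreover have "N (a m) \<le> N (b m \<ominus> c \<otimes> a m)"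
    using z(1) cA by (simp add: far_from_integers_def a_def b_def f)
  ultimately show False by simp
qed

text \<open>With \<open>T = p q s\<close> one has \<open>(1 + T) (1 - T) + (p\<^sup>2 s) (q\<^sup>2 s) = 1\<close>, and \<open>p\<^sup>2 s / (1 + T)\<close> tends to
  \<open>p / q\<close> as \<open>s\<close> grows.\<close>

lemma exists_unimodular_far_from_integers:
  assumes pq: "p \<in> A" "q \<in> A" "q \<noteq> \<zero>" and e: "e > 0"
    and far: "\<And>y c. y \<in> carrier K \<Longrightarrow> N (y \<ominus> p \<otimes> inv q) < e \<Longrightarrow> c \<in> A \<Longrightarrow> 1 \<le> N (y \<ominus> c)"
  obtains a b x y where "a \<in> A" "b \<in> A" "x \<in> A" "y \<in> A" "a \<otimes> x \<oplus> b \<otimes> y = \<one>" "far_from_integers (a, b)"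
proof -
  have [simp]: "p \<in> carrier K" "q \<in> carrier K" using pq A_sub by auto
  note iq = nonzero_inv[OF \<open>q \<in> carrier K\<close> pq(3)]
  have self: "N (p \<otimes> inv q \<ominus> p \<otimes> inv q) < e" using iq e N_zero by (simp add: minus_eq r_neg)
  \<comment> \<open>The point \<open>p / q\<close> is itself far from \<open>A\<close> and so not in
    \<open>A\<close>; hence \<open>q\<close> is a nonunit and its powers grow.\<close>
  have "inv q \<notin> A"
  proof
    assume "inv q \<in> A"
    then have "p \<otimes> inv q \<in> A" using pq by auto
    then have "1 \<le> N (p \<otimes> inv q \<ominus> p \<otimes> inv q)" using far[OF _ self] iq by simp
    then show False using iq N_zero by (simp add: minus_eq r_neg)
  qed
  then have q2: "2 \<le> N q" using N_ge_2 pq by blast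
  have p0: "p \<noteq> \<zero>"
  proof
    assume "p = \<zero>"
    then have "1 \<le> N (\<zero> \<ominus> \<zero>)" using far[OF _ self, of \<zero>] iq by (simp add: minus_eq)
    then show False using N_zero by (simp add: minus_eq)
  qed
  have Np: "1 \<le> N p" using N_ge_1 pq p0 by blast
  \<comment> \<open>The error will be \<open>y - p/q = - p / (q a)\<close> with
    \<open>N a >= N s - 1\<close>; this \<open>j\<close> makes \<open>N a\<close> exceed
    \<open>N p / e\<close>.\<close>
  obtain j where j: "1 + N p / e < 2 ^ j" using real_arch_pow[of 2 "1 + N p / e"] by auto
  define s where "s = q [^] j"
  have s: "s \<in> A" unfolding s_def using pq(2) by (induction j) auto
  have Ns: "N s = N q ^ j" unfolding s_def by (induction j) (auto simp: N_one N_mult)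
  have Ns2: "2 ^ j \<le> N s" unfolding Ns using q2 by (intro power_mono) auto
  have [simp]: "s \<in> carrier K" using s A_sub by auto
  have pqs: "p \<in> carrier K" "q \<in> carrier K" "s \<in> carrier K" by simp_all
  define T where "T = p \<otimes> q \<otimes> s"
  have T: "T \<in> A" "T \<in> carrier K" using pq s by (auto simp: T_def)
  define a b where "a = \<one> \<oplus> T" and "b = p \<otimes> p \<otimes> s"
  have ab: "a \<in> A" "b \<in> A" using T pq s by (auto simp: a_def b_def)
  then have abK: "a \<in> carrier K" "b \<in> carrier K" using A_sub by auto
  have NT: "N s \<le> N T"
  proof -
    have "1 * N s \<le> (N p * N q) * N s"
      using mult_mono[of 1 "N p" 1 "N q"] Np q2 N_nonneg[of s] by (intro mult_right_mono) auto
    then show ?thesis by (simp add: T_def N_mult)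
  qed
  have "N T \<le> N a + N \<one>"
  proof -
    have "T = a \<ominus> \<one>" unfolding a_def using T by algebra
    then show ?thesis using N_diff[OF abK(1) one_closed] by simp
  qed
  then have Na: "N p / e < N a" using NT Ns2 j N_one by simp
  moreover have "0 \<le> N p / e" using Np e by simp
  ultimately have Na0: "0 < N a" by simp
  then have a0: "a \<noteq> \<zero>" using N_zero by auto
  note ia = nonzero_inv[OF abK(1) a0]
  have bez: "a \<otimes> (\<one> \<ominus> T) \<oplus> b \<otimes> (q \<otimes> q \<otimes> s) = \<one>"
    unfolding a_def b_def T_def using pqs by algebra
  define y where "y = b \<otimes> inv a"
  have y: "y \<in> carrier K" using ia abK by (simp add: y_def)
  have "(y \<ominus> p \<otimes> inv q) \<otimes> (q \<otimes> a) = (b \<otimes> (inv a \<otimes> a)) \<otimes> q \<ominus> p \<otimes> (inv q \<otimes> q) \<otimes> a"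
    unfolding y_def using abK ia(1) iq(1) pqs by algebra
  also have "\<dots> = b \<otimes> q \<ominus> p \<otimes> a" using ia iq abK by simp
  also have "\<dots> = \<ominus> p" unfolding a_def b_def T_def using pqs by algebra
  finally have "N (y \<ominus> p \<otimes> inv q) * (N q * N a) = N p"
    using y iq abK N_uminus[of p] by (metis N_mult minus_closed m_closed \<open>p \<in> carrier K\<close> \<open>q \<in> carrier K\<close>)
  then have "N (y \<ominus> p \<otimes> inv q) * N a * N q = N p" by (simp add: mult_ac)
  moreover have "N (y \<ominus> p \<otimes> inv q) * N a * 1 \<le> N (y \<ominus> p \<otimes> inv q) * N a * N q"
    using q2 Na0 N_nonneg y iq by (intro mult_left_mono mult_nonneg_nonneg) auto
  ultimately have "N (y \<ominus> p \<otimes> inv q) * N a \<le> N p" by simp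
  also have "\<dots> < e * N a" using Na e by (simp add: field_simps)
  finally have close: "N (y \<ominus> p \<otimes> inv q) < e" using Na0 by simp
  have "far_from_integers (a, b)"
    unfolding far_from_integers_def
  proof (intro conjI ballI)
    show "fst (a, b) \<noteq> \<zero>" using a0 by simp
    fix c assume c: "c \<in> A"
    then have cK: "c \<in> carrier K" by (rule A_sub)
    have "1 * N a \<le> N (y \<ominus> c) * N a" using far[OF y close c] Na0 by (intro mult_right_mono) auto
    moreover have "(y \<ominus> c) \<otimes> a = b \<ominus> c \<otimes> a"
    proof -
      have "(y \<ominus> c) \<otimes> a = b \<otimes> (inv a \<otimes> a) \<ominus> c \<otimes> a" unfolding y_def using abK ia(1) cK by algebra
      then show ?thesis using ia abK by simp
    qed
    ultimately show "N (fst (a, b)) \<le> N (snd (a, b) \<ominus> c \<otimes> fst (a, b))"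
      using N_mult[of "y \<ominus> c" a] y cK abK by simp
  qed
  then show thesis
    using that[of a b "\<one> \<ominus> T" "q \<otimes> q \<otimes> s"] ab bez T pq s by blast
qed

end

section \<open>Links in the complex of partial bases\<close>

lemma simplicial_complex_link:
  assumes "simplicial_complex C" shows "simplicial_complex (link C s)"
  unfolding simplicial_complex_def
proof (intro conjI ballI allI impI)
  fix t assume t: "t \<in> link C s"
  then show "finite t" "t \<noteq> {}" using assms unfolding link_def simplicial_complex_def by blast+
  fix u assume u: "u \<subseteq> t \<and> u \<noteq> {}"
  have "u \<in> C" "u \<union> s \<in> C"
    using simplicial_complex_face[OF assms, of t u] simplicial_complex_face[OF assms, of "t \<union> s" "u \<union> s"] t u
    unfolding link_def by blast+
  then show "u \<in> link C s" using t u unfolding link_def by blast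
qed

context discretely_normed_subring
begin

abbreviation AR :: "('a, 'b) ring_scheme" where "AR \<equiv> K\<lparr>carrier := A\<rparr>"

lemma domain_AR: "domain AR"
  by (rule subring_is_domain[OF subring_A])

lemma AR_uminus: "x \<in> A \<Longrightarrow> \<ominus>\<^bsub>AR\<^esub> x = \<ominus> x"
proof -
  assume x: "x \<in> A"
  interpret R: domain AR by (rule domain_AR)
  have "\<ominus> x \<oplus>\<^bsub>AR\<^esub> x = \<zero>\<^bsub>AR\<^esub>" using x A_sub by (simp add: l_neg)
  then show ?thesis using x by (intro R.minus_equality) auto
qed

lemma AR_minus: "x \<in> A \<Longrightarrow> y \<in> A \<Longrightarrow> x \<ominus>\<^bsub>AR\<^esub> y = x \<ominus> y"
  using AR_uminus by (simp add: a_minus_def)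

lemma A_unit_if_Units_AR: "u \<in> Units AR \<Longrightarrow> A_unit u"
  by (auto simp: Units_def intro: A_unitI)

theorem partial_bases_not_cohen_macaulay:
  assumes n: "n \<ge> 2" and pq: "p \<in> A" "q \<in> A" "q \<noteq> \<zero>" and e: "e > 0"
    and far: "\<And>y c. y \<in> carrier K \<Longrightarrow> N (y \<ominus> p \<otimes> inv q) < e \<Longrightarrow> c \<in> A \<Longrightarrow> 1 \<le> N (y \<ominus> c)"
  shows "\<not> cohen_macaulay (partial_bases_complex AR n) (int n - 1)"
proof
  let ?C = "partial_bases_complex AR n" and ?U = "unit_vec AR n ` {2..<n}" and ?M = "free_module AR n"
  assume cm: "cohen_macaulay ?C (int n - 1)"
  interpret R: domain AR by (rule domain_AR)
  have one: "\<one>\<^bsub>AR\<^esub> \<noteq> \<zero>\<^bsub>AR\<^esub>" by (rule R.one_not_zero)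
  obtain a b x y where ab: "a \<in> A" "b \<in> A" "x \<in> A" "y \<in> A" "a \<otimes> x \<oplus> b \<otimes> y = \<one>"
    and bad: "far_from_integers (a, b)"
    using exists_unimodular_far_from_integers[OF pq e far] by blast
  have bas: "finite_basis AR ?M (insert (plane_vec AR n a b) (insert (plane_vec AR n (\<ominus>\<^bsub>AR\<^esub> y) x) ?U))"
    if "a \<in> A" "b \<in> A" "x \<in> A" "y \<in> A" "a \<otimes> x \<oplus> b \<otimes> y = \<one>" for a b x y
    using R.finite_basis_plane_vec(1)[OF one n, of a b x y] that by simp
  have inC: "insert (plane_vec AR n a b) ?U \<in> ?C" "{plane_vec AR n a b} \<in> ?C"
    if "a \<in> A" "b \<in> A" "x \<in> A" "y \<in> A" "a \<otimes> x \<oplus> b \<otimes> y = \<one>" for a b x y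
    using bas[OF that] unfolding partial_bases_complex_def by blast+
  have vert: "{plane_vec AR n a b} \<in> link ?C ?U"
    if "a \<in> A" "b \<in> A" "x \<in> A" "y \<in> A" "a \<otimes> x \<oplus> b \<otimes> y = \<one>" for a b x y
    using inC[OF that] R.plane_vec_not_unit[OF one, of n a b] unfolding link_def by simp
  have inj: "inj_on (unit_vec AR n) {2..<n}"
    using R.inj_unit_vec[OF one] by (rule inj_on_subset) auto
  have cardU: "card ?U = n - 2" using card_image[OF inj] by simp
  \<comment> \<open>That a basis has at most \<open>n\<close> elements is read off from the
    dimension that Cohen--Macaulayness prescribes.\<close>
  have dimC: "card s \<le> n" if "s \<in> ?C" for s
  proof -
    have "has_dimension ?C (int n - 1)" using cm by (simp only: cohen_macaulay_def)
    moreover have "?C \<noteq> {}" using that by blast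
    ultimately have "simplex_dim s \<le> int n - 1" using that unfolding has_dimension_def by simp
    then show ?thesis by (simp add: simplex_dim_def)
  qed
  \<comment> \<open>For \<open>n = 2\<close> the set \<open>?U\<close> is empty, hence not a
    simplex, and the connectivity of the whole complex is used. Otherwise \<open>?U\<close> has
    dimension \<open>n - 3\<close>, and \<open>(n - 1) - (n - 3) - 2 = 0\<close>.\<close>
  have conn: "k_connected 0 (realization (link ?C ?U))"
  proof (cases "n = 2")
    case True
    then have "link ?C ?U = ?C" unfolding link_def by auto
    moreover have "k_connected (int n - 1 - 1) (realization ?C)" using cm by (simp only: cohen_macaulay_def)
    ultimately show ?thesis using True by simp
  next
    case False
    then have "?U \<noteq> {}" using n by auto
    then have U: "?U \<in> ?C"
      using simplicial_complex_face[OF simplicial_complex_partial_bases inC(1)[OF ab], of ?U] by blast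
    have "int n - 1 - simplex_dim ?U - 2 = 0" using cardU n by (simp add: simplex_dim_def)
    moreover have "k_connected (int n - 1 - simplex_dim ?U - 2) (realization (link ?C ?U))"
      using cm U unfolding cohen_macaulay_def by blast
    ultimately show ?thesis by (simp only:)
  qed
  let ?v0 = "plane_vec AR n \<zero> \<one>" and ?v1 = "plane_vec AR n a b"
  have "{?v0} \<in> link ?C ?U" by (rule vert[of _ _ \<zero> \<one>]) auto
  moreover have "{?v1} \<in> link ?C ?U" by (rule vert[OF ab])
  ultimately have "(?v0, ?v1) \<in> {(v, w). {v, w} \<in> link ?C ?U}\<^sup>*"
    by (intro k_connected_0_realization_imp_edge_path simplicial_complex_link
        simplicial_complex_partial_bases conn)
  then have "((?v0 0, ?v0 1), (?v1 0, ?v1 1)) \<in> unimodular_edges\<^sup>*"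
  proof (induction rule: rtrancl_induct)
    case base
    then show ?case by simp
  next
    case (step v w)
    have "((v 0, v 1), (w 0, w 1)) \<in> unimodular_edges\<^sup>*"
    \<comment> \<open>A vertex is also a set \<open>{v, v}\<close>, so the edge relation contains
      loops, which are trivial steps.\<close>
    proof (cases "v = w")
      case True
      then show ?thesis by simp
    next
      case False
      \<comment> \<open>The vectors \<open>v\<close>, \<open>w\<close> and \<open>?U\<close> are
        \<open>n\<close> in number, so a basis containing them has no further element and the
        determinant criterion applies.\<close>
      have "{v, w} \<union> ?U \<in> ?C" and disj: "{v, w} \<inter> ?U = {}" using step by (auto simp: link_def)
      then obtain B where B: "finite_basis AR ?M B" "insert v (insert w ?U) \<subseteq> B"
        unfolding partial_bases_complex_def by auto
      then have "B \<in> ?C" unfolding partial_bases_complex_def by blast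
      then have "card B \<le> n" by (rule dimC)
      moreover have "card (insert v (insert w ?U)) = n"
        using False disj cardU n by simp
      moreover have "finite B" using B by (simp add: finite_basis_def)
      ultimately have eq: "insert v (insert w ?U) = B"
        using B(2) by (intro card_seteq) auto
      have M: "v \<in> carrier ?M" "w \<in> carrier ?M" using B by (auto simp: finite_basis_def)
      then have vw: "v 0 \<in> A" "v 1 \<in> A" "w 0 \<in> A" "w 1 \<in> A"
        using R.free_module_coord[of v n 0] R.free_module_coord[of v n 1]
          R.free_module_coord[of w n 0] R.free_module_coord[of w n 1] n by auto
      have "v 0 \<otimes>\<^bsub>AR\<^esub> w 1 \<ominus>\<^bsub>AR\<^esub> v 1 \<otimes>\<^bsub>AR\<^esub> w 0 \<in> Units AR"
        by (rule R.det_unit_of_finite_basis[OF one n]) (use False disj B eq in auto)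
      then have "A_unit (v 0 \<otimes>\<^bsub>AR\<^esub> w 1 \<ominus>\<^bsub>AR\<^esub> v 1 \<otimes>\<^bsub>AR\<^esub> w 0)"
        by (rule A_unit_if_Units_AR)
      moreover have "v 0 \<otimes>\<^bsub>AR\<^esub> w 1 \<ominus>\<^bsub>AR\<^esub> v 1 \<otimes>\<^bsub>AR\<^esub> w 0 = v 0 \<otimes> w 1 \<ominus> v 1 \<otimes> w 0"
        using AR_minus vw by simp
      ultimately have "A_unit (v 0 \<otimes> w 1 \<ominus> v 1 \<otimes> w 0)" by (simp only:)
      then show ?thesis using vw by (auto simp: unimodular_edges_def)
    qed
    then show ?case using step.IH by (rule rtrancl_trans[rotated])
  qed
  moreover have "?v0 0 = \<zero>" "?v0 1 = \<one>" "?v1 0 = a" "?v1 1 = b" using n by (auto simp: plane_vec_def)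
  ultimately have "((\<zero>, \<one>), (a, b)) \<in> unimodular_edges\<^sup>*" by simp
  then show False using not_far_from_integers_if_connected bad by blast
qed

end

section \<open>Discrete valuations\<close>

lemma (in field) nonzero_mult:
  "x \<in> carrier R \<Longrightarrow> x \<noteq> \<zero> \<Longrightarrow> y \<in> carrier R \<Longrightarrow> y \<noteq> \<zero> \<Longrightarrow> x \<otimes> y \<noteq> \<zero>"
  using integral by blast

lemma (in field) nonzero_pow: "x \<in> carrier R \<Longrightarrow> x \<noteq> \<zero> \<Longrightarrow> x [^] (n::nat) \<noteq> \<zero>"
  by (induction n) (auto simp: nonzero_mult)

locale discrete_valuation = field K for K :: "('a, 'b) ring_scheme" (structure) +
  fixes v :: "'a \<Rightarrow> int"
  assumes normalized: "normalized_valuation K v"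
begin

text \<open>The convention that zero has infinite valuation, which the integer-valued
  \<open>v\<close> cannot express.\<close>

definition vge :: "int \<Rightarrow> 'a \<Rightarrow> bool" where
  "vge m x \<longleftrightarrow> x = \<zero> \<or> m \<le> v x"

lemma v_mult:
  "x \<in> carrier K \<Longrightarrow> x \<noteq> \<zero> \<Longrightarrow> y \<in> carrier K \<Longrightarrow> y \<noteq> \<zero> \<Longrightarrow> v (x \<otimes> y) = v x + v y"
  using normalized by (auto simp: normalized_valuation_def epi_def hom_def integer_group_def)

lemma v_surj: obtains x where "x \<in> carrier K" "x \<noteq> \<zero>" "v x = m"
proof -
  have "v ` (carrier K - {\<zero>}) = UNIV"
    using normalized by (auto simp: normalized_valuation_def epi_def integer_group_def)
  then obtain x where "x \<in> carrier K - {\<zero>}" "v x = m" by (metis UNIV_I imageE)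
  then show thesis using that by auto
qed

lemma v_one: "v \<one> = 0"
  using v_mult[of \<one> \<one>] by simp

lemma v_inv: "x \<in> carrier K \<Longrightarrow> x \<noteq> \<zero> \<Longrightarrow> v (inv x) = - v x"
  using v_mult[of x "inv x"] nonzero_inv[of x] v_one by simp

lemma v_pow: "x \<in> carrier K \<Longrightarrow> x \<noteq> \<zero> \<Longrightarrow> v (x [^] n) = int n * v x"
proof (induction n)
  case 0
  then show ?case by (simp add: v_one)
next
  case (Suc n)
  have "x [^] n \<noteq> \<zero>" using Suc.prems by (simp add: nonzero_pow)
  then show ?case using Suc v_mult[of "x [^] n" x] by (simp add: algebra_simps)
qed

lemma v_uminus: "x \<in> carrier K \<Longrightarrow> x \<noteq> \<zero> \<Longrightarrow> v (\<ominus> x) = v x"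
proof -
  assume x: "x \<in> carrier K" "x \<noteq> \<zero>"
  have m1: "\<ominus> \<one> \<noteq> \<zero>" using add.inv_eq_1_iff by auto
  have "\<ominus> \<one> \<otimes> \<ominus> \<one> = \<one>" by algebra
  then have "v (\<ominus> \<one>) + v (\<ominus> \<one>) = 0" using v_mult[of "\<ominus> \<one>" "\<ominus> \<one>"] m1 v_one by simp
  then show ?thesis using v_mult[of "\<ominus> \<one>" x] x m1 by (simp add: l_minus)
qed

lemma vge_zero [simp]: "vge m \<zero>" by (simp add: vge_def)

lemma vge_one [simp]: "vge 0 \<one>" by (simp add: vge_def v_one)

lemma vge_mono: "vge m x \<Longrightarrow> l \<le> m \<Longrightarrow> vge l x" by (auto simp: vge_def)

lemma vge_add:
  assumes "vge m x" "vge m y" "x \<in> carrier K" "y \<in> carrier K"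
  shows "vge m (x \<oplus> y)"
proof (cases "x = \<zero> \<or> y = \<zero> \<or> x \<oplus> y = \<zero>")
  case True
  then show ?thesis using assms by (auto simp: vge_def)
next
  case False
  then have "min (v x) (v y) \<le> v (x \<oplus> y)"
    using normalized assms by (auto simp: normalized_valuation_def)
  then show ?thesis using assms False by (auto simp: vge_def)
qed

lemma vge_mult:
  "vge m x \<Longrightarrow> vge l y \<Longrightarrow> x \<in> carrier K \<Longrightarrow> y \<in> carrier K \<Longrightarrow> vge (m + l) (x \<otimes> y)"
  by (cases "x = \<zero>"; cases "y = \<zero>") (auto simp: vge_def v_mult)

lemma vge_mult0: "vge 0 x \<Longrightarrow> vge m y \<Longrightarrow> x \<in> carrier K \<Longrightarrow> y \<in> carrier K \<Longrightarrow> vge m (x \<otimes> y)"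
  using vge_mult[of 0 x m y] by simp

lemma vge_uminus: "vge m x \<Longrightarrow> x \<in> carrier K \<Longrightarrow> vge m (\<ominus> x)"
  by (cases "x = \<zero>") (auto simp: vge_def v_uminus)

lemma vge_diff: "vge m x \<Longrightarrow> vge m y \<Longrightarrow> x \<in> carrier K \<Longrightarrow> y \<in> carrier K \<Longrightarrow> vge m (x \<ominus> y)"
  unfolding minus_eq by (intro vge_add vge_uminus) auto

text \<open>If the sum had larger valuation than \<open>x\<close>, so would
  \<open>x = (x + y) - y\<close>.\<close>

lemma v_add_dominant:
  assumes "x \<in> carrier K" "x \<noteq> \<zero>" "y \<in> carrier K" "vge (v x + 1) y"
  shows "x \<oplus> y \<noteq> \<zero>" "v (x \<oplus> y) = v x"
proof -
  have "vge (v x) (x \<oplus> y)" using assms by (intro vge_add) (auto simp: vge_def)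
  moreover have "\<not> vge (v x + 1) (x \<oplus> y)"
  proof
    assume "vge (v x + 1) (x \<oplus> y)"
    then have "vge (v x + 1) ((x \<oplus> y) \<ominus> y)" using assms by (intro vge_diff) auto
    moreover have "(x \<oplus> y) \<ominus> y = x" using assms by algebra
    ultimately show False using assms by (simp add: vge_def)
  qed
  ultimately show "x \<oplus> y \<noteq> \<zero>" "v (x \<oplus> y) = v x" by (auto simp: vge_def)
qed

lemma vge_combine:
  "set Ks \<subseteq> carrier K \<Longrightarrow> set Us \<subseteq> carrier K \<Longrightarrow> (\<And>x. x \<in> set Ks \<Longrightarrow> vge 0 x) \<Longrightarrow>
    (\<And>x. x \<in> set Us \<Longrightarrow> vge m x) \<Longrightarrow> vge m (combine Ks Us)"
  by (induction Ks Us rule: combine.induct) (auto intro!: vge_add vge_mult0)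

text \<open>Inclusion of the valuation rings forces equality: units for \<open>v\<close> are units
  for \<open>w\<close>, so \<open>w\<close> is \<open>w p\<close> times \<open>v\<close> for a
  uniformizer \<open>p\<close> of \<open>v\<close>, and surjectivity onto the integers leaves
  \<open>w p = 1\<close>.\<close>

lemma v_eq_if_vge_imp:
  assumes w: "normalized_valuation K w"
    and imp: "\<And>x. x \<in> carrier K \<Longrightarrow> x \<noteq> \<zero> \<Longrightarrow> 0 \<le> v x \<Longrightarrow> 0 \<le> w x"
  shows "w = v"
proof -
  interpret w: discrete_valuation K w by unfold_locales (rule w)
  obtain p where p: "p \<in> carrier K" "p \<noteq> \<zero>" "v p = 1" by (rule v_surj)
  have unit0: "w x = 0" if x: "x \<in> carrier K" "x \<noteq> \<zero>" "v x = 0" for x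
    using imp[OF x(1,2)] imp[of "inv x"] x nonzero_inv[OF x(1,2)] v_inv w.v_inv by fastforce
  have nat: "w x = int n * w p" if x: "x \<in> carrier K" "x \<noteq> \<zero>" "v x = int n" for x n
  proof -
    have pn: "p [^] n \<in> carrier K" "p [^] n \<noteq> \<zero>" using p by (auto simp: nonzero_pow)
    note i = nonzero_inv[OF pn]
    have nz: "x \<otimes> inv (p [^] n) \<noteq> \<zero>" using x i integral by fastforce
    have "v (x \<otimes> inv (p [^] n)) = 0" using x p pn i by (simp add: v_mult v_inv v_pow)
    then have "w (x \<otimes> inv (p [^] n)) = 0" using unit0 nz x i by simp
    then show ?thesis using x p pn i by (simp add: w.v_mult w.v_inv w.v_pow)
  qed
  have all: "w x = v x * w p" if x: "x \<in> carrier K" "x \<noteq> \<zero>" for x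
  proof (cases "0 \<le> v x")
    case True
    then show ?thesis using nat[OF x, of "nat (v x)"] by simp
  next
    case False
    note i = nonzero_inv[OF x]
    have "w (inv x) = int (nat (- v x)) * w p"
      using nat[OF i(1,2), of "nat (- v x)"] False x by (simp add: v_inv)
    then show ?thesis using False x by (simp add: w.v_inv)
  qed
  obtain q where q: "q \<in> carrier K" "q \<noteq> \<zero>" "w q = 1" by (rule w.v_surj)
  have "v q * w p = 1" using all q by simp
  moreover have "0 \<le> w p" using imp p by simp
  ultimately have "w p = 1" using zmult_eq_1_iff by auto
  then have eq: "w x = v x" if "x \<in> carrier K - {\<zero>}" for x using all that by simp
  show ?thesis
  proof (rule extensionalityI)
    show "w \<in> extensional (carrier K - {\<zero>})" "v \<in> extensional (carrier K - {\<zero>})"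
      using w normalized by (auto simp: normalized_valuation_def)
  qed (rule eq)
qed

end

lemma (in field) discrete_valuationI: "normalized_valuation R v \<Longrightarrow> discrete_valuation R v"
  by (simp add: discrete_valuation.intro discrete_valuation_axioms.intro field_axioms)

text \<open>Every nonzero element of the field is a unit of \<open>A\<close> times an integral power
  of \<open>p\<close>, and the valuation is the exponent.\<close>

lemma (in field) valuation_of_discrete_valuation_ring:
  assumes A: "subring A R" and p: "p \<in> A" "p \<noteq> \<zero>" "inv p \<notin> A"
    and tot: "\<And>x. x \<in> carrier R \<Longrightarrow> x \<noteq> \<zero> \<Longrightarrow> x \<in> A \<or> inv x \<in> A"
    and fact: "\<And>x. x \<in> A \<Longrightarrow> x \<noteq> \<zero> \<Longrightarrow> \<exists>j u. u \<in> A \<and> u \<noteq> \<zero> \<and> inv u \<in> A \<and> x = u \<otimes> p [^] (j::nat)"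
  shows "\<exists>v. normalized_valuation R v \<and> (\<forall>x\<in>carrier R - {\<zero>}. x \<in> A \<longleftrightarrow> 0 \<le> v x)"
proof -
  define U where "U = {u \<in> A. u \<noteq> \<zero> \<and> inv u \<in> A}"
  have Ac: "x \<in> A \<Longrightarrow> x \<in> carrier R" for x using subringE(1)[OF A] by blast
  note Aops = subringE(3,5,6,7)[OF A]
  have UI: "u \<in> U" if "u \<in> A" "w \<in> A" "u \<otimes> w = \<one>" for u w
  proof -
    have "inv u = w" "u \<noteq> \<zero>" using that Ac by (auto intro: comm_inv_char)
    then show ?thesis using that by (simp add: U_def)
  qed
  have Uc: "u \<in> carrier R" "u \<noteq> \<zero>" "inv u \<in> A" "inv u \<in> carrier R" "u \<otimes> inv u = \<one>" if "u \<in> U" for u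
    using that Ac nonzero_inv[of u] by (auto simp: U_def)
  have U_mult: "u \<otimes> w \<in> U" if "u \<in> U" "w \<in> U" for u w
  proof (rule UI)
    show "u \<otimes> w \<in> A" "inv u \<otimes> inv w \<in> A" using that Aops by (auto simp: U_def)
    have "u \<otimes> w \<otimes> (inv u \<otimes> inv w) = (u \<otimes> inv u) \<otimes> (w \<otimes> inv w)"
      using Uc[OF that(1)] Uc[OF that(2)] by algebra
    then show "u \<otimes> w \<otimes> (inv u \<otimes> inv w) = \<one>" using Uc that by simp
  qed
  have U_inv: "inv u \<in> U" if "u \<in> U" for u
    by (rule UI[of _ u]) (use Uc[OF that] that in \<open>auto simp: U_def m_comm\<close>)
  have pc: "p \<in> carrier R" using p Ac by auto
  have ppow: "p [^] (n::nat) \<in> A" "p [^] n \<in> carrier R" "p [^] n \<noteq> \<zero>" for n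
  proof -
    show "p [^] n \<in> A" by (induction n) (use p Aops in auto)
    then show "p [^] n \<in> carrier R" using Ac by auto
    show "p [^] n \<noteq> \<zero>" using pc p by (simp add: nonzero_pow)
  qed
  have p_not_unit: "p \<otimes> a \<noteq> \<one>" if "a \<in> A" for a
    using UI[OF p(1) that] p by (auto simp: U_def)
  \<comment> \<open>A unit times \<open>p [^] i\<close> is not divisible by a higher power of
    \<open>p\<close>, which makes the exponent unique.\<close>
  have pow_unit: "j \<le> i" if eq: "u \<otimes> p [^] i = w \<otimes> p [^] j" and uw: "u \<in> U" "w \<in> A" for i j :: nat and u w
  proof (rule ccontr)
    assume "\<not> j \<le> i"
    then obtain l where l: "j = i + Suc l" by (metis add_Suc_right less_imp_Suc_add not_le)
    note c = Uc[OF uw(1)] Ac[OF uw(2)]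
    have "u \<otimes> p [^] i = (w \<otimes> (p [^] l \<otimes> p)) \<otimes> p [^] i"
      using eq c ppow pc by (simp add: l nat_pow_mult[symmetric] m_ac)
    then have "u = w \<otimes> (p [^] l \<otimes> p)"
      using m_rcancel[of "p [^] i" u "w \<otimes> (p [^] l \<otimes> p)"] ppow c pc by simp
    then have "p \<otimes> (w \<otimes> p [^] l \<otimes> inv u) = u \<otimes> inv u"
      using c ppow pc by (simp add: m_ac)
    then show False using p_not_unit[of "w \<otimes> p [^] l \<otimes> inv u"] c uw ppow Aops by simp
  qed
  \<comment> \<open>\<open>d\<close> is the exponent of \<open>p\<close> in \<open>x\<close>; the
    factor \<open>p [^] j\<close> on the left avoids negative powers.\<close>
  define rel where "rel x d \<longleftrightarrow> (\<exists>i j u. u \<in> U \<and> d = int i - int j \<and> x \<otimes> p [^] j = u \<otimes> p [^] i)" for x d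
  have rel_ex: "\<exists>d. rel x d" if x: "x \<in> carrier R" "x \<noteq> \<zero>" for x
  proof (cases "x \<in> A")
    case True
    then obtain i u where "u \<in> U" "x = u \<otimes> p [^] (i::nat)" using fact[OF True x(2)] by (auto simp: U_def)
    then have "x \<otimes> p [^] (0::nat) = u \<otimes> p [^] i" "u \<in> U" using x by auto
    then show ?thesis unfolding rel_def by blast
  next
    case False
    then obtain j u where u: "u \<in> U" "inv x = u \<otimes> p [^] (j::nat)"
      using fact[of "inv x"] tot[OF x] nonzero_inv[OF x] by (auto simp: U_def)
    note c = Uc[OF u(1)]
    have "x \<otimes> p [^] j = x \<otimes> (u \<otimes> inv u \<otimes> p [^] j)" using c ppow x by simp
    also have "\<dots> = x \<otimes> inv x \<otimes> inv u" unfolding u(2) using c(1,4) ppow(2)[of j] x(1) by algebra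
    also have "\<dots> = inv u \<otimes> p [^] (0::nat)" using nonzero_inv[OF x] c by simp
    finally show ?thesis unfolding rel_def using U_inv[OF u(1)] by blast
  qed
  have rel_le: "e \<le> d" if h: "rel x d" "rel x e" "x \<in> carrier R" for x d e
  proof -
    obtain i j u where 1: "u \<in> U" "d = int i - int j" "x \<otimes> p [^] j = u \<otimes> p [^] i"
      using h(1) unfolding rel_def by blast
    obtain i' j' u' where 2: "u' \<in> U" "e = int i' - int j'" "x \<otimes> p [^] j' = u' \<otimes> p [^] i'"
      using h(2) unfolding rel_def by blast
    note c = Uc[OF 1(1)] Uc[OF 2(1)] h(3) ppow
    have "u \<otimes> p [^] (i + j') = (x \<otimes> p [^] j) \<otimes> p [^] j'"
      unfolding 1(3) using c by (simp add: nat_pow_mult[symmetric] pc m_assoc)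
    also have "\<dots> = (x \<otimes> p [^] j') \<otimes> p [^] j" using h(3) ppow(2)[of j] ppow(2)[of j'] by algebra
    also have "\<dots> = u' \<otimes> p [^] (i' + j)"
      unfolding 2(3) using c by (simp add: nat_pow_mult[symmetric] pc m_assoc)
    finally have "i' + j \<le> i + j'" by (rule pow_unit) (use 1 2 in \<open>auto simp: U_def\<close>)
    then show ?thesis using 1 2 by simp
  qed
  define v where "v = restrict (\<lambda>x. THE d. rel x d) (carrier R - {\<zero>})"
  have v_eq: "v x = d" if "rel x d" "x \<in> carrier R" "x \<noteq> \<zero>" for x d
  proof -
    have "(THE d. rel x d) = d" using that rel_le[of x] by (intro the_equality) (auto intro: antisym)
    then show ?thesis using that by (simp add: v_def)
  qed
  have v_rel: "rel x (v x)" if "x \<in> carrier R" "x \<noteq> \<zero>" for x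
    using rel_ex[OF that] v_eq that by auto
  have vmult: "v (x \<otimes> y) = v x + v y" if x: "x \<in> carrier R" "x \<noteq> \<zero>" and y: "y \<in> carrier R" "y \<noteq> \<zero>" for x y
  proof -
    obtain i j u where 1: "u \<in> U" "v x = int i - int j" "x \<otimes> p [^] j = u \<otimes> p [^] i"
      using v_rel[OF x] unfolding rel_def by blast
    obtain i' j' u' where 2: "u' \<in> U" "v y = int i' - int j'" "y \<otimes> p [^] j' = u' \<otimes> p [^] i'"
      using v_rel[OF y] unfolding rel_def by blast
    note c = Uc[OF 1(1)] Uc[OF 2(1)] ppow
    have "x \<otimes> y \<otimes> p [^] (j + j') = (x \<otimes> p [^] j) \<otimes> (y \<otimes> p [^] j')"
      using c x y by (simp add: nat_pow_mult[symmetric] pc m_ac)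
    also have "\<dots> = (u \<otimes> u') \<otimes> p [^] (i + i')"
      unfolding 1(3) 2(3) using c by (simp add: nat_pow_mult[symmetric] pc m_ac)
    finally have "rel (x \<otimes> y) (int (i + i') - int (j + j'))" unfolding rel_def using U_mult 1 2 by blast
    then show ?thesis using v_eq x y nonzero_mult 1 2 by simp
  qed
  have v_A: "x \<in> A \<longleftrightarrow> 0 \<le> v x" if x: "x \<in> carrier R" "x \<noteq> \<zero>" for x
  proof
    assume "x \<in> A"
    then obtain i u where "u \<in> U" "x = u \<otimes> p [^] (i::nat)" using fact[OF _ x(2)] by (auto simp: U_def)
    then have "x \<otimes> p [^] (0::nat) = u \<otimes> p [^] i" "u \<in> U" using x by auto
    then have "rel x (int i - int 0)" unfolding rel_def by blast
    then show "0 \<le> v x" using v_eq x by simp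
  next
    assume "0 \<le> v x"
    moreover obtain i j u where 1: "u \<in> U" "v x = int i - int j" "x \<otimes> p [^] j = u \<otimes> p [^] i"
      using v_rel[OF x] unfolding rel_def by blast
    ultimately have ij: "j \<le> i" by simp
    have "x \<otimes> p [^] j = (u \<otimes> p [^] (i - j)) \<otimes> p [^] j"
      using 1 ij Uc[OF 1(1)] ppow pc by (simp add: m_assoc nat_pow_mult)
    then have "x = u \<otimes> p [^] (i - j)"
      using m_rcancel[of "p [^] j" x "u \<otimes> p [^] (i - j)"] ppow Uc[OF 1(1)] x by simp
    then show "x \<in> A" using 1 ppow Aops by (auto simp: U_def)
  qed
  have one_U: "\<one> \<in> U" by (rule UI[of _ \<one>]) (use Aops in auto)
  have "\<exists>x\<in>carrier R - {\<zero>}. v x = d" for d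
  proof (cases d rule: int_cases)
    case (nonneg n)
    have "rel (p [^] n) (int n - int 0)"
      unfolding rel_def using one_U ppow
      by (intro exI[of _ n] exI[of _ "0::nat"] exI[of _ \<one>]) auto
    then have "v (p [^] n) = int n - int 0" by (rule v_eq) (fact ppow)+
    then show ?thesis using nonneg ppow by (intro bexI[of _ "p [^] n"]) auto
  next
    case (neg n)
    let ?q = "p [^] Suc n"
    note i = nonzero_inv[OF ppow(2,3), of "Suc n"]
    have "rel (inv ?q) (int 0 - int (Suc n))"
      unfolding rel_def by (intro exI[of _ "0::nat"] exI[of _ "Suc n"] exI[of _ \<one>]) (use i one_U in auto)
    then have "v (inv ?q) = int 0 - int (Suc n)" by (rule v_eq) (fact i)+
    then show ?thesis using neg i by (intro bexI[of _ "inv ?q"]) auto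
  qed
  then have surj: "v ` (carrier R - {\<zero>}) = UNIV" by (metis (no_types, lifting) UNIV_eq_I image_eqI)
  \<comment> \<open>After division by \<open>x\<close> it remains to see that
    \<open>1 + y / x\<close> lies in \<open>A\<close>.\<close>
  have ultra: "v x \<le> v (x \<oplus> y)"
    if x: "x \<in> carrier R" "x \<noteq> \<zero>" and y: "y \<in> carrier R" "y \<noteq> \<zero>" and xy: "x \<oplus> y \<noteq> \<zero>" and le: "v x \<le> v y" for x y
  proof -
    note ix = nonzero_inv[OF x]
    have yx: "y \<otimes> inv x \<in> carrier R" "y \<otimes> inv x \<noteq> \<zero>" using y ix nonzero_mult by auto
    have "v (y \<otimes> inv x \<otimes> x) = v (y \<otimes> inv x) + v x" using vmult[OF yx x] .
    moreover have "y \<otimes> inv x \<otimes> x = y" using ix x y by (simp add: m_assoc)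
    ultimately have "0 \<le> v (y \<otimes> inv x)" using le by simp
    then have "y \<otimes> inv x \<in> A" using v_A yx by blast
    then have A1: "\<one> \<oplus> y \<otimes> inv x \<in> A" using Aops by simp
    have "(\<one> \<oplus> y \<otimes> inv x) \<otimes> x = x \<oplus> y \<otimes> (inv x \<otimes> x)" using x y ix(1) by algebra
    then have eq: "(\<one> \<oplus> y \<otimes> inv x) \<otimes> x = x \<oplus> y" using x y ix by simp
    then have nz: "\<one> \<oplus> y \<otimes> inv x \<noteq> \<zero>" using xy x by auto
    have "v (x \<oplus> y) = v (\<one> \<oplus> y \<otimes> inv x) + v x" using vmult[OF Ac[OF A1] nz x] eq by simp
    moreover have "0 \<le> v (\<one> \<oplus> y \<otimes> inv x)" using v_A Ac[OF A1] nz A1 by blast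
    ultimately show ?thesis by simp
  qed
  have "normalized_valuation R v"
    unfolding normalized_valuation_def
  proof (intro conjI ballI impI)
    show "v \<in> extensional (carrier R - {\<zero>})" by (simp add: v_def)
    show "v \<in> epi (Multiplicative_Group.mult_of R) integer_group"
      using surj vmult by (auto simp: epi_def hom_def integer_group_def)
    fix x y assume xy: "x \<in> carrier R - {\<zero>}" "y \<in> carrier R - {\<zero>}" "x \<oplus> y \<noteq> \<zero>"
    show "min (v x) (v y) \<le> v (x \<oplus> y)"
    proof (cases "v x \<le> v y")
      case True
      then show ?thesis using ultra[of x y] xy by auto
    next
      case False
      then show ?thesis using ultra[of y x] xy by (auto simp: a_comm)
    qed
  qed
  then show ?thesis using v_A by blast
qed

section \<open>Linear algebra over a transcendental element\<close>

context field
begin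

text \<open>In contrast to \<open>eval\<close>, the constant coefficient comes first.\<close>

fun horner :: "'a list \<Rightarrow> 'a \<Rightarrow> 'a" where
  "horner [] x = \<zero>"
| "horner (c # cs) x = horner cs x \<otimes> x \<oplus> c"

lemma horner_closed: "set cs \<subseteq> carrier R \<Longrightarrow> x \<in> carrier R \<Longrightarrow> horner cs x \<in> carrier R"
  by (induction cs) auto

lemma horner_in_simple_extension: "set cs \<subseteq> k \<Longrightarrow> horner cs x \<in> simple_extension k x"
  by (induction cs) (auto intro: simple_extension.intros)

lemma simple_extension_horner: "p \<in> simple_extension k x \<Longrightarrow> \<exists>cs. set cs \<subseteq> k \<and> p = horner cs x"
proof (induction rule: simple_extension.induct)
  case zero
  then show ?case by (intro exI[of _ "[]"]) simp
next
  case (lin k1 k2)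
  then obtain cs where "set cs \<subseteq> k" "k1 = horner cs x" by auto
  then show ?case using lin by (intro exI[of _ "k2 # cs"]) simp
qed

lemma horner_rev: "set p \<subseteq> carrier R \<Longrightarrow> x \<in> carrier R \<Longrightarrow> horner (rev p) x = eval p x"
  by (induction p rule: rev_induct) (auto simp: eval_append_aux)

text \<open>Turns a linear relation among powers of \<open>x\<close> into a polynomial equation for
  \<open>x\<close>. The offset \<open>i\<close> is what the induction needs.\<close>

lemma combine_powers:
  assumes "set Ks \<subseteq> carrier R" "x \<in> carrier R"
  shows "combine Ks (map (\<lambda>j. x [^] (i + j)) [0..<length Ks]) = x [^] i \<otimes> horner Ks x"
  using assms(1)
proof (induction Ks arbitrary: i)
  case Nil
  then show ?case using assms(2) by simp
next
  case (Cons c Ks)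
  have h: "horner Ks x \<in> carrier R" "c \<in> carrier R" "x [^] i \<in> carrier R"
    using Cons.prems assms(2) horner_closed by auto
  have "map (\<lambda>j. x [^] (i + j)) [0..<length (c # Ks)] =
     x [^] i # map (\<lambda>j. x [^] (Suc i + j)) [0..<length Ks]"
    by (simp add: map_upt_Suc del: upt_Suc)
  then have "combine (c # Ks) (map (\<lambda>j. x [^] (i + j)) [0..<length (c # Ks)])
    = c \<otimes> x [^] i \<oplus> combine Ks (map (\<lambda>j. x [^] (Suc i + j)) [0..<length Ks])"
    by simp
  also have "\<dots> = c \<otimes> x [^] i \<oplus> x [^] Suc i \<otimes> horner Ks x"
    using Cons.IH[of "Suc i"] Cons.prems by simp
  also have "\<dots> = x [^] i \<otimes> (horner Ks x \<otimes> x \<oplus> c)"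
    using h assms(2) by (simp, algebra)
  finally show ?case by simp
qed

lemma combine_powers0:
  assumes "set Ks \<subseteq> carrier R" "x \<in> carrier R" "length Ks = n"
  shows "combine Ks (map (\<lambda>j. x [^] j) [0..<n]) = horner Ks x"
  using combine_powers[OF assms(1,2), of 0] horner_closed[OF assms(1,2)] assms(3) by simp

text \<open>With \<open>p = eval q x\<close>, the list \<open>q @ [c]\<close> would be a polynomial
  with root \<open>x\<close>; transcendence allows this only if \<open>q\<close> is empty, and then
  \<open>p\<close> and \<open>c\<close> vanish.\<close>

lemma transcendental_constant_term:
  assumes k: "subfield k R" and x: "x \<in> carrier R" "transcendental k x"
    and p: "p \<in> simple_extension k x" "c \<in> k" "p \<otimes> x \<oplus> c = \<zero>"
  shows "c = \<zero>"
proof -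
  have kc: "k \<subseteq> carrier R" using subfieldE(3)[OF k] .
  obtain q where q: "q \<in> carrier (k[X])" "p = eval q x"
    using p(1) simple_extension_as_eval_img[OF kc x(1)] by auto
  then have pol: "polynomial k q" by (simp add: univ_poly_carrier)
  then have qs: "set q \<subseteq> k" by (rule polynomial_incl)
  show ?thesis
  proof (cases "q = []")
    case True
    then show ?thesis using q p kc x by auto
  next
    case False
    then have "polynomial k (q @ [c])" using pol p(2) by (auto simp: polynomial_def)
    then have m: "q @ [c] \<in> carrier (k[X])" by (simp add: univ_poly_carrier)
    have "eval (q @ [c]) x = \<zero>"
      using eval_append_aux[of q c x] qs kc p x q by auto
    then have "q @ [c] = []"
      using eval_transcendental[of k x "q @ [c]"] x m by (simp add: over_def)
    then show ?thesis by simp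
  qed
qed

lemma transcendental_nonzero:
  assumes "subfield k R" "transcendental k x" shows "x \<noteq> \<zero>"
  using zero_is_algebraic[OF subfieldE(1)[OF assms(1)]] assms(2) by (auto simp: over_def)

lemma transcendental_horner:
  assumes k: "subfield k R" and x: "x \<in> carrier R" "transcendental k x"
    and cs: "set cs \<subseteq> k" "horner cs x = \<zero>"
  shows "set cs \<subseteq> {\<zero>}"
  using cs
proof (induction cs)
  case (Cons c cs)
  have kc: "k \<subseteq> carrier R" using subfieldE(3)[OF k] .
  have h: "horner cs x \<in> carrier R" using Cons.prems horner_closed[of cs x] kc x by auto
  have "c = \<zero>"
    by (rule transcendental_constant_term[OF k x, of "horner cs x"])
       (use Cons.prems horner_in_simple_extension in auto)
  moreover from this have "horner cs x \<otimes> x = \<zero>" using Cons.prems h x by simp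
  then have "horner cs x = \<zero>" using integral h x transcendental_nonzero[OF k x(2)] by blast
  ultimately show ?case using Cons by auto
qed auto

lemma algebraic_horner:
  assumes k: "subfield k R" and x: "x \<in> carrier R" "\<not> transcendental k x"
  obtains cs where "set cs \<subseteq> k" "\<not> set cs \<subseteq> {\<zero>}" "horner cs x = \<zero>"
proof -
  have kc: "k \<subseteq> carrier R" using subfieldE(3)[OF k] .
  obtain p where p: "p \<in> carrier (k[X])" "p \<noteq> []" "eval p x = \<zero>"
    using algebraicE[OF subfieldE(1)[OF k] x(1)] x(2) by (auto simp: over_def)
  then have pol: "polynomial k p" by (simp add: univ_poly_carrier)
  then have "set p \<subseteq> k" "lead_coeff p \<noteq> \<zero>" using p(2) by (auto simp: polynomial_def)
  moreover have "lead_coeff p \<in> set p" using p(2) by simp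
  ultimately have "set (rev p) \<subseteq> k" "\<not> set (rev p) \<subseteq> {\<zero>}" by (simp, metis set_rev singletonD subsetD)
  moreover from this have "horner (rev p) x = \<zero>" using horner_rev[of p x] kc x p by auto
  ultimately show thesis by (rule that)
qed

lemma simple_extension_ops:
  assumes k: "subfield k R" and y: "y \<in> carrier R"
  shows "subring (simple_extension k y) R" "k \<subseteq> simple_extension k y" "y \<in> simple_extension k y"
    "simple_extension k y \<subseteq> carrier R"
proof -
  note kr = subfieldE(1)[OF k]
  show s: "subring (simple_extension k y) R" by (rule simple_extension_is_subring[OF kr y])
  show "k \<subseteq> simple_extension k y" using simple_extension_incl[OF subringE(1)[OF kr] y] .
  show "y \<in> simple_extension k y" by (rule simple_extension_mem[OF kr y])
  show "simple_extension k y \<subseteq> carrier R" by (rule subringE(1)[OF s])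
qed

text \<open>Factors out the power of \<open>y\<close> up to the lowest nonzero coefficient of a
  polynomial in \<open>y\<close>.\<close>

lemma simple_extension_strip:
  assumes k: "subfield k R" and y: "y \<in> carrier R"
    and p: "p \<in> simple_extension k y" "p \<noteq> \<zero>"
  obtains e c q where "c \<in> k" "c \<noteq> \<zero>" "q \<in> simple_extension k y" "p = y [^] (e::nat) \<otimes> (c \<oplus> y \<otimes> q)"
proof -
  note ops = simple_extension_ops[OF k y]
  have "p \<noteq> \<zero> \<longrightarrow> (\<exists>e c q. c \<in> k \<and> c \<noteq> \<zero> \<and> q \<in> simple_extension k y \<and> p = y [^] (e::nat) \<otimes> (c \<oplus> y \<otimes> q))"
    using p(1)
  proof (induction rule: simple_extension.induct)
    case (lin q c)
    have qc: "q \<in> carrier R" "c \<in> carrier R" using lin ops by auto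
    show ?case
    proof (intro impI)
      assume nz: "q \<otimes> y \<oplus> c \<noteq> \<zero>"
      show "\<exists>e c' q'. c' \<in> k \<and> c' \<noteq> \<zero> \<and> q' \<in> simple_extension k y \<and> q \<otimes> y \<oplus> c = y [^] (e::nat) \<otimes> (c' \<oplus> y \<otimes> q')"
      proof (cases "c = \<zero>")
        case True
        then have "q \<noteq> \<zero>" using nz qc y by auto
        then obtain e c' q' where h: "c' \<in> k" "c' \<noteq> \<zero>" "q' \<in> simple_extension k y" "q = y [^] (e::nat) \<otimes> (c' \<oplus> y \<otimes> q')"
          using lin by blast
        have "c' \<in> carrier R" "q' \<in> carrier R" using h ops by auto
        then have "q \<otimes> y \<oplus> c = y [^] Suc e \<otimes> (c' \<oplus> y \<otimes> q')" using True h(4) y by (simp add: m_ac)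
        then show ?thesis using h by blast
      next
        case False
        have "q \<otimes> y \<oplus> c = y [^] (0::nat) \<otimes> (c \<oplus> y \<otimes> q)" using qc y by (simp add: m_comm a_comm)
        then show ?thesis using False lin by blast
      qed
    qed
  qed simp
  then show thesis using that p by blast
qed

lemma subring_combine:
  assumes "subring A R" "set Ks \<subseteq> A" "set Us \<subseteq> A"
  shows "combine Ks Us \<in> A"
  using assms(2,3) by (induction Ks Us rule: combine.induct) (use subringE[OF assms(1)] in auto)

text \<open>\<open>P\<close> will be a polynomial ring \<open>k[y]\<close> and not a field, so
  dependence means the existence of a nontrivial relation.\<close>

definition dependent_over :: "'a set \<Rightarrow> 'a list \<Rightarrow> bool" where
  "dependent_over P Us \<longleftrightarrow>
     (\<exists>Ks. length Ks = length Us \<and> set Ks \<subseteq> P \<and> \<not> set Ks \<subseteq> {\<zero>} \<and> combine Ks Us = \<zero>)"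

lemma combine_split:
  assumes "set Ks \<subseteq> P" "\<And>x. x \<in> P \<Longrightarrow> c x \<in> carrier R \<and> p x \<in> carrier R \<and> x = c x \<oplus> y \<otimes> p x"
    "set Us \<subseteq> carrier R" "y \<in> carrier R"
  shows "combine Ks Us = combine (map c Ks) Us \<oplus> y \<otimes> combine (map p Ks) Us"
  using assms(1,3)
proof (induction Ks Us rule: combine.induct)
  case (1 x Ks u Us)
  have c: "c x \<in> carrier R" "p x \<in> carrier R" "x = c x \<oplus> y \<otimes> p x" "u \<in> carrier R"
    using assms(2)[of x] 1 by auto
  have "set (map c Ks) \<subseteq> carrier R" "set (map p Ks) \<subseteq> carrier R"
    using assms(2) 1(2) by auto
  then have d: "combine (map c Ks) Us \<in> carrier R" "combine (map p Ks) Us \<in> carrier R"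
    using 1 by auto
  have "combine (x # Ks) (u # Us) = (c x \<oplus> y \<otimes> p x) \<otimes> u \<oplus> (combine (map c Ks) Us \<oplus> y \<otimes> combine (map p Ks) Us)"
    using 1 c(3) by simp
  also have "\<dots> = (c x \<otimes> u \<oplus> combine (map c Ks) Us) \<oplus> y \<otimes> (p x \<otimes> u \<oplus> combine (map p Ks) Us)"
    using c(1,2,4) d assms(4) by algebra
  finally show ?case by simp
qed (use assms(4) in auto)

text \<open>Dividing a relation over \<open>k[y]\<close> by a power of \<open>y\<close> makes one of its constant terms nonzero.\<close>

lemma dependent_over_simple_extension_normalize:
  assumes k: "subfield k R" and y: "y \<in> carrier R" "y \<noteq> \<zero>" and Us: "set Us \<subseteq> carrier R"
    and dep: "dependent_over (simple_extension k y) Us"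
  obtains cs Ps where "length cs = length Us" "set cs \<subseteq> k" "\<not> set cs \<subseteq> {\<zero>}"
    "length Ps = length Us" "set Ps \<subseteq> simple_extension k y" "combine cs Us \<oplus> y \<otimes> combine Ps Us = \<zero>"
proof -
  let ?P = "simple_extension k y"
  note ops = simple_extension_ops[OF k y(1)]
  have kc: "k \<subseteq> carrier R" using subfieldE(3)[OF k] .
  \<comment> \<open>An element of \<open>k[y]\<close> may be written as \<open>c + y p\<close> in
    several ways, since \<open>y\<close> may be algebraic here. The choice takes a nonzero
    \<open>c\<close> whenever there is one.\<close>
  have "\<forall>x. \<exists>c p. x \<in> ?P \<longrightarrow> c \<in> k \<and> p \<in> ?P \<and> x = c \<oplus> y \<otimes> p \<and>
     ((\<exists>c' p'. c' \<in> k \<and> c' \<noteq> \<zero> \<and> p' \<in> ?P \<and> x = c' \<oplus> y \<otimes> p') \<longrightarrow> c \<noteq> \<zero>)"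
  proof
    fix x
    show "\<exists>c p. x \<in> ?P \<longrightarrow> c \<in> k \<and> p \<in> ?P \<and> x = c \<oplus> y \<otimes> p \<and>
     ((\<exists>c' p'. c' \<in> k \<and> c' \<noteq> \<zero> \<and> p' \<in> ?P \<and> x = c' \<oplus> y \<otimes> p') \<longrightarrow> c \<noteq> \<zero>)"
    proof (cases "\<exists>c' p'. c' \<in> k \<and> c' \<noteq> \<zero> \<and> p' \<in> ?P \<and> x = c' \<oplus> y \<otimes> p'")
      case True
      then show ?thesis by blast
    next
      case False
      have "\<exists>c p. c \<in> k \<and> p \<in> ?P \<and> x = c \<oplus> y \<otimes> p" if "x \<in> ?P"
        using that
      proof (cases rule: simple_extension.cases)
        case zero
        have "\<zero> = \<zero> \<oplus> y \<otimes> \<zero>" using y by simp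
        then show ?thesis using zero subringE(2)[OF subfieldE(1)[OF k]] simple_extension.zero by blast
      next
        case (lin k1 k2)
        then have "k1 \<in> carrier R" "k2 \<in> carrier R" using ops by auto
        then have "x = k2 \<oplus> y \<otimes> k1" using lin y by (simp add: m_comm a_comm)
        then show ?thesis using lin by blast
      qed
      then show ?thesis using False by blast
    qed
  qed
  then obtain c p where cp: "\<And>x. x \<in> ?P \<Longrightarrow> c x \<in> k" "\<And>x. x \<in> ?P \<Longrightarrow> p x \<in> ?P"
    "\<And>x. x \<in> ?P \<Longrightarrow> x = c x \<oplus> y \<otimes> p x"
    "\<And>x c' p'. x \<in> ?P \<Longrightarrow> c' \<in> k \<Longrightarrow> c' \<noteq> \<zero> \<Longrightarrow> p' \<in> ?P \<Longrightarrow> x = c' \<oplus> y \<otimes> p' \<Longrightarrow> c x \<noteq> \<zero>"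
    by metis
  have split: "combine Ks Us = combine (map c Ks) Us \<oplus> y \<otimes> combine (map p Ks) Us" if "set Ks \<subseteq> ?P" for Ks
  proof (rule combine_split[OF that])
    fix x assume x: "x \<in> ?P"
    show "c x \<in> carrier R \<and> p x \<in> carrier R \<and> x = c x \<oplus> y \<otimes> p x"
      using cp(1,2)[OF x] kc ops(4) cp(3)[OF x] by blast
  qed (fact Us y)+
  \<comment> \<open>Induction on the power of \<open>y\<close> in one nonzero coefficient: if all
    constant terms vanish, the whole relation can be divided by \<open>y\<close>, which lowers that
    power.\<close>
  have main: "\<exists>cs Ps. length cs = length Us \<and> set cs \<subseteq> k \<and> \<not> set cs \<subseteq> {\<zero>} \<and> length Ps = length Us \<and>
      set Ps \<subseteq> ?P \<and> combine cs Us \<oplus> y \<otimes> combine Ps Us = \<zero>"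
    if "x \<in> set Ks" "x = y [^] (e::nat) \<otimes> (c0 \<oplus> y \<otimes> q)" "c0 \<in> k" "c0 \<noteq> \<zero>" "q \<in> ?P"
      "length Ks = length Us" "set Ks \<subseteq> ?P" "combine Ks Us = \<zero>" for e x Ks c0 q
    using that
  proof (induction e arbitrary: x Ks)
    case (0 x Ks)
    have c0q: "c0 \<in> carrier R" "q \<in> carrier R" using 0 kc ops by auto
    then have "x = c0 \<oplus> y \<otimes> q" using 0 y by simp
    then have "c x \<noteq> \<zero>" using cp(4) 0 by blast
    then have "\<not> set (map c Ks) \<subseteq> {\<zero>}" using 0 by auto
    moreover have "set (map c Ks) \<subseteq> k" "set (map p Ks) \<subseteq> ?P" using cp 0 by auto
    ultimately show ?case
      using split[of Ks] 0 by (intro exI[of _ "map c Ks"] exI[of _ "map p Ks"]) auto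
  next
    case (Suc e x Ks)
    have sub: "set (map c Ks) \<subseteq> k" "set (map p Ks) \<subseteq> ?P" using cp Suc by auto
    show ?case
    proof (cases "set (map c Ks) \<subseteq> {\<zero>}")
      case False
      then show ?thesis using split[of Ks] Suc sub
        by (intro exI[of _ "map c Ks"] exI[of _ "map p Ks"]) auto
    next
      case True
      have x: "x \<in> ?P" using Suc.prems(1,7) by blast
      have px: "p x \<in> ?P" by (rule cp(2)[OF x])
      then have px': "p x \<in> carrier R" using ops(4) by blast
      have c0q: "c0 \<in> carrier R" "q \<in> carrier R" using Suc.prems(3,5) kc ops(4) by blast+
      have "c x \<in> set (map c Ks)" using Suc.prems(1) by simp
      then have cx: "c x = \<zero>" using True by blast
      have "y \<otimes> p x = c x \<oplus> y \<otimes> p x" unfolding cx using px' y by simp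
      also have "\<dots> = x" by (rule cp(3)[OF x, symmetric])
      also have "\<dots> = y [^] Suc e \<otimes> (c0 \<oplus> y \<otimes> q)" by (rule Suc.prems(2))
      also have "\<dots> = y \<otimes> (y [^] e \<otimes> (c0 \<oplus> y \<otimes> q))" using c0q y by (simp add: m_ac)
      finally have "y \<otimes> p x = y \<otimes> (y [^] e \<otimes> (c0 \<oplus> y \<otimes> q))" .
      then have pxe: "p x = y [^] e \<otimes> (c0 \<oplus> y \<otimes> q)"
        using m_lcancel[OF y(2,1), of "p x" "y [^] e \<otimes> (c0 \<oplus> y \<otimes> q)"] px' c0q y by simp
      have comb0: "combine (map p Ks) Us = \<zero>"
      proof -
        have "map c Ks = replicate (length Us) \<zero>"
          using True Suc.prems(6) by (intro replicate_eqI) auto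
        then have "combine (map c Ks) Us = \<zero>" using combine_replicate[OF Us] by simp
        moreover have C: "combine (map p Ks) Us \<in> carrier R" using sub ops(4) Us by (intro combine_in_carrier) auto
        ultimately have "y \<otimes> combine (map p Ks) Us = \<zero>"
          using split[OF Suc.prems(7)] Suc.prems(8) y by simp
        then show ?thesis using integral C y by blast
      qed
      have "p x \<in> set (map p Ks)" using Suc.prems(1) by simp
      then show ?thesis
        by (rule Suc.IH[OF _ pxe Suc.prems(3-5) _ sub(2) comb0]) (use Suc.prems(6) in simp)
    qed
  qed
  obtain Ks where Ks: "length Ks = length Us" "set Ks \<subseteq> ?P" "\<not> set Ks \<subseteq> {\<zero>}" "combine Ks Us = \<zero>"
    using dep unfolding dependent_over_def by blast
  then obtain x where x: "x \<in> set Ks" "x \<noteq> \<zero>" by blast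
  moreover from this have "x \<in> ?P" using Ks by blast
  ultimately obtain e c0 q where "c0 \<in> k" "c0 \<noteq> \<zero>" "q \<in> ?P" "x = y [^] (e::nat) \<otimes> (c0 \<oplus> y \<otimes> q)"
    using simple_extension_strip[OF k y(1)] by metis
  then show thesis using main[of x Ks e c0 q] that x Ks by blast
qed

text \<open>Denominators clear relations over \<open>k(y)\<close> to relations over
  \<open>k[y]\<close>, where constant terms make sense. For the inverse of \<open>h\<close> the
  numerator \<open>q h\<close> becomes the denominator.\<close>

lemma generate_field_denominator:
  assumes k: "subfield k R" and y: "y \<in> carrier R"
    and x: "x \<in> generate_field R (insert y k)"
  shows "\<exists>q\<in>simple_extension k y. q \<noteq> \<zero> \<and> q \<otimes> x \<in> simple_extension k y"
  using x
proof (induction rule: generate_field.induct)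
  let ?P = "simple_extension k y"
  note ops = simple_extension_ops[OF k y]
  note Pops = subringE[OF ops(1)]
  have gc: "h \<in> carrier R" if "h \<in> generate_field R (insert y k)" for h
    using generate_field_in_carrier[OF _ that] ops y by auto
  {
    case one
    then show ?case using Pops by (intro bexI[of _ \<one>]) auto
  next
    case (incl h)
    then have "h \<in> ?P" using ops by auto
    then show ?case using Pops by (intro bexI[of _ \<one>]) auto
  next
    case (a_inv h)
    then obtain q where q: "q \<in> ?P" "q \<noteq> \<zero>" "q \<otimes> h \<in> ?P" by blast
    have "q \<otimes> \<ominus> h = \<ominus> (q \<otimes> h)" using gc a_inv q ops by (intro r_minus) auto
    then show ?case using q Pops by auto
  next
    case (m_inv h)
    then obtain q where q: "q \<in> ?P" "q \<noteq> \<zero>" "q \<otimes> h \<in> ?P" by blast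
    have hc: "h \<in> carrier R" "q \<in> carrier R" using gc m_inv q ops by auto
    note i = nonzero_inv[OF hc(1) m_inv(2)]
    have "q \<otimes> h \<otimes> inv h = q" using hc i by (simp add: m_assoc)
    moreover have "q \<otimes> h \<noteq> \<zero>" using integral hc q m_inv by blast
    ultimately show ?case using q by (intro bexI[of _ "q \<otimes> h"]) auto
  next
    case (eng_add h1 h2)
    then obtain q1 q2 where q: "q1 \<in> ?P" "q1 \<noteq> \<zero>" "q1 \<otimes> h1 \<in> ?P" "q2 \<in> ?P" "q2 \<noteq> \<zero>" "q2 \<otimes> h2 \<in> ?P" by blast
    have c: "h1 \<in> carrier R" "h2 \<in> carrier R" "q1 \<in> carrier R" "q2 \<in> carrier R" using gc eng_add q ops by auto
    have "q1 \<otimes> q2 \<otimes> (h1 \<oplus> h2) = q2 \<otimes> (q1 \<otimes> h1) \<oplus> q1 \<otimes> (q2 \<otimes> h2)" using c by algebra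
    moreover have "q1 \<otimes> q2 \<noteq> \<zero>" using integral c q by blast
    ultimately show ?case using q Pops by (intro bexI[of _ "q1 \<otimes> q2"]) auto
  next
    case (eng_mult h1 h2)
    then obtain q1 q2 where q: "q1 \<in> ?P" "q1 \<noteq> \<zero>" "q1 \<otimes> h1 \<in> ?P" "q2 \<in> ?P" "q2 \<noteq> \<zero>" "q2 \<otimes> h2 \<in> ?P" by blast
    have c: "h1 \<in> carrier R" "h2 \<in> carrier R" "q1 \<in> carrier R" "q2 \<in> carrier R" using gc eng_mult q ops by auto
    have "q1 \<otimes> q2 \<otimes> (h1 \<otimes> h2) = (q1 \<otimes> h1) \<otimes> (q2 \<otimes> h2)" using c by algebra
    moreover have "q1 \<otimes> q2 \<noteq> \<zero>" using integral c q by blast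
    ultimately show ?case using q Pops by (intro bexI[of _ "q1 \<otimes> q2"]) auto
  }
qed

lemma common_denominator:
  assumes k: "subfield k R" and y: "y \<in> carrier R"
    and Ks: "set Ks \<subseteq> generate_field R (insert y k)"
  shows "\<exists>q\<in>simple_extension k y. q \<noteq> \<zero> \<and> (\<forall>x\<in>set Ks. q \<otimes> x \<in> simple_extension k y)"
  using Ks
proof (induction Ks)
  note ops = simple_extension_ops[OF k y]
  note Pops = subringE[OF ops(1)]
  {
    case Nil
    then show ?case using Pops by (intro bexI[of _ \<one>]) auto
  next
    case (Cons x Ks)
    then obtain q where q: "q \<in> simple_extension k y" "q \<noteq> \<zero>" "\<forall>x\<in>set Ks. q \<otimes> x \<in> simple_extension k y" by auto
    obtain r where r: "r \<in> simple_extension k y" "r \<noteq> \<zero>" "r \<otimes> x \<in> simple_extension k y"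
      using generate_field_denominator[OF k y, of x] Cons by auto
    have xc: "x \<in> carrier R" "set Ks \<subseteq> carrier R"
      using generate_field_incl[of "insert y k"] Cons.prems ops y by auto
    have c: "q \<in> carrier R" "r \<in> carrier R" using q r ops by auto
    have "q \<otimes> r \<noteq> \<zero>" using integral c q r by blast
    moreover have "q \<otimes> r \<otimes> x \<in> simple_extension k y"
      using q r c xc Pops(6)[of q "r \<otimes> x"] by (simp add: m_assoc)
    moreover have "q \<otimes> r \<otimes> z \<in> simple_extension k y" if "z \<in> set Ks" for z
    proof -
      have "q \<otimes> r \<otimes> z = r \<otimes> (q \<otimes> z)" using c xc that by (simp add: m_ac subset_iff)
      then show ?thesis using q r that Pops by auto
    qed
    ultimately show ?case using q r Pops by (intro bexI[of _ "q \<otimes> r"]) auto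
  }
qed

text \<open>The form in which finiteness over \<open>k(y)\<close> enters the later bounds:
  independence over \<open>k(y)\<close> with denominators cleared.\<close>

lemma finite_dimension_imp_dependent:
  assumes k: "subfield k R" and y: "y \<in> carrier R"
    and fd: "finite_dimension (generate_field R (insert y k)) (carrier R)"
  obtains n where "\<And>Us. set Us \<subseteq> carrier R \<Longrightarrow> n < length Us \<Longrightarrow> dependent_over (simple_extension k y) Us"
proof -
  let ?F = "generate_field R (insert y k)" and ?P = "simple_extension k y"
  note ops = simple_extension_ops[OF k y]
  have sub: "insert y k \<subseteq> carrier R" using ops y by auto
  have F: "subfield ?F R" by (rule generate_field_is_subfield[OF sub])
  obtain n where n: "dimension n ?F (carrier R)" using fd by auto
  show thesis
  proof (rule that)
    fix Us assume Us: "set Us \<subseteq> carrier R" "n < length Us"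
    have "dependent ?F Us"
      using independent_length_le_dimension[OF F n, of Us] Us by auto
    then obtain Ks where Ks: "length Ks = length Us" "combine Ks Us = \<zero>" "set Ks \<subseteq> ?F" "set Ks \<noteq> {\<zero>}"
      using dependent_imp_non_trivial_combine[OF F Us(1)] by blast
    have "Ks \<noteq> []" using Us Ks by auto
    then have nz: "\<not> set Ks \<subseteq> {\<zero>}" using Ks(4) by (metis set_empty subset_singletonD)
    obtain q where q: "q \<in> ?P" "q \<noteq> \<zero>" "\<forall>x\<in>set Ks. q \<otimes> x \<in> ?P"
      using common_denominator[OF k y Ks(3)] by blast
    have Kc: "set Ks \<subseteq> carrier R" using Ks(3) subfieldE(3)[OF F] by auto
    have qc: "q \<in> carrier R" using q ops by auto
    have "combine (map ((\<otimes>) q) Ks) Us = \<zero>"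
      using combine_r_distr[OF Kc Us(1) qc] Ks(2) qc by simp
    moreover have "\<not> set (map ((\<otimes>) q) Ks) \<subseteq> {\<zero>}"
    proof -
      obtain x where "x \<in> set Ks" "x \<noteq> \<zero>" using nz by blast
      then have "q \<otimes> x \<noteq> \<zero>" "q \<otimes> x \<in> set (map ((\<otimes>) q) Ks)" using integral qc q Kc by auto
      then show ?thesis by blast
    qed
    moreover have "set (map ((\<otimes>) q) Ks) \<subseteq> ?P" using q by auto
    ultimately show "dependent_over ?P Us"
      unfolding dependent_over_def using Ks(1) by (intro exI[of _ "map ((\<otimes>) q) Ks"]) auto
  qed
qed

text \<open>An exchange argument. Enough powers of \<open>z\<close> are dependent over
  \<open>k[t]\<close>, and after division by \<open>t\<close> the constant term of the relation is a
  nontrivial polynomial in \<open>z\<close> over \<open>k\<close>. Were \<open>t\<close>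
  transcendental over \<open>k(z)\<close>, this term would vanish. So \<open>t\<close> is algebraic
  over \<open>k(z)\<close>, and \<open>K\<close> is finite over \<open>k(z)(t)\<close>, which is
  finite over \<open>k(z)\<close>.\<close>

theorem finite_dimension_over_transcendental:
  assumes k: "subfield k R" and t: "t \<in> carrier R"
    and fd: "finite_dimension (generate_field R (insert t k)) (carrier R)"
    and z: "z \<in> carrier R" "transcendental k z"
  shows "finite_dimension (generate_field R (insert z k)) (carrier R)"
proof -
  let ?F = "generate_field R (insert z k)" and ?P = "simple_extension k t"
  note ops = simple_extension_ops[OF k t]
  have kc: "k \<subseteq> carrier R" using subfieldE(3)[OF k] .
  have sub: "insert z k \<subseteq> carrier R" "insert t k \<subseteq> carrier R" using kc z t by auto
  have F: "subfield ?F R" by (rule generate_field_is_subfield[OF sub(1)])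
  have kF: "k \<subseteq> ?F" and zF: "z \<in> ?F" by (auto intro: generate_field.incl)
  note Fops = subringE[OF subfieldE(1)[OF F]]
  have alg: "\<not> transcendental ?F t"
  proof
    assume tr: "transcendental ?F t"
    have t0: "t \<noteq> \<zero>" by (rule transcendental_nonzero[OF F tr])
    obtain n where n: "\<And>Us. set Us \<subseteq> carrier R \<Longrightarrow> n < length Us \<Longrightarrow> dependent_over ?P Us"
      using finite_dimension_imp_dependent[OF k t fd] by blast
    define Us where "Us = map (\<lambda>j. z [^] j) [0..<Suc n]"
    have lenU: "length Us = Suc n" by (simp add: Us_def)
    have UF: "set Us \<subseteq> ?F"
    proof -
      have "z [^] (j::nat) \<in> ?F" for j by (induction j) (use Fops zF in auto)
      then show ?thesis by (auto simp: Us_def)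
    qed
    have Uc: "set Us \<subseteq> carrier R" using UF Fops(1) by auto
    have "dependent_over ?P Us" using n[OF Uc] lenU by simp
    then obtain cs Ps where h: "length cs = length Us" "set cs \<subseteq> k" "\<not> set cs \<subseteq> {\<zero>}"
      "length Ps = length Us" "set Ps \<subseteq> ?P" "combine cs Us \<oplus> t \<otimes> combine Ps Us = \<zero>"
      using dependent_over_simple_extension_normalize[OF k t t0 Uc] by metis
    note E = subringE[OF simple_extension_is_subring[OF subfieldE(1)[OF F] t]]
    have "set Ps \<subseteq> simple_extension ?F t" using mono_simple_extension[OF kF] h(5) by blast
    moreover have "set Us \<subseteq> simple_extension ?F t" using simple_extension_ops(2)[OF F t] UF by blast
    ultimately have S: "combine Ps Us \<in> simple_extension ?F t"
      by (rule subring_combine[OF simple_extension_is_subring[OF subfieldE(1)[OF F] t]])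
    have C: "combine cs Us \<in> ?F"
      by (rule subring_combine[OF subfieldE(1)[OF F]]) (use h(2) kF UF in auto)
    have "combine Ps Us \<in> carrier R" "combine cs Us \<in> carrier R"
      using S C E(1) Fops(1) by auto
    then have "combine Ps Us \<otimes> t \<oplus> combine cs Us = \<zero>"
      using h(6) t by (simp add: m_comm a_comm)
    then have "combine cs Us = \<zero>"
      using transcendental_constant_term[OF F t tr S C] by simp
    moreover have "combine cs Us = horner cs z"
      unfolding Us_def using combine_powers0[of cs z "Suc n"] h kc z lenU by auto
    ultimately have "set cs \<subseteq> {\<zero>}" using transcendental_horner[OF k z h(2)] by simp
    then show False using h(3) by simp
  qed
  let ?L = "simple_extension ?F t"
  have L: "subfield ?L R" using simple_extension_is_subfield[OF F t] alg by (simp add: over_def)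
  have FL: "finite_dimension ?F ?L" using finite_dimension_simple_extension[OF F t] alg by (simp add: over_def)
  have G: "subfield (generate_field R (insert t k)) R" by (rule generate_field_is_subfield[OF sub(2)])
  have GL: "generate_field R (insert t k) \<subseteq> ?L"
    by (rule generate_field_min_subfield1[OF sub(2) L]) (use simple_extension_ops[OF F t] kF in auto)
  obtain m where "dimension m (generate_field R (insert t k)) (carrier R)" using fd by auto
  then obtain Vs where Vs: "set Vs \<subseteq> carrier R" "Span (generate_field R (insert t k)) Vs = carrier R"
    using exists_base[OF G] by blast
  have "carrier R \<subseteq> Span ?L Vs"
  proof
    fix x assume "x \<in> carrier R"
    then obtain Ks where "set Ks \<subseteq> generate_field R (insert t k)" "length Ks = length Vs" "x = combine Ks Vs"
      using Span_mem_iff_length_version[OF G Vs(1)] Vs(2) by auto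
    then show "x \<in> Span ?L Vs" using Span_mem_iff_length_version[OF L Vs(1)] GL by blast
  qed
  then have "Span ?L Vs = carrier R" using Span_in_carrier[of ?L Vs] Vs subfieldE(3)[OF L] by auto
  then have "finite_dimension ?L (carrier R)" using Span_finite_dimension[OF L Vs(1)] by simp
  then show ?thesis using telescopic_base_dim(1)[OF F L FL] by simp
qed

text \<open>Linear independence over \<open>k\<close> of the classes modulo
  \<open>W\<close>.\<close>

definition indep_mod :: "'a set \<Rightarrow> 'a set \<Rightarrow> 'a list \<Rightarrow> bool" where
  "indep_mod k W Us \<longleftrightarrow>
     (\<forall>cs. length cs = length Us \<longrightarrow> set cs \<subseteq> k \<longrightarrow> combine cs Us \<in> W \<longrightarrow> set cs \<subseteq> {\<zero>})"

text \<open>A relation over \<open>k[y]\<close>, divided by powers of \<open>y\<close>, has a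
  nontrivial constant part, and this part is a relation over \<open>k\<close> modulo
  \<open>y A\<close>.\<close>

lemma indep_mod_imp_independent:
  assumes k: "subfield k R" and A: "subring A R" "k \<subseteq> A" and y: "y \<in> A" "y \<noteq> \<zero>"
    and Us: "set Us \<subseteq> A" "indep_mod k ((\<otimes>) y ` A) Us"
  shows "\<not> dependent_over (simple_extension k y) Us"
proof
  have Ac: "A \<subseteq> carrier R" using subringE(1)[OF A(1)] .
  have yc: "y \<in> carrier R" using y Ac by auto
  assume "dependent_over (simple_extension k y) Us"
  then obtain cs Ps where h: "length cs = length Us" "set cs \<subseteq> k" "\<not> set cs \<subseteq> {\<zero>}"
    "set Ps \<subseteq> simple_extension k y" "combine cs Us \<oplus> y \<otimes> combine Ps Us = \<zero>"
    using dependent_over_simple_extension_normalize[OF k yc y(2)] Us Ac by (metis order_trans)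
  have "simple_extension k y \<subseteq> A" by (rule simple_extension_subring_incl[OF A y(1)])
  then have P: "combine Ps Us \<in> A" using subring_combine[OF A(1)] h Us by auto
  have C: "combine cs Us \<in> A" using subring_combine[OF A(1)] h Us A by auto
  have PC: "combine Ps Us \<in> carrier R" "combine cs Us \<in> carrier R" using P C Ac by auto
  have "combine cs Us = y \<otimes> \<ominus> combine Ps Us"
  proof -
    have "combine cs Us = (combine cs Us \<oplus> y \<otimes> combine Ps Us) \<oplus> y \<otimes> \<ominus> combine Ps Us"
      using PC yc by algebra
    then show ?thesis using h(5) PC yc by simp
  qed
  moreover have "\<ominus> combine Ps Us \<in> A" using subringE(5)[OF A(1) P] .
  ultimately have "combine cs Us \<in> (\<otimes>) y ` A" by blast
  then show False using Us(2) h unfolding indep_mod_def by blast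
qed

text \<open>The bound makes the quotient by \<open>W\<close> a space of dimension at most
  \<open>N\<close> over the finite field \<open>k\<close>. The combinations of a longest independent
  list represent all classes.\<close>

lemma finite_cover_mod:
  assumes k: "subfield k R" "finite k" and A: "A \<subseteq> carrier R"
    and Agen: "\<And>cs Us. set cs \<subseteq> k \<Longrightarrow> set Us \<subseteq> A \<Longrightarrow> combine cs Us \<in> A"
    and W: "\<And>c w. c \<in> k \<Longrightarrow> w \<in> W \<Longrightarrow> c \<otimes> w \<in> W"
    and bound: "\<And>Us. set Us \<subseteq> A \<Longrightarrow> indep_mod k W Us \<Longrightarrow> length Us \<le> N"
  obtains T where "T \<subseteq> A" "finite T" "card T \<le> card k ^ N" "\<And>a. a \<in> A \<Longrightarrow> \<exists>t\<in>T. a \<ominus> t \<in> W"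
proof -
  have kc: "k \<subseteq> carrier R" using subfieldE(3)[OF k(1)] .
  let ?Q = "\<lambda>n. \<exists>Us. set Us \<subseteq> A \<and> indep_mod k W Us \<and> length Us = n"
  have "?Q 0" by (auto simp: indep_mod_def)
  moreover have "\<forall>n. ?Q n \<longrightarrow> n \<le> N" using bound by blast
  ultimately obtain n where n: "?Q n" "\<And>m. ?Q m \<Longrightarrow> m \<le> n"
    using Nat.ex_has_greatest_nat[of ?Q 0 N] by blast
  then obtain Us where Us: "set Us \<subseteq> A" "indep_mod k W Us" "length Us = n" by blast
  have nN: "n \<le> N" using bound Us by blast
  define L where "L = {cs. set cs \<subseteq> k \<and> length cs = n}"
  have L: "finite L" "card L = card k ^ n" unfolding L_def
    using finite_lists_length_eq[OF k(2)] card_lists_length_eq[OF k(2)] by auto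
  have k1: "card k \<ge> 1" using k subringE(2)[OF subfieldE(1)[OF k(1)]]
    by (metis One_nat_def Suc_leI card_gt_0_iff empty_iff)
  let ?T = "(\<lambda>cs. combine cs Us) ` L"
  show thesis
  proof (rule that[of ?T])
    show "?T \<subseteq> A" using Agen Us by (auto simp: L_def)
    show "finite ?T" using L by simp
    have "card ?T \<le> card k ^ n" using card_image_le[OF L(1)] L by metis
    also have "\<dots> \<le> card k ^ N" using nN k1 by (intro power_increasing) auto
    finally show "card ?T \<le> card k ^ N" .
    fix a assume a: "a \<in> A"
    then have ac: "a \<in> carrier R" using A by auto
    \<comment> \<open>A longest list cannot be extended by \<open>a\<close>. In the resulting
      relation the coefficient \<open>d\<close> of \<open>a\<close> is nonzero, hence invertible in
      \<open>k\<close>, and one solves for \<open>a\<close> modulo \<open>W\<close>.\<close>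
    have "\<not> indep_mod k W (a # Us)"
    proof
      assume "indep_mod k W (a # Us)"
      then have "?Q (Suc n)" using a Us by (intro exI[of _ "a # Us"]) auto
      then show False using n(2) by fastforce
    qed
    then obtain ds where ds: "length ds = Suc n" "set ds \<subseteq> k" "combine ds (a # Us) \<in> W" "\<not> set ds \<subseteq> {\<zero>}"
      using Us by (auto simp: indep_mod_def)
    then obtain d es where de: "ds = d # es" "length es = n" by (auto simp: length_Suc_conv)
    have des: "d \<in> k" "set es \<subseteq> k" using ds de by auto
    have dc: "d \<in> carrier R" "set es \<subseteq> carrier R" "set Us \<subseteq> carrier R" using des kc Us A by auto
    then have ec: "combine es Us \<in> carrier R" by simp
    have W1: "d \<otimes> a \<oplus> combine es Us \<in> W" using ds de by simp
    have d0: "d \<noteq> \<zero>"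
    proof
      assume d0: "d = \<zero>"
      then have "combine es Us \<in> W" using W1 ac ec by simp
      then have "set es \<subseteq> {\<zero>}" using Us(2)[unfolded indep_mod_def, rule_format, of es] de(2) Us(3) des by simp
      then show False using ds(4) de d0 by auto
    qed
    have i: "inv d \<in> k" "inv d \<otimes> d = \<one>" "inv d \<in> carrier R"
      using subfield_m_inv[OF k(1), of d] des d0 kc by auto
    have m: "\<ominus> (inv d) \<in> k" using subringE(5)[OF subfieldE(1)[OF k(1)] i(1)] .
    let ?cs = "map ((\<otimes>) (\<ominus> (inv d))) es"
    have cs: "?cs \<in> L" using m des de subringE(6)[OF subfieldE(1)[OF k(1)]] by (auto simp: L_def)
    have "combine ?cs Us = \<ominus> (inv d) \<otimes> combine es Us"
      using combine_r_distr[OF dc(2,3), of "\<ominus> (inv d)"] i by simp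
    then have "a \<ominus> combine ?cs Us = inv d \<otimes> d \<otimes> a \<oplus> inv d \<otimes> combine es Us"
      using i ac ec by (simp add: minus_eq l_minus)
    also have "\<dots> = inv d \<otimes> (d \<otimes> a \<oplus> combine es Us)" using i(3) dc(1) ac ec by algebra
    finally have "a \<ominus> combine ?cs Us \<in> W" using W[OF i(1) W1] by simp
    then show "\<exists>t\<in>?T. a \<ominus> t \<in> W" using cs by blast
  qed
qed

end

section \<open>Existence of poles\<close>

text \<open>Such an \<open>A\<close> turns out to be a valuation ring in which \<open>y\<close> is
  not a unit; a valuation belonging to it has a pole at \<open>inv y\<close>.\<close>

locale maximal_subring_avoiding = field +
  fixes A and y
  assumes A: "subring A R" and y: "y \<in> A" "y \<noteq> \<zero>" and avoid: "inv y \<notin> A"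
    and maximal: "\<And>B. subring B R \<Longrightarrow> A \<subseteq> B \<Longrightarrow> inv y \<notin> B \<Longrightarrow> B = A"
begin

lemma Ac: "a \<in> A \<Longrightarrow> a \<in> carrier R"
  using subringE(1)[OF A] by blast

lemmas Aops [simp, intro] = subringE(2,3,5,6,7)[OF A]

lemma A_minus [simp, intro]: "a \<in> A \<Longrightarrow> b \<in> A \<Longrightarrow> a \<ominus> b \<in> A"
  by (auto simp: minus_eq)

lemma yc: "y \<in> carrier R" using y Ac by blast

lemma y_mult_neq_one: "a \<in> A \<Longrightarrow> y \<otimes> a \<noteq> \<one>"
proof
  assume a: "a \<in> A" "y \<otimes> a = \<one>"
  then have "inv y = a" using yc Ac by (intro comm_inv_char) auto
  then show False using a avoid by simp
qed

text \<open>Localizing \<open>A\<close> at the multiplicative set \<open>1 + y A\<close> does not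
  create \<open>inv y\<close>, so by maximality the localization is \<open>A\<close> itself:
  \<open>y\<close> lies in the Jacobson radical.\<close>

lemma one_plus_unit:
  assumes a: "a \<in> A"
  shows "\<one> \<oplus> y \<otimes> a \<noteq> \<zero>" "inv (\<one> \<oplus> y \<otimes> a) \<in> A"
proof -
  note c = Ac[OF a] yc
  have nz: "\<one> \<oplus> y \<otimes> b \<noteq> \<zero>" if b: "b \<in> A" for b
  proof
    assume "\<one> \<oplus> y \<otimes> b = \<zero>"
    then have "\<one> \<oplus> y \<otimes> b \<ominus> y \<otimes> b = \<ominus> (y \<otimes> b)" using Ac[OF b] yc by (simp add: minus_eq)
    moreover have "\<one> \<oplus> y \<otimes> b \<ominus> y \<otimes> b = \<one>" using Ac[OF b] yc by algebra
    ultimately have "y \<otimes> (\<ominus> b) = \<one>" using Ac[OF b] yc by (simp add: r_minus)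
    then show False using y_mult_neq_one[of "\<ominus> b"] b by auto
  qed
  show "\<one> \<oplus> y \<otimes> a \<noteq> \<zero>" by (rule nz[OF a])
  \<comment> \<open>The localization, given by denominators of the form
    \<open>1 + y b\<close>.\<close>
  define B where "B = {x \<in> carrier R. \<exists>b\<in>A. x \<otimes> (\<one> \<oplus> y \<otimes> b) \<in> A}"
  have AB: "A \<subseteq> B"
  proof
    fix x assume "x \<in> A"
    moreover have "x \<otimes> (\<one> \<oplus> y \<otimes> \<zero>) = x" using \<open>x \<in> A\<close> Ac yc by simp
    ultimately show "x \<in> B" using Ac unfolding B_def by (auto intro!: bexI[of _ \<zero>])
  qed
  have prod: "(\<one> \<oplus> y \<otimes> b) \<otimes> (\<one> \<oplus> y \<otimes> c) = \<one> \<oplus> y \<otimes> (b \<oplus> c \<oplus> y \<otimes> b \<otimes> c)" if "b \<in> A" "c \<in> A" for b c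
    using Ac[OF that(1)] Ac[OF that(2)] yc by algebra
  have "subring B R"
  proof (rule subringI)
    show "B \<subseteq> carrier R" by (auto simp: B_def)
    show "\<one> \<in> B" using AB by auto
    fix h assume "h \<in> B"
    then obtain b where b: "h \<in> carrier R" "b \<in> A" "h \<otimes> (\<one> \<oplus> y \<otimes> b) \<in> A" by (auto simp: B_def)
    have "\<ominus> h \<otimes> (\<one> \<oplus> y \<otimes> b) = \<ominus> (h \<otimes> (\<one> \<oplus> y \<otimes> b))" using b Ac[OF b(2)] yc by (simp add: l_minus)
    then have "\<ominus> h \<otimes> (\<one> \<oplus> y \<otimes> b) \<in> A" using b(3) by simp
    then show "\<ominus> h \<in> B" using b unfolding B_def by auto
    fix g assume "g \<in> B"
    then obtain c where c: "g \<in> carrier R" "c \<in> A" "g \<otimes> (\<one> \<oplus> y \<otimes> c) \<in> A" by (auto simp: B_def)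
    note cc = Ac[OF b(2)] Ac[OF c(2)] yc b(1) c(1)
    have d: "b \<oplus> c \<oplus> y \<otimes> b \<otimes> c \<in> A" using b c y by auto
    have "(h \<otimes> g) \<otimes> ((\<one> \<oplus> y \<otimes> b) \<otimes> (\<one> \<oplus> y \<otimes> c)) = (h \<otimes> (\<one> \<oplus> y \<otimes> b)) \<otimes> (g \<otimes> (\<one> \<oplus> y \<otimes> c))"
      using cc by algebra
    then have "(h \<otimes> g) \<otimes> (\<one> \<oplus> y \<otimes> (b \<oplus> c \<oplus> y \<otimes> b \<otimes> c)) \<in> A"
      unfolding prod[OF b(2) c(2)] using b(3) c(3) by simp
    then show "h \<otimes> g \<in> B" using cc d unfolding B_def by auto
    have "(h \<oplus> g) \<otimes> ((\<one> \<oplus> y \<otimes> b) \<otimes> (\<one> \<oplus> y \<otimes> c)) =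
        (h \<otimes> (\<one> \<oplus> y \<otimes> b)) \<otimes> (\<one> \<oplus> y \<otimes> c) \<oplus> (g \<otimes> (\<one> \<oplus> y \<otimes> c)) \<otimes> (\<one> \<oplus> y \<otimes> b)"
      using cc by algebra
    moreover have "\<dots> \<in> A" using b(2,3) c(2,3) y by auto
    ultimately have "(h \<oplus> g) \<otimes> (\<one> \<oplus> y \<otimes> (b \<oplus> c \<oplus> y \<otimes> b \<otimes> c)) \<in> A"
      unfolding prod[OF b(2) c(2)] by simp
    then show "h \<oplus> g \<in> B" using cc d unfolding B_def by auto
  qed
  moreover have "inv y \<notin> B"
  proof
    assume "inv y \<in> B"
    then obtain b where b: "b \<in> A" "inv y \<otimes> (\<one> \<oplus> y \<otimes> b) \<in> A" by (auto simp: B_def)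
    note i = nonzero_inv[OF yc y(2)]
    have "inv y \<otimes> (\<one> \<oplus> y \<otimes> b) = inv y \<oplus> (inv y \<otimes> y) \<otimes> b" using i(1) yc Ac[OF b(1)] by algebra
    then have "inv y \<oplus> b \<in> A" using b i Ac by simp
    then have "inv y \<oplus> b \<ominus> b \<in> A" using b by blast
    moreover have "inv y \<oplus> b \<ominus> b = inv y" using i(1) Ac[OF b(1)] by algebra
    ultimately show False using avoid by simp
  qed
  ultimately have BA: "B = A" using maximal AB by blast
  have "\<one> \<oplus> y \<otimes> a \<in> carrier R" using c by simp
  note i = nonzero_inv[OF this nz[OF a]]
  have "inv (\<one> \<oplus> y \<otimes> a) \<otimes> (\<one> \<oplus> y \<otimes> a) \<in> A" using i by simp
  then have "inv (\<one> \<oplus> y \<otimes> a) \<in> B" using a i(1) unfolding B_def by blast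
  then show "inv (\<one> \<oplus> y \<otimes> a) \<in> A" using BA by simp
qed

text \<open>The elements of \<open>y A[u]\<close> of degree at most \<open>n\<close> in \<open>u\<close>.\<close>

inductive_set ypoly :: "'a \<Rightarrow> nat \<Rightarrow> 'a set" for u n where
  zero: "\<zero> \<in> ypoly u n"
| add: "s \<in> ypoly u n \<Longrightarrow> a \<in> A \<Longrightarrow> i \<le> n \<Longrightarrow> s \<oplus> y \<otimes> a \<otimes> u [^] i \<in> ypoly u n"

lemma ypoly_closed: "s \<in> ypoly u n \<Longrightarrow> u \<in> carrier R \<Longrightarrow> s \<in> carrier R"
  by (induction rule: ypoly.induct) (auto simp: Ac yc)

lemma ypoly_monom: "u \<in> carrier R \<Longrightarrow> a \<in> A \<Longrightarrow> i \<le> n \<Longrightarrow> y \<otimes> a \<otimes> u [^] i \<in> ypoly u n"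
  using ypoly.add[OF ypoly.zero, of a i n u] Ac[of a] yc by simp

lemma ypoly_add:
  assumes u: "u \<in> carrier R" and s: "s \<in> ypoly u n" and t: "t \<in> ypoly u n"
  shows "s \<oplus> t \<in> ypoly u n"
  using t
proof (induction rule: ypoly.induct)
  case zero
  then show ?case using s ypoly_closed[OF s u] by simp
next
  case (add t a i)
  have "s \<oplus> (t \<oplus> y \<otimes> a \<otimes> u [^] i) = (s \<oplus> t) \<oplus> y \<otimes> a \<otimes> u [^] i"
    using ypoly_closed[OF s u] ypoly_closed[OF add(1) u] Ac[OF add(2)] yc u by (simp add: a_assoc)
  then show ?case using ypoly.add[OF add(4,2,3)] by simp
qed

lemma ypoly_times:
  assumes u: "u \<in> carrier R" and s: "s \<in> ypoly u n"
  shows "s \<otimes> u \<in> ypoly u (Suc n)"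
  using s
proof (induction rule: ypoly.induct)
  case zero
  then show ?case using u by (simp add: ypoly.zero)
next
  case (add t a i)
  have "(t \<oplus> y \<otimes> a \<otimes> u [^] i) \<otimes> u = t \<otimes> u \<oplus> y \<otimes> a \<otimes> u [^] Suc i"
    using ypoly_closed[OF add(1) u] Ac[OF add(2)] yc u by (simp add: l_distr m_assoc)
  then show ?case using ypoly.add[OF add(4,2), of "Suc i"] add(3) by simp
qed

lemma ypoly_top:
  assumes u: "u \<in> carrier R" and s: "s \<in> ypoly u (Suc n)"
  shows "\<exists>t\<in>ypoly u n. \<exists>a\<in>A. s = t \<oplus> y \<otimes> a \<otimes> u [^] Suc n"
  using s
proof (induction rule: ypoly.induct)
  case zero
  then show ?case using u yc by (intro bexI[of _ \<zero>]) (auto simp: ypoly.zero)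
next
  case (add s b i)
  then obtain t a where ta: "t \<in> ypoly u n" "a \<in> A" "s = t \<oplus> y \<otimes> a \<otimes> u [^] Suc n" by blast
  note c = ypoly_closed[OF ta(1) u] Ac[OF ta(2)] Ac[OF add(2)] yc
  have c': "u [^] i \<in> carrier R" "u [^] Suc n \<in> carrier R" using u by auto
  show ?case
  proof (cases "i = Suc n")
    case True
    have "s \<oplus> y \<otimes> b \<otimes> u [^] i = t \<oplus> y \<otimes> (a \<oplus> b) \<otimes> u [^] Suc n"
      unfolding ta(3) True using c c'(2) by algebra
    then show ?thesis using ta add(2) by blast
  next
    case False
    have "s \<oplus> y \<otimes> b \<otimes> u [^] i = (t \<oplus> y \<otimes> b \<otimes> u [^] i) \<oplus> y \<otimes> a \<otimes> u [^] Suc n"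
      unfolding ta(3) using c c' by algebra
    moreover have "t \<oplus> y \<otimes> b \<otimes> u [^] i \<in> ypoly u n" using ypoly.add[OF ta(1) add(2)] add(3) False by simp
    ultimately show ?thesis using ta by blast
  qed
qed

text \<open>Multiplying an expression in \<open>w = 1 / u\<close> of degree at most
  \<open>n + 1\<close> by \<open>u [^] Suc n\<close> turns every term except the constant
  \<open>y b\<close> into one of degree at most \<open>n\<close> in \<open>u\<close>. The factor
  \<open>e\<close> allows scaling by ring elements.\<close>

lemma ypoly_flip:
  assumes uw: "u \<in> carrier R" "w \<in> carrier R" "u \<otimes> w = \<one>"
    and s: "s \<in> ypoly w r" and r: "r \<le> Suc n"
  shows "\<exists>b\<in>A. \<forall>e\<in>A. e \<otimes> (s \<ominus> y \<otimes> b) \<otimes> u [^] Suc n \<in> ypoly u n"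
  using s
proof (induction rule: ypoly.induct)
  case zero
  have "e \<otimes> (\<zero> \<ominus> y \<otimes> \<zero>) \<otimes> u [^] Suc n = \<zero>" if "e \<in> A" for e
    using that Ac yc uw by (simp add: minus_eq)
  then show ?case by (intro bexI[of _ \<zero>]) (auto simp: ypoly.zero simp del: nat_pow_Suc)
next
  case (add s a i)
  then obtain b where b: "b \<in> A" "\<And>e. e \<in> A \<Longrightarrow> e \<otimes> (s \<ominus> y \<otimes> b) \<otimes> u [^] Suc n \<in> ypoly u n" by blast
  note c = ypoly_closed[OF add(1) uw(2)] Ac[OF b(1)] Ac[OF add(2)] yc
  have c': "u [^] Suc n \<in> carrier R" "w [^] i \<in> carrier R" using uw by auto
  show ?case
  proof (cases i)
    case 0
    have "s \<oplus> y \<otimes> a \<otimes> w [^] i \<ominus> y \<otimes> (b \<oplus> a) = s \<oplus> y \<otimes> a \<otimes> \<one> \<ominus> y \<otimes> (b \<oplus> a)" using 0 by simp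
    also have "\<dots> = s \<ominus> y \<otimes> b" using c by algebra
    finally show ?thesis using b add(2) by (intro bexI[of _ "b \<oplus> a"]) auto
  next
    case (Suc j)
    have "e \<otimes> (s \<oplus> y \<otimes> a \<otimes> w [^] i \<ominus> y \<otimes> b) \<otimes> u [^] Suc n \<in> ypoly u n" if e: "e \<in> A" for e
    proof -
      have "w [^] i \<otimes> u [^] Suc n = u [^] (n - j)"
      proof -
        have ij: "Suc n = (n - j) + i" using Suc add(3) r by simp
        have "w [^] i \<otimes> u [^] Suc n = w [^] i \<otimes> (u [^] (n - j) \<otimes> u [^] i)"
          unfolding ij using uw by (simp add: nat_pow_mult[symmetric])
        also have "\<dots> = (u [^] i \<otimes> w [^] i) \<otimes> u [^] (n - j)" using uw(1,2) by (simp add: m_ac)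
        also have "u [^] i \<otimes> w [^] i = \<one>" using nat_pow_distrib[OF uw(1,2), of i] uw(3) by simp
        finally show ?thesis using uw by simp
      qed
      then have "y \<otimes> (e \<otimes> a) \<otimes> (w [^] i \<otimes> u [^] Suc n) \<in> ypoly u n"
        using ypoly_monom[OF uw(1), of "e \<otimes> a" "n - j" n] e add(2) by (simp del: nat_pow_Suc)
      moreover have "e \<otimes> (s \<oplus> y \<otimes> a \<otimes> w [^] i \<ominus> y \<otimes> b) \<otimes> u [^] Suc n =
        e \<otimes> (s \<ominus> y \<otimes> b) \<otimes> u [^] Suc n \<oplus> y \<otimes> (e \<otimes> a) \<otimes> (w [^] i \<otimes> u [^] Suc n)"
        using c c' Ac[OF e] by algebra
      ultimately show ?thesis using ypoly_add[OF uw(1) b(2)[OF e]] by (simp del: nat_pow_Suc)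
    qed
    then show ?thesis using b(1) by blast
  qed
qed

lemma ypoly_0: "\<one> \<notin> ypoly u 0" if u: "u \<in> carrier R"
proof
  assume "\<one> \<in> ypoly u 0"
  moreover have "\<exists>a\<in>A. s = y \<otimes> a" if "s \<in> ypoly u 0" for s
    using that
  proof (induction rule: ypoly.induct)
    case zero
    then show ?case using yc by (intro bexI[of _ \<zero>]) auto
  next
    case (add s a i)
    then obtain b where "b \<in> A" "s = y \<otimes> b" by blast
    then have "s \<oplus> y \<otimes> a \<otimes> u [^] i = y \<otimes> (b \<oplus> a)" using add Ac yc by (simp add: r_distr)
    then show ?case using add \<open>b \<in> A\<close> by blast
  qed
  ultimately obtain a where "a \<in> A" "\<one> = y \<otimes> a" by blast
  then show False using y_mult_neq_one[of a] by simp
qed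

text \<open>By \<open>ypoly_flip\<close> the expression for 1 in \<open>w\<close> rewrites
  \<open>(1 - y b) u [^] n\<close> with lower powers of \<open>u\<close>. As \<open>1 - y b\<close>
  is a unit, the top term of the expression in \<open>u\<close> can be replaced.\<close>

lemma ypoly_descent:
  assumes uw: "u \<in> carrier R" "w \<in> carrier R" "u \<otimes> w = \<one>"
    and 1: "\<one> \<in> ypoly u n" "\<one> \<in> ypoly w r" "r \<le> n"
  shows "\<exists>m<n. \<one> \<in> ypoly u m"
proof -
  obtain m where m: "n = Suc m" using ypoly_0[OF uw(1)] 1 by (cases n) auto
  obtain t a where ta: "t \<in> ypoly u m" "a \<in> A" "\<one> = t \<oplus> y \<otimes> a \<otimes> u [^] Suc m"
    using ypoly_top[OF uw(1)] 1 m by blast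
  obtain b where b: "b \<in> A" "\<And>e. e \<in> A \<Longrightarrow> e \<otimes> (\<one> \<ominus> y \<otimes> b) \<otimes> u [^] Suc m \<in> ypoly u m"
    using ypoly_flip[OF uw 1(2), of m] 1 m by blast
  define d where "d = \<one> \<oplus> y \<otimes> (\<ominus> b)"
  have d: "d \<noteq> \<zero>" "inv d \<in> A" unfolding d_def using one_plus_unit[of "\<ominus> b"] b by auto
  have dc: "d \<in> carrier R" "d = \<one> \<ominus> y \<otimes> b" using b Ac yc by (auto simp: d_def r_minus minus_eq)
  note i = nonzero_inv[OF dc(1) d(1)]
  have "(y \<otimes> a \<otimes> inv d) \<otimes> d \<otimes> u [^] Suc m \<in> ypoly u m"
    using b(2)[of "y \<otimes> a \<otimes> inv d"] d ta y dc by (simp del: nat_pow_Suc)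
  moreover have "(y \<otimes> a \<otimes> inv d) \<otimes> d = y \<otimes> a" using i Ac[OF ta(2)] yc dc by (simp add: m_assoc)
  ultimately have "y \<otimes> a \<otimes> u [^] Suc m \<in> ypoly u m" by (simp del: nat_pow_Suc)
  then have "\<one> \<in> ypoly u m" using ypoly_add[OF uw(1) ta(1)] ta(3) by (simp del: nat_pow_Suc)
  then show ?thesis using m by auto
qed

text \<open>By maximality \<open>A[u]\<close> contains \<open>inv y\<close>; multiply its expression
  by \<open>y\<close>.\<close>

lemma one_in_ypoly:
  assumes u: "u \<in> carrier R" "u \<notin> A"
  shows "\<exists>n. \<one> \<in> ypoly u n"
proof -
  let ?B = "simple_extension A u"
  have B: "subring ?B R" by (rule simple_extension_is_subring[OF A u(1)])
  moreover have "A \<subseteq> ?B" using simple_extension_incl[OF subringE(1)[OF A] u(1)] A by blast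
  moreover have "u \<in> ?B" by (rule simple_extension_mem[OF A u(1)])
  ultimately have iy: "inv y \<in> ?B" using maximal[OF B] u by blast
  have "\<exists>n. y \<otimes> p \<in> ypoly u n" if "p \<in> ?B" for p
    using that
  proof (induction rule: simple_extension.induct)
    case zero
    then show ?case using yc ypoly.zero by auto
  next
    case (lin p a)
    then obtain n where n: "y \<otimes> p \<in> ypoly u n" by blast
    have pc: "p \<in> carrier R" using lin subringE(1)[OF B] by blast
    have "y \<otimes> (p \<otimes> u \<oplus> a) = y \<otimes> p \<otimes> u \<oplus> y \<otimes> a \<otimes> u [^] (0::nat)"
      using pc Ac[OF lin(2)] yc u by (simp add: r_distr m_assoc)
    then show ?case using ypoly.add[OF ypoly_times[OF u(1) n] lin(2), of 0] by auto
  qed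
  from this[OF iy] show ?thesis using nonzero_inv[OF yc y(2)] by simp
qed

text \<open>If both \<open>u\<close> and its inverse were missing, 1 would have an expression of
  least degree in each of them, and the one of larger degree could be shortened by means of the
  other.\<close>

theorem valuation_ring_property:
  assumes u: "u \<in> carrier R" "u \<noteq> \<zero>"
  shows "u \<in> A \<or> inv u \<in> A"
proof (rule ccontr)
  assume not: "\<not> (u \<in> A \<or> inv u \<in> A)"
  note i = nonzero_inv[OF u]
  define n where "n = (LEAST n. \<one> \<in> ypoly u n)"
  define r where "r = (LEAST n. \<one> \<in> ypoly (inv u) n)"
  have n: "\<one> \<in> ypoly u n" "\<And>m. \<one> \<in> ypoly u m \<Longrightarrow> n \<le> m"
    unfolding n_def using one_in_ypoly[OF u(1)] not by (auto intro: LeastI_ex Least_le)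
  have r: "\<one> \<in> ypoly (inv u) r" "\<And>m. \<one> \<in> ypoly (inv u) m \<Longrightarrow> r \<le> m"
    unfolding r_def using one_in_ypoly[OF i(1)] not by (auto intro: LeastI_ex Least_le)
  show False
  proof (cases "r \<le> n")
    case True
    then show False using ypoly_descent[OF u(1) i(1,3) n(1) r(1)] n(2) by (meson not_le)
  next
    case False
    then show False using ypoly_descent[OF i(1) u(1) i(4) r(1) n(1)] r(2) by (meson not_le le_cases)
  qed
qed

end

lemma (in field) exists_maximal_subring_avoiding:
  assumes P: "subring P R" "y \<in> P" "y \<noteq> \<zero>" "inv y \<notin> P"
  obtains A where "P \<subseteq> A" "maximal_subring_avoiding R A y"
proof -
  let ?S = "{A. subring A R \<and> P \<subseteq> A \<and> inv y \<notin> A}"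
  have "\<exists>A\<in>?S. \<forall>B\<in>?S. A \<subseteq> B \<longrightarrow> B = A"
  proof (rule subset_Zorn_nonempty)
    show "?S \<noteq> {}" using P by blast
    fix C assume C: "C \<noteq> {}" "subset.chain ?S C"
    then have CS: "\<And>B. B \<in> C \<Longrightarrow> subring B R \<and> P \<subseteq> B \<and> inv y \<notin> B"
      and ch: "\<And>B D. B \<in> C \<Longrightarrow> D \<in> C \<Longrightarrow> B \<subseteq> D \<or> D \<subseteq> B"
      by (auto simp: subset_chain_def)
    have two: "\<exists>B\<in>C. a \<in> B \<and> b \<in> B" if "a \<in> \<Union>C" "b \<in> \<Union>C" for a b
      using that ch by blast
    have "subring (\<Union>C) R"
    proof (rule subringI)
      show "\<Union>C \<subseteq> carrier R" using CS subringE(1) by blast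
      obtain D where "D \<in> C" using C(1) by blast
      then show "\<one> \<in> \<Union>C" using CS[of D] subringE(3)[of D] by blast
      fix a assume "a \<in> \<Union>C"
      then obtain D where "D \<in> C" "a \<in> D" by blast
      then show "\<ominus> a \<in> \<Union>C" using CS[of D] subringE(5)[of D] by blast
      fix b assume "b \<in> \<Union>C"
      then obtain B where "B \<in> C" "a \<in> B" "b \<in> B" using two \<open>a \<in> \<Union>C\<close> by blast
      then show "a \<otimes> b \<in> \<Union>C" "a \<oplus> b \<in> \<Union>C" using CS[of B] subringE(6,7)[of B] by blast+
    qed
    then show "\<Union>C \<in> ?S" using CS C(1) by blast
  qed
  then obtain A where "A \<in> ?S" and max: "\<forall>B\<in>?S. A \<subseteq> B \<longrightarrow> B = A" by (rule bexE)
  then have A: "subring A R" "P \<subseteq> A" "inv y \<notin> A" by simp_all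
  have maxB: "B = A" if "subring B R" "A \<subseteq> B" "inv y \<notin> B" for B
    using max that A(2) by simp
  have "maximal_subring_avoiding R A y"
    by (intro maximal_subring_avoiding.intro maximal_subring_avoiding_axioms.intro maxB)
       (use field_axioms A P in blast)+
  then show thesis by (rule that[OF A(2)])
qed

section \<open>The maximal subring is a discrete valuation ring\<close>

locale finite_maximal_subring_avoiding = maximal_subring_avoiding +
  fixes k N
  assumes k: "subfield k R" "finite k" "k \<subseteq> A"
    and dep: "\<And>Us. set Us \<subseteq> carrier R \<Longrightarrow> N < length Us \<Longrightarrow> dependent_over (simple_extension k y) Us"
begin

text \<open>The principal ideal of \<open>a\<close>; \<open>b \<in> Mul a\<close> is divisibility of
  \<open>b\<close> by \<open>a\<close> in \<open>A\<close>.\<close>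

definition Mul :: "'a \<Rightarrow> 'a set" where "Mul a = (\<otimes>) a ` A"

lemma Mul_iff: "a \<in> carrier R \<Longrightarrow> a \<noteq> \<zero> \<Longrightarrow> b \<in> carrier R \<Longrightarrow> b \<in> Mul a \<longleftrightarrow> inv a \<otimes> b \<in> A"
proof
  assume a: "a \<in> carrier R" "a \<noteq> \<zero>" "b \<in> carrier R"
  note i = nonzero_inv[OF a(1,2)]
  show "inv a \<otimes> b \<in> A" if "b \<in> Mul a"
  proof -
    obtain c where c: "c \<in> A" "b = a \<otimes> c" using \<open>b \<in> Mul a\<close> by (auto simp: Mul_def)
    have "inv a \<otimes> b = c" unfolding c(2) using i a Ac[OF c(1)] by (simp add: m_assoc[symmetric])
    then show ?thesis using c by simp
  qed
  show "b \<in> Mul a" if "inv a \<otimes> b \<in> A"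
  proof -
    have "b = a \<otimes> (inv a \<otimes> b)" using i a by (simp add: m_assoc[symmetric])
    then show ?thesis using that unfolding Mul_def by blast
  qed
qed

lemma Mul_add: "a \<in> carrier R \<Longrightarrow> b \<in> Mul a \<Longrightarrow> c \<in> Mul a \<Longrightarrow> b \<oplus> c \<in> Mul a"
  unfolding Mul_def using Ac by (auto simp: r_distr[symmetric])

lemma Mul_mult: "a \<in> carrier R \<Longrightarrow> b \<in> Mul a \<Longrightarrow> c \<in> A \<Longrightarrow> b \<otimes> c \<in> Mul a"
  unfolding Mul_def using Ac by (auto simp: m_assoc)

lemma Mul_trans: "a \<in> carrier R \<Longrightarrow> b \<in> Mul a \<Longrightarrow> c \<in> Mul b \<Longrightarrow> c \<in> Mul a"
  using Mul_mult[of a b] by (auto simp: Mul_def[of b])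

lemma Mul_self: "a \<in> carrier R \<Longrightarrow> a \<in> Mul a"
  unfolding Mul_def by (auto intro!: image_eqI[of _ _ \<one>])

lemma Mul_total:
  assumes "a \<in> A" "a \<noteq> \<zero>" "b \<in> A" "b \<noteq> \<zero>"
  shows "b \<in> Mul a \<or> a \<in> Mul b"
proof -
  have c: "a \<in> carrier R" "b \<in> carrier R" using assms Ac by auto
  note i = nonzero_inv[OF c(1) assms(2)] nonzero_inv[OF c(2) assms(4)]
  have nz: "inv a \<otimes> b \<noteq> \<zero>" using nonzero_mult i c assms by simp
  have "inv (inv a \<otimes> b) = inv b \<otimes> a"
  proof (rule comm_inv_char)
    have "inv a \<otimes> b \<otimes> (inv b \<otimes> a) = (inv a \<otimes> a) \<otimes> (b \<otimes> inv b)" using i(1,5) c by algebra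
    then show "inv a \<otimes> b \<otimes> (inv b \<otimes> a) = \<one>" using i by simp
  qed (use i c in auto)
  then show ?thesis
    using valuation_ring_property[of "inv a \<otimes> b"] nz i c assms by (simp add: Mul_iff)
qed

text \<open>\<open>A / y A\<close> is finite, because elements independent modulo \<open>y\<close>
  are independent over \<open>k[y]\<close>, and there are at most \<open>N\<close> of those.\<close>

lemma finite_cover_mod_y:
  obtains T where "T \<subseteq> A" "finite T" "\<And>a. a \<in> A \<Longrightarrow> \<exists>t\<in>T. a \<ominus> t \<in> Mul y"
proof (rule finite_cover_mod[OF k(1,2), of A "(\<otimes>) y ` A" N])
  show "A \<subseteq> carrier R" using Ac by blast
  show "combine cs Us \<in> A" if "set cs \<subseteq> k" "set Us \<subseteq> A" for cs Us
    using subring_combine[OF A] that k(3) by blast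
  show "c \<otimes> w \<in> (\<otimes>) y ` A" if cw: "c \<in> k" "w \<in> (\<otimes>) y ` A" for c w
  proof -
    have cA: "c \<in> A" using k cw by blast
    obtain a where a: "a \<in> A" "w = y \<otimes> a" using cw by blast
    have "c \<otimes> w = y \<otimes> (c \<otimes> a)" using a Ac[OF cA] Ac[OF a(1)] yc by (simp add: m_ac)
    then show ?thesis using cA a by blast
  qed
  show "length Us \<le> N" if "set Us \<subseteq> A" "indep_mod k ((\<otimes>) y ` A) Us" for Us
    using indep_mod_imp_independent[OF k(1) A k(3) y that] dep[of Us] that(1) Ac by (meson not_le subsetI subset_trans)
  fix T assume "T \<subseteq> A" "finite T" "\<And>a. a \<in> A \<Longrightarrow> \<exists>t\<in>T. a \<ominus> t \<in> (\<otimes>) y ` A"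
  then show thesis using that[of T] by (simp add: Mul_def)
qed

definition nonunits :: "'a set" where
  "nonunits = {a \<in> A. a \<noteq> \<zero> \<and> inv a \<notin> A}"

text \<open>An ideal containing \<open>y A\<close> is a union of cosets of \<open>y A\<close>, so
  inclusions between such ideals can be tested on the representatives \<open>T\<close>.\<close>

lemma cover_transfer:
  assumes T: "T \<subseteq> A" "\<And>a. a \<in> A \<Longrightarrow> \<exists>t\<in>T. a \<ominus> t \<in> Mul y"
    and ab: "a \<in> A" "b \<in> A" "y \<in> Mul a" "y \<in> Mul b" "T \<inter> Mul b \<subseteq> Mul a"
  shows "b \<in> Mul a"
proof -
  obtain t where t: "t \<in> T" "b \<ominus> t \<in> Mul y" using T ab by blast
  have c: "a \<in> carrier R" "b \<in> carrier R" "t \<in> carrier R" using ab t T Ac by auto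
  have d: "b \<ominus> t \<in> Mul a" "b \<ominus> t \<in> Mul b" using Mul_trans c ab t by blast+
  have "\<ominus> (b \<ominus> t) \<in> Mul b"
    using Mul_mult[OF c(2) d(2), of "\<ominus> \<one>"] c by (simp add: r_minus)
  then have "b \<oplus> \<ominus> (b \<ominus> t) \<in> Mul b" using Mul_add Mul_self c by blast
  moreover have "b \<oplus> \<ominus> (b \<ominus> t) = t" using c by algebra
  ultimately have "t \<in> Mul a" using ab t by auto
  then have "t \<oplus> (b \<ominus> t) \<in> Mul a" using Mul_add d c by blast
  moreover have "t \<oplus> (b \<ominus> t) = b" using c by algebra
  ultimately show ?thesis by simp
qed

text \<open>As \<open>A / y A\<close> is finite and principal ideals form a chain, there is a
  largest proper one containing \<open>y\<close>; it absorbs every nonunit.\<close>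

lemma exists_uniformizer:
  obtains p where "p \<in> nonunits" "\<And>b. b \<in> nonunits \<Longrightarrow> b \<in> Mul p" "\<exists>j. y \<notin> Mul (p [^] (j::nat))"
proof -
  obtain T where T: "T \<subseteq> A" "finite T" "\<And>a. a \<in> A \<Longrightarrow> \<exists>t\<in>T. a \<ominus> t \<in> Mul y"
    by (rule finite_cover_mod_y) blast
  \<comment> \<open>The size of an ideal containing \<open>y\<close> is measured by the number of
    representatives in it.\<close>
  let ?C = "\<lambda>a. a \<in> nonunits \<and> y \<in> Mul a"
  have "?C y" using y avoid Mul_self yc by (simp add: nonunits_def)
  moreover have "\<forall>a. ?C a \<longrightarrow> card (T \<inter> Mul a) < Suc (card T)"
    using T(2) by (auto simp: less_Suc_eq_le intro: card_mono)
  ultimately obtain p where p: "?C p" "\<And>a. ?C a \<Longrightarrow> card (T \<inter> Mul a) \<le> card (T \<inter> Mul p)"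
    using ex_has_greatest_nat[of ?C y "\<lambda>a. card (T \<inter> Mul a)"] by blast
  have pA: "p \<in> A" "p \<in> carrier R" "p \<noteq> \<zero>" "inv p \<notin> A" using p Ac by (auto simp: nonunits_def)
  have gen: "b \<in> Mul p" if b: "b \<in> nonunits" for b
  proof (rule ccontr)
    assume not: "b \<notin> Mul p"
    have bA: "b \<in> A" "b \<in> carrier R" "b \<noteq> \<zero>" using b Ac by (auto simp: nonunits_def)
    then have pb: "p \<in> Mul b" using Mul_total pA not by blast
    then have "y \<in> Mul b" using Mul_trans p bA by blast
    then have "card (T \<inter> Mul b) \<le> card (T \<inter> Mul p)" using p(2) b by blast
    moreover have "T \<inter> Mul p \<subseteq> T \<inter> Mul b" using Mul_trans[OF bA(2) pb] by blast
    ultimately have "T \<inter> Mul b = T \<inter> Mul p" using T(2) by (metis card_seteq finite_Int)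
    then have "b \<in> Mul p" using cover_transfer[OF T(1,3) pA(1) bA(1)] p \<open>y \<in> Mul b\<close> by blast
    then show False using not by simp
  qed
  have pp: "p [^] (j::nat) \<in> A" "p [^] j \<in> carrier R" for j
  proof -
    show "p [^] j \<in> A" by (induction j) (use pA in auto)
    then show "p [^] j \<in> carrier R" using Ac by auto
  qed
  have "\<exists>j. y \<notin> Mul (p [^] (j::nat))"
  proof (rule ccontr)
    assume "\<not> ?thesis"
    then have all: "y \<in> Mul (p [^] j)" for j :: nat by blast
    have mono: "Mul (p [^] Suc j) \<subseteq> Mul (p [^] j)" for j :: nat
      using Mul_trans[OF pp(2), of "p [^] Suc j" j] Mul_mult[OF pp(2) Mul_self[OF pp(2)] pA(1)] by auto
    \<comment> \<open>If all powers of \<open>p\<close> divided \<open>y\<close>, each of them would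
      lose a representative against the one before, which cannot go on for more than
      \<open>card T\<close> steps.\<close>
    have strict: "T \<inter> Mul (p [^] Suc j) \<subset> T \<inter> Mul (p [^] j)" for j :: nat
    proof (rule psubsetI)
      show "T \<inter> Mul (p [^] Suc j) \<subseteq> T \<inter> Mul (p [^] j)" using mono by blast
      show "T \<inter> Mul (p [^] Suc j) \<noteq> T \<inter> Mul (p [^] j)"
      proof
        assume "T \<inter> Mul (p [^] Suc j) = T \<inter> Mul (p [^] j)"
        then have "p [^] j \<in> Mul (p [^] Suc j)"
          using cover_transfer[OF T(1,3) pp(1)[of "Suc j"] pp(1)[of j] all all] by blast
        then obtain a where a: "a \<in> A" "p [^] j = p [^] Suc j \<otimes> a" by (auto simp: Mul_def)
        have "p [^] j \<otimes> \<one> = p [^] j \<otimes> (p \<otimes> a)" using a pp pA Ac[OF a(1)] by (simp add: m_assoc)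
        then have "\<one> = p \<otimes> a"
          using m_lcancel[OF nonzero_pow[OF pA(2,3), of j] pp(2)[of j], of \<one> "p \<otimes> a"] pA Ac[OF a(1)] by simp
        then have "inv p = a" using a pA Ac by (intro comm_inv_char) auto
        then show False using a pA by simp
      qed
    qed
    have "card (T \<inter> Mul (p [^] j)) + j \<le> card T" for j :: nat
    proof (induction j)
      case 0
      then show ?case using T(2) by (auto intro: card_mono)
    next
      case (Suc j)
      then show ?case using psubset_card_mono[OF _ strict[of j]] T(2) by fastforce
    qed
    from this[of "Suc (card T)"] show False by simp
  qed
  then show thesis using that p gen by blast
qed

text \<open>\<open>b\<close> is a root of a nonzero polynomial over \<open>k[y]\<close>, so it
  divides the lowest nonzero coefficient; and a nonzero element of \<open>k[y]\<close> is a power of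
  \<open>y\<close> times a unit of \<open>A\<close>.\<close>

lemma power_of_y_in_Mul:
  assumes b: "b \<in> A" "b \<noteq> \<zero>"
  shows "\<exists>e. y [^] (e::nat) \<in> Mul b"
proof -
  let ?P = "simple_extension k y"
  have bc: "b \<in> carrier R" using b Ac by blast
  have PA: "?P \<subseteq> A" by (rule simple_extension_subring_incl[OF A k(3) y(1)])
  have "dependent_over ?P (map (\<lambda>j. b [^] j) [0..<Suc N])" by (rule dep) (use bc in auto)
  then obtain Ks where Ks: "length Ks = Suc N" "set Ks \<subseteq> ?P" "\<not> set Ks \<subseteq> {\<zero>}"
    "combine Ks (map (\<lambda>j. b [^] j) [0..<Suc N]) = \<zero>"
    unfolding dependent_over_def by auto
  have KA: "set Ks \<subseteq> A" using Ks PA by blast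
  have "horner Ks b = \<zero>" using combine_powers0[of Ks b "Suc N"] Ks KA Ac bc by (metis subset_iff)
  then have "\<exists>q\<in>set Ks. q \<noteq> \<zero> \<and> q \<in> Mul b"
    using KA Ks(3)
  proof (induction Ks)
    case (Cons c cs)
    have h: "horner cs b \<in> A"
      using Cons.prems(2) by (induction cs) (use b in auto)
    have cc: "c \<in> carrier R" "horner cs b \<in> carrier R" using Cons h Ac by auto
    show ?case
    proof (cases "c = \<zero>")
      case True
      then have "horner cs b \<otimes> b = \<zero>" using Cons cc bc by simp
      then have "horner cs b = \<zero>" using integral cc bc b by blast
      then show ?thesis using Cons True by auto
    next
      case False
      have "c = (horner cs b \<otimes> b \<oplus> c) \<oplus> b \<otimes> (\<ominus> horner cs b)" using cc bc by algebra
      then have "c = b \<otimes> (\<ominus> horner cs b)" using Cons.prems(1) cc bc by simp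
      then have "c \<in> Mul b" using h unfolding Mul_def by blast
      then show ?thesis using False by auto
    qed
  qed simp
  then obtain q where q: "q \<in> ?P" "q \<noteq> \<zero>" "q \<in> Mul b" using Ks by blast
  obtain e c r where s: "c \<in> k" "c \<noteq> \<zero>" "r \<in> ?P" "q = y [^] (e::nat) \<otimes> (c \<oplus> y \<otimes> r)"
    by (rule simple_extension_strip[OF k(1) yc q(1,2)])
  have ck: "inv c \<in> A" "inv c \<otimes> c = \<one>" "c \<in> A" using subfield_m_inv[OF k(1), of c] s k by auto
  have rA: "r \<in> A" using s PA by blast
  note cc = Ac[OF ck(1)] Ac[OF ck(3)] Ac[OF rA] yc
  \<comment> \<open>The coefficient is \<open>y [^] e * c * d\<close> with \<open>c\<close> a
    nonzero constant and \<open>d\<close> in \<open>1 + y A\<close>, both units of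
    \<open>A\<close>.\<close>
  define d where "d = \<one> \<oplus> y \<otimes> (inv c \<otimes> r)"
  have d: "d \<noteq> \<zero>" "inv d \<in> A" unfolding d_def using one_plus_unit[of "inv c \<otimes> r"] ck rA by auto
  have dc: "d \<in> carrier R" using cc by (simp add: d_def)
  note i = nonzero_inv[OF dc d(1)]
  have "c \<oplus> y \<otimes> r = c \<otimes> \<one> \<oplus> y \<otimes> (inv c \<otimes> c) \<otimes> r" using cc ck by simp
  also have "\<dots> = c \<otimes> d" unfolding d_def using cc by algebra
  finally have q': "q = y [^] e \<otimes> (c \<otimes> d)" using s by simp
  have "q \<otimes> (inv c \<otimes> inv d) = y [^] e \<otimes> (inv c \<otimes> c) \<otimes> (inv d \<otimes> d)"
    unfolding q' using cc dc i(1) nat_pow_closed[OF yc, of e] by algebra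
  then have "q \<otimes> (inv c \<otimes> inv d) = y [^] e" using ck i cc by simp
  moreover have "q \<otimes> (inv c \<otimes> inv d) \<in> Mul b" using Mul_mult[OF bc q(3)] ck d by blast
  ultimately show ?thesis by metis
qed

text \<open>With \<open>y\<close> a unit times \<open>p [^] i0\<close>, an element dividing
  \<open>y [^] e\<close> is not divisible by \<open>p [^] (i0 * e + 1)\<close>. So every nonzero
  element contains only finitely many factors \<open>p\<close> and is a unit times a power of
  \<open>p\<close>.\<close>

theorem exists_valuation: "\<exists>v. normalized_valuation R v \<and> v (inv y) < 0"
proof -
  obtain p where p: "p \<in> nonunits" "\<And>b. b \<in> nonunits \<Longrightarrow> b \<in> Mul p" "\<exists>j. y \<notin> Mul (p [^] (j::nat))"
    by (rule exists_uniformizer) blast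
  have pA: "p \<in> A" "p \<in> carrier R" "p \<noteq> \<zero>" "inv p \<notin> A" using p Ac by (auto simp: nonunits_def)
  have pp: "p [^] (j::nat) \<in> A" "p [^] j \<in> carrier R" for j
  proof -
    show "p [^] j \<in> A" by (induction j) (use pA in auto)
    then show "p [^] j \<in> carrier R" using Ac by auto
  qed
  have pn: "p \<otimes> a \<noteq> \<one>" if "a \<in> A" for a
  proof
    assume "p \<otimes> a = \<one>"
    then have "inv p = a" using that pA Ac by (intro comm_inv_char) auto
    then show False using that pA by simp
  qed
  have factor: "\<exists>i u. u \<in> A \<and> u \<noteq> \<zero> \<and> inv u \<in> A \<and> b = u \<otimes> p [^] (i::nat)"
    if b: "b \<in> A" "b \<noteq> \<zero>" "\<exists>j. b \<notin> Mul (p [^] (j::nat))" for b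
  proof -
    \<comment> \<open>The first power of \<open>p\<close> not dividing \<open>b\<close>. The
      cofactor of the power before it is not divisible by \<open>p\<close>, hence a unit.\<close>
    define j where "j = (LEAST j. b \<notin> Mul (p [^] (j::nat)))"
    have j: "b \<notin> Mul (p [^] j)" unfolding j_def using b(3) by (rule LeastI_ex)
    have "b \<in> Mul (p [^] (0::nat))" using b Ac unfolding Mul_def by (auto intro!: image_eqI[of _ _ b])
    then obtain i where i: "j = Suc i" using j by (cases j) auto
    then have "b \<in> Mul (p [^] i)" using not_less_Least[of i "\<lambda>j. b \<notin> Mul (p [^] (j::nat))"] j_def by auto
    then obtain u where u: "u \<in> A" "b = p [^] i \<otimes> u" by (auto simp: Mul_def)
    have u0: "u \<noteq> \<zero>" using u b pp by auto
    have "inv u \<in> A"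
    proof (rule ccontr)
      assume "inv u \<notin> A"
      then have "u \<in> Mul p" using p u u0 by (simp add: nonunits_def)
      then obtain a where a: "a \<in> A" "u = p \<otimes> a" by (auto simp: Mul_def)
      then have "b = p [^] j \<otimes> a" using u i pA pp Ac[OF a(1)] by (simp add: m_assoc)
      then show False using j a unfolding Mul_def by blast
    qed
    then show ?thesis using u u0 pp Ac[OF u(1)] by (intro exI[of _ i] exI[of _ u]) (auto simp: m_comm)
  qed
  obtain i0 w where w: "w \<in> A" "w \<noteq> \<zero>" "inv w \<in> A" "y = w \<otimes> p [^] (i0::nat)"
    using factor[OF y p(3)] by blast
  have wc: "w \<in> carrier R" using w Ac by auto
  note iw = nonzero_inv[OF wc w(2)]
  have yp: "y [^] e \<notin> Mul (p [^] Suc (i0 * e))" for e :: nat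
  proof
    assume "y [^] e \<in> Mul (p [^] Suc (i0 * e))"
    then obtain a where a: "a \<in> A" "y [^] e = p [^] Suc (i0 * e) \<otimes> a" by (auto simp: Mul_def)
    have iwe: "inv w [^] e \<in> A" by (induction e) (use w in auto)
    have wce: "w [^] e \<in> carrier R" "inv w [^] e \<in> carrier R" using wc iw by auto
    have one: "inv w [^] e \<otimes> w [^] e = \<one>"
      using nat_pow_distrib[of "inv w" w e] wc iw by simp
    have pie: "(p [^] i0) [^] e = p [^] (i0 * e)" using pA by (simp add: nat_pow_pow)
    have "w [^] e \<otimes> p [^] (i0 * e) = p [^] Suc (i0 * e) \<otimes> a"
      using a(2) unfolding w(4) using wc pp by (simp add: nat_pow_distrib pie)
    then have "inv w [^] e \<otimes> (w [^] e \<otimes> p [^] (i0 * e)) = inv w [^] e \<otimes> (p [^] Suc (i0 * e) \<otimes> a)" by simp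
    then have "p [^] (i0 * e) \<otimes> \<one> = p [^] (i0 * e) \<otimes> (p \<otimes> (inv w [^] e \<otimes> a))"
      using one wce pp pA Ac[OF a(1)] by (simp add: m_assoc[symmetric]) (simp add: m_ac)
    then have "\<one> = p \<otimes> (inv w [^] e \<otimes> a)"
      using m_lcancel[OF nonzero_pow[OF pA(2,3), of "i0 * e"] pp(2)[of "i0 * e"], of \<one> "p \<otimes> (inv w [^] e \<otimes> a)"]
        pA Ac[OF a(1)] wce by simp
    then show False using pn[of "inv w [^] e \<otimes> a"] iwe a by auto
  qed
  have fact: "\<exists>i u. u \<in> A \<and> u \<noteq> \<zero> \<and> inv u \<in> A \<and> b = u \<otimes> p [^] (i::nat)" if b: "b \<in> A" "b \<noteq> \<zero>" for b
  proof (rule factor[OF b])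
    obtain e where "y [^] (e::nat) \<in> Mul b" using power_of_y_in_Mul[OF b] by blast
    then have "b \<notin> Mul (p [^] Suc (i0 * e))" using yp[of e] Mul_trans[OF pp(2)] by blast
    then show "\<exists>j. b \<notin> Mul (p [^] (j::nat))" by blast
  qed
  have "\<exists>v. normalized_valuation R v \<and> (\<forall>x\<in>carrier R - {\<zero>}. x \<in> A \<longleftrightarrow> 0 \<le> v x)"
    by (rule valuation_of_discrete_valuation_ring[OF A pA(1,3,4) valuation_ring_property fact])
  then obtain v where v: "normalized_valuation R v" "\<forall>x\<in>carrier R - {\<zero>}. x \<in> A \<longleftrightarrow> 0 \<le> v x"
    by blast
  have "\<not> 0 \<le> v (inv y)" using v(2) nonzero_inv[OF yc y(2)] avoid by blast
  then show ?thesis using v(1) by auto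
qed

end

text \<open>Applied to \<open>y = inv x\<close>, the construction starts from \<open>k[y]\<close>,
  which does not contain \<open>inv y\<close>: that would be a polynomial relation for the
  transcendental \<open>y\<close>.\<close>

theorem (in field) transcendental_has_pole:
  assumes k: "subfield k R" "finite k" and t: "t \<in> carrier R"
    and fd: "finite_dimension (generate_field R (insert t k)) (carrier R)"
    and x: "x \<in> carrier R" "transcendental k x"
  shows "\<exists>v. normalized_valuation R v \<and> v x < 0"
proof -
  have x0: "x \<noteq> \<zero>" by (rule transcendental_nonzero[OF k(1) x(2)])
  define y where "y = inv x"
  note i = nonzero_inv[OF x(1) x0]
  have y: "y \<in> carrier R" "y \<noteq> \<zero>" using i by (auto simp: y_def)
  have xy: "inv y = x" unfolding y_def using x(1) x0 i by (intro comm_inv_char) auto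
  let ?alg = "{x \<in> carrier R. (algebraic over k) x}"
  have tr: "transcendental k y"
  proof (rule ccontr)
    assume "\<not> transcendental k y"
    then have "y \<in> ?alg - {\<zero>}" using y by (simp add: over_def)
    then have "inv y \<in> ?alg" using subfield_m_inv(1)[OF subfield_of_algebraics[OF k(1)]] by blast
    then show False using x(2) xy by (simp add: over_def)
  qed
  let ?P = "simple_extension k y"
  note ops = simple_extension_ops[OF k(1) y(1)]
  have "inv y \<notin> ?P"
  proof
    assume a: "inv y \<in> ?P"
    have "\<ominus> \<one> \<in> k" using subringE(3,5)[OF subfieldE(1)[OF k(1)]] by blast
    moreover have "inv y \<otimes> y \<oplus> \<ominus> \<one> = \<zero>" using nonzero_inv[OF y] by (simp add: r_neg)
    ultimately have "\<ominus> \<one> = \<zero>" by (rule transcendental_constant_term[OF k(1) y(1) tr a])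
    then show False using add.inv_eq_1_iff by auto
  qed
  then obtain A where A: "?P \<subseteq> A" "maximal_subring_avoiding R A y"
    using exists_maximal_subring_avoiding[OF ops(1,3) y(2)] by blast
  obtain N where N: "\<And>Us. set Us \<subseteq> carrier R \<Longrightarrow> N < length Us \<Longrightarrow> dependent_over ?P Us"
    using finite_dimension_imp_dependent[OF k(1) y(1) finite_dimension_over_transcendental[OF k(1) t fd y(1) tr]]
    by blast
  interpret finite_maximal_subring_avoiding R A y k N
    using A(2) k ops(2) A(1) N by (simp add: finite_maximal_subring_avoiding_def finite_maximal_subring_avoiding_axioms_def)
  show ?thesis using exists_valuation xy by simp
qed

section \<open>Places of global function fields\<close>

lemma (in field) horner_append:
  "set cs \<subseteq> carrier R \<Longrightarrow> c \<in> carrier R \<Longrightarrow> x \<in> carrier R \<Longrightarrow>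
    horner (cs @ [c]) x = horner cs x \<oplus> c \<otimes> x [^] length cs"
proof (induction cs)
  case Nil
  then show ?case by simp
next
  case (Cons d cs)
  have h: "horner cs x \<in> carrier R" "d \<in> carrier R" "c \<in> carrier R" "x [^] length cs \<in> carrier R"
    using Cons.prems horner_closed by auto
  have "horner ((d # cs) @ [c]) x = (horner cs x \<oplus> c \<otimes> x [^] length cs) \<otimes> x \<oplus> d"
    using Cons by simp
  also have "\<dots> = (horner cs x \<otimes> x \<oplus> d) \<oplus> c \<otimes> (x [^] length cs \<otimes> x)" using h Cons.prems(3) by algebra
  finally show ?case by simp
qed

lemma (in field) horner_leading:
  assumes "set Ks \<subseteq> carrier R" "\<not> set Ks \<subseteq> {\<zero>}" "x \<in> carrier R" "horner Ks x = \<zero>"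
  obtains Ls a where "set (Ls @ [a]) \<subseteq> set Ks" "a \<noteq> \<zero>" "horner (Ls @ [a]) x = \<zero>"
proof -
  have "\<exists>Ls a. set (Ls @ [a]) \<subseteq> set Ks \<and> a \<noteq> \<zero> \<and> horner (Ls @ [a]) x = \<zero>"
    using assms(1,2,4)
  proof (induction Ks rule: rev_induct)
    case (snoc a Ks)
    show ?case
    proof (cases "a = \<zero>")
      case True
      have "set Ks \<subseteq> carrier R" "\<not> set Ks \<subseteq> {\<zero>}" using snoc.prems True by auto
      moreover from this have "horner Ks x = \<zero>"
        using snoc.prems(3) horner_append[of Ks a x] assms(3) True horner_closed[of Ks x] by simp
      ultimately obtain Ls b where "set (Ls @ [b]) \<subseteq> set Ks" "b \<noteq> \<zero>" "horner (Ls @ [b]) x = \<zero>"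
        using snoc.IH by blast
      then show ?thesis by (intro exI[of _ Ls] exI[of _ b]) auto
    next
      case False
      then show ?thesis using snoc.prems(3) by (intro exI[of _ Ks] exI[of _ a]) simp
    qed
  qed simp
  then show thesis using that by blast
qed

context discrete_valuation
begin

lemma vge_horner:
  assumes "set cs \<subseteq> carrier K" "\<And>c. c \<in> set cs \<Longrightarrow> vge 0 c" "x \<in> carrier K" "x \<noteq> \<zero>" "v x \<le> 0" "cs \<noteq> []"
  shows "vge (int (length cs - 1) * v x) (horner cs x)"
  using assms(1,2,6)
proof (induction cs)
  case (Cons c cs)
  show ?case
  proof (cases "cs = []")
    case True
    then show ?thesis using Cons assms by simp
  next
    case False
    have h: "horner cs x \<in> carrier K" using Cons.prems horner_closed assms(3) by auto
    have len: "int (length cs) * v x = int (length cs - 1) * v x + v x" using False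
      by (cases cs) (auto simp: algebra_simps)
    have "vge (int (length cs - 1) * v x + v x) (horner cs x \<otimes> x)"
      by (rule vge_mult) (use Cons False h assms in \<open>auto simp: vge_def\<close>)
    then have "vge (int (length cs) * v x) (horner cs x \<otimes> x)" using len by simp
    moreover have "vge (int (length cs) * v x) c"
      by (rule vge_mono[of 0]) (use Cons assms in \<open>auto simp: mult_le_0_iff\<close>)
    ultimately have "vge (int (length cs) * v x) (horner cs x \<otimes> x \<oplus> c)"
      by (intro vge_add) (use Cons h assms in auto)
    then show ?thesis by simp
  qed
qed simp

text \<open>Multiplying by the leading coefficient makes a root integral: if \<open>a x\<close> had
  a pole, the leading term would be the unique term of smallest valuation and could not
  cancel.\<close>

lemma vge_leading_mult:
  assumes L: "set (Ls @ [a]) \<subseteq> carrier K" "\<And>c. c \<in> set (Ls @ [a]) \<Longrightarrow> vge 0 c" and a: "a \<noteq> \<zero>"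
    and x: "x \<in> carrier K" and zero: "horner (Ls @ [a]) x = \<zero>"
  shows "vge 0 (a \<otimes> x)"
proof (rule ccontr)
  assume not: "\<not> vge 0 (a \<otimes> x)"
  have ac: "a \<in> carrier K" using L by simp
  have x0: "x \<noteq> \<zero>" using not ac by (auto simp: vge_def)
  have va: "0 \<le> v a" using L(2)[of a] a by (simp add: vge_def)
  have lt: "v a + v x < 0" using not v_mult[OF ac a x x0] by (simp add: vge_def)
  have Ls: "Ls \<noteq> []"
  proof
    assume "Ls = []"
    then show False using zero a ac x by simp
  qed
  let ?d = "length Ls"
  have xd: "x [^] ?d \<in> carrier K" "x [^] ?d \<noteq> \<zero>" using x x0 nonzero_pow by auto
  let ?t = "a \<otimes> x [^] ?d"
  have t: "?t \<in> carrier K" "?t \<noteq> \<zero>" "v ?t = v a + int ?d * v x"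
    using ac a xd nonzero_mult v_mult v_pow x x0 by auto
  have "vge (int (?d - 1) * v x) (horner Ls x)"
    by (rule vge_horner) (use L x x0 va lt Ls in auto)
  moreover have "v ?t + 1 \<le> int (?d - 1) * v x"
    using t(3) lt Ls by (cases Ls) (auto simp: algebra_simps)
  ultimately have "vge (v ?t + 1) (horner Ls x)" by (rule vge_mono)
  then have "?t \<oplus> horner Ls x \<noteq> \<zero>"
    using v_add_dominant(1)[OF t(1,2)] horner_closed[of Ls x] L x by simp
  moreover have "horner (Ls @ [a]) x = horner Ls x \<oplus> ?t" using horner_append[of Ls a x] L x by simp
  moreover have "horner Ls x \<oplus> ?t = ?t \<oplus> horner Ls x"
    using t(1) horner_closed[of Ls x] L x by (intro a_comm) auto
  ultimately show False using zero by simp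
qed

lemma vge_list_bound:
  "set Us \<subseteq> carrier K \<Longrightarrow> \<exists>m. \<forall>u\<in>set Us. vge m u"
proof (induction Us)
  case (Cons u Us)
  then obtain m where "\<forall>u\<in>set Us. vge m u" by auto
  then have "\<forall>w\<in>set (u # Us). vge (min m (v u)) w" by (auto simp: vge_def)
  then show ?case by blast
qed simp

end

lemma (in field) subring_vge_all:
  assumes "\<And>g. g \<in> G \<Longrightarrow> normalized_valuation R g"
  shows "subring {x \<in> carrier R. \<forall>g\<in>G. x = \<zero> \<or> 0 \<le> g x} R" (is "subring ?B R")
proof (rule subringI)
  have one: "0 \<le> g \<one>" if "g \<in> G" for g
    using discrete_valuation.v_one[OF discrete_valuationI[OF assms[OF that]]] by simp
  have eq: "discrete_valuation.vge R g 0 x \<longleftrightarrow> x = \<zero> \<or> 0 \<le> g x" if "g \<in> G" for g x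
    using discrete_valuation.vge_def[OF discrete_valuationI[OF assms[OF that]]] .
  show "?B \<subseteq> carrier R" by auto
  show "\<one> \<in> ?B" using one by auto
  fix a assume a: "a \<in> ?B"
  show "\<ominus> a \<in> ?B"
  proof -
    have "discrete_valuation.vge R g 0 (\<ominus> a)" if "g \<in> G" for g
      by (rule discrete_valuation.vge_uminus[OF discrete_valuationI[OF assms[OF that]]])
         (use a that eq[OF that] in auto)
    then show ?thesis using a eq by auto
  qed
  fix b assume b: "b \<in> ?B"
  show "a \<otimes> b \<in> ?B"
  proof -
    have "discrete_valuation.vge R g 0 (a \<otimes> b)" if "g \<in> G" for g
      by (rule discrete_valuation.vge_mult0[OF discrete_valuationI[OF assms[OF that]]])
         (use a b that eq[OF that] in auto)
    then show ?thesis using a b eq by auto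
  qed
  show "a \<oplus> b \<in> ?B"
  proof -
    have "discrete_valuation.vge R g 0 (a \<oplus> b)" if "g \<in> G" for g
      by (rule discrete_valuation.vge_add[OF discrete_valuationI[OF assms[OF that]]])
         (use a b that eq[OF that] in auto)
    then show ?thesis using a b eq by auto
  qed
qed

text \<open>Neither valuation ring contains the other, which gives an element for each direction;
  the quotient of the two has a pole for \<open>v\<close> and a zero for \<open>w\<close>.\<close>

lemma (in field) valuations_separate:
  assumes v: "normalized_valuation R v" and w: "normalized_valuation R w" and ne: "v \<noteq> w"
  obtains a where "a \<in> carrier R" "a \<noteq> \<zero>" "v a < 0" "0 < w a"
proof -
  interpret v: discrete_valuation R v by (rule discrete_valuationI[OF v])
  interpret w: discrete_valuation R w by (rule discrete_valuationI[OF w])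
  obtain a where a: "a \<in> carrier R" "a \<noteq> \<zero>" "0 \<le> w a" "v a < 0"
    using w.v_eq_if_vge_imp[OF v] ne by (meson not_le)
  obtain b where b: "b \<in> carrier R" "b \<noteq> \<zero>" "0 \<le> v b" "w b < 0"
    using v.v_eq_if_vge_imp[OF w] ne by (metis not_le)
  note i = nonzero_inv[OF b(1,2)]
  have "a \<otimes> inv b \<in> carrier R" "a \<otimes> inv b \<noteq> \<zero>" using a i nonzero_mult by auto
  moreover have "v (a \<otimes> inv b) < 0" "0 < w (a \<otimes> inv b)"
    using a b i by (auto simp: v.v_mult w.v_mult v.v_inv w.v_inv)
  ultimately show thesis using that by blast
qed

text \<open>Induction on \<open>G\<close>: an element \<open>a\<close> good for \<open>G\<close> is
  combined with a \<open>b\<close> that separates \<open>f\<close> from the new \<open>g\<close>.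
  The factor built from \<open>a\<close> must dominate \<open>b\<close> on \<open>G\<close> without
  spoiling \<open>f\<close> and \<open>g\<close>.\<close>

lemma (in field) weak_approximation:
  assumes "finite G" "normalized_valuation R f" "\<And>g. g \<in> G \<Longrightarrow> normalized_valuation R g" "f \<notin> G"
  shows "\<exists>a\<in>carrier R. a \<noteq> \<zero> \<and> f a < 0 \<and> (\<forall>g\<in>G. 0 < g a)"
  using assms
proof (induction G rule: finite_induct)
  case empty
  interpret f: discrete_valuation R f by (rule discrete_valuationI[OF assms(2)])
  obtain a where "a \<in> carrier R" "a \<noteq> \<zero>" "f a = -1" by (rule f.v_surj)
  then show ?case by (intro bexI[of _ a]) auto
next
  case (insert g G)
  interpret f: discrete_valuation R f by (rule discrete_valuationI[OF assms(2)])
  interpret g: discrete_valuation R g by (rule discrete_valuationI) (use insert in auto)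
  obtain a where a: "a \<in> carrier R" "a \<noteq> \<zero>" "f a < 0" "\<forall>g\<in>G. 0 < g a" using insert by auto
  obtain b where b: "b \<in> carrier R" "b \<noteq> \<zero>" "f b < 0" "0 < g b"
    using valuations_separate[of f g] insert by auto
  \<comment> \<open>Large enough for \<open>a [^] M\<close> to outweigh every pole of
    \<open>b\<close> on \<open>G\<close>.\<close>
  define M where "M = Suc (\<Sum>h\<in>G. nat \<bar>h b\<bar>)"
  have M: "0 < int M * h a + h b" if h: "h \<in> G" for h
  proof -
    have "nat \<bar>h b\<bar> \<le> (\<Sum>h\<in>G. nat \<bar>h b\<bar>)" using h insert(1) by (intro member_le_sum) auto
    then have "nat \<bar>h b\<bar> < M" by (simp only: M_def less_Suc_eq_le)
    then have "\<bar>h b\<bar> < int M" by linarith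
    moreover have "int M * 1 \<le> int M * h a" using a(4) h by (intro mult_left_mono) auto
    ultimately show ?thesis by linarith
  qed
  have aM: "a [^] M \<in> carrier R" "a [^] M \<noteq> \<zero>" using a nonzero_pow by auto
  have hval: "discrete_valuation R h" if "h \<in> G" for h
    by (rule discrete_valuationI) (use insert that in auto)
  have M0: "0 < int M" by (simp only: M_def of_nat_0_less_iff zero_less_Suc)
  have fM: "int M * f a < 0" by (rule mult_pos_neg[OF M0 a(3)])
  show ?case
  proof (cases "0 \<le> g a")
    case True
    let ?c = "a [^] M \<otimes> b"
    have c: "?c \<in> carrier R" "?c \<noteq> \<zero>" using aM b nonzero_mult by auto
    have val: "h ?c = int M * h a + h b" if "discrete_valuation R h" for h
      using discrete_valuation.v_mult[OF that aM b(1,2)] discrete_valuation.v_pow[OF that a(1,2)] by simp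
    have "f ?c < 0" using val[OF f.discrete_valuation_axioms] fM b by simp
    moreover have "0 < g ?c" using val[OF g.discrete_valuation_axioms] True b
      by (simp add: add_nonneg_pos)
    moreover have "0 < h ?c" if "h \<in> G" for h using val[OF hval[OF that]] M[OF that] by simp
    ultimately show ?thesis using c by blast
  next
    case False
    \<comment> \<open>If \<open>a\<close> has a pole at \<open>g\<close>, then
      \<open>a [^] M / (a [^] M + 1)\<close> is used: it has valuation 0 at \<open>f\<close> and
      \<open>g\<close>, where only \<open>b\<close> counts, and the zeros of \<open>a [^] M\<close>
      on \<open>G\<close>.\<close>
    let ?u = "a [^] M \<oplus> \<one>"
    have dom: "?u \<noteq> \<zero>" "h ?u = int M * h a" if "discrete_valuation R h" "h a < 0" for h
    proof -
      have "h (a [^] M) = int M * h a" using discrete_valuation.v_pow[OF that(1) a(1,2)] .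
      moreover have "int M * h a < 0" by (rule mult_pos_neg[OF M0 that(2)])
      ultimately have "discrete_valuation.vge R h (h (a [^] M) + 1) \<one>"
        using discrete_valuation.vge_def[OF that(1)] discrete_valuation.v_one[OF that(1)] by simp
      from discrete_valuation.v_add_dominant[OF that(1) aM one_closed this]
      show "?u \<noteq> \<zero>" "h ?u = int M * h a" using \<open>h (a [^] M) = int M * h a\<close> by auto
    qed
    have u: "?u \<in> carrier R" "?u \<noteq> \<zero>" using dom(1)[OF f.discrete_valuation_axioms a(3)] aM by auto
    note i = nonzero_inv[OF u]
    let ?c = "a [^] M \<otimes> (inv ?u \<otimes> b)"
    have iub: "inv ?u \<otimes> b \<in> carrier R" "inv ?u \<otimes> b \<noteq> \<zero>" using i b nonzero_mult by auto
    have c: "?c \<in> carrier R" "?c \<noteq> \<zero>" using aM iub nonzero_mult by auto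
    have val: "h ?c = int M * h a - h ?u + h b" if "discrete_valuation R h" for h
      using discrete_valuation.v_mult[OF that aM iub] discrete_valuation.v_mult[OF that i(1,2) b(1,2)]
        discrete_valuation.v_pow[OF that a(1,2)] discrete_valuation.v_inv[OF that u] by simp
    have "f ?c < 0" using val[OF f.discrete_valuation_axioms] dom(2)[OF f.discrete_valuation_axioms a(3)] b by simp
    moreover have "0 < g ?c" using val[OF g.discrete_valuation_axioms] dom(2)[OF g.discrete_valuation_axioms] False b by simp
    moreover have "0 < h ?c" if h: "h \<in> G" for h
    proof -
      have "0 < int M * h a" using M0 a(4) h by (intro mult_pos_pos) auto
      then have "discrete_valuation.vge R h (h \<one> + 1) (a [^] M)"
        using discrete_valuation.vge_def[OF hval[OF h]] discrete_valuation.v_one[OF hval[OF h]]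
          discrete_valuation.v_pow[OF hval[OF h] a(1,2), of M] by simp
      from discrete_valuation.v_add_dominant(2)[OF hval[OF h] one_closed one_not_zero aM(1) this]
      have "h ?u = 0" using discrete_valuation.v_one[OF hval[OF h]] aM by (simp add: a_comm)
      then show ?thesis using val[OF hval[OF h]] M[OF h] by simp
    qed
    ultimately show ?thesis using c by blast
  qed
qed

section \<open>Global function fields: constants, zeros and integral multiples\<close>

locale global_function_field = field +
  fixes k
  assumes k: "subfield k R" "finite k"
    and fd: "\<exists>t\<in>carrier R. finite_dimension (generate_field R (insert t k)) (carrier R)"
begin

lemma kc: "k \<subseteq> carrier R" using subfieldE(3)[OF k(1)] .

lemmas kops = subringE(2,3,5,6,7)[OF subfieldE(1)[OF k(1)]]

lemma dependence_bound:
  assumes "y \<in> carrier R" "transcendental k y"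
  obtains n where "\<And>Us. set Us \<subseteq> carrier R \<Longrightarrow> n < length Us \<Longrightarrow> dependent_over (simple_extension k y) Us"
proof -
  obtain t where t: "t \<in> carrier R" "finite_dimension (generate_field R (insert t k)) (carrier R)"
    using fd by blast
  show thesis
    using finite_dimension_imp_dependent[OF k(1) assms(1)
        finite_dimension_over_transcendental[OF k(1) t assms]] that by blast
qed

lemma pole_exists:
  assumes "x \<in> carrier R" "transcendental k x"
  shows "\<exists>v. normalized_valuation R v \<and> v x < 0"
  using fd transcendental_has_pole[OF k _ _ assms] by blast

text \<open>By finiteness two powers of \<open>c\<close> coincide, so some positive multiple of
  \<open>v c\<close> is 0.\<close>

lemma constant_valuation:
  assumes v: "normalized_valuation R v" and c: "c \<in> k" "c \<noteq> \<zero>"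
  shows "v c = 0"
proof -
  interpret v: discrete_valuation R v by (rule discrete_valuationI[OF v])
  have cc: "c \<in> carrier R" using c kc by blast
  have "c [^] (n::nat) \<in> k" for n by (induction n) (use kops c in auto)
  then have "\<not> inj (\<lambda>n::nat. c [^] n)"
    using k(2) finite_subset[of "range (\<lambda>n::nat. c [^] n)" k] infinite_UNIV_nat finite_imageD by blast
  then obtain i j :: nat where ij: "i < j" "c [^] i = c [^] j"
    unfolding inj_def by (metis linorder_neqE_nat)
  have "int i * v c = int j * v c" using v.v_pow[OF cc c(2)] ij(2) by metis
  then show ?thesis using ij by simp
qed

lemma algebraic_integral:
  assumes v: "normalized_valuation R v" and x: "x \<in> carrier R" "\<not> transcendental k x" "x \<noteq> \<zero>"
  shows "0 \<le> v x"
proof -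
  interpret v: discrete_valuation R v by (rule discrete_valuationI[OF v])
  obtain cs where cs: "set cs \<subseteq> k" "\<not> set cs \<subseteq> {\<zero>}" "horner cs x = \<zero>"
    by (rule algebraic_horner[OF k(1) x(1,2)])
  have csc: "set cs \<subseteq> carrier R" using cs kc by blast
  obtain Ls a where La: "set (Ls @ [a]) \<subseteq> set cs" "a \<noteq> \<zero>" "horner (Ls @ [a]) x = \<zero>"
    by (rule horner_leading[OF csc cs(2) x(1) cs(3)])
  have vk: "v.vge 0 c" if "c \<in> k" for c
    using constant_valuation[OF v that] by (cases "c = \<zero>") (simp_all add: v.vge_def)
  have "v.vge 0 (a \<otimes> x)"
    by (rule v.vge_leading_mult[OF _ _ La(2) x(1) La(3)]) (use La cs kc vk in blast)+
  moreover have "a \<in> k" "a \<in> carrier R" using La cs kc by auto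
  moreover have "a \<otimes> x \<noteq> \<zero>" using nonzero_mult x La \<open>a \<in> carrier R\<close> by simp
  ultimately show ?thesis
    using v.v_mult[of a x] constant_valuation[OF v, of a] La x by (simp add: v.vge_def)
qed

lemma algebraic_inv:
  assumes "x \<in> carrier R" "\<not> transcendental k x" "x \<noteq> \<zero>"
  shows "\<not> transcendental k (inv x)"
proof -
  have "x \<in> {x \<in> carrier R. (algebraic over k) x} - {\<zero>}" using assms by (simp add: over_def)
  then have "inv x \<in> {x \<in> carrier R. (algebraic over k) x}"
    using subfield_m_inv(1)[OF subfield_of_algebraics[OF k(1)]] by blast
  then show ?thesis by (simp add: over_def)
qed

lemma algebraic_valuation:
  assumes v: "normalized_valuation R v" and x: "x \<in> carrier R" "\<not> transcendental k x" "x \<noteq> \<zero>"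
  shows "v x = 0"
proof -
  interpret v: discrete_valuation R v by (rule discrete_valuationI[OF v])
  note i = nonzero_inv[OF x(1,3)]
  have "0 \<le> v (inv x)" by (rule algebraic_integral[OF v i(1) algebraic_inv[OF x] i(2)])
  then show ?thesis using algebraic_integral[OF v x] v.v_inv[OF x(1,3)] by simp
qed

text \<open>For finitely many zeros, weak approximation yields elements each of which is a unit at
  one zero and vanishes at the others. They are independent modulo \<open>y\<close> over the ring
  regular at these zeros, so the rank bound limits their number.\<close>

lemma finite_zeros:
  assumes y: "y \<in> carrier R" "transcendental k y"
  shows "finite {g. normalized_valuation R g \<and> 0 < g y}"
proof -
  have y0: "y \<noteq> \<zero>" by (rule transcendental_nonzero[OF k(1) y(2)])
  obtain N where N: "\<And>Us. set Us \<subseteq> carrier R \<Longrightarrow> N < length Us \<Longrightarrow> dependent_over (simple_extension k y) Us"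
    using dependence_bound[OF y] by blast
  have "card G \<le> N" if G: "finite G" "G \<subseteq> {g. normalized_valuation R g \<and> 0 < g y}" for G
  proof -
    have val: "normalized_valuation R g" "0 < g y" if "g \<in> G" for g using G that by auto
    have "\<exists>x. x \<in> carrier R \<and> x \<noteq> \<zero> \<and> g x = 0 \<and> (\<forall>h\<in>G - {g}. 0 < h x)" if g: "g \<in> G" for g
    proof -
      obtain a where a: "a \<in> carrier R" "a \<noteq> \<zero>" "g a < 0" "\<forall>h\<in>G - {g}. 0 < h a"
        using weak_approximation[of "G - {g}" g] G g by auto
      interpret g: discrete_valuation R g by (rule discrete_valuationI[OF val(1)[OF g]])
      have "g.vge (g a + 1) \<one>" using a(3) by (simp add: g.vge_def g.v_one)
      note d = g.v_add_dominant[OF a(1,2) one_closed this]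
      have u: "a \<oplus> \<one> \<in> carrier R" using a by simp
      note i = nonzero_inv[OF u d(1)]
      \<comment> \<open>\<open>a / (a + 1)\<close> is a unit at \<open>g\<close>, where
        \<open>a\<close> has a pole, and vanishes wherever \<open>a\<close> does.\<close>
      let ?x = "a \<otimes> inv (a \<oplus> \<one>)"
      have x: "?x \<in> carrier R" "?x \<noteq> \<zero>" using a i nonzero_mult by auto
      have "g ?x = 0" using g.v_mult[OF a(1,2) i(1,2)] g.v_inv[OF u d(1)] d(2) by simp
      moreover have "0 < h ?x" if h: "h \<in> G - {g}" for h
      proof -
        interpret h: discrete_valuation R h by (rule discrete_valuationI) (use val h in auto)
        have "0 < h a" using a(4) h by blast
        then have "h.vge (h \<one> + 1) a" by (simp add: h.vge_def h.v_one)
        then have "h (\<one> \<oplus> a) = h \<one>" by (rule h.v_add_dominant(2)[OF one_closed one_not_zero a(1)])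
        then have "h (a \<oplus> \<one>) = 0" using a by (simp add: h.v_one a_comm)
        then show ?thesis using h.v_mult[OF a(1,2) i(1,2)] h.v_inv[OF u d(1)] a(4) h by simp
      qed
      ultimately show ?thesis using x by blast
    qed
    then obtain x where x: "\<And>g. g \<in> G \<Longrightarrow> x g \<in> carrier R" "\<And>g. g \<in> G \<Longrightarrow> x g \<noteq> \<zero>" "\<And>g. g \<in> G \<Longrightarrow> g (x g) = 0"
      "\<And>g h. g \<in> G \<Longrightarrow> h \<in> G - {g} \<Longrightarrow> 0 < h (x g)" by metis
    obtain gs where gs: "set gs = G" "distinct gs" using finite_distinct_list[OF G(1)] by blast
    \<comment> \<open>The semilocal ring of functions regular at the chosen zeros.\<close>
    let ?A = "{x \<in> carrier R. \<forall>g\<in>G. x = \<zero> \<or> 0 \<le> g x}"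
    have A: "subring ?A R" by (rule subring_vge_all) (use val in auto)
    have kA: "k \<subseteq> ?A" using constant_valuation[OF val(1)] kc by fastforce
    have yA: "y \<in> ?A" using y val by force
    let ?Us = "map x gs"
    have "0 \<le> h (x g)" if "g \<in> G" "h \<in> G" for g h
      using x(3)[OF that(1)] x(4)[of g h] that by (cases "h = g") auto
    then have UsA: "set ?Us \<subseteq> ?A" using x(1) gs by auto
    have "indep_mod k ((\<otimes>) y ` ?A) ?Us"
      unfolding indep_mod_def
    proof (intro allI impI subsetI)
      fix cs c assume cs: "length cs = length ?Us" "set cs \<subseteq> k" "combine cs ?Us \<in> (\<otimes>) y ` ?A" "c \<in> set cs"
      obtain i where i: "i < length cs" "cs ! i = c" using cs(4) by (metis in_set_conv_nth)
      have il: "i < length gs" using i cs by simp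
      define g where "g = gs ! i"
      have g: "g \<in> G" using il gs by (auto simp: g_def)
      interpret g: discrete_valuation R g by (rule discrete_valuationI[OF val(1)[OF g]])
      let ?c1 = "take i cs" and ?c2 = "drop (Suc i) cs" and ?u1 = "map x (take i gs)" and ?u2 = "map x (drop (Suc i) gs)"
      have cs_eq: "cs = ?c1 @ c # ?c2" using id_take_nth_drop[OF i(1)] i(2) by simp
      have gs_eq: "gs = take i gs @ g # drop (Suc i) gs" using id_take_nth_drop[OF il] by (simp add: g_def)
      have dist: "g \<notin> set (take i gs)" "g \<notin> set (drop (Suc i) gs)"
        using gs(2) gs_eq by (metis distinct.simps(2) distinct_append disjoint_iff list.set_intros(1), metis distinct.simps(2) distinct_append)
      have sub: "set (take i gs) \<subseteq> G - {g}" "set (drop (Suc i) gs) \<subseteq> G - {g}"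
        using dist gs(1) set_take_subset[of i gs] set_drop_subset[of "Suc i" gs] by auto
      have csub: "set ?c1 \<subseteq> k" "set ?c2 \<subseteq> k" "c \<in> k" "set ?c1 \<subseteq> carrier R" "set ?c2 \<subseteq> carrier R" "c \<in> carrier R"
        using cs(2,4) set_take_subset[of i cs] set_drop_subset[of "Suc i" cs] kc by auto
      have usub: "set ?u1 \<subseteq> carrier R" "set ?u2 \<subseteq> carrier R" using sub x(1) by auto
      have k0: "g.vge 0 d" if "d \<in> k" for d
        using constant_valuation[OF val(1)[OF g] that] by (cases "d = \<zero>") (simp_all add: g.vge_def)
      have pos: "g.vge 1 (x h)" if "h \<in> G - {g}" for h
        using x(4)[of h g] that g by (auto simp: g.vge_def int_one_le_iff_zero_less)
      have v1: "g.vge 1 (combine ?c1 ?u1)" "g.vge 1 (combine ?c2 ?u2)"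
      proof -
        have "g.vge 1 w" if w: "w \<in> set ?u1 \<union> set ?u2" for w
        proof -
          obtain h where "h \<in> set (take i gs) \<union> set (drop (Suc i) gs)" "w = x h" using w by auto
          then show ?thesis using pos[of h] sub by blast
        qed
        then show "g.vge 1 (combine ?c1 ?u1)" "g.vge 1 (combine ?c2 ?u2)"
          using csub usub k0 by (intro g.vge_combine; blast)+
      qed
      have cl: "combine ?c1 ?u1 \<in> carrier R" "combine ?c2 ?u2 \<in> carrier R" using csub usub by auto
      have "combine cs ?Us = combine (?c1 @ c # ?c2) (?u1 @ x g # ?u2)"
        using cs_eq gs_eq by (metis list.simps(9) map_append)
      also have "\<dots> = combine ?c1 ?u1 \<oplus> combine (c # ?c2) (x g # ?u2)"
        by (rule combine_append[symmetric]) (use i il csub usub x(1)[OF g] in auto)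
      finally have comb: "combine cs ?Us = combine ?c1 ?u1 \<oplus> (c \<otimes> x g \<oplus> combine ?c2 ?u2)" by simp
      have xg: "x g \<in> carrier R" "x g \<noteq> \<zero>" "g (x g) = 0" using x g by auto
      obtain b where b: "b \<in> ?A" "combine cs ?Us = y \<otimes> b" using cs(3) by blast
      have v1': "g.vge 1 (combine cs ?Us)"
        unfolding b(2) using g.vge_mult[of 1 y 0 b] val(2)[OF g] b(1) g y by (auto simp: g.vge_def)
      \<comment> \<open>At the place \<open>g\<close> every other summand vanishes, as does the
        whole combination, being a multiple of \<open>y\<close>; a nonzero \<open>c\<close> would
        leave a unit.\<close>
      have "c = \<zero>"
      proof (rule ccontr)
        assume c0: "c \<noteq> \<zero>"
        have cx: "c \<otimes> x g \<in> carrier R" "c \<otimes> x g \<noteq> \<zero>" "g (c \<otimes> x g) = 0"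
          using csub xg c0 nonzero_mult g.v_mult constant_valuation[OF val(1)[OF g] csub(3) c0] by auto
        have "c \<otimes> x g = combine cs ?Us \<ominus> combine ?c1 ?u1 \<ominus> combine ?c2 ?u2"
          unfolding comb using cl cx(1) by algebra
        moreover have "g.vge 1 (combine cs ?Us \<ominus> combine ?c1 ?u1 \<ominus> combine ?c2 ?u2)"
          using v1 v1' cl cx(1) comb by (intro g.vge_diff) auto
        ultimately show False using cx by (simp add: g.vge_def)
      qed
      then show "c \<in> {\<zero>}" by simp
    qed
    then have "\<not> dependent_over (simple_extension k y) ?Us"
      by (rule indep_mod_imp_independent[OF k(1) A kA yA y0 UsA])
    then have "length ?Us \<le> N" using N[of ?Us] UsA by (metis (no_types, lifting) mem_Collect_eq not_le subsetI subsetD)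
    then show ?thesis using distinct_card[OF gs(2)] gs(1) by simp
  qed
  then show ?thesis by (metis (no_types, lifting) finite_if_finite_subsets_card_bdd)
qed

lemma transcendental_if_valuation_nonzero:
  assumes "normalized_valuation R v" "x \<in> carrier R" "x \<noteq> \<zero>" "v x \<noteq> 0"
  shows "transcendental k x"
  using algebraic_valuation[OF assms(1,2)] assms(3,4) by blast

lemma constants_subfield: "subfield {x \<in> carrier R. \<not> transcendental k x} R"
  using subfield_of_algebraics[OF k(1)] by (simp add: over_def)

text \<open>Nonzero constants have valuation 0, so no nonzero constant is divisible by an element
  \<open>y\<close> vanishing at \<open>f\<close>. Constants independent over \<open>k\<close> are
  therefore independent modulo \<open>y\<close>, which bounds their dimension.\<close>

lemma finite_constants:
  assumes f: "normalized_valuation R f"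
  shows "finite {x \<in> carrier R. \<not> transcendental k x}" (is "finite ?C")
proof -
  interpret f: discrete_valuation R f by (rule discrete_valuationI[OF f])
  obtain y where y: "y \<in> carrier R" "y \<noteq> \<zero>" "f y = 1" by (rule f.v_surj)
  have tr: "transcendental k y" by (rule transcendental_if_valuation_nonzero[OF f y(1,2)]) (simp add: y)
  obtain N where N: "\<And>Us. set Us \<subseteq> carrier R \<Longrightarrow> N < length Us \<Longrightarrow> dependent_over (simple_extension k y) Us"
    using dependence_bound[OF y(1) tr] by blast
  let ?A = "{x \<in> carrier R. \<forall>g\<in>{f}. x = \<zero> \<or> 0 \<le> g x}"
  have A: "subring ?A R" by (rule subring_vge_all) (use f in auto)
  have CA: "?C \<subseteq> ?A" using algebraic_integral[OF f] by auto
  have kC: "k \<subseteq> ?C" using algebraic_self[OF subfieldE(1)[OF k(1)]] kc by (auto simp: over_def)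
  have yA: "y \<in> ?A" using y by auto
  have comb: "combine cs Us \<in> ?C" if "set cs \<subseteq> k" "set Us \<subseteq> ?C" for cs Us
    using subring_combine[OF subfieldE(1)[OF constants_subfield]] that kC by blast
  have bound: "length Us \<le> N" if Us: "set Us \<subseteq> ?C" "indep_mod k {\<zero>} Us" for Us
  proof -
    have "indep_mod k ((\<otimes>) y ` ?A) Us"
      unfolding indep_mod_def
    proof (intro allI impI)
      fix cs assume cs: "length cs = length Us" "set cs \<subseteq> k" "combine cs Us \<in> (\<otimes>) y ` ?A"
      then obtain b where b: "b \<in> ?A" "combine cs Us = y \<otimes> b" by blast
      have C: "combine cs Us \<in> ?C" by (rule comb[OF cs(2) Us(1)])
      have "combine cs Us = \<zero>"
      proof (rule ccontr)
        assume nz: "combine cs Us \<noteq> \<zero>"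
        then have "b \<noteq> \<zero>" using b(2) y by auto
        then have "f (combine cs Us) \<ge> 1" unfolding b(2) using b(1) y f.v_mult by auto
        then show False using algebraic_valuation[OF f] C nz by auto
      qed
      then show "set cs \<subseteq> {\<zero>}" using Us(2)[unfolded indep_mod_def, rule_format, of cs] cs by simp
    qed
    then have "\<not> dependent_over (simple_extension k y) Us"
      using indep_mod_imp_independent[OF k(1) A order_trans[OF kC CA] yA y(2), of Us] Us(1) CA by blast
    moreover have "set Us \<subseteq> carrier R" using Us by blast
    ultimately show ?thesis using N[of Us] by (meson not_le)
  qed
  \<comment> \<open>Covering modulo the zero subspace means listing all constants.\<close>
  have "\<exists>T. T \<subseteq> ?C \<and> finite T \<and> (\<forall>a\<in>?C. \<exists>t\<in>T. a \<ominus> t \<in> {\<zero>})"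
    by (rule finite_cover_mod[OF k, of ?C "{\<zero>}" N]) (use comb bound kc in auto)
  then obtain T where T: "T \<subseteq> ?C" "finite T" "\<And>a. a \<in> ?C \<Longrightarrow> \<exists>t\<in>T. a \<ominus> t \<in> {\<zero>}" by blast
  have "?C \<subseteq> T"
  proof
    fix a assume a: "a \<in> ?C"
    then obtain t where t: "t \<in> T" "a \<ominus> t = \<zero>" using T(3) by blast
    then have "a = t" using a T(1) by (metis (no_types, lifting) mem_Collect_eq r_right_minus_eq subsetD)
    then show "a \<in> T" using t by simp
  qed
  then show ?thesis using T(2) finite_subset by blast
qed

text \<open>A polynomial in \<open>y\<close> with at most \<open>M\<close> coefficients, divided by
  \<open>y [^] M\<close>, is regular wherever \<open>y\<close> does not vanish, including the poles
  of \<open>y\<close>.\<close>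

lemma vge_power_mult_horner:
  assumes g: "normalized_valuation R g" and y: "y \<in> carrier R" "y \<noteq> \<zero>" "g y \<le> 0"
    and cs: "set cs \<subseteq> k" "length cs \<le> M"
  shows "discrete_valuation.vge R g 0 (inv y [^] M \<otimes> horner cs y)"
proof -
  interpret g: discrete_valuation R g by (rule discrete_valuationI[OF g])
  note i = nonzero_inv[OF y(1,2)]
  have zp: "g.vge 0 (inv y [^] (M::nat))" "inv y [^] M \<in> carrier R" for M
    using g.v_pow[OF i(1,2), of M] g.v_inv[OF y(1,2)] y(3) i(1)
    by (auto simp: g.vge_def mult_nonneg_nonpos)
  have k0: "g.vge 0 c" if "c \<in> k" for c
    using constant_valuation[OF g that] by (cases "c = \<zero>") (simp_all add: g.vge_def)
  show ?thesis using cs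
  proof (induction cs arbitrary: M)
    case Nil
    then show ?case using zp by simp
  next
    case (Cons c cs)
    then obtain L where L: "M = Suc L" by (cases M) auto
    have h: "horner cs y \<in> carrier R" "c \<in> carrier R" using Cons.prems horner_closed[of cs y] kc y by auto
    have "inv y [^] M \<otimes> horner (c # cs) y = inv y [^] L \<otimes> inv y \<otimes> (horner cs y \<otimes> y \<oplus> c)" by (simp add: L)
    also have "\<dots> = inv y [^] L \<otimes> horner cs y \<otimes> (inv y \<otimes> y) \<oplus> inv y [^] L \<otimes> inv y \<otimes> c"
      using h y(1) i(1) zp(2)[of L] by algebra
    also have "\<dots> = inv y [^] L \<otimes> horner cs y \<oplus> inv y [^] M \<otimes> c" using i h zp(2)[of L] by (simp add: L)
    finally have eq: "inv y [^] M \<otimes> horner (c # cs) y = inv y [^] L \<otimes> horner cs y \<oplus> inv y [^] M \<otimes> c" .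
    have "g.vge 0 (inv y [^] L \<otimes> horner cs y)" using Cons L by simp
    moreover have "g.vge 0 (inv y [^] M \<otimes> c)"
      using g.vge_mult0[OF zp(1) k0 zp(2)] Cons.prems h by simp
    ultimately show ?case unfolding eq by (intro g.vge_add) (use h zp in auto)
  qed
qed

text \<open>\<open>q\<close> is the leading coefficient of an equation for \<open>w\<close> over
  \<open>k[y]\<close>. Then \<open>q w\<close> has poles only at zeros and poles of
  \<open>y\<close>, and at the poles of \<open>y\<close> their order is bounded in terms of
  \<open>M\<close>.\<close>

lemma integral_multiple:
  assumes y: "y \<in> carrier R" "transcendental k y" and w: "w \<in> carrier R"
  shows "\<exists>q M. q \<in> simple_extension k y \<and> q \<noteq> \<zero> \<and>
    (\<forall>g. normalized_valuation R g \<longrightarrow> g y \<le> 0 \<longrightarrow> discrete_valuation.vge R g 0 (inv y [^] (M::nat) \<otimes> (q \<otimes> w)))"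
proof -
  let ?P = "simple_extension k y"
  note ops = simple_extension_ops[OF k(1) y(1)]
  have y0: "y \<noteq> \<zero>" by (rule transcendental_nonzero[OF k(1) y(2)])
  note i = nonzero_inv[OF y(1) y0]
  obtain N where N: "\<And>Us. set Us \<subseteq> carrier R \<Longrightarrow> N < length Us \<Longrightarrow> dependent_over ?P Us"
    using dependence_bound[OF y] by blast
  have "dependent_over ?P (map (\<lambda>j. w [^] j) [0..<Suc N])" by (rule N) (use w in auto)
  then obtain Ks where Ks: "length Ks = Suc N" "set Ks \<subseteq> ?P" "\<not> set Ks \<subseteq> {\<zero>}"
    "combine Ks (map (\<lambda>j. w [^] j) [0..<Suc N]) = \<zero>"
    unfolding dependent_over_def by auto
  have Kc: "set Ks \<subseteq> carrier R" using Ks ops by blast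
  have "horner Ks w = \<zero>" using combine_powers0[OF Kc w Ks(1)] Ks(4) by simp
  then obtain Ls a where La: "set (Ls @ [a]) \<subseteq> set Ks" "a \<noteq> \<zero>" "horner (Ls @ [a]) w = \<zero>"
    using horner_leading[OF Kc Ks(3) w] by blast
  have "\<exists>M. \<forall>x\<in>set Ks. \<exists>cs. set cs \<subseteq> k \<and> length cs \<le> M \<and> x = horner cs y"
    using Ks(2)
  proof (induction Ks)
    case (Cons x Ks)
    then obtain M where M: "\<forall>x\<in>set Ks. \<exists>cs. set cs \<subseteq> k \<and> length cs \<le> M \<and> x = horner cs y" by auto
    obtain cs where cs: "set cs \<subseteq> k" "x = horner cs y" using simple_extension_horner[of x k y] Cons by auto
    have "\<exists>cs. set cs \<subseteq> k \<and> length cs \<le> max M (length cs') \<and> x = horner cs y" if "x \<in> set Ks" for x cs'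
      using M that by (metis max.coboundedI1)
    then show ?case using cs by (intro exI[of _ "max M (length cs)"]) (auto intro: max.cobounded2)
  qed simp
  then obtain M where M: "\<And>x. x \<in> set Ks \<Longrightarrow> \<exists>cs. set cs \<subseteq> k \<and> length cs \<le> M \<and> x = horner cs y" by blast
  \<comment> \<open>Scaling the equation by \<open>y [^] (-M)\<close> makes all its coefficients
    integral where \<open>y\<close> does not vanish, so the leading coefficient argument applies at
    all these places at once.\<close>
  let ?Z = "inv y [^] M"
  have Z: "?Z \<in> carrier R" "?Z \<noteq> \<zero>" using i nonzero_pow by auto
  have Lac: "set (Ls @ [a]) \<subseteq> carrier R" using La Kc by blast
  have hz: "horner (map ((\<otimes>) ?Z) cs) w = ?Z \<otimes> horner cs w" if "set cs \<subseteq> carrier R" for cs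
    using that
  proof (induction cs)
    case (Cons c cs)
    have "horner cs w \<in> carrier R" "c \<in> carrier R" using Cons.prems horner_closed w by auto
    then have "?Z \<otimes> horner cs w \<otimes> w \<oplus> ?Z \<otimes> c = ?Z \<otimes> (horner cs w \<otimes> w \<oplus> c)" using Z(1) w by algebra
    then show ?case using Cons by simp
  qed (use Z in simp)
  have "discrete_valuation.vge R g 0 (?Z \<otimes> (a \<otimes> w))" if g: "normalized_valuation R g" "g y \<le> 0" for g
  proof -
    interpret g: discrete_valuation R g by (rule discrete_valuationI[OF g(1)])
    have in0: "g.vge 0 (?Z \<otimes> x)" if "x \<in> set Ks" for x
      using M[OF that] vge_power_mult_horner[OF g(1) y(1) y0 g(2)] by auto
    have "g.vge 0 ((?Z \<otimes> a) \<otimes> w)"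
    proof (rule g.vge_leading_mult[of "map ((\<otimes>) ?Z) Ls" "?Z \<otimes> a" w])
      show "set (map ((\<otimes>) ?Z) Ls @ [?Z \<otimes> a]) \<subseteq> carrier R" using Lac Z by auto
      show "g.vge 0 c" if "c \<in> set (map ((\<otimes>) ?Z) Ls @ [?Z \<otimes> a])" for c using that in0 La(1) by auto
      show "?Z \<otimes> a \<noteq> \<zero>" using nonzero_mult Z La Lac by simp
      show "horner (map ((\<otimes>) ?Z) Ls @ [?Z \<otimes> a]) w = \<zero>" using hz[OF Lac] La(3) Z by simp
    qed (rule w)
    moreover have "(?Z \<otimes> a) \<otimes> w = ?Z \<otimes> (a \<otimes> w)" using Z Lac w by (simp add: m_assoc)
    ultimately show ?thesis by simp
  qed
  moreover have "a \<in> ?P" using La Ks by auto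
  ultimately show ?thesis using La(2) by blast
qed

end

section \<open>Functions with poles at a single place\<close>

lemma (in field) combine_scaled:
  "set Ks \<subseteq> carrier R \<Longrightarrow> set ws \<subseteq> carrier R \<Longrightarrow> (\<And>w. w \<in> set ws \<Longrightarrow> q w \<in> carrier R) \<Longrightarrow>
    combine Ks (map (\<lambda>w. q w \<otimes> w) ws) = combine (map (\<lambda>(K, w). K \<otimes> q w) (zip Ks ws)) ws"
  by (induction Ks ws rule: combine.induct) (auto simp: m_assoc)

lemma (in field) combine_diff:
  "length Ks = length Us \<Longrightarrow> length Ls = length Us \<Longrightarrow> set Ks \<subseteq> carrier R \<Longrightarrow> set Ls \<subseteq> carrier R \<Longrightarrow>
    set Us \<subseteq> carrier R \<Longrightarrow>
    combine (map (\<lambda>(a, b). a \<ominus> b) (zip Ks Ls)) Us = combine Ks Us \<ominus> combine Ls Us"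
proof (induction Us arbitrary: Ks Ls)
  case Nil
  then show ?case by (simp add: minus_eq)
next
  case (Cons u Us)
  then obtain a Ks' b Ls' where e: "Ks = a # Ks'" "Ls = b # Ls'" by (metis length_Suc_conv list.size(4) Suc_eq_plus1)
  have c: "combine Ks' Us \<in> carrier R" "combine Ls' Us \<in> carrier R" "a \<in> carrier R" "b \<in> carrier R" "u \<in> carrier R"
    using Cons e by auto
  have "combine (map (\<lambda>(a, b). a \<ominus> b) (zip Ks' Ls')) Us = combine Ks' Us \<ominus> combine Ls' Us"
    using Cons e by auto
  moreover have "(a \<ominus> b) \<otimes> u \<oplus> (combine Ks' Us \<ominus> combine Ls' Us) = (a \<otimes> u \<oplus> combine Ks' Us) \<ominus> (b \<otimes> u \<oplus> combine Ls' Us)"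
    using c by algebra
  ultimately show ?case using e by simp
qed

lemma (in field) horner_inj:
  assumes k: "subfield k R" and y: "y \<in> carrier R" "transcendental k y"
  shows "length cs = length ds \<Longrightarrow> set cs \<subseteq> k \<Longrightarrow> set ds \<subseteq> k \<Longrightarrow> horner cs y = horner ds y \<Longrightarrow> cs = ds"
proof (induction cs arbitrary: ds)
  case (Cons c cs)
  then obtain d ds' where ds: "ds = d # ds'" by (cases ds) auto
  have kc: "k \<subseteq> carrier R" using subfieldE(3)[OF k] .
  note ops = simple_extension_ops[OF k y(1)]
  note P = horner_in_simple_extension[of cs k y] horner_in_simple_extension[of ds' k y]
  have h: "horner cs y \<in> carrier R" "horner ds' y \<in> carrier R" "c \<in> carrier R" "d \<in> carrier R"
    using Cons.prems ds kc horner_closed[of _ y] y by auto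
  have cd: "c \<ominus> d \<in> k" using Cons.prems ds subringE(5,7)[OF subfieldE(1)[OF k]] by (auto simp: minus_eq)
  have "(horner cs y \<ominus> horner ds' y) \<otimes> y \<oplus> (c \<ominus> d) = (horner cs y \<otimes> y \<oplus> c) \<ominus> (horner ds' y \<otimes> y \<oplus> d)"
    using h y(1) by algebra
  also have "\<dots> = \<zero>" using Cons.prems ds h y by (simp add: minus_eq r_neg)
  finally have eq: "(horner cs y \<ominus> horner ds' y) \<otimes> y \<oplus> (c \<ominus> d) = \<zero>" .
  have "horner cs y \<ominus> horner ds' y \<in> simple_extension k y"
    using P Cons.prems ds subringE(5,7)[OF ops(1)] by (auto simp: minus_eq)
  then have "c \<ominus> d = \<zero>" using transcendental_constant_term[OF k y _ cd eq] by simp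
  then have "c = d" using h by simp
  moreover have "(horner cs y \<ominus> horner ds' y) \<otimes> y = \<zero>" using eq \<open>c \<ominus> d = \<zero>\<close> h y by simp
  then have "horner cs y \<ominus> horner ds' y = \<zero>"
    using integral h y transcendental_nonzero[OF k y(2)] by blast
  then have "horner cs y = horner ds' y" using h by simp
  ultimately show ?case using Cons ds by auto
qed simp

context global_function_field
begin

text \<open>The ring of \<open>S\<close>-integers for \<open>S = {f}\<close> in a field all of whose
  places are finite.\<close>

definition regular_outside :: "('a \<Rightarrow> int) \<Rightarrow> 'a set" where
  "regular_outside f = {x \<in> carrier R. \<forall>g. normalized_valuation R g \<longrightarrow> g \<noteq> f \<longrightarrow> x = \<zero> \<or> 0 \<le> g x}"

lemma subring_regular_outside: "subring (regular_outside f) R"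
proof -
  have "regular_outside f = {x \<in> carrier R. \<forall>g\<in>{g. normalized_valuation R g \<and> g \<noteq> f}. x = \<zero> \<or> 0 \<le> g x}"
    by (auto simp: regular_outside_def)
  then show ?thesis using subring_vge_all[of "{g. normalized_valuation R g \<and> g \<noteq> f}"] by simp
qed

text \<open>If the valuation ring of \<open>f\<close> could be dropped from the zeros of \<open>y\<close> without decreasing the
  number of elements independent modulo \<open>y\<close>, the remaining semilocal ring would still be finite over
  \<open>k[y]\<close> localised at \<open>y\<close>, hence contained in the valuation ring of \<open>f\<close>.\<close>

lemma indep_mod_length_less:
  assumes f: "normalized_valuation R f" and y: "y \<in> carrier R" "y \<noteq> \<zero>" "0 < f y"
    and A: "subring A R" "k \<subseteq> A" "y \<in> A" and x: "x \<in> A" "x \<noteq> \<zero>" "f x < 0"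
    and bound: "\<And>Us. set Us \<subseteq> carrier R \<Longrightarrow> n < length Us \<Longrightarrow> dependent_over (simple_extension k y) Us"
    and Us: "set Us \<subseteq> A" "indep_mod k ((\<otimes>) y ` A) Us"
  shows "length Us < n"
proof (rule ccontr)
  assume "\<not> length Us < n"
  interpret f: discrete_valuation R f by (rule discrete_valuationI[OF f])
  let ?P = "simple_extension k y"
  note ops = simple_extension_ops[OF k(1) y(1)]
  have Ac: "A \<subseteq> carrier R" using subringE(1)[OF A(1)] .
  have PA: "?P \<subseteq> A" by (rule simple_extension_subring_incl[OF A])
  have Uc: "set Us \<subseteq> carrier R" using Us Ac by blast
  have xc: "x \<in> carrier R" using x Ac by blast
  \<comment> \<open>\<open>m\<close> bounds the poles of \<open>Us\<close> at \<open>f\<close>. The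
    power \<open>x [^] j\<close> has a worse pole, so it is no combination of \<open>Us\<close> with
    coefficients integral at \<open>f\<close>.\<close>
  obtain m where m: "\<forall>u\<in>set Us. f.vge m u" using f.vge_list_bound[OF Uc] by blast
  define j where "j = Suc (nat \<bar>m\<bar>)"
  have xj: "x [^] j \<in> A" "x [^] j \<in> carrier R" "x [^] j \<noteq> \<zero>"
  proof -
    show "x [^] j \<in> A" by (induction j) (use x subringE(3,6)[OF A(1)] in auto)
    then show "x [^] j \<in> carrier R" using Ac by blast
    show "x [^] j \<noteq> \<zero>" using nonzero_pow xc x by simp
  qed
  have "dependent_over ?P (x [^] j # Us)"
    by (rule bound) (use xj Uc \<open>\<not> length Us < n\<close> in auto)
  then obtain cs Ps where h: "length cs = Suc (length Us)" "set cs \<subseteq> k" "\<not> set cs \<subseteq> {\<zero>}"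
    "length Ps = Suc (length Us)" "set Ps \<subseteq> ?P"
    "combine cs (x [^] j # Us) \<oplus> y \<otimes> combine Ps (x [^] j # Us) = \<zero>"
    using dependent_over_simple_extension_normalize[OF k(1) y(1,2), of "x [^] j # Us"] xj Uc by auto
  obtain c cs' where c: "cs = c # cs'" "length cs' = length Us" using h(1) by (auto simp: length_Suc_conv)
  obtain p Ps' where p: "Ps = p # Ps'" using h(4) by (auto simp: length_Suc_conv)
  have ck: "c \<in> k" "set cs' \<subseteq> k" "p \<in> ?P" "set Ps' \<subseteq> ?P" using h c p by auto
  let ?C = "combine cs' Us" and ?Q = "combine Ps' Us" and ?X = "x [^] j"
  have QA: "?C \<in> A" "?Q \<in> A" using subring_combine[OF A(1)] ck A(2) PA Us by blast+
  have cc: "c \<in> carrier R" "p \<in> carrier R" "?C \<in> carrier R" "?Q \<in> carrier R"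
    using ck kc ops(4) QA Ac by auto
  have rel: "(c \<otimes> ?X \<oplus> ?C) \<oplus> y \<otimes> (p \<otimes> ?X \<oplus> ?Q) = \<zero>" using h(6) c p by simp
  \<comment> \<open>Were \<open>c\<close> zero, a nontrivial combination of \<open>Us\<close> over
    \<open>k\<close> would lie in \<open>y A\<close>.\<close>
  have c0: "c \<noteq> \<zero>"
  proof
    assume c0: "c = \<zero>"
    have "?C = y \<otimes> \<ominus> (p \<otimes> ?X \<oplus> ?Q) \<oplus> ((\<zero> \<otimes> ?X \<oplus> ?C) \<oplus> y \<otimes> (p \<otimes> ?X \<oplus> ?Q))"
      using cc xj(2) y(1) by algebra
    then have "?C = y \<otimes> \<ominus> (p \<otimes> ?X \<oplus> ?Q)" using rel c0 cc xj y by simp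
    moreover have "\<ominus> (p \<otimes> ?X \<oplus> ?Q) \<in> A"
      by (intro subringE(5)[OF A(1)] subringE(7)[OF A(1)] subringE(6)[OF A(1)] QA(2) xj(1))
         (use ck(3) PA in blast)
    ultimately have "?C \<in> (\<otimes>) y ` A" by blast
    then have "set cs' \<subseteq> {\<zero>}" using Us(2)[unfolded indep_mod_def, rule_format, of cs'] c(2) ck(2) by simp
    then show False using h(3) c c0 by simp
  qed
  have k0: "f.vge 0 d" if "d \<in> k" for d
    using constant_valuation[OF f that] by (cases "d = \<zero>") (simp_all add: f.vge_def)
  have P0: "f.vge 0 q" if "q \<in> ?P" for q
    using that
  proof (induction rule: simple_extension.induct)
    case (lin q1 q2)
    have "q1 \<in> carrier R" "q2 \<in> carrier R" using lin ops by auto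
    then show ?case using lin k0 y by (intro f.vge_add f.vge_mult0) (auto simp: f.vge_def)
  qed simp
  have y1: "f.vge 1 y" "f.vge 0 y" using y by (auto simp: f.vge_def)
  have yp: "f.vge 1 (y \<otimes> p)" using f.vge_mult[OF y1(1) P0[OF ck(3)] y(1) cc(2)] by simp
  have vc: "f c = 0" by (rule constant_valuation[OF f ck(1) c0])
  \<comment> \<open>\<open>c\<close> is a nonzero constant and \<open>y\<close> vanishes at
    \<open>f\<close>, so \<open>c + y p\<close> is a unit at \<open>f\<close> and the relation
    expresses \<open>x [^] j\<close> up to this unit.\<close>
  have u: "c \<oplus> y \<otimes> p \<in> carrier R" "c \<oplus> y \<otimes> p \<noteq> \<zero>" "f (c \<oplus> y \<otimes> p) = 0"
    using f.v_add_dominant[OF cc(1) c0, of "y \<otimes> p"] yp vc cc y by auto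
  have "(c \<oplus> y \<otimes> p) \<otimes> ?X = \<ominus> (?C \<oplus> y \<otimes> ?Q)"
  proof -
    have "(c \<oplus> y \<otimes> p) \<otimes> ?X = \<ominus> (?C \<oplus> y \<otimes> ?Q) \<oplus> ((c \<otimes> ?X \<oplus> ?C) \<oplus> y \<otimes> (p \<otimes> ?X \<oplus> ?Q))"
      using cc xj(2) y(1) by algebra
    then show ?thesis using rel cc y by simp
  qed
  moreover have "f.vge m (\<ominus> (?C \<oplus> y \<otimes> ?Q))"
  proof -
    have 1: "f.vge m ?C" by (rule f.vge_combine) (use ck(2) kc Uc k0 m in blast)+
    have 2: "f.vge m ?Q" by (rule f.vge_combine) (use ck(4) ops(4) Uc P0 m in blast)+
    show ?thesis using 1 2 f.vge_mult0[OF y1(2) 2 y(1) cc(4)] cc y by (intro f.vge_uminus f.vge_add) auto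
  qed
  ultimately have "f.vge m ((c \<oplus> y \<otimes> p) \<otimes> ?X)" by simp
  moreover have "(c \<oplus> y \<otimes> p) \<otimes> ?X \<noteq> \<zero>" using nonzero_mult u xj by blast
  ultimately have "m \<le> int j * f x" using f.v_mult[OF u(1,2) xj(2,3)] u(3) f.v_pow[OF xc x(2)] by (simp add: f.vge_def)
  moreover have "int j * f x \<le> int j * (- 1)" using x(3) by (intro mult_left_mono) auto
  ultimately show False by (simp add: j_def)
qed

text \<open>The representatives modulo \<open>y [^] m\<close> are the \<open>y\<close>-adic
  expansions of length \<open>m\<close> with digits in \<open>T\<close>.\<close>

lemma power_cover:
  assumes A: "subring A R" and y: "y \<in> A" and T: "T \<subseteq> A" "finite T" "\<And>a. a \<in> A \<Longrightarrow> \<exists>t\<in>T. a \<ominus> t \<in> (\<otimes>) y ` A"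
  shows "\<exists>S. S \<subseteq> A \<and> finite S \<and> card S \<le> card T ^ m \<and> (\<forall>a\<in>A. \<exists>t\<in>S. a \<ominus> t \<in> (\<otimes>) (y [^] (m::nat)) ` A)"
proof (induction m)
  have Ac: "a \<in> carrier R" if "a \<in> A" for a using that subringE(1)[OF A] by blast
  note ops = subringE(2,3,5,6,7)[OF A]
  have yc: "y \<in> carrier R" using y Ac by blast
  have yp: "y [^] (m::nat) \<in> A" for m by (induction m) (use y ops in auto)
  {
    case 0
    have "a \<ominus> \<zero> \<in> (\<otimes>) (y [^] (0::nat)) ` A" if "a \<in> A" for a
      using that Ac by (intro image_eqI[of _ _ a]) (auto simp: minus_eq)
    then show ?case using ops by (intro exI[of _ "{\<zero>}"]) auto
  next
    case (Suc m)
    then obtain S where S: "S \<subseteq> A" "finite S" "card S \<le> card T ^ m" "\<And>a. a \<in> A \<Longrightarrow> \<exists>t\<in>S. a \<ominus> t \<in> (\<otimes>) (y [^] m) ` A"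
      by blast
    let ?S = "(\<lambda>(s, t). s \<oplus> y [^] m \<otimes> t) ` (S \<times> T)"
    have "s \<oplus> y [^] m \<otimes> t \<in> A" if "s \<in> S" "t \<in> T" for s t
      using that S(1) T(1) yp[of m] by (intro ops(5) ops(4)) auto
    then have "?S \<subseteq> A" by auto
    moreover have "finite ?S" using S T by auto
    moreover have "card ?S \<le> card T ^ Suc m"
    proof -
      have "card ?S \<le> card (S \<times> T)" by (rule card_image_le) (use S T in auto)
      also have "\<dots> = card S * card T" by (simp add: card_cartesian_product)
      also have "\<dots> \<le> card T ^ m * card T" using S by (intro mult_right_mono) auto
      finally show ?thesis by (simp add: mult.commute)
    qed
    moreover have "\<exists>t\<in>?S. a \<ominus> t \<in> (\<otimes>) (y [^] Suc m) ` A" if a: "a \<in> A" for a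
    proof -
      obtain s b where s: "s \<in> S" "b \<in> A" "a \<ominus> s = y [^] m \<otimes> b" using S(4)[OF a] by blast
      obtain t c where t: "t \<in> T" "c \<in> A" "b \<ominus> t = y \<otimes> c" using T(3)[OF s(2)] by blast
      have cs: "a \<in> carrier R" "s \<in> carrier R" "b \<in> carrier R" "t \<in> carrier R" "c \<in> carrier R" "y [^] m \<in> carrier R"
        using a s t S T Ac yp by auto
      have "a \<ominus> (s \<oplus> y [^] m \<otimes> t) = (a \<ominus> s) \<ominus> y [^] m \<otimes> t" using cs by algebra
      also have "\<dots> = y [^] m \<otimes> (b \<ominus> t)" unfolding s(3) using cs by algebra
      also have "\<dots> = y [^] Suc m \<otimes> c" unfolding t(3) using cs yc by (simp add: m_assoc)
      finally have "a \<ominus> (s \<oplus> y [^] m \<otimes> t) \<in> (\<otimes>) (y [^] Suc m) ` A" using t by blast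
      then show ?thesis using s(1) t(1)
        by (intro bexI[of _ "s \<oplus> y [^] m \<otimes> t"] image_eqI[of _ _ "(s, t)"]) auto
    qed
    ultimately show ?case by blast
  }
qed

text \<open>A count in place of Riemann-Roch. If the ring had only constants, it would be finite.
  But the \<open>n\<close>-tuples of polynomials of length \<open>m\<close> number
  \<open>card k ^ (m n)\<close>, while vanishing to order about \<open>m\<close> at the zeros of
  \<open>y\<close> other than \<open>f\<close> imposes only about \<open>m (n - 1)\<close>
  conditions over \<open>k\<close>. So for large \<open>m\<close> too many tuples agree there, and
  their differences, divided by a power of \<open>y\<close>, have poles only at
  \<open>f\<close>.\<close>

theorem exists_transcendental_regular_outside:
  assumes f: "normalized_valuation R f"
  shows "\<exists>s\<in>regular_outside f. transcendental k s"
proof (rule ccontr)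
  assume not: "\<not> ?thesis"
  let ?O = "regular_outside f"
  have "?O \<subseteq> {x \<in> carrier R. \<not> transcendental k x}" using not by (auto simp: regular_outside_def)
  then have finO: "finite ?O" using finite_constants[OF f] finite_subset by blast
  note Oops = subringE[OF subring_regular_outside[of f]]
  interpret f: discrete_valuation R f by (rule discrete_valuationI[OF f])
  obtain y where y: "y \<in> carrier R" "y \<noteq> \<zero>" "f y = 1" by (rule f.v_surj)
  have tr: "transcendental k y" by (rule transcendental_if_valuation_nonzero[OF f y(1,2)]) (simp add: y)
  let ?P = "simple_extension k y"
  note ops = simple_extension_ops[OF k(1) y(1)]
  note Pops = subringE(2,3,5,6,7)[OF ops(1)]
  note i = nonzero_inv[OF y(1,2)]
  obtain N where N: "\<And>Us. set Us \<subseteq> carrier R \<Longrightarrow> N < length Us \<Longrightarrow> dependent_over ?P Us"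
    using dependence_bound[OF y(1) tr] by blast
  \<comment> \<open>\<open>n\<close> below is the rank of \<open>K\<close> over \<open>k[y]\<close>.
    It is positive, so that \<open>l = n - 1\<close> makes sense.\<close>
  let ?rk = "\<lambda>n. \<exists>Us. set Us \<subseteq> carrier R \<and> \<not> dependent_over ?P Us \<and> length Us = n"
  have rk1: "?rk 1"
  proof (intro exI[of _ "[\<one>]"] conjI)
    show "\<not> dependent_over ?P [\<one>]"
    proof
      assume "dependent_over ?P [\<one>]"
      then obtain Ks where Ks: "length Ks = length [\<one>]" "set Ks \<subseteq> ?P" "\<not> set Ks \<subseteq> {\<zero>}" "combine Ks [\<one>] = \<zero>"
        unfolding dependent_over_def by blast
      then obtain c where c: "Ks = [c]" by (auto simp: length_Suc_conv)
      then have "c \<in> carrier R" using Ks ops by auto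
      then show False using Ks c by simp
    qed
  qed auto
  have "\<forall>n. ?rk n \<longrightarrow> n \<le> N" using N by (meson not_le)
  then obtain n where n: "?rk n" "\<And>m. ?rk m \<Longrightarrow> m \<le> n"
    using Nat.ex_has_greatest_nat[of ?rk 1 N] rk1 by blast
  then obtain l where l: "n = Suc l" using rk1 by (cases n) force+
  have bound: "dependent_over ?P Us" if "set Us \<subseteq> carrier R" "n < length Us" for Us
    using n(2)[of "length Us"] that by (metis not_le)
  obtain ws where ws: "set ws \<subseteq> carrier R" "\<not> dependent_over ?P ws" "length ws = n" using n(1) by blast
  let ?vge = "\<lambda>g. discrete_valuation.vge R g 0"
  have "\<forall>w. \<exists>q M. w \<in> carrier R \<longrightarrow> q \<in> ?P \<and> q \<noteq> \<zero> \<and>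
    (\<forall>g. normalized_valuation R g \<longrightarrow> g y \<le> 0 \<longrightarrow> ?vge g (inv y [^] (M::nat) \<otimes> (q \<otimes> w)))"
    using integral_multiple[OF y(1) tr] by blast
  then obtain q M where qM: "\<And>w. w \<in> carrier R \<Longrightarrow> q w \<in> ?P" "\<And>w. w \<in> carrier R \<Longrightarrow> q w \<noteq> \<zero>"
    "\<And>w g. w \<in> carrier R \<Longrightarrow> normalized_valuation R g \<Longrightarrow> g y \<le> 0 \<Longrightarrow> ?vge g (inv y [^] (M w :: nat) \<otimes> (q w \<otimes> w))"
    by metis
  \<comment> \<open>Scaling the independent list by elements of \<open>k[y]\<close> keeps it
    independent and, up to a power of \<open>y\<close>, makes it regular wherever \<open>y\<close>
    does not vanish.\<close>
  define ws' where "ws' = map (\<lambda>w. q w \<otimes> w) ws"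
  have lenw: "length ws' = n" using ws by (simp add: ws'_def)
  have qc: "q w \<in> carrier R" if "w \<in> carrier R" for w using qM(1)[OF that] ops(4) by blast
  have wc': "set ws' \<subseteq> carrier R" using ws(1) qc by (auto simp: ws'_def)
  have ind': "\<not> dependent_over ?P ws'"
  proof
    assume "dependent_over ?P ws'"
    then obtain Ks where Ks: "length Ks = length ws'" "set Ks \<subseteq> ?P" "\<not> set Ks \<subseteq> {\<zero>}" "combine Ks ws' = \<zero>"
      unfolding dependent_over_def by blast
    let ?Ls = "map (\<lambda>(K, w). K \<otimes> q w) (zip Ks ws)"
    have Kc: "set Ks \<subseteq> carrier R" using Ks ops by blast
    have qw: "q w \<in> carrier R" if "w \<in> set ws" for w using qc ws(1) that by blast
    have "combine ?Ls ws = \<zero>" using combine_scaled[OF Kc ws(1) qw] Ks(4) by (simp add: ws'_def)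
    moreover have "length ?Ls = length ws" using Ks by (simp add: ws'_def)
    moreover have "set ?Ls \<subseteq> ?P"
    proof
      fix x assume "x \<in> set ?Ls"
      then obtain K w where "K \<in> set Ks" "w \<in> set ws" "x = K \<otimes> q w" by (auto dest: set_zip_leftD set_zip_rightD)
      then show "x \<in> ?P" using Ks(2) qM(1)[of w] ws(1) Pops by blast
    qed
    moreover have "\<not> set ?Ls \<subseteq> {\<zero>}"
    proof -
      obtain K where K: "K \<in> set Ks" "K \<noteq> \<zero>" using Ks(3) by blast
      then obtain j where j: "j < length Ks" "Ks ! j = K" by (metis in_set_conv_nth)
      have jw: "j < length ws" using j Ks by (simp add: ws'_def)
      have "?Ls ! j = K \<otimes> q (ws ! j)" using j jw by simp
      moreover have "?Ls ! j \<in> set ?Ls" using j jw by (intro nth_mem) simp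
      moreover have "ws ! j \<in> carrier R" using ws(1) jw nth_mem by blast
      moreover have "K \<in> carrier R" using K Kc by blast
      ultimately show ?thesis using nonzero_mult K qM(2) qc by (metis singletonD subsetD)
    qed
    ultimately have "dependent_over ?P ws" unfolding dependent_over_def by blast
    then show False using ws(2) by simp
  qed
  define M0 where "M0 = sum_list (map M ws)"
  have int': "?vge g (inv y [^] M0 \<otimes> w')" if g: "normalized_valuation R g" "g y \<le> 0" and w': "w' \<in> set ws'" for g w'
  proof -
    interpret g: discrete_valuation R g by (rule discrete_valuationI[OF g(1)])
    obtain w where w: "w \<in> set ws" "w' = q w \<otimes> w" using w' by (auto simp: ws'_def)
    have wc: "w \<in> carrier R" using w ws by blast
    have "M w \<le> M0" unfolding M0_def using w by (intro member_le_sum_list) auto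
    then have "inv y [^] M0 = inv y [^] (M0 - M w) \<otimes> inv y [^] M w" using i by (simp add: nat_pow_mult)
    then have "inv y [^] M0 \<otimes> w' = inv y [^] (M0 - M w) \<otimes> (inv y [^] M w \<otimes> (q w \<otimes> w))"
      using w i qc wc by (simp add: m_assoc)
    moreover have "g.vge 0 (inv y [^] (M0 - M w))"
      using g.v_pow[OF i(1,2)] g.v_inv[OF y(1,2)] g(2) by (simp add: g.vge_def mult_nonneg_nonpos)
    ultimately show ?thesis
      using g.vge_mult0[OF _ qM(3)[OF wc g]] i qc wc by simp
  qed
  \<comment> \<open>Leaving \<open>f\<close> out of the zeros of \<open>y\<close> brings the
    dimension of \<open>A / y A\<close> down to at most \<open>l\<close>, one less than the rank.
    The count lives on this gap.\<close>
  define G where "G = {g. normalized_valuation R g \<and> 0 < g y} - {f}"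
  have G: "finite G" "\<And>g. g \<in> G \<Longrightarrow> normalized_valuation R g" "f \<notin> G" "\<And>g. g \<in> G \<Longrightarrow> 0 < g y"
    using finite_zeros[OF y(1) tr] by (auto simp: G_def)
  define A where "A = {x \<in> carrier R. \<forall>g\<in>G. x = \<zero> \<or> 0 \<le> g x}"
  have A: "subring A R" unfolding A_def by (rule subring_vge_all) (use G in auto)
  have kA: "k \<subseteq> A" using constant_valuation[OF G(2)] kc by (fastforce simp: A_def)
  have yA: "y \<in> A" using y G(4) by (force simp: A_def)
  have Ac: "A \<subseteq> carrier R" by (auto simp: A_def)
  note Aops = subringE(2,3,5,6,7)[OF A]
  have PA: "?P \<subseteq> A" by (rule simple_extension_subring_incl[OF A kA yA])
  obtain x where x: "x \<in> carrier R" "x \<noteq> \<zero>" "f x < 0" "\<forall>g\<in>G. 0 < g x"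
    using weak_approximation[OF G(1) f G(2,3)] by blast
  have xA: "x \<in> A" using x by (auto simp: A_def)
  have lenA: "length Us \<le> l" if "set Us \<subseteq> A" "indep_mod k ((\<otimes>) y ` A) Us" for Us
  proof -
    have "length Us < n"
      by (rule indep_mod_length_less[OF f y(1,2) _ A kA yA xA x(2,3) bound that]) (simp_all add: y(3))
    then show ?thesis by (simp add: l)
  qed
  have "\<exists>T. T \<subseteq> A \<and> finite T \<and> card T \<le> card k ^ l \<and> (\<forall>a\<in>A. \<exists>t\<in>T. a \<ominus> t \<in> (\<otimes>) y ` A)"
  proof (rule finite_cover_mod[OF k Ac, of "(\<otimes>) y ` A" l])
    show "combine cs Us \<in> A" if "set cs \<subseteq> k" "set Us \<subseteq> A" for cs Us
      using subring_combine[OF A] that kA by blast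
    show "c \<otimes> w \<in> (\<otimes>) y ` A" if cw: "c \<in> k" "w \<in> (\<otimes>) y ` A" for c w
    proof -
      obtain a where a: "a \<in> A" "w = y \<otimes> a" using cw by blast
      have ca: "c \<in> A" "c \<in> carrier R" "a \<in> carrier R" using cw kA Ac a by auto
      have "c \<otimes> w = y \<otimes> (c \<otimes> a)" using a ca y by (simp add: m_ac)
      then show ?thesis using Aops a ca by blast
    qed
    show "length Us \<le> l" if "set Us \<subseteq> A" "indep_mod k ((\<otimes>) y ` A) Us" for Us by (rule lenA[OF that])
    fix T assume "T \<subseteq> A" "finite T" "card T \<le> card k ^ l" "\<And>a. a \<in> A \<Longrightarrow> \<exists>t\<in>T. a \<ominus> t \<in> (\<otimes>) y ` A"
    then show ?thesis by blast
  qed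
  then obtain T where T: "T \<subseteq> A" "finite T" "card T \<le> card k ^ l" "\<And>a. a \<in> A \<Longrightarrow> \<exists>t\<in>T. a \<ominus> t \<in> (\<otimes>) y ` A"
    by blast
  \<comment> \<open>\<open>y [^] c\<close> clears the poles of \<open>ws'\<close> on
    \<open>G\<close>, since \<open>y\<close> vanishes there.\<close>
  define c where "c = (\<Sum>g\<in>G. \<Sum>w\<in>set ws'. nat \<bar>g w\<bar>)"
  have wA: "y [^] c \<otimes> w \<in> A" if w: "w \<in> set ws'" for w
  proof -
    have wcar: "w \<in> carrier R" using w wc' by blast
    have "0 \<le> g (y [^] c \<otimes> w)" if g: "g \<in> G" "w \<noteq> \<zero>" for g
    proof -
      interpret g: discrete_valuation R g by (rule discrete_valuationI[OF G(2)[OF g(1)]])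
      have "nat \<bar>g w\<bar> \<le> (\<Sum>w\<in>set ws'. nat \<bar>g w\<bar>)" using w by (intro member_le_sum) auto
      also have "\<dots> \<le> c" unfolding c_def using g G(1) by (intro member_le_sum[of g G "\<lambda>g. \<Sum>w\<in>set ws'. nat \<bar>g w\<bar>"]) auto
      finally have "\<bar>g w\<bar> \<le> int c" by linarith
      moreover have "int c * 1 \<le> int c * g y" using G(4)[OF g(1)] by (intro mult_left_mono) auto
      moreover have "g (y [^] c \<otimes> w) = int c * g y + g w"
        using g.v_mult[of "y [^] c" w] g.v_pow[OF y(1,2)] nonzero_pow[OF y(1,2)] y wcar g by simp
      ultimately show ?thesis by linarith
    qed
    then show ?thesis using wcar y by (cases "w = \<zero>") (auto simp: A_def)
  qed
  \<comment> \<open>Chosen so that \<open>m * n = l * (m + C) + card ?O\<close>; the count then ends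
    in \<open>card ?O < card k ^ card ?O\<close>.\<close>
  define m where "m = l * (M0 + c) + card ?O"
  define C where "C = M0 + c"
  obtain S where S: "S \<subseteq> A" "finite S" "card S \<le> card T ^ (m + C)"
    "\<And>a. a \<in> A \<Longrightarrow> \<exists>t\<in>S. a \<ominus> t \<in> (\<otimes>) (y [^] (m + C)) ` A"
    using power_cover[OF A yA T(1,2,4), of "m + C"] by blast
  \<comment> \<open>\<open>E\<close> indexes the combinations of \<open>ws'\<close> whose
    coefficients are polynomials in \<open>y\<close> of length \<open>m\<close>.\<close>
  define E0 where "E0 = {cs. set cs \<subseteq> k \<and> length cs = m}"
  define E where "E = {L. set L \<subseteq> E0 \<and> length L = n}"
  have E0: "finite E0" "card E0 = card k ^ m" unfolding E0_def
    using finite_lists_length_eq[OF k(2)] card_lists_length_eq[OF k(2)] by auto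
  have E: "finite E" "card E = (card k ^ m) ^ n" unfolding E_def
    using finite_lists_length_eq[OF E0(1)] card_lists_length_eq[OF E0(1)] E0(2) by auto
  define h where "h L = map (\<lambda>cs. horner cs y) L" for L
  have hP: "set (h L) \<subseteq> ?P" "length (h L) = n" if "L \<in> E" for L
    using that horner_in_simple_extension[of _ k y] by (auto simp: E_def E0_def h_def)
  have hc: "set (h L) \<subseteq> carrier R" if "L \<in> E" for L using hP[OF that] ops by blast
  define B where "B L = combine (h L) ws'" for L
  have Bc: "B L \<in> carrier R" if "L \<in> E" for L unfolding B_def using hc[OF that] wc' by simp
  have Binj: "L = L'" if L: "L \<in> E" "L' \<in> E" "B L = B L'" for L L'
  proof -
    let ?D = "map (\<lambda>(a, b). a \<ominus> b) (zip (h L) (h L'))"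
    have "combine ?D ws' = B L \<ominus> B L'"
      unfolding B_def by (rule combine_diff) (use hP L hc lenw wc' in auto)
    then have "combine ?D ws' = \<zero>" using L Bc by (simp add: minus_eq r_neg)
    moreover have lenD: "length ?D = length ws'" using hP L lenw by simp
    moreover have "set ?D \<subseteq> ?P"
    proof
      fix d assume "d \<in> set ?D"
      then obtain a b where ab: "a \<in> set (h L)" "b \<in> set (h L')" "d = a \<ominus> b"
        by (auto dest: set_zip_leftD set_zip_rightD)
      have "a \<in> ?P" "b \<in> ?P" using ab hP(1)[OF L(1)] hP(1)[OF L(2)] by auto
      then show "d \<in> ?P" unfolding ab(3) minus_eq by (intro Pops(5) Pops(3))
    qed
    ultimately have D0: "set ?D \<subseteq> {\<zero>}" using ind' unfolding dependent_over_def by blast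
    show "L = L'"
    proof (rule nth_equalityI)
      show len: "length L = length L'" using L by (simp add: E_def)
      fix j assume j: "j < length L"
      have jD: "j < length (h L)" "j < length (h L')" using j len by (auto simp: h_def)
      have "?D ! j \<in> set ?D" using jD by (intro nth_mem) simp
      then have "h L ! j \<ominus> h L' ! j = \<zero>" using D0 jD by auto
      then have "h L ! j = h L' ! j" using hc[OF L(1)] hc[OF L(2)] jD nth_mem by (metis r_right_minus_eq subsetD)
      then have "horner (L ! j) y = horner (L' ! j) y" using j len by (simp add: h_def)
      moreover have "L ! j \<in> E0" "L' ! j \<in> E0" using L(1,2) j len nth_mem[of j L] nth_mem[of j L'] by (auto simp: E_def)
      ultimately show "L ! j = L' ! j"
        using horner_inj[OF k(1) y(1) tr, of "L ! j" "L' ! j"] by (simp add: E0_def)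
    qed
  qed
  have BA: "y [^] c \<otimes> B L \<in> A" if L: "L \<in> E" for L
  proof -
    have yc: "y [^] c \<in> carrier R" using y by simp
    have "y [^] c \<otimes> B L = B L \<otimes> y [^] c" using Bc[OF L] yc by (simp add: m_comm)
    also have "\<dots> = combine (h L) (map (\<lambda>u. u \<otimes> y [^] c) ws')"
      unfolding B_def using combine_l_distr[OF hc[OF L] wc' yc] .
    finally have "y [^] c \<otimes> B L = combine (h L) (map (\<lambda>u. u \<otimes> y [^] c) ws')" .
    moreover have "set (map (\<lambda>u. u \<otimes> y [^] c) ws') \<subseteq> A"
    proof
      fix a assume "a \<in> set (map (\<lambda>u. u \<otimes> y [^] c) ws')"
      then obtain u where u: "u \<in> set ws'" "a = u \<otimes> y [^] c" by auto
      then have "a = y [^] c \<otimes> u" using wc' yc by (auto simp: m_comm)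
      then show "a \<in> A" using wA u by simp
    qed
    ultimately show ?thesis using subring_combine[OF A] hP(1)[OF L] PA by (metis order_trans)
  qed
  \<comment> \<open>Multiplication by \<open>Z\<close> makes every \<open>B L\<close> regular where
    \<open>y\<close> does not vanish; the zeros of \<open>y\<close> in \<open>G\<close> are dealt
    with by congruences.\<close>
  define Z where "Z = inv y [^] (m + M0)"
  have Zc: "Z \<in> carrier R" "Z \<noteq> \<zero>" using i nonzero_pow by (auto simp: Z_def)
  have Zint: "?vge g (Z \<otimes> B L)" if g: "normalized_valuation R g" "g y \<le> 0" and L: "L \<in> E" for g L
  proof -
    interpret g: discrete_valuation R g by (rule discrete_valuationI[OF g(1)])
    have comb: "g.vge 0 (inv y [^] (m + M0) \<otimes> combine Ks Us)"
      if "set Ks \<subseteq> carrier R" "set Us \<subseteq> carrier R" "\<And>K. K \<in> set Ks \<Longrightarrow> g.vge 0 (inv y [^] m \<otimes> K)"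
        "\<And>u. u \<in> set Us \<Longrightarrow> g.vge 0 (inv y [^] M0 \<otimes> u)" for Ks Us
      using that
    proof (induction Ks Us rule: combine.induct)
      case (1 K Ks u Us)
      have cs: "K \<in> carrier R" "u \<in> carrier R" "combine Ks Us \<in> carrier R"
        "inv y [^] m \<in> carrier R" "inv y [^] M0 \<in> carrier R"
        using 1 i by auto
      have "inv y [^] (m + M0) = inv y [^] m \<otimes> inv y [^] M0" using i by (simp add: nat_pow_mult)
      then have "inv y [^] (m + M0) \<otimes> combine (K # Ks) (u # Us)
         = inv y [^] m \<otimes> inv y [^] M0 \<otimes> (K \<otimes> u \<oplus> combine Ks Us)" by simp
      also have "\<dots> = (inv y [^] m \<otimes> K) \<otimes> (inv y [^] M0 \<otimes> u) \<oplus> (inv y [^] m \<otimes> inv y [^] M0) \<otimes> combine Ks Us"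
        using cs by algebra
      also have "(inv y [^] m \<otimes> inv y [^] M0) = inv y [^] (m + M0)" using i by (simp add: nat_pow_mult)
      finally have eq: "inv y [^] (m + M0) \<otimes> combine (K # Ks) (u # Us) =
        (inv y [^] m \<otimes> K) \<otimes> (inv y [^] M0 \<otimes> u) \<oplus> inv y [^] (m + M0) \<otimes> combine Ks Us" .
      have "g.vge 0 ((inv y [^] m \<otimes> K) \<otimes> (inv y [^] M0 \<otimes> u))"
        by (rule g.vge_mult0) (use 1 cs in auto)
      moreover have "g.vge 0 (inv y [^] (m + M0) \<otimes> combine Ks Us)" using 1 by auto
      ultimately show ?case unfolding eq using cs i by (intro g.vge_add) auto
    qed (use i in auto)
    have hK: "g.vge 0 (inv y [^] m \<otimes> K)" if K: "K \<in> set (h L)" for K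
    proof -
      obtain cs where cs: "cs \<in> set L" "K = horner cs y" using K by (auto simp: h_def)
      then have "set cs \<subseteq> k" "length cs \<le> m" using L by (auto simp: E_def E0_def)
      then show ?thesis using vge_power_mult_horner[OF g(1) y(1,2) g(2)] cs by simp
    qed
    show ?thesis unfolding Z_def B_def by (rule comb[OF hc[OF L] wc' hK int'[OF g]])
  qed
  \<comment> \<open>Differences of members of one class modulo \<open>y [^] (m + C)\<close> become
    regular on \<open>G\<close> after multiplication by \<open>Z\<close>, hence regular outside
    \<open>f\<close>. So a class has at most \<open>card ?O\<close> members.\<close>
  have fibre: "card {L \<in> E. y [^] c \<otimes> B L \<ominus> t \<in> (\<otimes>) (y [^] (m + C)) ` A} \<le> card ?O" (is "card ?F \<le> _")
    if t: "t \<in> S" for t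
  proof (cases "?F = {}")
    case True
    show ?thesis unfolding True by simp
  next
    case False
    then obtain L0 where L0: "L0 \<in> ?F" by blast
    have tc: "t \<in> carrier R" using t S Ac by blast
    have "inj_on (\<lambda>L. Z \<otimes> B L \<ominus> Z \<otimes> B L0) ?F"
    proof (rule inj_onI)
      fix L L' assume LL: "L \<in> ?F" "L' \<in> ?F" "Z \<otimes> B L \<ominus> Z \<otimes> B L0 = Z \<otimes> B L' \<ominus> Z \<otimes> B L0"
      have b: "B L \<in> carrier R" "B L' \<in> carrier R" "B L0 \<in> carrier R" using Bc LL L0 by auto
      have "Z \<otimes> B L = (Z \<otimes> B L \<ominus> Z \<otimes> B L0) \<oplus> Z \<otimes> B L0" using b Zc(1) by algebra
      also have "\<dots> = Z \<otimes> B L'" unfolding LL(3) using b Zc(1) by algebra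
      finally have "B L = B L'" using m_lcancel[OF Zc(2,1) b(1,2)] by simp
      then show "L = L'" using Binj LL by blast
    qed
    moreover have "(\<lambda>L. Z \<otimes> B L \<ominus> Z \<otimes> B L0) ` ?F \<subseteq> ?O"
    proof
      fix o' assume "o' \<in> (\<lambda>L. Z \<otimes> B L \<ominus> Z \<otimes> B L0) ` ?F"
      then obtain L where L: "L \<in> ?F" "o' = Z \<otimes> B L \<ominus> Z \<otimes> B L0" by blast
      have b: "B L \<in> carrier R" "B L0 \<in> carrier R" "L \<in> E" "L0 \<in> E" using Bc L L0 by auto
      have oc: "o' \<in> carrier R" using L b Zc by simp
      obtain a where a: "a \<in> A" "y [^] c \<otimes> B L \<ominus> t = y [^] (m + C) \<otimes> a" using L by blast
      obtain a0 where a0: "a0 \<in> A" "y [^] c \<otimes> B L0 \<ominus> t = y [^] (m + C) \<otimes> a0" using L0 by blast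
      have ac: "a \<in> carrier R" "a0 \<in> carrier R" using a a0 Ac by auto
      have pc: "y [^] c \<in> carrier R" "y [^] (m + C) \<in> carrier R" "inv y [^] c \<in> carrier R" using y i by auto
      have "y [^] c \<otimes> (B L \<ominus> B L0) = (y [^] c \<otimes> B L \<ominus> t) \<ominus> (y [^] c \<otimes> B L0 \<ominus> t)"
        using b(1,2) pc tc by algebra
      also have "\<dots> = y [^] (m + C) \<otimes> (a \<ominus> a0)" unfolding a(2) a0(2) using ac pc by algebra
      finally have e1: "y [^] c \<otimes> (B L \<ominus> B L0) = y [^] (m + C) \<otimes> (a \<ominus> a0)" .
      have inv1: "inv y [^] (j::nat) \<otimes> y [^] j = \<one>" for j
        using nat_pow_distrib[of "inv y" y j] i y by simp
      have Zi: "Z \<otimes> inv y [^] c = inv y [^] (m + C)" using i by (simp add: Z_def C_def nat_pow_mult add.assoc)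
      have "o' = (Z \<otimes> (inv y [^] c \<otimes> y [^] c)) \<otimes> (B L \<ominus> B L0)"
        unfolding L(2) inv1 using b Zc by (simp, algebra)
      also have "\<dots> = (Z \<otimes> inv y [^] c) \<otimes> (y [^] c \<otimes> (B L \<ominus> B L0))" using b(1,2) Zc(1) pc by algebra
      also have "\<dots> = (inv y [^] (m + C) \<otimes> y [^] (m + C)) \<otimes> (a \<ominus> a0)"
        unfolding e1 Zi using pc i ac by (simp add: m_assoc)
      also have "\<dots> = a \<ominus> a0" unfolding inv1 using ac by simp
      finally have "o' = a \<ominus> a0" .
      then have oA: "o' \<in> A" using a a0 Aops by (simp add: minus_eq)
      have "o' = \<zero> \<or> 0 \<le> g o'" if g: "normalized_valuation R g" "g \<noteq> f" for g
      proof (cases "0 < g y")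
        case True
        then have "g \<in> G" using g by (simp add: G_def)
        then show ?thesis using oA by (auto simp: A_def)
      next
        case False
        interpret g: discrete_valuation R g by (rule discrete_valuationI[OF g(1)])
        have "g.vge 0 (Z \<otimes> B L \<ominus> Z \<otimes> B L0)"
          by (rule g.vge_diff) (use Zint[OF g(1)] False b Zc in auto)
        then show ?thesis unfolding L(2) by (simp add: g.vge_def)
      qed
      then show "o' \<in> ?O" using oc unfolding regular_outside_def by blast
    qed
    ultimately show ?thesis using finO by (rule card_inj_on_le)
  qed
  have k2: "card k \<ge> 2"
  proof -
    have "card {\<zero>, \<one>} \<le> card k" by (rule card_mono[OF k(2)]) (use kops in auto)
    then show ?thesis by simp
  qed
  \<comment> \<open>The classes cover \<open>E\<close>; their number times \<open>card ?O\<close> is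
    less than \<open>card E\<close>.\<close>
  have "E \<subseteq> (\<Union>t\<in>S. {L \<in> E. y [^] c \<otimes> B L \<ominus> t \<in> (\<otimes>) (y [^] (m + C)) ` A})"
    using S(4)[OF BA] by blast
  then have "card E \<le> card (\<Union>t\<in>S. {L \<in> E. y [^] c \<otimes> B L \<ominus> t \<in> (\<otimes>) (y [^] (m + C)) ` A})"
    using S(2) E(1) by (intro card_mono) auto
  also have "\<dots> \<le> (\<Sum>t\<in>S. card {L \<in> E. y [^] c \<otimes> B L \<ominus> t \<in> (\<otimes>) (y [^] (m + C)) ` A})"
    by (rule card_UN_le[OF S(2)])
  also have "\<dots> \<le> (\<Sum>t\<in>S. card ?O)" by (rule sum_mono[OF fibre])
  also have "\<dots> = card S * card ?O" by simp
  also have "\<dots> \<le> (card k ^ l) ^ (m + C) * card ?O"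
    using S(3) T(3) by (intro mult_right_mono order_trans[OF S(3)] power_mono) auto
  also have "\<dots> < (card k ^ l) ^ (m + C) * card k ^ card ?O"
  proof -
    have "card ?O < 2 ^ card ?O" by (rule less_exp)
    also have "\<dots> \<le> card k ^ card ?O" using k2 by (intro power_mono) auto
    finally show ?thesis using k2 by (intro mult_strict_left_mono) auto
  qed
  also have "\<dots> = card k ^ (l * (m + C) + card ?O)" by (simp only: power_mult[symmetric] power_add[symmetric])
  also have "l * (m + C) + card ?O = m * n" by (simp add: l m_def C_def algebra_simps)
  also have "card k ^ (m * n) = card E" by (simp add: E power_mult)
  finally show False by simp
qed

end

section \<open>Rings of functions regular outside a single place\<close>

lemma (in ring) subring_minus:
  assumes "subring A R" "x \<in> A" "y \<in> A"
  shows "x \<ominus>\<^bsub>R\<lparr>carrier := A\<rparr>\<^esub> y = x \<ominus> y"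
proof -
  interpret A: ring "R\<lparr>carrier := A\<rparr>" by (rule subring_is_ring[OF assms(1)])
  have "y \<in> carrier R" "\<ominus> y \<in> A" using subringE(1,5)[OF assms(1)] assms by auto
  then have "\<ominus>\<^bsub>R\<lparr>carrier := A\<rparr>\<^esub> y = \<ominus> y"
    using assms by (intro A.minus_equality) (auto simp: l_neg)
  then show ?thesis by (simp add: a_minus_def)
qed

context discrete_valuation
begin

lemma subring_valuation_ring: "subring (carrier (valuation_ring K v)) K"
  using subring_vge_all[of "{v}"] normalized by (simp add: valuation_ring_def)

lemma cring_valuation_ring: "cring (valuation_ring K v)"
proof -
  have "subring {x \<in> carrier K. x = \<zero> \<or> 0 \<le> v x} K"
    using subring_valuation_ring by (simp add: valuation_ring_def)
  then have "domain (valuation_ring K v)" unfolding valuation_ring_def by (rule subring_is_domain)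
  then show ?thesis by (rule domain.axioms(1))
qed

lemma maximalideal_valuation_ideal: "maximalideal (valuation_ideal K v) (valuation_ring K v)"
proof (rule maximalidealI)
  let ?V = "valuation_ring K v" and ?m = "valuation_ideal K v"
  interpret V: cring ?V by (rule cring_valuation_ring)
  have V: "x \<in> carrier ?V \<longleftrightarrow> x \<in> carrier K \<and> vge 0 x" for x by (auto simp: valuation_ring_def vge_def)
  have m: "x \<in> ?m \<longleftrightarrow> x \<in> carrier K \<and> vge 1 x" for x by (auto simp: valuation_ideal_def vge_def)
  have Vops: "x \<otimes>\<^bsub>?V\<^esub> y = x \<otimes> y" "x \<oplus>\<^bsub>?V\<^esub> y = x \<oplus> y" "\<one>\<^bsub>?V\<^esub> = \<one>" "\<zero>\<^bsub>?V\<^esub> = \<zero>" for x y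
    by (auto simp: valuation_ring_def)
  have neg: "\<ominus>\<^bsub>?V\<^esub> x = \<ominus> x" if "x \<in> carrier ?V" for x
  proof (rule V.minus_equality)
    show "\<ominus> x \<oplus>\<^bsub>?V\<^esub> x = \<zero>\<^bsub>?V\<^esub>" using that V by (simp add: Vops l_neg)
    show "\<ominus> x \<in> carrier ?V" using that V vge_uminus by auto
  qed (rule that)
  have sub: "x \<in> carrier ?V" if "x \<in> ?m" for x using that V m vge_mono[of 1 x 0] by auto
  show "ideal ?m ?V"
  proof (rule idealI)
    show "ring ?V" by (rule V.ring_axioms)
    show "subgroup ?m (add_monoid ?V)"
    proof (rule V.add.subgroupI)
      show "?m \<subseteq> carrier ?V" using sub by blast
      show "?m \<noteq> {}" using m[of \<zero>] by auto
      show "\<ominus>\<^bsub>?V\<^esub> a \<in> ?m" if "a \<in> ?m" for a using that sub neg m vge_uminus by auto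
      show "a \<oplus>\<^bsub>?V\<^esub> b \<in> ?m" if "a \<in> ?m" "b \<in> ?m" for a b
        using that m vge_add by (simp add: Vops)
    qed
    show "x \<otimes>\<^bsub>?V\<^esub> a \<in> ?m" if "a \<in> ?m" "x \<in> carrier ?V" for a x
      using that m V vge_mult0 by (simp add: Vops)
    then show "a \<otimes>\<^bsub>?V\<^esub> x \<in> ?m" if "a \<in> ?m" "x \<in> carrier ?V" for a x
      using that sub V.m_comm by metis
  qed
  show "carrier ?V \<noteq> ?m"
  proof
    assume "carrier ?V = ?m"
    moreover have "\<one> \<in> carrier ?V" using V by simp
    ultimately have "\<one> \<in> ?m" by simp
    then show False using m by (simp add: vge_def v_one)
  qed
  fix J assume J: "ideal J ?V" "?m \<subseteq> J" "J \<subseteq> carrier ?V"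
  interpret J: ideal J ?V by (rule J(1))
  show "J = ?m \<or> J = carrier ?V"
  proof (cases "J \<subseteq> ?m")
    case True
    then show ?thesis using J by blast
  next
    case False
    then obtain x where x: "x \<in> J" "x \<notin> ?m" by blast
    then have xV: "x \<in> carrier K" "vge 0 x" using J V by auto
    then have x0: "x \<noteq> \<zero>" "v x = 0" using x m by (auto simp: vge_def)
    note i = nonzero_inv[OF xV(1) x0(1)]
    have "inv x \<in> carrier ?V" using V i v_inv[OF xV(1) x0(1)] x0 by (simp add: vge_def)
    then have "inv x \<otimes>\<^bsub>?V\<^esub> x \<in> J" using J.I_l_closed x by blast
    then have "\<one>\<^bsub>?V\<^esub> \<in> J" using i by (simp add: Vops)
    then show ?thesis using J.one_imp_carrier by blast
  qed
qed

lemma field_residue_field: "field (residue_field K v)"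
  unfolding residue_field_def
  by (rule maximalideal.quotient_is_field[OF maximalideal_valuation_ideal cring_valuation_ring])

lemma residue_coset_eq:
  assumes "x \<in> carrier (valuation_ring K v)" "y \<in> carrier (valuation_ring K v)" "vge 1 (x \<ominus> y)"
  shows "valuation_ideal K v +>\<^bsub>valuation_ring K v\<^esub> x = valuation_ideal K v +>\<^bsub>valuation_ring K v\<^esub> y"
proof -
  interpret V: cring "valuation_ring K v" by (rule cring_valuation_ring)
  have "valuation_ring K v = K\<lparr>carrier := carrier (valuation_ring K v)\<rparr>" by (simp add: valuation_ring_def)
  then have "x \<ominus>\<^bsub>valuation_ring K v\<^esub> y = x \<ominus> y"
    using subring_minus[OF subring_valuation_ring assms(1,2)] by simp
  moreover have "x \<ominus> y \<in> carrier K" using assms by (auto simp: valuation_ring_def)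
  ultimately have "x \<ominus>\<^bsub>valuation_ring K v\<^esub> y \<in> valuation_ideal K v"
    using assms(3) by (auto simp: valuation_ideal_def vge_def)
  then show ?thesis
    using V.quotient_eq_iff_same_a_r_cos[OF maximalideal.axioms(1)[OF maximalideal_valuation_ideal] assms(1,2)]
    by blast
qed

text \<open>The constants map onto the whole residue field, which has dimension 1 over
  itself.\<close>

lemma place_degree_1:
  assumes "\<And>x. x \<in> carrier K \<Longrightarrow> vge 0 x \<Longrightarrow> \<exists>c\<in>full_constant_field K k. c \<in> carrier K \<and> vge 0 c \<and> vge 1 (x \<ominus> c)"
    and "\<And>c. c \<in> full_constant_field K k \<Longrightarrow> vge 0 c"
  shows "place_degree K k (Finite_Place v) = 1"
proof -
  let ?V = "valuation_ring K v" and ?m = "valuation_ideal K v" and ?F = "residue_field K v"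
  interpret F: field ?F by (rule field_residue_field)
  have V: "x \<in> carrier ?V \<longleftrightarrow> x \<in> carrier K \<and> vge 0 x" for x by (auto simp: valuation_ring_def vge_def)
  have carF: "carrier ?F = (\<lambda>x. ?m +>\<^bsub>?V\<^esub> x) ` carrier ?V"
    by (auto simp: residue_field_def FactRing_def A_RCOSETS_def' )
  have "(\<lambda>c. ?m +>\<^bsub>?V\<^esub> c) ` full_constant_field K k = carrier ?F"
  proof
    show "(\<lambda>c. ?m +>\<^bsub>?V\<^esub> c) ` full_constant_field K k \<subseteq> carrier ?F"
      unfolding carF using V assms(2) by (auto simp: full_constant_field_def)
    show "carrier ?F \<subseteq> (\<lambda>c. ?m +>\<^bsub>?V\<^esub> c) ` full_constant_field K k"
      unfolding carF
    proof
      fix z assume "z \<in> (\<lambda>x. ?m +>\<^bsub>?V\<^esub> x) ` carrier ?V"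
      then obtain x where x: "x \<in> carrier ?V" "z = ?m +>\<^bsub>?V\<^esub> x" by blast
      obtain c where c: "c \<in> full_constant_field K k" "c \<in> carrier K" "vge 0 c" "vge 1 (x \<ominus> c)"
        using assms(1)[of x] x V by blast
      then have "z = ?m +>\<^bsub>?V\<^esub> c" using residue_coset_eq[of x c] x V by simp
      then show "z \<in> (\<lambda>c. ?m +>\<^bsub>?V\<^esub> c) ` full_constant_field K k" using c by blast
    qed
  qed
  moreover have "subfield (carrier ?F) ?F" using F.carrier_is_subfield .
  ultimately show ?thesis
    using F.dimI[OF _ F.dimension_one] by (simp add: place_degree_def over_def)
qed

end

section \<open>Principal fractional ideals and the class group\<close>

lemma (in field) ideal_prod_principal:
  assumes A: "subring A R" and xy: "x \<in> carrier R" "y \<in> carrier R"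
  shows "ideal_prod R (x <# A) (y <# A) = (x \<otimes> y) <# A"
proof
  have Ac: "a \<in> carrier R" if "a \<in> A" for a using subringE(1)[OF A] that by blast
  show "ideal_prod R (x <# A) (y <# A) \<subseteq> (x \<otimes> y) <# A"
  proof
    fix s assume "s \<in> ideal_prod R (x <# A) (y <# A)"
    then show "s \<in> (x \<otimes> y) <# A"
    proof (induction rule: ideal_prod.induct)
      case (prod i j)
      then obtain a b where ab: "a \<in> A" "b \<in> A" "i = x \<otimes> a" "j = y \<otimes> b" by (auto simp: l_coset_def)
      have "i \<otimes> j = (x \<otimes> y) \<otimes> (a \<otimes> b)"
        unfolding ab(3,4) using xy Ac[OF ab(1)] Ac[OF ab(2)] by algebra
      then show ?case using ab subringE(6)[OF A] by (auto simp: l_coset_def)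
    next
      case (sum s t)
      then obtain a b where ab: "a \<in> A" "b \<in> A" "s = x \<otimes> y \<otimes> a" "t = x \<otimes> y \<otimes> b" by (auto simp: l_coset_def)
      have "s \<oplus> t = (x \<otimes> y) \<otimes> (a \<oplus> b)"
        unfolding ab(3,4) using xy Ac[OF ab(1)] Ac[OF ab(2)] by algebra
      then show ?case using ab subringE(7)[OF A] by (auto simp: l_coset_def)
    qed
  qed
  show "(x \<otimes> y) <# A \<subseteq> ideal_prod R (x <# A) (y <# A)"
  proof
    fix s assume "s \<in> (x \<otimes> y) <# A"
    then obtain a where a: "a \<in> A" "s = x \<otimes> y \<otimes> a" by (auto simp: l_coset_def)
    have "x \<otimes> a \<in> x <# A" "y \<otimes> \<one> \<in> y <# A" using a subringE(3)[OF A] by (auto simp: l_coset_def)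
    then have "(x \<otimes> a) \<otimes> (y \<otimes> \<one>) \<in> ideal_prod R (x <# A) (y <# A)" by (rule ideal_prod.prod)
    moreover have "(x \<otimes> a) \<otimes> (y \<otimes> \<one>) = s" unfolding a(2) using xy Ac[OF a(1)] by algebra
    ultimately show "s \<in> ideal_prod R (x <# A) (y <# A)" by simp
  qed
qed

text \<open>Multiplication by a principal ideal permutes the principal ideals, so all cosets
  coincide. The carrier of the quotient is computed directly, without its group laws.\<close>

lemma (in field) order_class_group_1:
  assumes A: "subring A R" and princ: "\<And>I. fractional_ideal R A I \<Longrightarrow> I \<in> principal_fractional_ideals R A"
  shows "order (class_group R A) = 1"
proof -
  let ?G = "fractional_ideal_group R A" and ?H = "principal_fractional_ideals R A"
  have Ac: "A \<subseteq> carrier R" using subringE(1)[OF A] .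
  have "fractional_ideal R A A"
    unfolding fractional_ideal_def
  proof (intro conjI ballI)
    show "additive_subgroup A R" using subring.axioms(1)[OF A] by (simp add: additive_subgroup_def)
    show "A \<noteq> {\<zero>}" using subringE(3)[OF A] one_not_zero by (metis singletonD)
    show "a \<otimes> x \<in> A" if "a \<in> A" "x \<in> A" for a x using subringE(6)[OF A] that .
    show "\<exists>a\<in>A. a \<noteq> \<zero> \<and> (\<forall>x\<in>A. a \<otimes> x \<in> A)"
      using subringE(3,6)[OF A] by (intro bexI[of _ \<one>]) auto
  qed
  moreover have "?H #>\<^bsub>?G\<^esub> J = ?H" if J: "fractional_ideal R A J" for J
  proof -
    obtain y where y: "y \<in> carrier R" "y \<noteq> \<zero>" "J = y <# A"
      using princ[OF J] by (auto simp: principal_fractional_ideals_def)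
    note i = nonzero_inv[OF y(1,2)]
    have "?H #>\<^bsub>?G\<^esub> J = {ideal_prod R (x <# A) (y <# A) |x. x \<in> carrier R - {\<zero>}}"
      unfolding r_coset_def principal_fractional_ideals_def y(3) by (auto simp: fractional_ideal_group_def)
    also have "\<dots> = {(x \<otimes> y) <# A |x. x \<in> carrier R - {\<zero>}}"
      using ideal_prod_principal[OF A _ y(1)] by (metis (no_types, lifting) DiffD1)
    also have "\<dots> = ?H"
    proof
      show "{(x \<otimes> y) <# A |x. x \<in> carrier R - {\<zero>}} \<subseteq> ?H"
        unfolding principal_fractional_ideals_def using nonzero_mult y by blast
      show "?H \<subseteq> {(x \<otimes> y) <# A |x. x \<in> carrier R - {\<zero>}}"
      proof
        fix I assume "I \<in> ?H"
        then obtain z where z: "z \<in> carrier R" "z \<noteq> \<zero>" "I = z <# A" by (auto simp: principal_fractional_ideals_def)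
        have "z \<otimes> inv y \<otimes> y = z" using z i y by (simp add: m_assoc)
        moreover have "z \<otimes> inv y \<in> carrier R - {\<zero>}" using z i nonzero_mult by simp
        ultimately show "I \<in> {(x \<otimes> y) <# A |x. x \<in> carrier R - {\<zero>}}" using z(3) by force
      qed
    qed
    finally show ?thesis .
  qed
  ultimately have "carrier (class_group R A) = {?H}"
    unfolding class_group_def carrier_FactGroup by (auto simp: fractional_ideal_group_def)
  then show ?thesis by (simp add: order_def)
qed

section \<open>The ring of functions regular outside one place\<close>

locale function_field_with_place = global_function_field +
  fixes f
  assumes f: "normalized_valuation R f"
begin

sublocale fv: discrete_valuation R f by (rule discrete_valuationI[OF f])

abbreviation OS :: "'a set" where "OS \<equiv> regular_outside f"

lemmas OS_subring = subring_regular_outside[of f]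

lemma OS_carrier: "x \<in> OS \<Longrightarrow> x \<in> carrier R" by (simp add: regular_outside_def)

text \<open>A transcendental element has a pole somewhere, but \<open>x\<close> has none at
  \<open>f\<close> and none elsewhere.\<close>

lemma algebraic_if_regular:
  assumes x: "x \<in> OS" "x \<noteq> \<zero>" "0 \<le> f x"
  shows "\<not> transcendental k x"
proof
  assume "transcendental k x"
  then obtain v where v: "normalized_valuation R v" "v x < 0" using pole_exists OS_carrier x by blast
  then have "v \<noteq> f" using x by auto
  then show False using v x by (auto simp: regular_outside_def)
qed

lemma OS_valuation_nonpos: "x \<in> OS \<Longrightarrow> x \<noteq> \<zero> \<Longrightarrow> f x \<le> 0"
  using algebraic_if_regular[of x] algebraic_valuation[OF f OS_carrier] by force

lemma OS_unit: assumes x: "x \<in> OS" "x \<noteq> \<zero>" "f x = 0" shows "inv x \<in> OS"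
proof -
  have alg: "\<not> transcendental k x" using algebraic_if_regular x by simp
  note i = nonzero_inv[OF OS_carrier[OF x(1)] x(2)]
  have "0 \<le> g (inv x)" if "normalized_valuation R g" for g
    by (rule algebraic_integral[OF that i(1) algebraic_inv[OF OS_carrier[OF x(1)] alg x(2)] i(2)])
  then show ?thesis using i by (simp add: regular_outside_def)
qed

text \<open>The ring contains \<open>k[s]\<close> for a transcendental \<open>s\<close>, over which
  \<open>x\<close> is algebraic. The leading coefficient of an equation for \<open>x\<close> makes
  it regular outside \<open>f\<close>.\<close>

lemma OS_denominator:
  assumes x: "x \<in> carrier R"
  shows "\<exists>q\<in>OS. q \<noteq> \<zero> \<and> q \<otimes> x \<in> OS"
proof -
  obtain s where s: "s \<in> OS" "transcendental k s" using exists_transcendental_regular_outside[OF f] by blast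
  have sc: "s \<in> carrier R" by (rule OS_carrier[OF s(1)])
  let ?P = "simple_extension k s"
  have kO: "k \<subseteq> OS"
  proof
    fix c assume c: "c \<in> k"
    have "c = \<zero> \<or> 0 \<le> g c" if "normalized_valuation R g" for g
      using constant_valuation[OF that c] by (cases "c = \<zero>") simp_all
    then show "c \<in> OS" using c kc by (auto simp: regular_outside_def)
  qed
  have PO: "?P \<subseteq> OS" by (rule simple_extension_subring_incl[OF OS_subring kO s(1)])
  obtain N where N: "\<And>Us. set Us \<subseteq> carrier R \<Longrightarrow> N < length Us \<Longrightarrow> dependent_over ?P Us"
    using dependence_bound[OF sc s(2)] by blast
  have "dependent_over ?P (map (\<lambda>j. x [^] j) [0..<Suc N])" by (rule N) (use x in auto)
  then obtain Ks where Ks: "length Ks = Suc N" "set Ks \<subseteq> ?P" "\<not> set Ks \<subseteq> {\<zero>}"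
    "combine Ks (map (\<lambda>j. x [^] j) [0..<Suc N]) = \<zero>"
    unfolding dependent_over_def by auto
  have KO: "set Ks \<subseteq> OS" using Ks PO by blast
  have Kc: "set Ks \<subseteq> carrier R" using KO OS_carrier by blast
  have "horner Ks x = \<zero>" using combine_powers0[OF Kc x Ks(1)] Ks(4) by simp
  then obtain Ls a where La: "set (Ls @ [a]) \<subseteq> set Ks" "a \<noteq> \<zero>" "horner (Ls @ [a]) x = \<zero>"
    using horner_leading[OF Kc Ks(3) x] by blast
  have aO: "a \<in> OS" using La KO by auto
  have "a \<otimes> x = \<zero> \<or> 0 \<le> g (a \<otimes> x)" if g: "normalized_valuation R g" "g \<noteq> f" for g
  proof -
    interpret g: discrete_valuation R g by (rule discrete_valuationI[OF g(1)])
    have O0: "g.vge 0 c" if "c \<in> OS" for c using that g by (auto simp: g.vge_def regular_outside_def)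
    have "g.vge 0 (a \<otimes> x)"
    proof (rule g.vge_leading_mult[OF _ _ La(2) x La(3)])
      show "set (Ls @ [a]) \<subseteq> carrier R" using La(1) Kc by blast
      show "g.vge 0 c" if "c \<in> set (Ls @ [a])" for c using O0 that La(1) KO by blast
    qed
    then show ?thesis by (simp add: g.vge_def)
  qed
  then have "a \<otimes> x \<in> OS" using OS_carrier[OF aO] x unfolding regular_outside_def by blast
  then show ?thesis using aO La(2) by blast
qed

text \<open>With base 2, a pole at \<open>f\<close> already gives absolute value at least 2, as
  required of nonunits.\<close>

definition absf :: "'a \<Rightarrow> real" where
  "absf x = (if x = \<zero> then 0 else 2 powr (- real_of_int (f x)))"

lemma absf_pos: "x \<noteq> \<zero> \<Longrightarrow> 0 < absf x" by (simp add: absf_def)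

lemma discretely_normed: "discretely_normed_subring R OS absf"
proof (intro discretely_normed_subring.intro discretely_normed_subring_axioms.intro)
  show "field R" by (rule field_axioms)
  show "subring OS R" by (rule OS_subring)
  show "absf \<zero> = 0" by (simp add: absf_def)
  show "absf (x \<otimes> y) = absf x * absf y" if "x \<in> carrier R" "y \<in> carrier R" for x y
    using that integral[of x y] fv.v_mult[of x y] nonzero_mult[of x y]
    by (auto simp: absf_def powr_add[symmetric])
  show "absf (x \<oplus> y) \<le> absf x + absf y" if xy: "x \<in> carrier R" "y \<in> carrier R" for x y
  proof (cases "x = \<zero> \<or> y = \<zero> \<or> x \<oplus> y = \<zero>")
    case True
    then show ?thesis using xy absf_pos[of x] absf_pos[of y] by (auto simp: absf_def)
  next
    case False
    have "fv.vge (min (f x) (f y)) (x \<oplus> y)" using xy by (intro fv.vge_add) (auto simp: fv.vge_def)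
    then have "min (f x) (f y) \<le> f (x \<oplus> y)" using False by (simp add: fv.vge_def)
    then have "absf (x \<oplus> y) \<le> 2 powr (- real_of_int (min (f x) (f y)))" using False by (simp add: absf_def)
    also have "\<dots> \<le> absf x + absf y" using False by (auto simp: absf_def min_def)
    finally show ?thesis .
  qed
  show "1 \<le> absf x" if "x \<in> OS" "x \<noteq> \<zero>" for x
    using OS_valuation_nonpos[OF that] that by (simp add: absf_def ge_one_powr_ge_zero)
  show "2 \<le> absf x" if x: "x \<in> OS" "x \<noteq> \<zero>" "inv x \<notin> OS" for x
  proof -
    have "f x \<noteq> 0" using OS_unit x by blast
    then have "f x \<le> -1" using OS_valuation_nonpos[OF x(1,2)] by simp
    then have "2 powr 1 \<le> (2::real) powr (- real_of_int (f x))" by (intro powr_mono) auto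
    then show ?thesis using x by (simp add: absf_def)
  qed
qed

text \<open>Stability is automatic for an ultrametric: if \<open>y\<close> is at distance less than
  1 from \<open>x\<close>, then \<open>y - c\<close> and \<open>x - c\<close> have the same
  valuation at \<open>f\<close>, so the radius 1 serves.\<close>

lemma not_cohen_macaulay_if_far:
  assumes n: "n \<ge> 2" and x: "x \<in> carrier R" and far: "\<And>c. c \<in> OS \<Longrightarrow> \<not> fv.vge 1 (x \<ominus> c)"
  shows "\<not> cohen_macaulay (partial_bases_complex (R\<lparr>carrier := OS\<rparr>) n) (int n - 1)"
proof -
  interpret D: discretely_normed_subring R OS absf by (rule discretely_normed)
  obtain q where q: "q \<in> OS" "q \<noteq> \<zero>" "q \<otimes> x \<in> OS" using OS_denominator[OF x] by blast
  have qc: "q \<in> carrier R" using q OS_carrier by blast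
  note i = nonzero_inv[OF qc q(2)]
  have "q \<otimes> x \<otimes> inv q = (inv q \<otimes> q) \<otimes> x" using qc x i(1) by algebra
  then have eq: "q \<otimes> x \<otimes> inv q = x" using i x by simp
  show ?thesis
  proof (rule D.partial_bases_not_cohen_macaulay[OF n q(3,1,2), of 1])
    fix y c assume y: "y \<in> carrier R" "absf (y \<ominus> q \<otimes> x \<otimes> inv q) < 1" "c \<in> OS"
    have cc: "c \<in> carrier R" using y OS_carrier by blast
    have "absf (y \<ominus> x) < 1" using y(2) unfolding eq .
    then have yx: "fv.vge 1 (y \<ominus> x)"
    proof (cases "y \<ominus> x = \<zero>")
      case False
      have "\<not> f (y \<ominus> x) \<le> 0"
      proof
        assume "f (y \<ominus> x) \<le> 0"
        then have "1 \<le> absf (y \<ominus> x)" using False by (simp add: absf_def ge_one_powr_ge_zero)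
        then show False using \<open>absf (y \<ominus> x) < 1\<close> by simp
      qed
      then show ?thesis by (simp add: fv.vge_def)
    qed simp
    have xc: "x \<ominus> c \<in> carrier R" "x \<ominus> c \<noteq> \<zero>" "f (x \<ominus> c) \<le> 0"
      using far[OF y(3)] x cc by (auto simp: fv.vge_def)
    have "fv.vge (f (x \<ominus> c) + 1) (y \<ominus> x)" using fv.vge_mono[OF yx] xc(3) by simp
    note d = fv.v_add_dominant[OF xc(1,2) _ this]
    have "(x \<ominus> c) \<oplus> (y \<ominus> x) = y \<ominus> c" using x y(1) cc by algebra
    then have "y \<ominus> c \<noteq> \<zero>" "f (y \<ominus> c) \<le> 0" using d x y(1) xc(3) by auto
    then show "1 \<le> absf (y \<ominus> c)" by (simp add: absf_def ge_one_powr_ge_zero)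
  qed simp
qed

text \<open>Euclidean division: an element \<open>b\<close> of \<open>I\<close> of largest valuation
  at \<open>f\<close> is a generator, since \<open>near\<close> divides by \<open>b\<close> with a
  remainder of larger valuation, which must be zero.\<close>

lemma fractional_ideal_principal:
  assumes near: "\<And>x. x \<in> carrier R \<Longrightarrow> \<exists>c\<in>OS. fv.vge 1 (x \<ominus> c)" and I: "fractional_ideal R OS I"
  shows "I \<in> principal_fractional_ideals R OS"
proof -
  interpret I: additive_subgroup I R using I by (simp add: fractional_ideal_def)
  have Ic: "x \<in> carrier R" if "x \<in> I" for x using that I.a_subset by blast
  have I0: "\<zero> \<in> I" by (rule I.zero_closed)
  obtain b0 where b0: "b0 \<in> I" "b0 \<noteq> \<zero>" using I I0 unfolding fractional_ideal_def by blast
  obtain a where a: "a \<in> OS" "a \<noteq> \<zero>" "\<And>x. x \<in> I \<Longrightarrow> a \<otimes> x \<in> OS" using I unfolding fractional_ideal_def by blast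
  have mult: "c \<otimes> x \<in> I" if "c \<in> OS" "x \<in> I" for c x using I that unfolding fractional_ideal_def by blast
  have bnd: "f x \<le> - f a" if x: "x \<in> I" "x \<noteq> \<zero>" for x
  proof -
    have ac: "a \<in> carrier R" using a OS_carrier by blast
    have "f (a \<otimes> x) \<le> 0" by (rule OS_valuation_nonpos[OF a(3)[OF x(1)]]) (use nonzero_mult ac a Ic x in auto)
    then show ?thesis using fv.v_mult[OF ac a(2) Ic[OF x(1)] x(2)] by simp
  qed
  \<comment> \<open>By \<open>bnd\<close> the valuation at \<open>f\<close> is bounded above on
    \<open>I\<close>; \<open>d\<close> is the distance to the bound, so minimizing it maximizes the
    valuation.\<close>
  define d where "d x = nat (- f a - f x)" for x
  define b where "b = arg_min d (\<lambda>x. x \<in> I \<and> x \<noteq> \<zero>)"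
  have b: "b \<in> I \<and> b \<noteq> \<zero>" unfolding b_def by (rule arg_min_natI[of _ b0]) (use b0 in auto)
  have min: "d b \<le> d x" if "x \<in> I" "x \<noteq> \<zero>" for x
    unfolding b_def by (rule arg_min_nat_le) (use that in auto)
  have max: "f x \<le> f b" if "x \<in> I" "x \<noteq> \<zero>" for x
    using min[OF that] bnd[OF that] bnd[of b] b by (simp add: d_def)
  have bc: "b \<in> carrier R" using b Ic by blast
  note i = nonzero_inv[of b]
  have "I \<subseteq> b <# OS"
  proof
    fix x assume x: "x \<in> I"
    have xc: "x \<in> carrier R" by (rule Ic[OF x])
    obtain c where c: "c \<in> OS" "fv.vge 1 (x \<otimes> inv b \<ominus> c)" using near[of "x \<otimes> inv b"] xc i b bc by auto
    have cc: "c \<in> carrier R" using c OS_carrier by blast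
    have "(x \<otimes> inv b \<ominus> c) \<otimes> b = x \<otimes> (inv b \<otimes> b) \<ominus> c \<otimes> b" using xc cc bc i(1) b by algebra
    then have eq: "(x \<otimes> inv b \<ominus> c) \<otimes> b = x \<ominus> c \<otimes> b" using i b bc xc by simp
    have "c \<otimes> b \<in> I" using mult c b by blast
    then have rI: "x \<ominus> c \<otimes> b \<in> I" unfolding minus_eq using x I.a_closed I.a_inv_closed by blast
    have "x \<ominus> c \<otimes> b = \<zero>"
    proof (rule ccontr)
      assume nz: "x \<ominus> c \<otimes> b \<noteq> \<zero>"
      have "fv.vge (1 + f b) ((x \<otimes> inv b \<ominus> c) \<otimes> b)"
        by (rule fv.vge_mult) (use c b bc xc cc i in \<open>auto simp: fv.vge_def\<close>)
      then have "f b < f (x \<ominus> c \<otimes> b)" using nz unfolding eq by (simp add: fv.vge_def)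
      then show False using max[OF rI nz] by simp
    qed
    then have "x = c \<otimes> b" using xc cc bc by simp
    then have "x = b \<otimes> c" using cc bc by (simp add: m_comm)
    then show "x \<in> b <# OS" using c by (auto simp: l_coset_def)
  qed
  moreover have "b <# OS \<subseteq> I"
  proof
    fix x assume "x \<in> b <# OS"
    then obtain c where c: "c \<in> OS" "x = b \<otimes> c" by (auto simp: l_coset_def)
    then have "x = c \<otimes> b" using OS_carrier bc by (simp add: m_comm)
    then show "x \<in> I" using mult c b by simp
  qed
  ultimately show ?thesis using b bc unfolding principal_fractional_ideals_def by blast
qed

text \<open>Either some point is far from the ring, or division with remainder works everywhere; the
  latter contradicts both alternatives of \<open>cl\<close>.\<close>

theorem partial_bases_not_cohen_macaulay_function_field:
  assumes n: "n \<ge> 2"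
    and cl: "order (class_group R OS) \<noteq> 1 \<or> place_degree R k (Finite_Place f) \<ge> 2"
  shows "\<not> cohen_macaulay (partial_bases_complex (R\<lparr>carrier := OS\<rparr>) n) (int n - 1)"
proof (cases "\<exists>x\<in>carrier R. \<forall>c\<in>OS. \<not> fv.vge 1 (x \<ominus> c)")
  case True
  then show ?thesis using not_cohen_macaulay_if_far[OF n] by blast
next
  case False
  then have near: "\<And>x. x \<in> carrier R \<Longrightarrow> \<exists>c\<in>OS. fv.vge 1 (x \<ominus> c)" by blast
  have "order (class_group R OS) = 1"
    by (rule order_class_group_1[OF OS_subring fractional_ideal_principal[OF near]])
  moreover have "place_degree R k (Finite_Place f) = 1"
  proof (rule fv.place_degree_1)
    fix c assume "c \<in> full_constant_field R k"
    then show "fv.vge 0 c" using algebraic_integral[OF f, of c] by (auto simp: full_constant_field_def fv.vge_def)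
  next
    fix x assume x: "x \<in> carrier R" "fv.vge 0 x"
    obtain c where c: "c \<in> OS" "fv.vge 1 (x \<ominus> c)" using near[OF x(1)] by blast
    have cc: "c \<in> carrier R" using c OS_carrier by blast
    \<comment> \<open>An element of the ring close to an \<open>x\<close> integral at
      \<open>f\<close> is itself integral there, hence without poles, hence constant. So constants
      represent all residues.\<close>
    have "fv.vge 0 (x \<ominus> (x \<ominus> c))" 
      by (rule fv.vge_diff) (use x cc fv.vge_mono[OF c(2), of 0] in auto)
    moreover have "x \<ominus> (x \<ominus> c) = c" using x(1) cc by algebra
    ultimately have v0: "fv.vge 0 c" by simp
    have "\<not> transcendental k c"
    proof (cases "c = \<zero>")
      case True
      then show ?thesis using zero_is_algebraic[OF subfieldE(1)[OF k(1)]] by (simp add: over_def)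
    next
      case False
      then show ?thesis using algebraic_if_regular[OF c(1)] v0 by (simp add: fv.vge_def)
    qed
    then have "c \<in> full_constant_field R k" using cc by (simp add: full_constant_field_def)
    then show "\<exists>c\<in>full_constant_field R k. c \<in> carrier R \<and> fv.vge 0 c \<and> fv.vge 1 (x \<ominus> c)"
      using cc v0 c(2) by blast
  qed
  ultimately show ?thesis using cl by simp
qed

end

text \<open>Positive characteristic excludes archimedean places: such an absolute value would be
  \<open>m\<close> on the sum of \<open>m\<close> ones.\<close>

lemma finite_char:
  assumes K: "field K" and k: "subfield k K" "finite k"
  shows "\<exists>m::nat. m > 0 \<and> add_pow K m \<one>\<^bsub>K\<^esub> = \<zero>\<^bsub>K\<^esub>"
proof -
  interpret K: field K by (rule K)
  note kops = subringE(2,3,5,6,7)[OF subfieldE(1)[OF k(1)]]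
  have "add_pow K m \<one>\<^bsub>K\<^esub> \<in> k" for m :: nat by (induction m) (use kops in auto)
  then have "\<not> inj (\<lambda>m::nat. add_pow K m \<one>\<^bsub>K\<^esub>)"
    using k(2) finite_subset[of "range (\<lambda>m::nat. add_pow K m \<one>\<^bsub>K\<^esub>)" k] infinite_UNIV_nat finite_imageD by blast
  then obtain i j :: nat where ij: "i < j" "add_pow K i \<one>\<^bsub>K\<^esub> = add_pow K j \<one>\<^bsub>K\<^esub>"
    unfolding inj_def by (metis linorder_neqE_nat)
  have "add_pow K i \<one>\<^bsub>K\<^esub> \<oplus>\<^bsub>K\<^esub> add_pow K (j - i) \<one>\<^bsub>K\<^esub> = add_pow K i \<one>\<^bsub>K\<^esub> \<oplus>\<^bsub>K\<^esub> \<zero>\<^bsub>K\<^esub>"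
    using ij K.add.nat_pow_mult[of "\<one>\<^bsub>K\<^esub>" i "j - i"] by simp
  then have "add_pow K (j - i) \<one>\<^bsub>K\<^esub> = \<zero>\<^bsub>K\<^esub>"
    using K.add.l_cancel[of "add_pow K i \<one>\<^bsub>K\<^esub>" "add_pow K (j - i) \<one>\<^bsub>K\<^esub>" "\<zero>\<^bsub>K\<^esub>"] by simp
  then show ?thesis using ij(1) by (intro exI[of _ "j - i"]) auto
qed

theorem function_field_case:
  assumes S: "{p} \<subseteq> places K" and ff: "function_field_over K k"
    and cl: "order (class_group K (S_integers K {p})) \<noteq> 1 \<or> place_degree K k p \<ge> 2" and n: "n \<ge> 2"
  shows "\<not> cohen_macaulay (partial_bases_complex (K\<lparr>carrier := S_integers K {p}\<rparr>) n) (int n - 1)"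
proof -
  have K: "field K" "subfield k K" "finite k" using ff by (auto simp: function_field_over_def)
  interpret K: field K by (rule K(1))
  have "p \<notin> infinite_places K"
  proof
    assume "p \<in> infinite_places K"
    then obtain a where a: "normalized_arch_abs K a" by (auto simp: infinite_places_def)
    obtain m :: nat where m: "m > 0" "add_pow K m \<one>\<^bsub>K\<^esub> = \<zero>\<^bsub>K\<^esub>" using finite_char[OF K] by blast
    have "a (add_pow K m \<one>\<^bsub>K\<^esub>) = real m" "a \<zero>\<^bsub>K\<^esub> = 0" using a by (auto simp: normalized_arch_abs_def)
    then show False using m by simp
  qed
  then obtain f where f: "p = Finite_Place f" "normalized_valuation K f"
    using S by (auto simp: places_def finite_places_def)
  obtain t where t: "t \<in> carrier K" "ring.finite_dimension K (generate_field K (insert t k)) (carrier K)"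
    using ff by (auto simp: function_field_over_def)
  interpret F: function_field_with_place K k f
    by (intro function_field_with_place.intro global_function_field.intro
        global_function_field_axioms.intro function_field_with_place_axioms.intro)
       (use K f t in auto)
  have "S_integers K {p} = F.OS"
    unfolding S_integers_def F.regular_outside_def f(1) by (auto simp: places_def finite_places_def infinite_places_def)
  then show ?thesis using F.partial_bases_not_cohen_macaulay_function_field[OF n] cl f(1) by simp
qed

section \<open>Imaginary quadratic fields\<close>

definition (in ring) zint :: "int \<Rightarrow> 'a" where
  "zint m = add_pow R m \<one>"

context cring
begin

lemma zint_closed [simp]: "zint m \<in> carrier R"
  by (simp add: zint_def)

lemma zint_0 [simp]: "zint 0 = \<zero>" and zint_1 [simp]: "zint 1 = \<one>"
  unfolding zint_def by (simp add: add_pow_def, rule add.int_pow_1, simp)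

lemma zint_add: "zint (a + b) = zint a \<oplus> zint b"
  unfolding zint_def by (rule add.int_pow_mult) simp

lemma zint_minus: "zint (- a) = \<ominus> zint a"
  unfolding zint_def by (rule add.int_pow_neg) simp

lemma zint_mult: "zint (a * b) = zint a \<otimes> zint b"
proof -
  have "zint a \<otimes> zint b = add_pow R a (\<one> \<otimes> zint b)"
    unfolding zint_def by (rule add_pow_ldistr_int) auto
  also have "\<dots> = add_pow R a (add_pow R b \<one>)" by (simp add: zint_def)
  also have "\<dots> = zint (b * a)" unfolding zint_def by (rule add.int_pow_pow) simp
  finally show ?thesis by (simp add: mult.commute)
qed

end

lemma (in field) subring_S_integers: "subring (S_integers R S) R"
proof -
  have "S_integers R S = {x \<in> carrier R. \<forall>g\<in>{g. Finite_Place g \<in> places R - S}. x = \<zero> \<or> 0 \<le> g x}"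
    by (auto simp: S_integers_def)
  moreover have "subring \<dots> R"
    by (rule subring_vge_all) (auto simp: places_def finite_places_def infinite_places_def)
  ultimately show ?thesis by simp
qed

lemma abs_le_3_if_square_le_12:
  fixes z :: int assumes "z\<^sup>2 \<le> 12" shows "\<bar>z\<bar> \<in> {0, 1, 2, 3}"
proof (rule ccontr)
  assume "\<bar>z\<bar> \<notin> {0, 1, 2, 3}"
  then have "4 \<le> \<bar>z\<bar>" by auto
  then have "4\<^sup>2 \<le> \<bar>z\<bar>\<^sup>2" by (intro power_mono) auto
  then show False using assms by simp
qed

text \<open>The equation asks for norm 2 or 3 in half-integral coordinates. For
  \<open>|v| = 1\<close> it leaves \<open>e\<close> among 3, 4, 7, 8, 11, 12, for
  \<open>|v| = 2\<close> among 1, 2, 3, and otherwise nothing; squarefreeness removes 4, 8 and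
  12.\<close>

lemma small_norms_excluded:
  fixes e u v :: int
  assumes e: "0 < e" "squarefree e" "e \<notin> {1, 2, 3, 7, 11}" and t: "t \<in> {8, 12}"
  shows "u\<^sup>2 + e * v\<^sup>2 \<noteq> t"
proof
  assume eq: "u\<^sup>2 + e * v\<^sup>2 = t"
  have sq: "e \<notin> {4, 8, 12}"
  proof
    assume "e \<in> {4, 8, 12}"
    then have "(2::int)\<^sup>2 dvd e" by auto
    then have "is_unit (2::int)" using e(2) unfolding squarefree_def by (elim allE[of _ 2]) (rule mp)
    then show False by simp
  qed
  have "0 \<le> e * v\<^sup>2" using e by simp
  then have "u\<^sup>2 \<le> 12" using eq t by auto
  then have u: "\<bar>u\<bar> \<in> {0, 1, 2, 3}" by (rule abs_le_3_if_square_le_12)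
  have "1 * v\<^sup>2 \<le> e * v\<^sup>2" using e by (intro mult_right_mono) auto
  then have "v\<^sup>2 \<le> 12" using eq t zero_le_power2[of u] by (smt (verit) insert_iff empty_iff)
  then have v: "\<bar>v\<bar> \<in> {0, 1, 2, 3}" by (rule abs_le_3_if_square_le_12)
  have eq': "\<bar>u\<bar>\<^sup>2 + e * \<bar>v\<bar>\<^sup>2 = t" using eq by simp
  define u' where "u' = \<bar>u\<bar>"
  have "u'\<^sup>2 \<in> {0, 1, 4, 9}" using u unfolding u'_def[symmetric] by auto
  then obtain w where w: "w = u'\<^sup>2" "w = 0 \<or> w = 1 \<or> w = 4 \<or> w = 9" by blast
  have t': "t = 8 \<or> t = 12" using t by simp
  have e': "e \<noteq> 1" "e \<noteq> 2" "e \<noteq> 3" "e \<noteq> 7" "e \<noteq> 11" "e \<noteq> 4" "e \<noteq> 8" "e \<noteq> 12" using e(3) sq by auto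
  consider "\<bar>v\<bar> = 0" | "\<bar>v\<bar> = 1" | "\<bar>v\<bar> = 2" | "\<bar>v\<bar> = 3" using v by blast
  then show False
  proof cases
    case 1
    have "w = t" using eq' unfolding 1 w(1) u'_def by simp
    then show False using w(2) t' by presburger
  next
    case 2
    have "w + e = t" using eq' unfolding 2 w(1) u'_def by simp
    then show False using w(2) t' e(1) e' by presburger
  next
    case 3
    have "w + 4 * e = t" using eq' unfolding 3 w(1) u'_def by simp
    then show False using w(2) t' e(1) e' by presburger
  next
    case 4
    have "w + 9 * e = t" using eq' unfolding 4 w(1) u'_def by simp
    then show False using w(2) t' e(1) e' by presburger
  qed
qed

text \<open>Squares are 0 or 1 modulo 4, and an odd entry leaves a nonzero residue. With
  \<open>e = - d\<close> it shows that half-integral coordinates of integers are integral in these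
  cases.\<close>

lemma even_if_4_dvd_norm_form:
  fixes a b e :: int
  assumes "4 dvd a\<^sup>2 + e * b\<^sup>2" "e mod 4 = 1 \<or> e mod 4 = 2"
  shows "even a" "even b"
proof -
  have "((a mod 4)\<^sup>2 + (e mod 4) * (b mod 4)\<^sup>2) mod 4 = (a\<^sup>2 + e * b\<^sup>2) mod 4"
    by (intro mod_add_cong mod_mult_cong power_mod) simp_all
  then have eq: "((a mod 4)\<^sup>2 + (e mod 4) * (b mod 4)\<^sup>2) mod 4 = 0" using assms(1) by presburger
  have "a mod 4 \<in> {0, 1, 2, 3}" "b mod 4 \<in> {0, 1, 2, 3}" by auto
  then have "(a mod 4 = 0 \<or> a mod 4 = 2) \<and> (b mod 4 = 0 \<or> b mod 4 = 2)" using eq assms(2) by auto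
  then show "even a" "even b" by presburger+
qed

text \<open>In lowest terms the square of the denominator divides \<open>e\<close>, so the
  denominator is a unit.\<close>

lemma squarefree_denominator:
  fixes e n l z :: int
  assumes "squarefree e" "l \<noteq> 0" "e * n\<^sup>2 = z * l\<^sup>2"
  shows "l dvd n"
proof -
  define g where "g = gcd n l"
  have g: "g \<noteq> 0" using assms by (simp add: g_def)
  obtain u v where uv: "n = u * g" "l = v * g" "coprime u v"
    using gcd_coprime_exists[OF g[unfolded g_def]] unfolding g_def by blast
  have "(e * u\<^sup>2) * g\<^sup>2 = (z * v\<^sup>2) * g\<^sup>2" using assms(3) uv by (simp add: power_mult_distrib algebra_simps)
  then have "e * u\<^sup>2 = z * v\<^sup>2" using g by simp
  then have "v\<^sup>2 dvd e * u\<^sup>2" by simp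
  moreover have "coprime (v\<^sup>2) (u\<^sup>2)" using uv(3) by (simp add: coprime_commute)
  ultimately have "v\<^sup>2 dvd e" using coprime_dvd_mult_left_iff by blast
  then have "is_unit v" using assms(1) unfolding squarefree_def by blast
  then show ?thesis using uv by (simp add: is_unit_mult_iff mult_dvd_mono unit_imp_dvd)
qed

locale imaginary_quadratic_field = field +
  fixes s and d :: int and S
  assumes char0: "char_zero R" and s: "s \<in> carrier R" "s \<otimes> s = add_pow R d \<one>"
    and gen: "generate_field R {s} = carrier R" and d: "d < 0" "squarefree d"
    and S_int: "S_integers R S = ring_of_integers R"
begin

lemma s_square: "s \<otimes> s = zint d" using s by (simp add: zint_def)

lemma zint_eq_0: "zint m = \<zero> \<longleftrightarrow> m = 0"
proof -
  have pos: "zint (int n) \<noteq> \<zero>" if "n > 0" for n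
    using char0 that unfolding char_zero_def zint_def by (simp add: add_pow_int_ge)
  show ?thesis
  proof (cases m rule: int_cases)
    case (nonneg n)
    then show ?thesis using pos[of n] by (cases n) auto
  next
    case (neg n)
    then have "zint m = \<ominus> zint (int (Suc n))" using zint_minus by metis
    then show ?thesis using pos[of "Suc n"] neg by (metis add.inv_eq_1_iff neg_equal_0_iff_equal of_nat_eq_0_iff zint_closed zero_less_Suc nat.distinct(1))
  qed
qed

definition qint :: "int \<Rightarrow> int \<Rightarrow> 'a" where
  "qint a b = zint a \<oplus> zint b \<otimes> s"

lemma qint_closed [simp]: "qint a b \<in> carrier R" using s by (simp add: qint_def)

lemma qint_add: "qint a b \<oplus> qint a' b' = qint (a + a') (b + b')"
  unfolding qint_def zint_add using s(1) zint_closed[of a] zint_closed[of b] zint_closed[of a'] zint_closed[of b'] by algebra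

lemma qint_mult: "qint a b \<otimes> qint a' b' = qint (a * a' + d * b * b') (a * b' + a' * b)"
proof -
  have "qint a b \<otimes> qint a' b' = zint a \<otimes> zint a' \<oplus> zint b \<otimes> zint b' \<otimes> (s \<otimes> s) \<oplus> (zint a \<otimes> zint b' \<oplus> zint a' \<otimes> zint b) \<otimes> s"
    unfolding qint_def using s(1) zint_closed[of a] zint_closed[of b] zint_closed[of a'] zint_closed[of b'] by algebra
  then show ?thesis unfolding s_square qint_def zint_add zint_mult
    using s(1) zint_closed[of a] zint_closed[of b] zint_closed[of a'] zint_closed[of b'] zint_closed[of d] by (simp add: m_ac)
qed

lemma qint_zint: "zint l \<otimes> qint a b = qint (l * a) (l * b)"
  unfolding qint_def zint_mult using s(1) zint_closed[of a] zint_closed[of b] zint_closed[of l] by algebra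

lemma norm_form_eq_0: "a * a - d * b * b = 0 \<longleftrightarrow> a = 0 \<and> b = (0::int)"
proof
  assume h: "a * a - d * b * b = 0"
  have "0 \<le> (- d) * (b * b)" using d by (intro mult_nonneg_nonneg[OF _ zero_le_square]) simp
  moreover have "a * a + (- d) * (b * b) = 0" using h by (simp add: algebra_simps)
  ultimately have "a * a = 0" "(- d) * (b * b) = 0" using zero_le_square[of a] by linarith+
  then show "a = 0 \<and> b = 0" using d by auto
qed auto

lemma qint_eq_0: "qint a b = \<zero> \<longleftrightarrow> a = 0 \<and> b = 0"
proof
  assume "qint a b = \<zero>"
  then have "qint a b \<otimes> qint a (- b) = \<zero>" by simp
  moreover have "qint a b \<otimes> qint a (- b) = zint (a * a - d * b * b)"
    unfolding qint_mult using s by (simp add: qint_def)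
  ultimately show "a = 0 \<and> b = 0" using zint_eq_0 norm_form_eq_0 by simp
qed (use s in \<open>simp add: qint_def\<close>)

text \<open>\<open>x = (a + b s) / l\<close>, not necessarily in lowest terms.\<close>

definition rep :: "'a \<Rightarrow> int \<Rightarrow> int \<Rightarrow> int \<Rightarrow> bool" where
  "rep x a b l \<longleftrightarrow> l \<noteq> 0 \<and> zint l \<otimes> x = qint a b"

lemma rep_add:
  assumes "rep x a b l" "rep y a' b' l'" "x \<in> carrier R" "y \<in> carrier R"
  shows "rep (x \<oplus> y) (l' * a + l * a') (l' * b + l * b') (l * l')"
proof -
  have "zint (l * l') \<otimes> (x \<oplus> y) = zint l' \<otimes> (zint l \<otimes> x) \<oplus> zint l \<otimes> (zint l' \<otimes> y)"
    unfolding zint_mult using assms(3,4) zint_closed[of l] zint_closed[of l'] by algebra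
  then show ?thesis using assms by (simp add: rep_def qint_zint qint_add)
qed

lemma rep_mult:
  assumes "rep x a b l" "rep y a' b' l'" "x \<in> carrier R" "y \<in> carrier R"
  shows "rep (x \<otimes> y) (a * a' + d * b * b') (a * b' + a' * b) (l * l')"
proof -
  have "zint (l * l') \<otimes> (x \<otimes> y) = (zint l \<otimes> x) \<otimes> (zint l' \<otimes> y)"
    unfolding zint_mult using assms(3,4) zint_closed[of l] zint_closed[of l'] by algebra
  then show ?thesis using assms by (simp add: rep_def qint_mult)
qed

lemma rep_exists: "x \<in> carrier R \<Longrightarrow> \<exists>a b l. rep x a b l"
proof -
  have "\<exists>a b l. rep x a b l" if "x \<in> generate_field R {s}" for x
    using that
  proof (induction rule: generate_field.induct)
    case one
    then show ?case using s by (intro exI[of _ 1] exI[of _ 0]) (simp add: rep_def qint_def)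
  next
    case (incl h)
    then show ?case using s by (intro exI[of _ 0] exI[of _ 1]) (simp add: rep_def qint_def)
  next
    case (a_inv h)
    then obtain a b l where h: "rep h a b l" by blast
    have hc: "h \<in> carrier R" using a_inv gen by simp
    have "zint l \<otimes> \<ominus> h = zint (-1) \<otimes> (zint l \<otimes> h)" using hc by (simp add: zint_minus r_minus l_minus)
    then have "rep (\<ominus> h) (- a) (- b) l" using h by (simp add: rep_def qint_zint)
    then show ?case by blast
  next
    case (m_inv h)
    then obtain a b l where h: "rep h a b l" by blast
    have hc: "h \<in> carrier R" using m_inv gen by simp
    note i = nonzero_inv[OF hc m_inv(2)]
    \<comment> \<open>The inverse comes from multiplying with the conjugate: \<open>D\<close> is the
      norm of \<open>a + b s\<close>.\<close>
    define D where "D = a * a - d * b * b"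
    have "qint a b \<noteq> \<zero>" using h nonzero_mult hc m_inv(2) by (metis rep_def zint_closed zint_eq_0)
    then have D0: "D \<noteq> 0" using qint_eq_0 norm_form_eq_0 unfolding D_def by blast
    have "zint D = qint a b \<otimes> qint a (- b)" unfolding qint_mult D_def using s by (simp add: qint_def)
    also have "\<dots> = zint l \<otimes> h \<otimes> qint a (- b)" using h by (simp add: rep_def)
    finally have "zint D \<otimes> inv h = zint l \<otimes> qint a (- b) \<otimes> (h \<otimes> inv h)"
      using hc i(1) by (simp add: m_ac)
    then have "zint D \<otimes> inv h = qint (l * a) (l * (- b))" using i by (simp add: qint_zint)
    then show ?case using D0 unfolding rep_def by blast
  next
    case (eng_add h1 h2)
    then show ?case using rep_add gen by blast
  next
    case (eng_mult h1 h2)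
    then show ?case using rep_mult gen by blast
  qed
  then show "x \<in> carrier R \<Longrightarrow> \<exists>a b l. rep x a b l" using gen by blast
qed

lemma rep_unique:
  assumes "rep x a b l" "rep x a' b' l'" "x \<in> carrier R"
  shows "l' * a = l * a'" "l' * b = l * b'"
proof -
  have "qint (l' * a) (l' * b) = zint l' \<otimes> (zint l \<otimes> x)" using assms by (simp add: rep_def qint_zint)
  also have "\<dots> = zint l \<otimes> (zint l' \<otimes> x)" using assms(3) by (simp add: m_ac)
  also have "\<dots> = qint (l * a') (l * b')" using assms by (simp add: rep_def qint_zint)
  finally have "qint (l' * a) (l' * b) \<oplus> qint (- (l * a')) (- (l * b')) = qint (l * a') (l * b') \<oplus> qint (- (l * a')) (- (l * b'))"
    by simp
  then have "qint (l' * a - l * a') (l' * b - l * b') = qint 0 0" by (simp add: qint_add)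
  then have "qint (l' * a - l * a') (l' * b - l * b') = \<zero>" using qint_eq_0[of 0 0] by simp
  then show "l' * a = l * a'" "l' * b = l * b'" by (auto simp: qint_eq_0)
qed

definition r :: real where "r = sqrt (- real_of_int d)"

lemma r2: "r * r = - real_of_int d" "r > 0" using d by (auto simp: r_def)

definition cval :: "int \<Rightarrow> int \<Rightarrow> int \<Rightarrow> complex" where
  "cval a b l = Complex (of_int a / of_int l) (of_int b * r / of_int l)"

text \<open>The complex embedding sending \<open>s\<close> to \<open>r\<close> times the imaginary
  unit, evaluated on an arbitrary representation; \<open>emb_rep\<close> shows that the choice does
  not matter.\<close>

definition emb :: "'a \<Rightarrow> complex" where
  "emb x = (SOME w. \<exists>a b l. rep x a b l \<and> w = cval a b l)"

lemma emb_rep: assumes "rep x a b l" "x \<in> carrier R" shows "emb x = cval a b l"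
proof -
  have "\<exists>a b l. rep x a b l \<and> emb x = cval a b l"
    unfolding emb_def by (rule someI_ex) (use assms in blast)
  then obtain a' b' l' where h: "rep x a' b' l'" "emb x = cval a' b' l'" by blast
  have l: "l \<noteq> 0" "l' \<noteq> 0" using assms h by (auto simp: rep_def)
  have "of_int l' * (of_int a::real) = of_int l * of_int a'" "of_int l' * (of_int b::real) = of_int l * of_int b'"
    using rep_unique[OF assms(1) h(1) assms(2)] by (metis of_int_mult)+
  then show ?thesis using h l by (simp add: cval_def field_simps)
qed

lemma cval_eq: "cval a b l = (of_int a + of_int b * (of_real r * \<i>)) / of_int l"
  by (simp add: cval_def complex_eq_iff)

lemma emb_add: "x \<in> carrier R \<Longrightarrow> y \<in> carrier R \<Longrightarrow> emb (x \<oplus> y) = emb x + emb y"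
proof -
  assume xy: "x \<in> carrier R" "y \<in> carrier R"
  obtain a b l a' b' l' where h: "rep x a b l" "rep y a' b' l'" using rep_exists xy by metis
  then have l: "l \<noteq> 0" "l' \<noteq> 0" by (auto simp: rep_def)
  show ?thesis
    unfolding emb_rep[OF h(1) xy(1)] emb_rep[OF h(2) xy(2)] emb_rep[OF rep_add[OF h xy] a_closed[OF xy]]
    using l by (simp add: cval_eq field_simps)
qed

lemma emb_mult: "x \<in> carrier R \<Longrightarrow> y \<in> carrier R \<Longrightarrow> emb (x \<otimes> y) = emb x * emb y"
proof -
  assume xy: "x \<in> carrier R" "y \<in> carrier R"
  obtain a b l a' b' l' where h: "rep x a b l" "rep y a' b' l'" using rep_exists xy by metis
  then have l: "l \<noteq> 0" "l' \<noteq> 0" by (auto simp: rep_def)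
  define z :: complex where "z = of_real r * \<i>"
  have z: "z * z = of_int d" using r2(1) by (simp add: z_def complex_eq_iff)
  have "(of_int a + of_int b * z) * (of_int a' + of_int b' * z)
      = of_int a * of_int a' + of_int b * of_int b' * (z * z) + (of_int a * of_int b' + of_int a' * of_int b) * z"
    by (simp add: algebra_simps)
  then have "of_int (a * a' + d * b * b') + of_int (a * b' + a' * b) * z
      = (of_int a + of_int b * z) * (of_int a' + of_int b' * z)"
    unfolding z by simp
  then show ?thesis
    unfolding emb_rep[OF h(1) xy(1)] emb_rep[OF h(2) xy(2)] emb_rep[OF rep_mult[OF h xy] m_closed[OF xy]]
    using l by (simp add: cval_eq z_def)
qed

lemma emb_eq_0: "x \<in> carrier R \<Longrightarrow> emb x = 0 \<longleftrightarrow> x = \<zero>"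
proof -
  assume x: "x \<in> carrier R"
  obtain a b l where h: "rep x a b l" using rep_exists x by blast
  then have l: "l \<noteq> 0" "zint l \<otimes> x = qint a b" by (auto simp: rep_def)
  have "emb x = 0 \<longleftrightarrow> a = 0 \<and> b = 0"
    unfolding emb_rep[OF h x] cval_def using l r2(2) by (auto simp: complex_eq_iff)
  also have "\<dots> \<longleftrightarrow> zint l \<otimes> x = \<zero>" using l qint_eq_0 by simp
  also have "\<dots> \<longleftrightarrow> x = \<zero>" using integral_iff[of "zint l" x] x zint_eq_0 l by simp
  finally show ?thesis .
qed

lemma emb_zint: "emb (zint m) = of_int m"
proof -
  have "rep (zint m) m 0 1" using s by (simp add: rep_def qint_def)
  then show ?thesis using emb_rep by (simp add: cval_eq)
qed

lemma emb_s: "emb s = of_real r * \<i>"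
proof -
  have "rep s 0 1 1" using s by (simp add: rep_def qint_def)
  then show ?thesis using emb_rep s by (simp add: cval_eq)
qed

lemma emb_one: "emb \<one> = 1" using emb_zint[of 1] by simp

lemma emb_pow: "x \<in> carrier R \<Longrightarrow> emb (x [^] (n::nat)) = emb x ^ n"
  by (induction n) (auto simp: emb_one emb_mult)

lemma emb_minus: "x \<in> carrier R \<Longrightarrow> y \<in> carrier R \<Longrightarrow> emb (x \<ominus> y) = emb x - emb y"
proof -
  assume xy: "x \<in> carrier R" "y \<in> carrier R"
  have "emb (x \<ominus> y \<oplus> y) = emb (x \<ominus> y) + emb y" using xy emb_add by simp
  moreover have "x \<ominus> y \<oplus> y = x" using xy by algebra
  ultimately show ?thesis by simp
qed

lemma emb_inv: "x \<in> carrier R \<Longrightarrow> x \<noteq> \<zero> \<Longrightarrow> emb (inv x) = inverse (emb x)"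
  using emb_mult[of x "inv x"] nonzero_inv[of x] emb_one emb_eq_0[of x] by (simp add: field_simps)

abbreviation OK :: "'a set" where "OK \<equiv> S_integers R S"

lemma OK_subring: "subring OK R" by (rule subring_S_integers)

lemma OK_carrier: "x \<in> OK \<Longrightarrow> x \<in> carrier R" by (simp add: S_integers_def)

lemma OK_poly:
  assumes "x \<in> OK"
  obtains p where "set p \<subseteq> range zint" "p \<noteq> []" "hd p = \<one>" "eval p x = \<zero>"
proof -
  obtain p where p: "polynomial\<^bsub>R\<^esub> (range (\<lambda>m::int. add_pow R m \<one>)) p" "p \<noteq> []" "hd p = \<one>" "eval p x = \<zero>"
    using assms unfolding S_int ring_of_integers_def by auto
  have "zint = (\<lambda>m::int. add_pow R m \<one>)" by (simp add: fun_eq_iff zint_def)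
  then have "set p \<subseteq> range zint" using p(1,2) by (auto simp: polynomial_def)
  then show thesis using that p by blast
qed

lemma OK_I:
  assumes "x \<in> carrier R" "set p \<subseteq> range zint" "p \<noteq> []" "hd p = \<one>" "eval p x = \<zero>"
  shows "x \<in> OK"
proof -
  have "zint = (\<lambda>m::int. add_pow R m \<one>)" by (simp add: fun_eq_iff zint_def)
  then have "polynomial\<^bsub>R\<^esub> (range (\<lambda>m::int. add_pow R m \<one>)) p"
    using assms by (auto simp: polynomial_def)
  then show ?thesis using assms unfolding S_int ring_of_integers_def by auto
qed

lemma zint_OK: "zint m \<in> OK"
proof -
  note ops = subringE(2,3,5,7)[OF OK_subring]
  have nat: "zint (int n) \<in> OK" for n by (induction n) (use ops zint_add in \<open>auto simp: add.commute\<close>)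
  show ?thesis
  proof (cases m rule: int_cases)
    case (neg n)
    then show ?thesis using ops(3)[OF nat[of "Suc n"]] zint_minus by metis
  qed (use nat in simp)
qed

lemma s_OK: "s \<in> OK"
proof (rule OK_I[of _ "[\<one>, \<zero>, zint (- d)]"])
  show "set [\<one>, \<zero>, zint (- d)] \<subseteq> range zint" using rangeI[of zint 0] rangeI[of zint 1] by simp
  have "s [^] (2::nat) = zint d" using s s_square by (simp add: numeral_2_eq_2)
  then show "eval [\<one>, \<zero>, zint (- d)] s = \<zero>" using s by (simp add: zint_minus numeral_2_eq_2 r_neg)
qed (use s in auto)

text \<open>Galois conjugation, pulled back from the complex numbers so that its properties can be
  read off through the injective \<open>emb\<close>.\<close>

definition cj :: "'a \<Rightarrow> 'a" where
  "cj x = (SOME y. y \<in> carrier R \<and> emb y = cnj (emb x))"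

lemma cj: assumes "x \<in> carrier R" shows "cj x \<in> carrier R" "emb (cj x) = cnj (emb x)"
proof -
  obtain a b l where h: "rep x a b l" using rep_exists assms by blast
  then have l: "l \<noteq> 0" by (simp add: rep_def)
  then have zl: "zint l \<in> carrier R" "zint l \<noteq> \<zero>" using zint_eq_0 by auto
  note i = nonzero_inv[OF zl]
  let ?y = "inv (zint l) \<otimes> qint a (- b)"
  have y: "?y \<in> carrier R" using i by simp
  have "rep ?y a (- b) l" using l i zl by (simp add: rep_def m_assoc[symmetric])
  then have "emb ?y = cnj (emb x)"
    unfolding emb_rep[OF h assms] using emb_rep[OF _ y] by (simp add: cval_def complex_eq_iff)
  then have "\<exists>y. y \<in> carrier R \<and> emb y = cnj (emb x)" using y by blast
  from someI_ex[OF this] show "cj x \<in> carrier R" "emb (cj x) = cnj (emb x)" by (auto simp: cj_def)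
qed

text \<open>Integer coefficients are fixed by conjugation, so the conjugate of an integral element
  is a root of the same monic polynomial.\<close>

lemma emb_eval_cj:
  assumes x: "x \<in> carrier R"
  shows "set p \<subseteq> range zint \<Longrightarrow> emb (eval p (cj x)) = cnj (emb (eval p x))"
proof (induction p)
  case Nil
  then show ?case using emb_eq_0[of \<zero>] by simp
next
  case (Cons a p)
  obtain m where m: "a = zint m" using Cons by auto
  have pc: "set p \<subseteq> carrier R" using Cons by auto
  have e: "eval p x \<in> carrier R" "eval p (cj x) \<in> carrier R" using eval_in_carrier pc x cj by auto
  have a: "a \<in> carrier R" using m by simp
  show ?case using Cons x cj[OF x] e a by (simp add: emb_add emb_mult emb_pow m emb_zint)
qed

lemma cj_OK: assumes "x \<in> OK" shows "cj x \<in> OK"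
proof -
  obtain p where p: "set p \<subseteq> range zint" "p \<noteq> []" "hd p = \<one>" "eval p x = \<zero>" by (rule OK_poly[OF assms])
  note c = cj[OF OK_carrier[OF assms]]
  have "set p \<subseteq> carrier R" using p by auto
  then have ec: "eval p (cj x) \<in> carrier R" using eval_in_carrier c by auto
  have "emb (eval p (cj x)) = 0" using emb_eval_cj[OF OK_carrier[OF assms] p(1)] p(4) emb_eq_0[of \<zero>] by simp
  then have "eval p (cj x) = \<zero>" using emb_eq_0[OF ec] by simp
  then show ?thesis using OK_I[OF c(1) p(1-3)] by simp
qed

lemma emb_eval_poly:
  assumes x: "x \<in> carrier R"
  shows "set p \<subseteq> range zint \<Longrightarrow> emb (eval p x) = poly (Poly (rev (map emb p))) (emb x)"
proof (induction p)
  case Nil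
  then show ?case using emb_eq_0[of \<zero>] by simp
next
  case (Cons a p)
  have pc: "set p \<subseteq> carrier R" "a \<in> carrier R" using Cons by auto
  have e: "eval p x \<in> carrier R" using eval_in_carrier pc x by auto
  show ?case using Cons x e pc by (simp add: emb_add emb_mult emb_pow Poly_snoc poly_monom)
qed

text \<open>Carries integrality in \<open>R\<close> over to the complex numbers, where rational
  algebraic integers are known to be integers. Lists here start with the leading coefficient, hence
  the reversal.\<close>

lemma emb_OK_algebraic_int:
  assumes "x \<in> OK" shows "algebraic_int (emb x)"
proof -
  obtain p where p: "set p \<subseteq> range zint" "p \<noteq> []" "hd p = \<one>" "eval p x = \<zero>" by (rule OK_poly[OF assms])
  obtain p' where p': "p = \<one> # p'" using p by (cases p) auto
  let ?q = "Poly (rev (map emb p))"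
  have co: "Polynomial.coeff ?q i = nth_default 0 (rev (map emb p') @ [1]) i" for i by (simp add: p' emb_one)
  have "Polynomial.degree ?q = length p'"
  proof (rule antisym)
    show "Polynomial.degree ?q \<le> length p'" by (rule degree_le, intro allI impI, simp only: co) (simp add: nth_default_def)
    show "length p' \<le> Polynomial.degree ?q" by (rule le_degree, simp only: co) (simp add: nth_default_def nth_append)
  qed
  then have "Polynomial.lead_coeff ?q = 1" by (simp only: co) (simp add: nth_default_def nth_append)
  moreover have "\<forall>i. Polynomial.coeff ?q i \<in> \<int>"
  proof
    fix i
    have "set (rev (map emb p)) \<subseteq> \<int>" using p(1) by (auto simp: emb_zint)
    moreover have "rev (map emb p) ! i \<in> set (rev (map emb p))" if "i < length p" using that by (intro nth_mem) simp
    ultimately show "Polynomial.coeff ?q i \<in> \<int>" unfolding coeff_Poly_eq nth_default_def by auto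
  qed
  moreover have "poly ?q (emb x) = 0"
    using emb_eval_poly[OF OK_carrier[OF assms] p(1)] p(4) emb_eq_0[of \<zero>] by simp
  ultimately show ?thesis by (rule algebraic_int.intros)
qed

lemma emb_OK_int:
  assumes "x \<in> OK" "emb x = of_real q" "q \<in> \<rat>"
  shows "\<exists>m::int. q = of_int m"
proof -
  have "emb x \<in> \<rat>" 
  proof -
    obtain i j :: int where "q = of_int i / of_int j" using assms(3) by (auto simp: Rats_eq_int_div_int)
    then have "emb x = of_int i / of_int j" using assms(2) by simp
    then show ?thesis by simp
  qed
  then have "emb x \<in> \<int>" using rational_algebraic_int_is_int[OF emb_OK_algebraic_int[OF assms(1)]] by blast
  then obtain m where "emb x = of_int m" by (auto elim: Ints_cases)
  then have "q = of_int m" using assms(2) by (metis of_real_eq_iff of_real_of_int_eq)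
  then show ?thesis by blast
qed

text \<open>Trace \<open>a\<close> and norm \<open>t\<close> of \<open>x\<close> are rational and
  integral, hence integers. They determine half-integral coordinates once the denominator of the
  \<open>s\<close>-part is controlled.\<close>

lemma OK_coords:
  assumes x: "x \<in> OK"
  obtains a b :: int where "emb x = Complex (of_int a / 2) (of_int b * r / 2)" "4 dvd a\<^sup>2 - d * b\<^sup>2"
proof -
  have xc: "x \<in> carrier R" by (rule OK_carrier[OF x])
  note c = cj[OF xc]
  obtain u v l where h: "rep x u v l" using rep_exists xc by blast
  then have l: "l \<noteq> 0" by (simp add: rep_def)
  have ex: "emb x = cval u v l" by (rule emb_rep[OF h xc])
  have t1: "x \<oplus> cj x \<in> OK" using subringE(7)[OF OK_subring x cj_OK[OF x]] .
  have "emb (x \<oplus> cj x) = of_real (2 * of_int u / of_int l)"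
    using emb_add[OF xc c(1)] c(2) ex by (simp add: cval_def complex_eq_iff)
  then obtain a where a: "2 * of_int u / of_int l = (of_int a :: real)"
    using emb_OK_int[OF t1] by fastforce
  have t2: "x \<otimes> cj x \<in> OK" using subringE(6)[OF OK_subring x cj_OK[OF x]] .
  have nrm: "emb (x \<otimes> cj x) = of_real ((of_int u * of_int u - of_int d * (of_int v * of_int v)) / (of_int l * of_int l))"
  proof -
    have "(of_int v * r / of_int l) * (of_int v * r / of_int l) = (of_int v * of_int v) * (r * r) / (of_int l * of_int l)" by simp
    then have "(of_int v * r / of_int l) * (of_int v * r / of_int l) = - of_int d * (of_int v * of_int v) / (of_int l * (of_int l::real))"
      unfolding r2 by simp
    then show ?thesis using emb_mult[OF xc c(1)] c(2) ex
      by (simp add: cval_def complex_eq_iff diff_divide_distrib)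
  qed
  then obtain t where t: "(of_int u * of_int u - of_int d * (of_int v * of_int v)) / (of_int l * of_int l) = (of_int t :: real)"
    using emb_OK_int[OF t2 nrm] by fastforce
  have "2 * (of_int u :: real) = of_int a * of_int l" using a l by (simp add: field_simps)
  then have ua: "2 * u = a * l" by (metis (mono_tags) of_int_eq_iff of_int_mult of_int_numeral)
  have "(of_int u * of_int u - of_int d * (of_int v * of_int v)) = (of_int t :: real) * (of_int l * of_int l)"
    using t l by (simp add: field_simps)
  then have "real_of_int (u * u - d * (v * v)) = real_of_int (t * (l * l))" by simp
  then have ut: "u * u - d * (v * v) = t * (l * l)" by (simp only: of_int_eq_iff)
  \<comment> \<open>Four times the norm minus the square of the trace is \<open>- d\<close> times
    the square of \<open>2 v / l\<close>; as \<open>d\<close> is squarefree, \<open>l\<close>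
    divides \<open>2 v\<close>.\<close>
  have "(- d) * (2 * v)\<^sup>2 = (4 * t - a * a) * l\<^sup>2"
  proof -
    have "(- d) * (2 * v)\<^sup>2 = 4 * (u * u - d * (v * v)) - (2 * u) * (2 * u)" by (simp add: power2_eq_square)
    then show ?thesis unfolding ut ua by (simp add: power2_eq_square algebra_simps)
  qed
  moreover have "squarefree (- d)" using d by simp
  ultimately have "l dvd 2 * v" by (rule squarefree_denominator[rotated 2, OF _ _ l]) 
  then obtain b where b: "2 * v = l * b" by auto
  have "of_int u / of_int l = (of_int a / 2 :: real)" unfolding a[symmetric] by simp
  moreover have "of_int v / of_int l = (of_int b / 2 :: real)"
  proof -
    have "2 * (of_int v :: real) = of_int l * of_int b" using b by (metis of_int_mult of_int_numeral)
    then show ?thesis using l by (simp add: field_simps)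
  qed
  ultimately have "emb x = Complex (of_int a / 2) (of_int b * r / 2)"
    unfolding ex cval_def by (metis times_divide_eq_left times_divide_eq_right)
  moreover have "a\<^sup>2 - d * b\<^sup>2 = 4 * t"
  proof -
    have "(a\<^sup>2 - d * b\<^sup>2) * l\<^sup>2 = (a * l) * (a * l) - d * ((l * b) * (l * b))" by (simp add: power2_eq_square algebra_simps)
    also have "\<dots> = 4 * (u * u - d * (v * v))" unfolding ua[symmetric] b[symmetric] by simp
    also have "\<dots> = (4 * t) * l\<^sup>2" unfolding ut by (simp add: power2_eq_square)
    finally show ?thesis using l by simp
  qed
  ultimately show thesis using that[of a b] by simp
qed

lemma cmod_coords:
  "(cmod (Complex (of_int a / 2) (of_int b * r / 2)))\<^sup>2 = of_int (a\<^sup>2 - d * b\<^sup>2) / 4"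
proof -
  have "(of_int b * r / 2)\<^sup>2 = of_int b * of_int b * (r * r) / 4" by (simp add: power2_eq_square)
  then have "(of_int b * r / 2)\<^sup>2 = - (of_int d * (of_int b)\<^sup>2) / 4" unfolding r2 by (simp add: power2_eq_square)
  then show ?thesis unfolding cmod_power2 complex.sel by (simp add: power_divide diff_divide_distrib)
qed

text \<open>The squared absolute value is the norm, a positive integer different from 2 and 3. Norm
  1 makes the conjugate an inverse, so a nonunit has norm at least 4.\<close>

lemma discretely_normed:
  assumes d': "d \<notin> {-1, -2, -3, -7, -11}"
  shows "discretely_normed_subring R OK (\<lambda>x. cmod (emb x))"
proof (intro discretely_normed_subring.intro discretely_normed_subring_axioms.intro)
  show "field R" by (rule field_axioms)
  show "subring OK R" by (rule OK_subring)
  show "cmod (emb \<zero>) = 0" using emb_eq_0[of \<zero>] by simp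
  show "cmod (emb (x \<otimes> y)) = cmod (emb x) * cmod (emb y)" if "x \<in> carrier R" "y \<in> carrier R" for x y
    using that by (simp add: emb_mult norm_mult)
  show "cmod (emb (x \<oplus> y)) \<le> cmod (emb x) + cmod (emb y)" if "x \<in> carrier R" "y \<in> carrier R" for x y
    using that by (simp add: emb_add norm_triangle_ineq)
  have sq: "\<exists>t::int. (cmod (emb x))\<^sup>2 = of_int t \<and> 1 \<le> t \<and> t \<noteq> 2 \<and> t \<noteq> 3" if x: "x \<in> OK" "x \<noteq> \<zero>" for x
  proof -
    obtain a b where ab: "emb x = Complex (of_int a / 2) (of_int b * r / 2)" "4 dvd a\<^sup>2 - d * b\<^sup>2"
      by (rule OK_coords[OF x(1)])
    obtain t where t: "a\<^sup>2 - d * b\<^sup>2 = 4 * t" using ab(2) by auto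
    have eq: "(cmod (emb x))\<^sup>2 = of_int t" unfolding ab(1) cmod_coords t by simp
    have "emb x \<noteq> 0" using emb_eq_0[OF OK_carrier[OF x(1)]] x by simp
    then have "0 < (cmod (emb x))\<^sup>2" by simp
    then have "1 \<le> t" unfolding eq by simp
    have md: "0 < - d" "squarefree (- d)" "- d \<notin> {1, 2, 3, 7, 11}" using d d' by auto
    have "a\<^sup>2 + (- d) * b\<^sup>2 \<noteq> 8" "a\<^sup>2 + (- d) * b\<^sup>2 \<noteq> 12"
      by (rule small_norms_excluded[OF md], simp)+
    then have "t \<noteq> 2" "t \<noteq> 3" using t by auto
    then show ?thesis using eq \<open>1 \<le> t\<close> by blast
  qed
  show "1 \<le> cmod (emb x)" if x: "x \<in> OK" "x \<noteq> \<zero>" for x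
  proof -
    obtain t :: int where "(cmod (emb x))\<^sup>2 = of_int t" "1 \<le> t" using sq[OF x] by blast
    then have "1\<^sup>2 \<le> (cmod (emb x))\<^sup>2" by simp
    then show ?thesis by (rule power2_le_imp_le) simp
  qed
  show "2 \<le> cmod (emb x)" if x: "x \<in> OK" "x \<noteq> \<zero>" "inv x \<notin> OK" for x
  proof -
    obtain t :: int where t: "(cmod (emb x))\<^sup>2 = of_int t" "1 \<le> t" "t \<noteq> 2" "t \<noteq> 3" using sq[OF x(1,2)] by blast
    have xc: "x \<in> carrier R" by (rule OK_carrier[OF x(1)])
    have "t \<noteq> 1"
    proof
      assume "t = 1"
      then have "emb x * cnj (emb x) = 1" using t(1) complex_norm_square[of "emb x"] by simp
      then have "emb (x \<otimes> cj x \<ominus> \<one>) = 0"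
        using cj[OF xc] xc by (simp add: emb_minus emb_mult emb_one)
      then have "x \<otimes> cj x = \<one>" using emb_eq_0[of "x \<otimes> cj x \<ominus> \<one>"] cj(1)[OF xc] xc by (simp add: r_right_minus_eq)
      then have "inv x = cj x" using cj(1)[OF xc] xc by (intro comm_inv_char) auto
      then show False using x(3) cj_OK[OF x(1)] by simp
    qed
    then have "4 \<le> t" using t by linarith
    then have "2\<^sup>2 \<le> (cmod (emb x))\<^sup>2" using t(1) by simp
    then show ?thesis by (rule power2_le_imp_le) simp
  qed
qed

text \<open>The witnesses are deep holes of the lattice of integers, with \<open>e = - d\<close>.
  For the lattice spanned by \<open>1\<close> and \<open>s\<close> it is the centre
  \<open>(1 + s) / 2\<close> of the rectangle; if \<open>(1 + s) / 2\<close> is integral, it is the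
  circumcentre of the triangle \<open>0\<close>, \<open>1\<close>,
  \<open>(1 + s) / 2\<close>.\<close>

lemma exists_far_point:
  assumes d': "d \<notin> {-1, -2, -3, -7, -11}"
  shows "\<exists>p q \<rho>. p \<in> OK \<and> q \<in> OK \<and> q \<noteq> \<zero> \<and> 1 < \<rho> \<and> (\<forall>c\<in>OK. \<rho> \<le> (cmod (emb (p \<otimes> inv q) - emb c))\<^sup>2)"
proof -
  define e where "e = - d"
  have e: "0 < e" "e \<notin> {1, 2, 3, 7, 11}" using d d' by (auto simp: e_def)
  have e4: "\<not> 4 dvd e"
  proof
    assume "4 dvd e"
    then have "(2::int)\<^sup>2 dvd d" by (simp add: e_def)
    then have "is_unit (2::int)" using d(2) unfolding squarefree_def by (elim allE[of _ 2]) (rule mp)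
    then show False by simp
  qed
  have r2': "r * r = of_int e" using r2 by (simp add: e_def)
  note ops = subringE(2,3,5,6,7)[OF OK_subring]
  have frac: "emb (qint a b \<otimes> inv (zint l)) = Complex (of_int a / of_int l) (of_int b * r / of_int l)" if "l \<noteq> 0" for a b l
  proof -
    have "emb (qint a b) = of_int a + of_int b * (of_real r * \<i>)"
      using s by (simp add: qint_def emb_add emb_mult emb_zint emb_s)
    then show ?thesis using that zint_eq_0 nonzero_inv[of "zint l"]
      by (simp add: emb_mult emb_inv emb_zint complex_eq_iff field_simps)
  qed
  have qOK: "qint a b \<in> OK" for a b unfolding qint_def by (intro ops(4,5) zint_OK s_OK)
  show ?thesis
  proof (cases "e mod 4 = 3")
    case False
    then have em: "e mod 4 = 1 \<or> e mod 4 = 2" using e4 by presburger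
    moreover have e': "e \<noteq> 1" "e \<noteq> 2" "e \<noteq> 3" "e \<noteq> 7" "e \<noteq> 11" using e(2) by auto
    ultimately have e5: "5 \<le> e" using e(1) by presburger
    \<comment> \<open>Half-integral coordinates are even here, so the squared distance is at least
      \<open>(1 + e) / 4\<close>, and \<open>e >= 5\<close>.\<close>
    have "3 / 2 \<le> (cmod (emb (qint 1 1 \<otimes> inv (zint 2)) - emb c))\<^sup>2" if c: "c \<in> OK" for c
    proof -
      obtain a b where ab: "emb c = Complex (of_int a / 2) (of_int b * r / 2)" "4 dvd a\<^sup>2 - d * b\<^sup>2"
        by (rule OK_coords[OF c])
      have ev: "even a" "even b" using even_if_4_dvd_norm_form[of a e b] ab(2) em by (simp_all add: e_def)
      then have "1 \<le> (1 - a)\<^sup>2" "1 \<le> (1 - b)\<^sup>2" by (auto simp: int_one_le_iff_zero_less)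
      then have "e * 1 \<le> e * (1 - b)\<^sup>2" using e by (intro mult_left_mono) auto
      then have "6 \<le> (1 - a)\<^sup>2 + e * (1 - b)\<^sup>2" using \<open>1 \<le> (1 - a)\<^sup>2\<close> e5 by linarith
      then have "6 \<le> (1 - a)\<^sup>2 - d * (1 - b)\<^sup>2" by (simp add: e_def)
      then have "6 \<le> real_of_int ((1 - a)\<^sup>2 - d * (1 - b)\<^sup>2)" by linarith
      moreover have "emb (qint 1 1 \<otimes> inv (zint 2)) - emb c = Complex (of_int (1 - a) / 2) (of_int (1 - b) * r / 2)"
        unfolding ab(1) using frac[of 2 1 1] by (simp add: complex_eq_iff field_simps)
      ultimately show ?thesis using cmod_coords[of "1 - a" "1 - b"] by simp
    qed
    moreover have "zint 2 \<noteq> \<zero>" using zint_eq_0 by simp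
    ultimately show ?thesis using qOK zint_OK
      by (intro exI[of _ "qint 1 1"] exI[of _ "zint 2"] exI[of _ "3/2"]) auto
  next
    case True
    moreover have e': "e \<noteq> 1" "e \<noteq> 2" "e \<noteq> 3" "e \<noteq> 7" "e \<noteq> 11" using e(2) by auto
    ultimately have e15: "15 \<le> e" using e(1) by presburger
    \<comment> \<open>The squared circumradius; it exceeds 1 because \<open>e >= 15\<close>.\<close>
    define \<rho> where "\<rho> = (of_int e + 1)\<^sup>2 / (16 * real_of_int e)"
    have "16 * e < (e + 1)\<^sup>2"
    proof -
      have "15 * e \<le> e * e" using e15 by (intro mult_right_mono) auto
      moreover have "(e + 1)\<^sup>2 = e * e + 2 * e + 1" by (simp add: power2_eq_square algebra_simps)
      ultimately show ?thesis using e15 by linarith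
    qed
    then have "real_of_int (16 * e) < real_of_int ((e + 1)\<^sup>2)" by (simp only: of_int_less_iff)
    then have rho: "1 < \<rho>" using e by (simp add: \<rho>_def field_simps)
    let ?x = "qint (2 * e) (e - 1) \<otimes> inv (zint (4 * e))"
    have "\<rho> \<le> (cmod (emb ?x - emb c))\<^sup>2" if c: "c \<in> OK" for c
    proof -
      obtain a b where ab: "emb c = Complex (of_int a / 2) (of_int b * r / 2)" "4 dvd a\<^sup>2 - d * b\<^sup>2"
        by (rule OK_coords[OF c])
      have par: "even a" if "b = 0" using ab(2) that even_if_4_dvd_norm_form[of a 1 0] by simp
      \<comment> \<open>The numerator over \<open>4 * e\<close> of the difference of the
        \<open>s\<close>-coefficients of \<open>?x\<close> and \<open>c\<close>.\<close>
      define w where "w = e - 1 - 2 * e * b"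
      have "emb ?x = Complex (1 / 2) (of_int (e - 1) * r / (4 * of_int e))"
        using frac[of "4 * e" "2 * e" "e - 1"] e by simp
      then have diff: "emb ?x - emb c = Complex (of_int (1 - a) / 2) (of_int w * r / (4 * of_int e))"
        unfolding ab(1) w_def using e by (simp add: complex_eq_iff field_simps)
      have "(of_int w * r / (4 * of_int e))\<^sup>2 = of_int w * of_int w * (r * r) / (16 * (of_int e * of_int e))"
        by (simp add: power2_eq_square)
      also have "\<dots> = of_int (w\<^sup>2) / (16 * of_int e)" unfolding r2' using e by (simp add: power2_eq_square)
      finally have cm: "(cmod (emb ?x - emb c))\<^sup>2 = of_int ((1 - a)\<^sup>2) / 4 + of_int (w\<^sup>2) / (16 * of_int e)"
        unfolding diff cmod_power2 complex.sel by (simp add: power_divide)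
      \<comment> \<open>Equality holds at the vertices of the triangle. For \<open>b = 0\<close>
        integrality makes \<open>a\<close> even, so \<open>1 - a\<close> is nonzero; for other
        \<open>b\<close> already \<open>|w| >= e + 1\<close>.\<close>
      have key: "(e + 1)\<^sup>2 \<le> 4 * e * (1 - a)\<^sup>2 + w\<^sup>2"
      proof (cases "b = 0")
        case True
        then have "1 - a \<noteq> 0" using par by auto
        then have "1 \<le> (1 - a)\<^sup>2" by (simp add: int_one_le_iff_zero_less)
        then have "4 * e * 1 \<le> 4 * e * (1 - a)\<^sup>2" using e by (intro mult_left_mono) auto
        moreover have "(e + 1)\<^sup>2 = 4 * e + w\<^sup>2" using True by (simp add: w_def power2_eq_square algebra_simps)
        ultimately show ?thesis by linarith
      next
        case False
        have "e + 1 \<le> \<bar>w\<bar>"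
        proof (cases "0 < b")
          case True
          then have "2 * e * 1 \<le> 2 * e * b" using e by (intro mult_left_mono) auto
          then show ?thesis unfolding w_def by linarith
        next
          case b: False
          then have "2 * e * b \<le> 2 * e * (-1)" using False e by (intro mult_left_mono) auto
          then show ?thesis using e15 unfolding w_def by linarith
        qed
        then have "(e + 1)\<^sup>2 \<le> \<bar>w\<bar>\<^sup>2" using e by (intro power_mono) auto
        moreover have "0 \<le> 4 * e * (1 - a)\<^sup>2" using e by simp
        ultimately show ?thesis by simp
      qed
      have "\<rho> = of_int ((e + 1)\<^sup>2) / (16 * of_int e)" by (simp add: \<rho>_def)
      also have "\<dots> \<le> of_int (4 * e * (1 - a)\<^sup>2 + w\<^sup>2) / (16 * of_int e)"
        by (rule divide_right_mono, simp only: of_int_le_iff, rule key) (use e in simp)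
      also have "\<dots> = (cmod (emb ?x - emb c))\<^sup>2" unfolding cm using e by (simp add: field_simps)
      finally show ?thesis .
    qed
    moreover have "zint (4 * e) \<noteq> \<zero>" using zint_eq_0 e by simp
    ultimately show ?thesis using qOK zint_OK rho
      by (intro exI[of _ "qint (2 * e) (e - 1)"] exI[of _ "zint (4 * e)"] exI[of _ \<rho>]) auto
  qed
qed

text \<open>The strict inequality \<open>\<rho> > 1\<close> leaves the margin
  \<open>sqrt \<rho> - 1\<close> by which the far point may be moved.\<close>

theorem partial_bases_not_cohen_macaulay_imaginary_quadratic:
  assumes d': "d \<notin> {-1, -2, -3, -7, -11}" and n: "n \<ge> 2"
  shows "\<not> cohen_macaulay (partial_bases_complex (R\<lparr>carrier := OK\<rparr>) n) (int n - 1)"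
proof -
  interpret D: discretely_normed_subring R OK "\<lambda>x. cmod (emb x)" by (rule discretely_normed[OF d'])
  obtain p q \<rho> where pq: "p \<in> OK" "q \<in> OK" "q \<noteq> \<zero>" "1 < \<rho>"
    "\<And>c. c \<in> OK \<Longrightarrow> \<rho> \<le> (cmod (emb (p \<otimes> inv q) - emb c))\<^sup>2"
    using exists_far_point[OF d'] by blast
  have x: "p \<otimes> inv q \<in> carrier R" using pq OK_carrier nonzero_inv(1)[of q] by simp
  show ?thesis
  proof (rule D.partial_bases_not_cohen_macaulay[OF n pq(1-3), of "sqrt \<rho> - 1"])
    show "0 < sqrt \<rho> - 1" using pq(4) by simp
    fix y c assume y: "y \<in> carrier R" "cmod (emb (y \<ominus> p \<otimes> inv q)) < sqrt \<rho> - 1" "c \<in> OK"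
    have cc: "c \<in> carrier R" using y OK_carrier by blast
    have "sqrt \<rho> \<le> cmod (emb (p \<otimes> inv q) - emb c)"
      using real_sqrt_le_mono[OF pq(5)[OF y(3)]] by simp
    also have "\<dots> \<le> cmod (emb y - emb c) + cmod (emb y - emb (p \<otimes> inv q))"
      using norm_triangle_ineq4[of "emb y - emb c" "emb y - emb (p \<otimes> inv q)"] by simp
    finally show "1 \<le> cmod (emb (y \<ominus> c))" using y x cc by (simp add: emb_minus)
  qed
qed

end

theorem theorem2p1:
  fixes K :: "('a, 'b) ring_scheme" and S :: "'a place set" and n :: nat
  assumes "arithmetic_type K S"
    and "(\<exists>d::int. adjoins_sqrt_to_rationals K d \<and> d < 0 \<and> squarefree d \<and>
             d \<notin> {-1, -2, -3, -7, -11} \<and> S_integers K S = ring_of_integers K)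
       \<or> (\<exists>k f. function_field_over K k \<and> odd (card k) \<and> S = {f} \<and>
             (order (class_group K (S_integers K S)) \<noteq> 1 \<or> place_degree K k f \<ge> 2))"
    and "n \<ge> 2"
  shows "\<not> cohen_macaulay (partial_bases_complex (K\<lparr>carrier := S_integers K S\<rparr>) n) (int n - 1)"
  using assms(2)
proof
  assume "\<exists>d::int. adjoins_sqrt_to_rationals K d \<and> d < 0 \<and> squarefree d \<and>
    d \<notin> {-1, -2, -3, -7, -11} \<and> S_integers K S = ring_of_integers K"
  then obtain d :: int where d: "adjoins_sqrt_to_rationals K d" "d < 0" "squarefree d"
    "d \<notin> {-1, -2, -3, -7, -11}" "S_integers K S = ring_of_integers K" by blast
  obtain s where s: "s \<in> carrier K" "s \<otimes>\<^bsub>K\<^esub> s = add_pow K d \<one>\<^bsub>K\<^esub>" "generate_field K {s} = carrier K"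
    and K: "field K" "char_zero K"
    using d(1) unfolding adjoins_sqrt_to_rationals_def by blast
  have "imaginary_quadratic_field K s d S"
    by (intro imaginary_quadratic_field.intro imaginary_quadratic_field_axioms.intro K s d)
  then show ?thesis
    by (rule imaginary_quadratic_field.partial_bases_not_cohen_macaulay_imaginary_quadratic[OF _ d(4) assms(3)])
next
  assume "\<exists>k f. function_field_over K k \<and> odd (card k) \<and> S = {f} \<and>
    (order (class_group K (S_integers K S)) \<noteq> 1 \<or> place_degree K k f \<ge> 2)"
  then obtain k f where f: "function_field_over K k" "S = {f}"
    "order (class_group K (S_integers K S)) \<noteq> 1 \<or> place_degree K k f \<ge> 2" by blast
  have "{f} \<subseteq> places K" using assms(1) f(2) by (simp add: arithmetic_type_def)
  then show ?thesis using f(3) unfolding f(2) by (intro function_field_case[OF _ f(1) _ assms(3)])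
qed

end
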